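(* Let $\Gamma$ be a basic finite-dimensional algebra over a field $\mathbb{K}$ with $\operatorname{domdim}\Gamma=d$, let $0\leq k\leq d$, and let $B_k$ and $B^k$ be the $k$-shifted and $k$-coshifted algebras of $\Gamma$. Then $$\operatorname{gldim}\Gamma-k\leq\operatorname{gldim}B_k\leq\operatorname{gldim}\Gamma,$$ $$\operatorname{gldim}\Gamma-k\leq\operatorname{gldim}B^k\leq\operatorname{gldim}\Gamma.$$
   Context: Modules are finitely generated left modules; $D=\operatorname{Hom}_{\mathbb{K}}(-,\mathbb{K})$; global dimensions may be infinite. $\operatorname{domdim}\Gamma\geq k$ if ${}_\Gamma\Gamma$ has an injective resolution whose first $k$ terms are projective-injective; $\operatorname{domdim}\Gamma=k$ if moreover not $\operatorname{domdim}\Gamma\geq k+1$. For $k\geq0$, a $\Gamma$-module $T$ is $k$-tilting if $\operatorname{pdim}T\leq k$, $\operatorname{Ext}^i_\Gamma(T,T)=0$ for $i>0$, and there is an exact sequence $0\to\Gamma\to t_0\to\cdots\to t_k\to0$ with all $t_j\in\operatorname{add}T$ ( * ). It is $P$-special, for $P$ projective, if $P\in\operatorname{add}T$ and there is a sequence ( * ) with $t_j\in\operatorname{add}P$ for $0\leq j\leq k-1$. Dually, $C$ is $k$-cotilting if $\operatorname{idim}C\leq k$, $\operatorname{Ext}^i_\Gamma(C,C)=0$ for $i>0$, and there is an exact sequence $0\to c^k\to\cdots\to c^0\to D\Gamma\to0$ with all $c^j\in\operatorname{add}C$ ( ** ). It is $I$-special, for $I$ injective, if $I\in\operatorname{add}C$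 and there is a sequence ( ** ) with $c^j\in\operatorname{add}I$ for $0\leq j\leq k-1$. Let $\Pi$ be a maximal projective-injective summand of $\Gamma$. For $0\leq k\leq\operatorname{domdim}\Gamma$ there are, unique up to isomorphism, a basic $\Pi$-special $k$-tilting module $T_k$ (the $k$-shifted module) and a basic $\Pi$-special $k$-cotilting module $C^k$ (the $k$-coshifted module). The $k$-shifted and $k$-coshifted algebras are $B_k=\operatorname{End}_\Gamma(T_k)^{\mathrm{op}}$ and $B^k=\operatorname{End}_\Gamma(C^k)^{\mathrm{op}}$. *)

theory Defs
  imports "HOL-Algebra.Module" "HOL-Algebra.Elementary_Groups" "HOL-Library.Extended_Nat"
begin

section \<open>Modules over a not necessarily commutative ring\<close>

text \<open>
  The locale \<^locale>\<open>module\<close> of the library only covers commutative rings. The record type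
  \<^typ>\<open>('a, 'b) module\<close> is reused; as in the library, the fields \<^const>\<open>mult\<close> and
  \<^const>\<open>one\<close> play no role when the record is viewed as a module (they carry the
  multiplication when it is viewed as an algebra).
\<close>

locale left_module = R?: ring R + M?: abelian_group M
  for R :: "('r, 'x) ring_scheme" (structure) and M :: "('r, 'm) module" (structure) +
  assumes smult_closed:
      "\<lbrakk>a \<in> carrier R; x \<in> carrier M\<rbrakk> \<Longrightarrow> a \<odot>\<^bsub>M\<^esub> x \<in> carrier M"
    and smult_l_distr:
      "\<lbrakk>a \<in> carrier R; b \<in> carrier R; x \<in> carrier M\<rbrakk> \<Longrightarrow>
        (a \<oplus> b) \<odot>\<^bsub>M\<^esub> x = a \<odot>\<^bsub>M\<^esub> x \<oplus>\<^bsub>M\<^esub> b \<odot>\<^bsub>M\<^esub> x"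
    and smult_r_distr:
      "\<lbrakk>a \<in> carrier R; x \<in> carrier M; y \<in> carrier M\<rbrakk> \<Longrightarrow>
        a \<odot>\<^bsub>M\<^esub> (x \<oplus>\<^bsub>M\<^esub> y) = a \<odot>\<^bsub>M\<^esub> x \<oplus>\<^bsub>M\<^esub> a \<odot>\<^bsub>M\<^esub> y"
    and smult_assoc:
      "\<lbrakk>a \<in> carrier R; b \<in> carrier R; x \<in> carrier M\<rbrakk> \<Longrightarrow>
        (a \<otimes> b) \<odot>\<^bsub>M\<^esub> x = a \<odot>\<^bsub>M\<^esub> (b \<odot>\<^bsub>M\<^esub> x)"
    and smult_one:
      "x \<in> carrier M \<Longrightarrow> \<one> \<odot>\<^bsub>M\<^esub> x = x"

lemma left_module_iff_module:
  assumes "cring R"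
  shows "left_module R M \<longleftrightarrow> Module.module R M"
proof
  assume "left_module R M"
  then interpret left_module R M .
  show "Module.module R M"
    by (intro moduleI assms M.abelian_group_axioms smult_closed smult_l_distr smult_r_distr
        smult_assoc smult_one)
next
  assume "Module.module R M"
  then interpret Module.module R M .
  show "left_module R M"
    by unfold_locales (simp_all add: smult_l_distr smult_r_distr smult_assoc1)
qed

definition finitely_generated :: "('r, 'x) ring_scheme \<Rightarrow> ('r, 'm) module \<Rightarrow> bool" where
  "finitely_generated R M \<longleftrightarrow>
     (\<exists>S. finite S \<and> S \<subseteq> carrier M \<and>
        (\<forall>x\<in>carrier M. \<exists>c \<in> S \<rightarrow> carrier R. x = (\<Oplus>\<^bsub>M\<^esub>s\<in>S. c s \<odot>\<^bsub>M\<^esub> s)))"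

definition fg_module :: "('r, 'x) ring_scheme \<Rightarrow> ('r, 'm) module \<Rightarrow> bool" where
  "fg_module R M \<longleftrightarrow> left_module R M \<and> finitely_generated R M"

definition zero_module :: "('r, 'm) module \<Rightarrow> bool" where
  "zero_module M \<longleftrightarrow> carrier M = {\<zero>\<^bsub>M\<^esub>}"

text \<open>Homomorphisms are extensional functions, so that equality of functions is equality of maps.\<close>

definition mod_hom :: "('r, 'x) ring_scheme \<Rightarrow> ('r, 'm) module \<Rightarrow> ('r, 'n) module \<Rightarrow> ('m \<Rightarrow> 'n) set" where
  "mod_hom R M N =
     {f \<in> carrier M \<rightarrow>\<^sub>E carrier N.
        (\<forall>x\<in>carrier M. \<forall>y\<in>carrier M. f (x \<oplus>\<^bsub>M\<^esub> y) = f x \<oplus>\<^bsub>N\<^esub> f y) \<and>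
        (\<forall>r\<in>carrier R. \<forall>x\<in>carrier M. f (r \<odot>\<^bsub>M\<^esub> x) = r \<odot>\<^bsub>N\<^esub> f x)}"

definition mod_iso :: "('r, 'x) ring_scheme \<Rightarrow> ('r, 'm) module \<Rightarrow> ('r, 'n) module \<Rightarrow> bool" where
  "mod_iso R M N \<longleftrightarrow> (\<exists>f \<in> mod_hom R M N. bij_betw f (carrier M) (carrier N))"

definition regular :: "('a, 'x) ring_scheme \<Rightarrow> ('a, 'a) module" where
  "regular R = \<lparr>carrier = carrier R, mult = mult R, one = one R, zero = zero R, add = add R,
                smult = mult R\<rparr>"

definition direct_sum :: "nat \<Rightarrow> (nat \<Rightarrow> ('r, 'm) module) \<Rightarrow> ('r, nat \<Rightarrow> 'm) module" where
  "direct_sum n N =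
     \<lparr>carrier = (\<Pi>\<^sub>E i\<in>{..<n}. carrier (N i)), mult = undefined, one = undefined,
      zero = (\<lambda>i\<in>{..<n}. \<zero>\<^bsub>N i\<^esub>),
      add = (\<lambda>x y. \<lambda>i\<in>{..<n}. x i \<oplus>\<^bsub>N i\<^esub> y i),
      smult = (\<lambda>r x. \<lambda>i\<in>{..<n}. r \<odot>\<^bsub>N i\<^esub> x i)\<rparr>"

definition is_summand :: "('r, 'x) ring_scheme \<Rightarrow> ('r, 'm) module \<Rightarrow> ('r, 'n) module \<Rightarrow> bool" where
  "is_summand R X M \<longleftrightarrow>
     (\<exists>\<iota> \<in> mod_hom R X M. \<exists>\<pi> \<in> mod_hom R M X. \<forall>x\<in>carrier X. \<pi> (\<iota> x) = x)"

definition in_add :: "('r, 'x) ring_scheme \<Rightarrow> ('r, 'm) module \<Rightarrow> ('r, 'n) module \<Rightarrow> bool" where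
  "in_add R X M \<longleftrightarrow> fg_module R X \<and> (\<exists>n. is_summand R X (direct_sum n (\<lambda>_. M)))"


section \<open>Finite-dimensional algebras and their finitely generated modules\<close>

text \<open>
  A \<open>\<K>\<close>-algebra is a record of type \<^typ>\<open>('k, 'a) module\<close>: a ring together with
  the scalar multiplication by \<open>\<K>\<close>.
\<close>

definition fin_dim_algebra :: "'k ring \<Rightarrow> ('k, 'a) module \<Rightarrow> bool" where
  "fin_dim_algebra K A \<longleftrightarrow>
     field K \<and> ring A \<and> Module.module K A \<and> finitely_generated K A \<and>
     (\<forall>c\<in>carrier K. \<forall>x\<in>carrier A. \<forall>y\<in>carrier A.
        c \<odot>\<^bsub>A\<^esub> (x \<otimes>\<^bsub>A\<^esub> y) = (c \<odot>\<^bsub>A\<^esub> x) \<otimes>\<^bsub>A\<^esub> y \<and>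
        c \<odot>\<^bsub>A\<^esub> (x \<otimes>\<^bsub>A\<^esub> y) = x \<otimes>\<^bsub>A\<^esub> (c \<odot>\<^bsub>A\<^esub> y))"

text \<open>
  A finitely generated module over a finite-dimensional \<open>\<K>\<close>-algebra is in bijection with some
  \<open>\<K>\<^sup>n\<close>, hence is isomorphic to one whose carrier is a subset of \<^typ>\<open>nat \<Rightarrow> 'k\<close>.
  Modules on this type (with arbitrary operations) therefore represent all isomorphism classes
  of finitely generated modules, and every quantification over modules below ranges over them.
\<close>

type_synonym ('k, 'a) fmodule = "('a, nat \<Rightarrow> 'k) module"

definition projective :: "('k, 'a) module \<Rightarrow> ('a, 'm) module \<Rightarrow> bool" where
  "projective A P \<longleftrightarrow> fg_module A P \<and>
     (\<forall>(M :: ('k, 'a) fmodule) (N :: ('k, 'a) fmodule).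
        fg_module A M \<and> fg_module A N \<longrightarrow>
        (\<forall>g \<in> mod_hom A M N. \<forall>f \<in> mod_hom A P N. g ` carrier M = carrier N \<longrightarrow>
          (\<exists>h \<in> mod_hom A P M. \<forall>x\<in>carrier P. g (h x) = f x)))"

definition injective :: "('k, 'a) module \<Rightarrow> ('a, 'm) module \<Rightarrow> bool" where
  "injective A I \<longleftrightarrow> fg_module A I \<and>
     (\<forall>(M :: ('k, 'a) fmodule) (N :: ('k, 'a) fmodule).
        fg_module A M \<and> fg_module A N \<longrightarrow>
        (\<forall>g \<in> mod_hom A M N. \<forall>f \<in> mod_hom A M I. inj_on g (carrier M) \<longrightarrow>
          (\<exists>h \<in> mod_hom A N I. \<forall>x\<in>carrier M. h (g x) = f x)))"

definition exact_at ::
    "('r, 'l) module \<Rightarrow> ('l \<Rightarrow> 'm) \<Rightarrow> ('r, 'm) module \<Rightarrow> ('m \<Rightarrow> 'n) \<Rightarrow> ('r, 'n) module \<Rightarrow> bool" where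
  "exact_at L f M g N \<longleftrightarrow> f ` carrier L = {x \<in> carrier M. g x = \<zero>\<^bsub>N\<^esub>}"

text \<open>Exact sequences \<open>\<dots> \<rightarrow> X\<^sub>1 \<rightarrow> X\<^sub>0 \<rightarrow> M \<rightarrow> 0\<close>, with \<open>d j : X (j + 1) \<rightarrow> X j\<close>.\<close>

definition left_resolution ::
    "('k, 'a) module \<Rightarrow> ('a, 'm) module \<Rightarrow> (nat \<Rightarrow> ('k, 'a) fmodule) \<Rightarrow>
     ((nat \<Rightarrow> 'k) \<Rightarrow> 'm) \<Rightarrow> (nat \<Rightarrow> (nat \<Rightarrow> 'k) \<Rightarrow> (nat \<Rightarrow> 'k)) \<Rightarrow> bool" where
  "left_resolution A M X \<epsilon> d \<longleftrightarrow>
     (\<forall>j. fg_module A (X j)) \<and>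
     \<epsilon> \<in> mod_hom A (X 0) M \<and> (\<forall>j. d j \<in> mod_hom A (X (Suc j)) (X j)) \<and>
     \<epsilon> ` carrier (X 0) = carrier M \<and>
     exact_at (X (Suc 0)) (d 0) (X 0) \<epsilon> M \<and>
     (\<forall>j. exact_at (X (Suc (Suc j))) (d (Suc j)) (X (Suc j)) (d j) (X j))"

text \<open>Exact sequences \<open>0 \<rightarrow> M \<rightarrow> X\<^sup>0 \<rightarrow> X\<^sup>1 \<rightarrow> \<dots>\<close>, with \<open>d j : X j \<rightarrow> X (j + 1)\<close>.\<close>

definition right_resolution ::
    "('k, 'a) module \<Rightarrow> ('a, 'm) module \<Rightarrow> (nat \<Rightarrow> ('k, 'a) fmodule) \<Rightarrow>
     ('m \<Rightarrow> (nat \<Rightarrow> 'k)) \<Rightarrow> (nat \<Rightarrow> (nat \<Rightarrow> 'k) \<Rightarrow> (nat \<Rightarrow> 'k)) \<Rightarrow> bool" where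
  "right_resolution A M X \<eta> d \<longleftrightarrow>
     (\<forall>j. fg_module A (X j)) \<and>
     \<eta> \<in> mod_hom A M (X 0) \<and> (\<forall>j. d j \<in> mod_hom A (X j) (X (Suc j))) \<and>
     inj_on \<eta> (carrier M) \<and>
     exact_at M \<eta> (X 0) (d 0) (X (Suc 0)) \<and>
     (\<forall>j. exact_at (X j) (d j) (X (Suc j)) (d (Suc j)) (X (Suc (Suc j))))"

definition projective_resolution where
  "projective_resolution A M P \<epsilon> d \<longleftrightarrow> left_resolution A M P \<epsilon> d \<and> (\<forall>j. projective A (P j))"

definition injective_resolution where
  "injective_resolution A M I \<eta> d \<longleftrightarrow> right_resolution A M I \<eta> d \<and> (\<forall>j. injective A (I j))"


section \<open>Homological dimensions and Ext\<close>

text \<open>A sequence of length \<open>n\<close> is a resolution whose terms vanish beyond index \<open>n\<close>.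
  The dimension is \<open>\<infinity>\<close> if no finite resolution exists, and \<open>0\<close> for the zero module.\<close>

definition pdim :: "('k, 'a) module \<Rightarrow> ('a, 'm) module \<Rightarrow> enat" where
  "pdim A M = Inf {enat n | n.
     \<exists>P \<epsilon> d. projective_resolution A M P \<epsilon> d \<and> (\<forall>j>n. zero_module (P j))}"

definition idim :: "('k, 'a) module \<Rightarrow> ('a, 'm) module \<Rightarrow> enat" where
  "idim A M = Inf {enat n | n.
     \<exists>I \<eta> d. injective_resolution A M I \<eta> d \<and> (\<forall>j>n. zero_module (I j))}"

definition gldim :: "('k, 'a) module \<Rightarrow> enat" where
  "gldim A = (SUP M \<in> {M :: ('k, 'a) fmodule. fg_module A M}. pdim A M)"

definition domdim_ge :: "('k, 'a) module \<Rightarrow> nat \<Rightarrow> bool" where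
  "domdim_ge A k \<longleftrightarrow>
     (\<exists>I \<eta> d. injective_resolution A (regular A) I \<eta> d \<and> (\<forall>j<k. projective A (I j)))"

definition domdim :: "('k, 'a) module \<Rightarrow> enat" where
  "domdim A = Sup {enat k | k. domdim_ge A k}"

text \<open>\<open>Ext\<^sup>i(M, N)\<close> is the \<open>i\<close>-th cohomology group of \<open>Hom(P\<^sub>\<bullet>, N)\<close> for a projective
  resolution \<open>P\<^sub>\<bullet>\<close> of \<open>M\<close>.\<close>

definition hom_group ::
    "('r, 'x) ring_scheme \<Rightarrow> ('r, 'm) module \<Rightarrow> ('r, 'n) module \<Rightarrow> ('m \<Rightarrow> 'n) monoid" where
  "hom_group R M N =
     \<lparr>carrier = mod_hom R M N,
      mult = (\<lambda>f g. \<lambda>x\<in>carrier M. f x \<oplus>\<^bsub>N\<^esub> g x),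
      one = (\<lambda>x\<in>carrier M. \<zero>\<^bsub>N\<^esub>)\<rparr>"

definition cocycles where
  "cocycles A P d N i =
     {f \<in> mod_hom A (P i) N. \<forall>x\<in>carrier (P (Suc i)). f (d i x) = \<zero>\<^bsub>N\<^esub>}"

definition coboundaries where
  "coboundaries A P d N i =
     (case i of
        0 \<Rightarrow> {\<lambda>x\<in>carrier (P 0). \<zero>\<^bsub>N\<^esub>}
      | Suc j \<Rightarrow> (\<lambda>g. compose (carrier (P (Suc j))) g (d j)) ` mod_hom A (P j) N)"

definition Ext ::
    "('k, 'a) module \<Rightarrow> nat \<Rightarrow> ('a, 'm) module \<Rightarrow> ('a, 'n) module \<Rightarrow> ((nat \<Rightarrow> 'k) \<Rightarrow> 'n) set monoid" where
  "Ext A i M N =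
     (let (P, \<epsilon>, d) = (SOME (P, \<epsilon>, d). projective_resolution A M P \<epsilon> d)
      in (hom_group A (P i) N)\<lparr>carrier := cocycles A P d N i\<rparr> Mod coboundaries A P d N i)"


section \<open>Special tilting and cotilting modules\<close>

text \<open>\<open>D\<Gamma> = Hom\<^sub>\<K>(\<Gamma>, \<K>)\<close> as a left module: \<open>(a f)(x) = f (x a)\<close>.\<close>

definition dual_regular :: "'k ring \<Rightarrow> ('k, 'a) module \<Rightarrow> ('a, 'a \<Rightarrow> 'k) module" where
  "dual_regular K A =
     \<lparr>carrier = mod_hom K A (regular K), mult = undefined, one = undefined,
      zero = (\<lambda>x\<in>carrier A. \<zero>\<^bsub>K\<^esub>),
      add = (\<lambda>f g. \<lambda>x\<in>carrier A. f x \<oplus>\<^bsub>K\<^esub> g x),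
      smult = (\<lambda>a f. \<lambda>x\<in>carrier A. f (x \<otimes>\<^bsub>A\<^esub> a))\<rparr>"

text \<open>The sequences \<open>0 \<rightarrow> \<Gamma> \<rightarrow> t\<^sub>0 \<rightarrow> \<dots> \<rightarrow> t\<^sub>k \<rightarrow> 0\<close> with all \<open>t\<^sub>j\<close> in \<open>add T\<close>,
  and dually \<open>0 \<rightarrow> c\<^sup>k \<rightarrow> \<dots> \<rightarrow> c\<^sup>0 \<rightarrow> D\<Gamma> \<rightarrow> 0\<close> with all \<open>c\<^sup>j\<close> in \<open>add C\<close>.\<close>

definition tilting_sequence where
  "tilting_sequence A k T t \<eta> d \<longleftrightarrow>
     right_resolution A (regular A) t \<eta> d \<and>
     (\<forall>j\<le>k. in_add A (t j) T) \<and> (\<forall>j>k. zero_module (t j))"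

definition cotilting_sequence where
  "cotilting_sequence K A k C c \<epsilon> d \<longleftrightarrow>
     left_resolution A (dual_regular K A) c \<epsilon> d \<and>
     (\<forall>j\<le>k. in_add A (c j) C) \<and> (\<forall>j>k. zero_module (c j))"

definition tilting :: "('k, 'a) module \<Rightarrow> nat \<Rightarrow> ('a, 'm) module \<Rightarrow> bool" where
  "tilting A k T \<longleftrightarrow>
     fg_module A T \<and> pdim A T \<le> enat k \<and> (\<forall>i>0. trivial_group (Ext A i T T)) \<and>
     (\<exists>t \<eta> d. tilting_sequence A k T t \<eta> d)"

definition special_tilting ::
    "('k, 'a) module \<Rightarrow> ('a, 'p) module \<Rightarrow> nat \<Rightarrow> ('a, 'm) module \<Rightarrow> bool" where
  "special_tilting A P k T \<longleftrightarrow>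
     tilting A k T \<and> projective A P \<and> in_add A P T \<and>
     (\<exists>t \<eta> d. tilting_sequence A k T t \<eta> d \<and> (\<forall>j<k. in_add A (t j) P))"

definition cotilting :: "'k ring \<Rightarrow> ('k, 'a) module \<Rightarrow> nat \<Rightarrow> ('a, 'm) module \<Rightarrow> bool" where
  "cotilting K A k C \<longleftrightarrow>
     fg_module A C \<and> idim A C \<le> enat k \<and> (\<forall>i>0. trivial_group (Ext A i C C)) \<and>
     (\<exists>c \<epsilon> d. cotilting_sequence K A k C c \<epsilon> d)"

definition special_cotilting ::
    "'k ring \<Rightarrow> ('k, 'a) module \<Rightarrow> ('a, 'p) module \<Rightarrow> nat \<Rightarrow> ('a, 'm) module \<Rightarrow> bool" where
  "special_cotilting K A I k C \<longleftrightarrow>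
     cotilting K A k C \<and> injective A I \<and> in_add A I C \<and>
     (\<exists>c \<epsilon> d. cotilting_sequence K A k C c \<epsilon> d \<and> (\<forall>j<k. in_add A (c j) I))"


section \<open>Basic modules, shifted modules and shifted algebras\<close>

definition indecomposable :: "('k, 'a) module \<Rightarrow> ('a, 'm) module \<Rightarrow> bool" where
  "indecomposable A M \<longleftrightarrow> fg_module A M \<and> \<not> zero_module M \<and>
     (\<forall>(X :: ('k, 'a) fmodule) (Y :: ('k, 'a) fmodule).
        fg_module A X \<and> fg_module A Y \<and>
        mod_iso A M (direct_sum 2 (\<lambda>i. if i = 0 then X else Y)) \<longrightarrow>
        zero_module X \<or> zero_module Y)"

definition basic_module :: "('k, 'a) module \<Rightarrow> ('a, 'm) module \<Rightarrow> bool" where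
  "basic_module A M \<longleftrightarrow> fg_module A M \<and>
     (\<exists>n (N :: nat \<Rightarrow> ('k, 'a) fmodule).
        (\<forall>i<n. indecomposable A (N i)) \<and>
        (\<forall>i<n. \<forall>j<n. i \<noteq> j \<longrightarrow> \<not> mod_iso A (N i) (N j)) \<and>
        mod_iso A M (direct_sum n N))"

definition basic_algebra :: "('k, 'a) module \<Rightarrow> bool" where
  "basic_algebra A \<longleftrightarrow> basic_module A (regular A)"

definition projective_injective_summand :: "('k, 'a) module \<Rightarrow> ('k, 'a) fmodule \<Rightarrow> bool" where
  "projective_injective_summand A Q \<longleftrightarrow>
     projective A Q \<and> injective A Q \<and> is_summand A Q (regular A)"

definition maximal_projective_injective_summand ::
    "('k, 'a) module \<Rightarrow> ('k, 'a) fmodule \<Rightarrow> bool" where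
  "maximal_projective_injective_summand A Q \<longleftrightarrow>
     projective_injective_summand A Q \<and>
     (\<forall>Q'. projective_injective_summand A Q' \<and> is_summand A Q Q' \<longrightarrow> mod_iso A Q Q')"

text \<open>The shifted and coshifted modules are determined up to isomorphism only, so they are
  introduced as predicates.\<close>

definition is_shifted_module ::
    "('k, 'a) module \<Rightarrow> ('k, 'a) fmodule \<Rightarrow> nat \<Rightarrow> ('k, 'a) fmodule \<Rightarrow> bool" where
  "is_shifted_module A Q k T \<longleftrightarrow> basic_module A T \<and> special_tilting A Q k T"

definition is_coshifted_module ::
    "'k ring \<Rightarrow> ('k, 'a) module \<Rightarrow> ('k, 'a) fmodule \<Rightarrow> nat \<Rightarrow> ('k, 'a) fmodule \<Rightarrow> bool" where
  "is_coshifted_module K A Q k C \<longleftrightarrow> basic_module A C \<and> special_cotilting K A Q k C"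

text \<open>Multiplication in the endomorphism algebra is composition of functions,
  \<open>(f g)(x) = f (g x)\<close>; scalars act on modules through \<open>c \<mapsto> c 1\<close>.\<close>

definition end_algebra :: "('k, 'a) module \<Rightarrow> ('a, 'm) module \<Rightarrow> ('k, 'm \<Rightarrow> 'm) module" where
  "end_algebra A M =
     \<lparr>carrier = mod_hom A M M,
      mult = (\<lambda>f g. compose (carrier M) f g),
      one = (\<lambda>x\<in>carrier M. x),
      zero = (\<lambda>x\<in>carrier M. \<zero>\<^bsub>M\<^esub>),
      add = (\<lambda>f g. \<lambda>x\<in>carrier M. f x \<oplus>\<^bsub>M\<^esub> g x),
      smult = (\<lambda>c f. \<lambda>x\<in>carrier M. (c \<odot>\<^bsub>A\<^esub> \<one>\<^bsub>A\<^esub>) \<odot>\<^bsub>M\<^esub> f x)\<rparr>"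

definition opposite_algebra :: "('k, 'a) module \<Rightarrow> ('k, 'a) module" where
  "opposite_algebra A = A\<lparr>mult := (\<lambda>x y. y \<otimes>\<^bsub>A\<^esub> x)\<rparr>"

definition endop :: "('k, 'a) module \<Rightarrow> ('a, 'm) module \<Rightarrow> ('k, 'm \<Rightarrow> 'm) module" where
  "endop A M = opposite_algebra (end_algebra A M)"

end

theory Submission
  imports Defs
begin

text \<open>The functor \<open>Hom(T, -)\<close> identifies \<open>add T\<close> with the projective modules over
\<open>B = End(T)\<^sup>o\<^sup>p\<close>, so a projective resolution over \<open>B\<close> becomes a complex in
\<open>add T\<close>. The coresolution of \<open>\<Gamma>\<close> by \<open>add T\<close> has length \<open>k\<close>, which makes this
complex exact from degree \<open>k\<close> on; the images of its differentials there admit no extensions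
from \<open>T\<close>. All terms of the coresolution but the last are projective-injective, which
forces such images to have injective dimension at most \<open>gldim \<Gamma> - k\<close>, so the complex splits
after \<open>gldim \<Gamma>\<close> steps. Conversely, an object without extensions from \<open>T\<close> has a
resolution by \<open>add T\<close> of length at most \<open>gldim B\<close>, and the \<open>k\<close>-th injective cosyzygy of
any object has no extensions from \<open>T\<close>.

The categorical axioms used are self-dual, hence the coshifted case is the shifted case in the
opposite category, where the functor \<open>Hom(-, C)\<close> lands in modules over \<open>End(C)\<close>.
That \<open>gldim R = gldim R\<^sup>o\<^sup>p\<close> is the case \<open>k = 0\<close> for the object \<open>D R\<close> in the
opposite of the category of \<open>R\<close>-modules.\<close>

section \<open>Abelian-like categories with enough projectives and injectives\<close>

text \<open>Only the vanishing of Ext matters, so no Ext group is built inside the category: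
  \<open>exz n\<close> is vanishing in degree n + 1, which makes \<open>gl n\<close> mean global
  dimension at most n, and the long exact sequences survive as implications between such statements.
  The functor Hom(T, -) is used as full and faithful only on maps out of add T; hence the work with
  complexes in add T instead of an inverse functor. Such a complex becomes exact only from degree k
  on, and by itself this would give the weaker upper bound gldim \<Gamma> + k. The drop of injective
  dimension by k that the projective-injective terms cause pays back exactly this loss. The count
  presupposes k \<le> gldim \<Gamma>. If gldim \<Gamma> < k, the coresolution splits, \<Gamma> is
  self-injective, and finite global dimension then forces every short exact sequence to split. All
  objects live on the one type \<open>nat \<Rightarrow> 'k\<close>; whatever arises on another type,
  such as products, D\<Gamma> or Hom modules, is copied there along an injection.\<close>

locale precat =
  fixes Ob :: "'o set" and Arr :: "'m set" and src tgt :: "'m \<Rightarrow> 'o"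
    and cmp :: "'m \<Rightarrow> 'm \<Rightarrow> 'm" (infixl "\<cdot>" 70)
    and idn :: "'o \<Rightarrow> 'm"
    and plus :: "'m \<Rightarrow> 'm \<Rightarrow> 'm" (infixl "\<boxplus>" 65)
    and neg :: "'m \<Rightarrow> 'm" and zer :: "'o \<Rightarrow> 'o \<Rightarrow> 'm"
  assumes src_Ob [simp]: "f \<in> Arr \<Longrightarrow> src f \<in> Ob"
    and tgt_Ob [simp]: "f \<in> Arr \<Longrightarrow> tgt f \<in> Ob"
    and cmp_Arr [simp]: "\<lbrakk>g \<in> Arr; f \<in> Arr; src g = tgt f\<rbrakk> \<Longrightarrow> g \<cdot> f \<in> Arr"
    and cmp_src [simp]: "\<lbrakk>g \<in> Arr; f \<in> Arr; src g = tgt f\<rbrakk> \<Longrightarrow> src (g \<cdot> f) = src f"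
    and cmp_tgt [simp]: "\<lbrakk>g \<in> Arr; f \<in> Arr; src g = tgt f\<rbrakk> \<Longrightarrow> tgt (g \<cdot> f) = tgt g"
    and cmp_assoc: "(h \<cdot> g) \<cdot> f = h \<cdot> (g \<cdot> f)"
    and idn_Arr [simp]: "X \<in> Ob \<Longrightarrow> idn X \<in> Arr"
    and idn_src [simp]: "X \<in> Ob \<Longrightarrow> src (idn X) = X"
    and idn_tgt [simp]: "X \<in> Ob \<Longrightarrow> tgt (idn X) = X"
    and cmp_idn [simp]: "\<lbrakk>f \<in> Arr; src f = X\<rbrakk> \<Longrightarrow> f \<cdot> idn X = f"
    and idn_cmp [simp]: "\<lbrakk>f \<in> Arr; tgt f = X\<rbrakk> \<Longrightarrow> idn X \<cdot> f = f"
    and plus_Arr [simp]: "\<lbrakk>f \<in> Arr; g \<in> Arr; src f = src g; tgt f = tgt g\<rbrakk> \<Longrightarrow> f \<boxplus> g \<in> Arr"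
    and plus_src [simp]:
      "\<lbrakk>f \<in> Arr; g \<in> Arr; src f = src g; tgt f = tgt g\<rbrakk> \<Longrightarrow> src (f \<boxplus> g) = src g"
    and plus_tgt [simp]:
      "\<lbrakk>f \<in> Arr; g \<in> Arr; src f = src g; tgt f = tgt g\<rbrakk> \<Longrightarrow> tgt (f \<boxplus> g) = tgt g"
    and plus_assoc: "(f \<boxplus> g) \<boxplus> h = f \<boxplus> (g \<boxplus> h)"
    and plus_comm: "f \<boxplus> g = g \<boxplus> f"
    and neg_Arr [simp]: "f \<in> Arr \<Longrightarrow> neg f \<in> Arr"
    and neg_src [simp]: "f \<in> Arr \<Longrightarrow> src (neg f) = src f"
    and neg_tgt [simp]: "f \<in> Arr \<Longrightarrow> tgt (neg f) = tgt f"
    and plus_neg: "f \<in> Arr \<Longrightarrow> f \<boxplus> neg f = zer (src f) (tgt f)"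
    and zer_Arr [simp]: "\<lbrakk>X \<in> Ob; Y \<in> Ob\<rbrakk> \<Longrightarrow> zer X Y \<in> Arr"
    and zer_src [simp]: "\<lbrakk>X \<in> Ob; Y \<in> Ob\<rbrakk> \<Longrightarrow> src (zer X Y) = X"
    and zer_tgt [simp]: "\<lbrakk>X \<in> Ob; Y \<in> Ob\<rbrakk> \<Longrightarrow> tgt (zer X Y) = Y"
    and plus_zer [simp]: "\<lbrakk>f \<in> Arr; src f = X; tgt f = Y\<rbrakk> \<Longrightarrow> f \<boxplus> zer X Y = f"
    and cmp_zer [simp]: "\<lbrakk>f \<in> Arr; src f = Y; X \<in> Ob\<rbrakk> \<Longrightarrow> f \<cdot> zer X Y = zer X (tgt f)"
    and zer_cmp [simp]: "\<lbrakk>f \<in> Arr; tgt f = X; Y \<in> Ob\<rbrakk> \<Longrightarrow> zer X Y \<cdot> f = zer (src f) Y"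
    and cmp_plus: "h \<cdot> (f \<boxplus> g) = h \<cdot> f \<boxplus> h \<cdot> g"
    and plus_cmp: "(f \<boxplus> g) \<cdot> h = f \<cdot> h \<boxplus> g \<cdot> h"
    and cmp_neg: "h \<cdot> neg f = neg (h \<cdot> f)"
    and neg_cmp: "neg h \<cdot> f = neg (h \<cdot> f)"
begin

abbreviation hom where "hom f X Y \<equiv> f \<in> Arr \<and> src f = X \<and> tgt f = Y"

abbreviation sub (infixl "\<boxminus>" 65) where "f \<boxminus> g \<equiv> f \<boxplus> neg g"

definition mono where
  "mono f \<longleftrightarrow> f \<in> Arr \<and>
     (\<forall>u. u \<in> Arr \<longrightarrow> tgt u = src f \<longrightarrow> f \<cdot> u = zer (src u) (tgt f) \<longrightarrow> u = zer (src u) (src f))"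

definition epi where
  "epi f \<longleftrightarrow> f \<in> Arr \<and>
     (\<forall>u. u \<in> Arr \<longrightarrow> src u = tgt f \<longrightarrow> u \<cdot> f = zer (src f) (tgt u) \<longrightarrow> u = zer (tgt f) (tgt u))"

text \<open>Asking for the kernel property of \<open>m\<close> and the cokernel property of
  \<open>e\<close> at the same time makes the notion self-dual and spares separate kernels and
  cokernels.\<close>

definition ses where
  "ses m e \<longleftrightarrow> mono m \<and> epi e \<and> tgt m = src e \<and> e \<cdot> m = zer (src m) (tgt e) \<and>
     (\<forall>u. u \<in> Arr \<longrightarrow> tgt u = src e \<longrightarrow> e \<cdot> u = zer (src u) (tgt e) \<longrightarrow>
        (\<exists>v. hom v (src u) (src m) \<and> m \<cdot> v = u)) \<and>
     (\<forall>u. u \<in> Arr \<longrightarrow> src u = tgt m \<longrightarrow> u \<cdot> m = zer (src m) (tgt u) \<longrightarrow>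
        (\<exists>v. hom v (tgt e) (tgt u) \<and> v \<cdot> e = u))"

definition biprod where
  "biprod X Y Z i j p q \<longleftrightarrow> hom i X Z \<and> hom j Y Z \<and> hom p Z X \<and> hom q Z Y \<and>
     p \<cdot> i = idn X \<and> q \<cdot> j = idn Y \<and> q \<cdot> i = zer X Y \<and> p \<cdot> j = zer Y X \<and>
     i \<cdot> p \<boxplus> j \<cdot> q = idn Z"

definition proj where
  "proj P \<longleftrightarrow> P \<in> Ob \<and> (\<forall>e f. epi e \<longrightarrow> hom f P (tgt e) \<longrightarrow> (\<exists>h. hom h P (src e) \<and> e \<cdot> h = f))"

definition inj where
  "inj I \<longleftrightarrow> I \<in> Ob \<and> (\<forall>m f. mono m \<longrightarrow> hom f (src m) I \<longrightarrow> (\<exists>h. hom h (tgt m) I \<and> h \<cdot> m = f))"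

definition pres where
  "pres W P X w e \<longleftrightarrow> ses w e \<and> hom w W P \<and> hom e P X \<and> proj P"

definition copres where
  "copres Y I Z j q \<longleftrightarrow> ses j q \<and> hom j Y I \<and> hom q I Z \<and> inj I"

text \<open>\<open>exz n X Y\<close> says that \<open>Ext\<close> of degree \<open>n + 1\<close> vanishes on \<open>(X, Y)\<close>.\<close>

primrec exz :: "nat \<Rightarrow> 'o \<Rightarrow> 'o \<Rightarrow> bool" where
  "exz 0 X Y \<longleftrightarrow> X \<in> Ob \<and> Y \<in> Ob \<and>
     (\<forall>W P w e. pres W P X w e \<longrightarrow> (\<forall>f. hom f W Y \<longrightarrow> (\<exists>h. hom h P Y \<and> h \<cdot> w = f)))"
| "exz (Suc n) X Y \<longleftrightarrow> X \<in> Ob \<and> Y \<in> Ob \<and> (\<forall>W P w e. pres W P X w e \<longrightarrow> exz n W Y)"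

text \<open>This is add T. Closure under binary biproducts and retracts replaces summands of powers
  of \<open>T\<close>, so that statements pass from \<open>T\<close> to add T by induction.\<close>

inductive addc for T where
  addc_self: "T \<in> Ob \<Longrightarrow> addc T T"
| addc_biprod: "\<lbrakk>addc T X; addc T Y; biprod X Y Z i j p q\<rbrakk> \<Longrightarrow> addc T Z"
| addc_retract: "\<lbrakk>addc T X; hom s Y X; hom r X Y; r \<cdot> s = idn Y\<rbrakk> \<Longrightarrow> addc T Y"

text \<open>Finite generation of Hom(T, X) over the endomorphism ring of \<open>T\<close>, acting by
  precomposition; in \<open>fgl\<close> the action is by postcomposition. Stating generation through
  closed subsets keeps linear combinations out of the category.\<close>

definition fgr where
  "fgr T X \<longleftrightarrow> (\<exists>S. finite S \<and> S \<subseteq> {f. hom f T X} \<and>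
     (\<forall>N. S \<subseteq> N \<longrightarrow> N \<subseteq> {f. hom f T X} \<longrightarrow> zer T X \<in> N \<longrightarrow> (\<forall>f\<in>N. \<forall>g\<in>N. f \<boxplus> g \<in> N) \<longrightarrow>
        (\<forall>f\<in>N. \<forall>h. hom h T T \<longrightarrow> f \<cdot> h \<in> N) \<longrightarrow> (\<forall>f. hom f T X \<longrightarrow> f \<in> N)))"

definition fgl where
  "fgl X T \<longleftrightarrow> (\<exists>S. finite S \<and> S \<subseteq> {f. hom f X T} \<and>
     (\<forall>N. S \<subseteq> N \<longrightarrow> N \<subseteq> {f. hom f X T} \<longrightarrow> zer X T \<in> N \<longrightarrow> (\<forall>f\<in>N. \<forall>g\<in>N. f \<boxplus> g \<in> N) \<longrightarrow>
        (\<forall>f\<in>N. \<forall>h. hom h T T \<longrightarrow> h \<cdot> f \<in> N) \<longrightarrow> (\<forall>f. hom f X T \<longrightarrow> f \<in> N)))"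

text \<open>Reversal permutes the axioms among themselves. Every lemma of the locale therefore has a
  dual, read off by interpreting the locale in the opposite category and translating with the
  \<open>op_\<close> equations.\<close>

lemma op_precat: "precat Ob Arr tgt src (\<lambda>g f. f \<cdot> g) idn plus neg (\<lambda>X Y. zer Y X)"
  by unfold_locales (simp_all add: cmp_assoc plus_assoc plus_neg cmp_plus plus_cmp
      cmp_neg neg_cmp, rule plus_comm)

lemma reassoc: "g \<cdot> f = h \<Longrightarrow> g \<cdot> (f \<cdot> x) = h \<cdot> x"
  by (simp add: cmp_assoc[symmetric])

lemma zer_plus [simp]: "\<lbrakk>f \<in> Arr; src f = X; tgt f = Y\<rbrakk> \<Longrightarrow> zer X Y \<boxplus> f = f"
  by (simp add: plus_comm)

lemma neg_zer [simp]:
  assumes "X \<in> Ob" "Y \<in> Ob" shows "neg (zer X Y) = zer X Y"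
  using plus_neg[of "zer X Y"] zer_plus[of "neg (zer X Y)" X Y] assms by simp

lemma sub_self [simp]: "f \<in> Arr \<Longrightarrow> f \<boxminus> f = zer (src f) (tgt f)"
  by (rule plus_neg)

lemma sub_eq_zer:
  assumes "f \<in> Arr" "g \<in> Arr" "src f = src g" "tgt f = tgt g" "f \<boxminus> g = zer (src g) (tgt g)"
  shows "f = g"
proof -
  have "f = f \<boxplus> (neg g \<boxplus> g)"
    using assms by (simp add: plus_comm[of "neg g"])
  then show ?thesis
    using assms by (simp add: plus_assoc[symmetric])
qed

lemma sub_plus_cancel:
  assumes "hom f X Y" "hom g X Y" shows "(f \<boxminus> g) \<boxplus> g = f"
  using assms by (simp add: plus_assoc plus_comm[of "neg g"])

lemma mono_cancel:
  assumes "mono m" "hom u W (src m)" "hom v W (src m)" "m \<cdot> u = m \<cdot> v"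
  shows "u = v"
proof (rule sub_eq_zer)
  have m: "m \<in> Arr" using assms(1) by (simp add: mono_def)
  have "m \<cdot> (u \<boxminus> v) = zer W (tgt m)"
    using assms m by (simp add: cmp_plus cmp_neg)
  then show "u \<boxminus> v = zer (src v) (tgt v)"
    using assms(1-3) unfolding mono_def
    by (metis neg_Arr neg_src neg_tgt plus_Arr plus_src plus_tgt)
qed (use assms in auto)

lemma mono_Arr: "mono f \<Longrightarrow> f \<in> Arr"
  by (simp add: mono_def)

lemma epi_Arr: "epi f \<Longrightarrow> f \<in> Arr"
  by (simp add: epi_def)

lemma sesD:
  assumes "ses m e"
  shows "mono m" "epi e" "m \<in> Arr" "e \<in> Arr" "tgt m = src e" "e \<cdot> m = zer (src m) (tgt e)"
  using assms by (auto simp: ses_def mono_def epi_def)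

lemma ses_lift:
  assumes "ses m e" "hom u W (src e)" "e \<cdot> u = zer W (tgt e)"
  obtains v where "hom v W (src m)" "m \<cdot> v = u"
  using assms unfolding ses_def by metis

lemma ses_desc:
  assumes "ses m e" "hom u (tgt m) W" "u \<cdot> m = zer (src m) W"
  obtains v where "hom v (tgt e) W" "v \<cdot> e = u"
  using assms unfolding ses_def by metis

lemma pres_Ob: "pres W P X w e \<Longrightarrow> W \<in> Ob \<and> P \<in> Ob \<and> X \<in> Ob"
  by (auto simp: pres_def)

lemma copres_Ob: "copres Y I Z j q \<Longrightarrow> Y \<in> Ob \<and> I \<in> Ob \<and> Z \<in> Ob"
  by (auto simp: copres_def)

lemma exz_Ob: "exz n X Y \<Longrightarrow> X \<in> Ob \<and> Y \<in> Ob"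
  by (cases n) auto

lemma projE:
  assumes "proj P" "epi e" "hom f P (tgt e)"
  obtains h where "hom h P (src e)" "e \<cdot> h = f"
  using assms unfolding proj_def by metis

lemma injE:
  assumes "inj I" "mono m" "hom f (src m) I"
  obtains h where "hom h (tgt m) I" "h \<cdot> m = f"
  using assms unfolding inj_def by metis

lemma addc_Ob: "addc T X \<Longrightarrow> X \<in> Ob"
  by (induction rule: addc.induct) (auto simp: biprod_def)

lemma proj_retract:
  assumes P: "proj P" and s: "hom s Y P" and r: "hom r P Y" and rs: "r \<cdot> s = idn Y"
  shows "proj Y"
  unfolding proj_def
proof (intro conjI allI impI)
  show "Y \<in> Ob" using s by auto
  fix e f assume e: "epi e" and f: "hom f Y (tgt e)"
  obtain h where h: "hom h P (src e)" "e \<cdot> h = f \<cdot> r"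
    using projE[OF P e, of "f \<cdot> r"] r f by auto
  have "e \<cdot> (h \<cdot> s) = f"
    using h s r rs f by (simp add: reassoc[OF h(2)] cmp_assoc)
  then show "\<exists>h. hom h Y (src e) \<and> e \<cdot> h = f"
    using h s by (intro exI[of _ "h \<cdot> s"]) auto
qed

lemma proj_biprod:
  assumes "proj X" "proj Y" "biprod X Y Z i j p q"
  shows "proj Z"
  unfolding proj_def
proof (intro conjI allI impI)
  have b: "hom i X Z" "hom j Y Z" "hom p Z X" "hom q Z Y" "i \<cdot> p \<boxplus> j \<cdot> q = idn Z"
    using assms(3) by (auto simp: biprod_def)
  show "Z \<in> Ob" using b by auto
  fix e f assume e: "epi e" and f: "hom f Z (tgt e)"
  obtain g where g: "hom g X (src e)" "e \<cdot> g = f \<cdot> i"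
    using projE[OF assms(1) e, of "f \<cdot> i"] b f by auto
  obtain h where h: "hom h Y (src e)" "e \<cdot> h = f \<cdot> j"
    using projE[OF assms(2) e, of "f \<cdot> j"] b f by auto
  have "e \<cdot> (g \<cdot> p \<boxplus> h \<cdot> q) = f \<cdot> (i \<cdot> p \<boxplus> j \<cdot> q)"
    by (simp add: cmp_plus reassoc[OF g(2)] reassoc[OF h(2)] cmp_assoc)
  then have "e \<cdot> (g \<cdot> p \<boxplus> h \<cdot> q) = f"
    using b f by simp
  then show "\<exists>h. hom h Z (src e) \<and> e \<cdot> h = f"
    using g h b by (intro exI[of _ "g \<cdot> p \<boxplus> h \<cdot> q"]) auto
qed

lemma addc_proj: "addc T X \<Longrightarrow> proj T \<Longrightarrow> proj X"
  by (induction rule: addc.induct) (auto intro: proj_biprod proj_retract)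

lemma addc_trans: "addc X Y \<Longrightarrow> addc T X \<Longrightarrow> addc T Y"
  by (induction rule: addc.induct) (auto intro: addc.intros)

text \<open>With this, closure of a vanishing condition under biproducts is a case of its closure
  under extensions.\<close>

lemma biprod_ses:
  assumes "biprod X Y Z i j p q"
  shows "ses i q"
proof -
  have b: "hom i X Z" "hom j Y Z" "hom p Z X" "hom q Z Y" "i \<cdot> p \<boxplus> j \<cdot> q = idn Z"
    "p \<cdot> i = idn X" "q \<cdot> j = idn Y" "q \<cdot> i = zer X Y" "p \<cdot> j = zer Y X"
    using assms by (auto simp: biprod_def)
  have XY: "X \<in> Ob" "Y \<in> Ob" "Z \<in> Ob" using b by auto
  have "mono i"
    unfolding mono_def
  proof (intro conjI allI impI)
    fix u assume u: "u \<in> Arr" "tgt u = src i" "i \<cdot> u = zer (src u) (tgt i)"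
    have "u = p \<cdot> (i \<cdot> u)" using b u(1,2) by (simp add: cmp_assoc[symmetric])
    then show "u = zer (src u) (src i)" using u b by simp
  qed (use b in auto)
  moreover have "epi q"
    unfolding epi_def
  proof (intro conjI allI impI)
    fix u assume u: "u \<in> Arr" "src u = tgt q" "u \<cdot> q = zer (src q) (tgt u)"
    have "u = (u \<cdot> q) \<cdot> j" using b u(1,2) by (simp add: reassoc cmp_assoc)
    then show "u = zer (tgt q) (tgt u)" using u b XY by simp
  qed (use b in auto)
  moreover have "\<exists>v. hom v (src u) (src i) \<and> i \<cdot> v = u"
    if u: "u \<in> Arr" "tgt u = src q" "q \<cdot> u = zer (src u) (tgt q)" for u
  proof -
    have "u = (i \<cdot> p \<boxplus> j \<cdot> q) \<cdot> u" using b u by simp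
    also have "\<dots> = i \<cdot> (p \<cdot> u) \<boxplus> j \<cdot> (q \<cdot> u)" by (simp add: plus_cmp cmp_assoc)
    also have "\<dots> = i \<cdot> (p \<cdot> u)" using u b by simp
    finally show ?thesis using u b by (intro exI[of _ "p \<cdot> u"]) auto
  qed
  moreover have "\<exists>v. hom v (tgt q) (tgt u) \<and> v \<cdot> q = u"
    if u: "u \<in> Arr" "src u = tgt i" "u \<cdot> i = zer (src i) (tgt u)" for u
  proof -
    have "u = u \<cdot> (i \<cdot> p \<boxplus> j \<cdot> q)" using b u by simp
    also have "\<dots> = (u \<cdot> i) \<cdot> p \<boxplus> (u \<cdot> j) \<cdot> q" by (simp add: cmp_plus cmp_assoc)
    also have "\<dots> = (u \<cdot> j) \<cdot> q" using u b by simp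
    finally show ?thesis using u b by (intro exI[of _ "u \<cdot> j"]) auto
  qed
  ultimately show ?thesis
    using b by (auto simp: ses_def)
qed

section \<open>Translation of the notions to the opposite category\<close>

lemma op_mono: "precat.mono Arr tgt src (\<lambda>g f. f \<cdot> g) (\<lambda>X Y. zer Y X) = epi"
  by (rule HOL.ext) (simp add: precat.mono_def[OF op_precat] epi_def)

lemma op_epi: "precat.epi Arr tgt src (\<lambda>g f. f \<cdot> g) (\<lambda>X Y. zer Y X) = mono"
  by (rule HOL.ext) (simp add: precat.epi_def[OF op_precat] mono_def)

lemma op_ses: "precat.ses Arr tgt src (\<lambda>g f. f \<cdot> g) (\<lambda>X Y. zer Y X) m e = ses e m"
  unfolding precat.ses_def[OF op_precat] ses_def op_mono op_epi by auto

lemma op_biprod: "precat.biprod Arr tgt src (\<lambda>g f. f \<cdot> g) idn plus (\<lambda>X Y. zer Y X) X Y Z i j p q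
   = biprod X Y Z p q i j"
  unfolding precat.biprod_def[OF op_precat] biprod_def by auto

lemma op_proj: "precat.proj Ob Arr tgt src (\<lambda>g f. f \<cdot> g) (\<lambda>X Y. zer Y X) = inj"
  by (rule HOL.ext) (auto simp: precat.proj_def[OF op_precat] inj_def op_epi)

lemma op_inj: "precat.inj Ob Arr tgt src (\<lambda>g f. f \<cdot> g) (\<lambda>X Y. zer Y X) = proj"
  by (rule HOL.ext) (auto simp: precat.inj_def[OF op_precat] proj_def op_mono)

lemma op_pres: "precat.pres Ob Arr tgt src (\<lambda>g f. f \<cdot> g) (\<lambda>X Y. zer Y X) W P X w e = copres X P W e w"
  unfolding precat.pres_def[OF op_precat] copres_def op_ses op_proj by auto

lemma op_fgr: "precat.fgr Arr tgt src (\<lambda>g f. f \<cdot> g) plus (\<lambda>X Y. zer Y X) X Y = fgl Y X"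
  unfolding precat.fgr_def[OF op_precat] fgl_def by (simp add: conj_commute)

lemma op_fgl: "precat.fgl Arr tgt src (\<lambda>g f. f \<cdot> g) plus (\<lambda>X Y. zer Y X) X Y = fgr Y X"
  unfolding precat.fgl_def[OF op_precat] fgr_def by (simp add: conj_commute)

lemma op_addc:
  assumes "addc T X"
  shows "precat.addc Ob Arr tgt src (\<lambda>g f. f \<cdot> g) idn plus (\<lambda>X Y. zer Y X) T X"
  using assms
proof induction
  case addc_self
  then show ?case by (rule precat.addc_self[OF op_precat])
next
  case (addc_biprod X Y Z i j p q)
  then show ?case
    using precat.addc_biprod[OF op_precat, of T X Y Z p q i j] by (simp add: op_biprod)
next
  case (addc_retract X s Y r)
  then show ?case
    by (intro precat.addc_retract[OF op_precat, of T X r Y s]) auto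
qed

lemma addc_inj:
  assumes "addc T X" "inj T" shows "inj X"
proof -
  interpret op: precat Ob Arr tgt src "\<lambda>g f. f \<cdot> g" idn plus neg "\<lambda>X Y. zer Y X"
    by (rule op_precat)
  show ?thesis using op.addc_proj[OF op_addc[OF assms(1)]] assms(2) by (simp add: op_proj)
qed

end

text \<open>The axioms are self-dual or come in dual pairs, which is what \<open>op_abcat\<close>
  needs. Finite dimensionality enters through \<open>fgr\<close> and \<open>fgl\<close>, the source
  of approximations by add T.\<close>

locale abcat = precat +
  assumes factor: "f \<in> Arr \<Longrightarrow> \<exists>m e. mono m \<and> epi e \<and> src m = tgt e \<and> f = m \<cdot> e"
    and mono_ses: "mono m \<Longrightarrow> \<exists>e. ses m e"
    and epi_ses: "epi e \<Longrightarrow> \<exists>m. ses m e"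
    and zero_object: "\<exists>Z \<in> Ob. idn Z = zer Z Z"
    and biprod_ex: "X \<in> Ob \<Longrightarrow> Y \<in> Ob \<Longrightarrow> \<exists>Z i j p q. biprod X Y Z i j p q"
    and enough_proj: "X \<in> Ob \<Longrightarrow> \<exists>e. epi e \<and> tgt e = X \<and> proj (src e)"
    and enough_inj: "X \<in> Ob \<Longrightarrow> \<exists>m. mono m \<and> src m = X \<and> inj (tgt m)"
    and fgr: "X \<in> Ob \<Longrightarrow> Y \<in> Ob \<Longrightarrow> fgr X Y"
    and fgl: "X \<in> Ob \<Longrightarrow> Y \<in> Ob \<Longrightarrow> fgl X Y"
begin

lemma op_abcat: "abcat Ob Arr tgt src (\<lambda>g f. f \<cdot> g) idn plus neg (\<lambda>X Y. zer Y X)"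
proof -
  interpret op: precat Ob Arr tgt src "\<lambda>g f. f \<cdot> g" idn plus neg "\<lambda>X Y. zer Y X"
    by (rule op_precat)
  show ?thesis
  proof (unfold_locales, unfold op_mono op_epi op_ses op_biprod op_proj op_inj op_fgr op_fgl)
    show "\<exists>m e. epi m \<and> mono e \<and> tgt m = src e \<and> f = e \<cdot> m" if "f \<in> Arr" for f
      using factor[OF that] by metis
    show "\<exists>Z i j p q. biprod X Y Z p q i j" if "X \<in> Ob" "Y \<in> Ob" for X Y
      using biprod_ex[OF that] by metis
  qed (use mono_ses epi_ses zero_object enough_proj enough_inj fgr fgl in auto)
qed

end

section \<open>Vanishing of extensions and dimensions\<close>

context precat
begin
declare exz.simps [simp del]
end

context abcat
begin

lemma op_copres: "precat.copres Ob Arr tgt src (\<lambda>g f. f \<cdot> g) (\<lambda>X Y. zer Y X) X P W e w = pres W P X w e"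
  unfolding precat.copres_def[OF op_precat] pres_def op_ses op_inj by auto

lemma epi_cancel:
  assumes "epi e" "hom u (tgt e) W" "hom v (tgt e) W" "u \<cdot> e = v \<cdot> e"
  shows "u = v"
proof -
  interpret op: abcat Ob Arr tgt src "\<lambda>g f. f \<cdot> g" idn plus neg "\<lambda>X Y. zer Y X"
    by (rule op_abcat)
  show ?thesis
    using op.mono_cancel[of e u W v] assms by (simp add: op_mono)
qed

lemma pres_ex:
  assumes "X \<in> Ob" obtains W P w e where "pres W P X w e"
proof -
  obtain e where e: "epi e" "tgt e = X" "proj (src e)"
    using enough_proj[OF assms] by auto
  obtain m where m: "ses m e" using epi_ses[OF e(1)] by auto
  have "pres (src m) (src e) X m e"
    using sesD[OF m] e m by (auto simp: pres_def)
  then show ?thesis by (rule that)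
qed

lemma copres_ex:
  assumes "Y \<in> Ob" obtains I Z j q where "copres Y I Z j q"
proof -
  interpret op: abcat Ob Arr tgt src "\<lambda>g f. f \<cdot> g" idn plus neg "\<lambda>X Y. zer Y X"
    by (rule op_abcat)
  show ?thesis
    using op.pres_ex[OF assms] that unfolding op_pres by metis
qed

section \<open>Degree one: lifting and extension criteria\<close>

lemma exz0E:
  assumes "exz 0 X Y" "pres W P X w e" "hom f W Y"
  obtains h where "hom h P Y" "h \<cdot> w = f"
  using assms unfolding exz.simps by metis

text \<open>A connecting homomorphism by hand: lift \<open>u\<close> over the projective P, and
  observe that on the syzygy W the lift lands in A. Vanishing of Ext extends this error to P, and
  the corrected lift descends to \<open>X\<close>.\<close>

lemma exz0_lift:
  assumes E: "exz 0 X A" and ab: "ses a b" "src a = A" and u: "hom u X (tgt b)"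
  obtains v where "hom v X (src b)" "b \<cdot> v = u"
proof -
  have Ob: "X \<in> Ob" "A \<in> Ob" using exz_Ob[OF E] by auto
  obtain W P w e where p: "pres W P X w e" using pres_ex Ob by metis
  then have we: "ses w e" "hom w W P" "hom e P X" "proj P" by (auto simp: pres_def)
  note s = sesD[OF ab(1)] and t = sesD[OF we(1)]
  obtain l where l: "hom l P (src b)" "b \<cdot> l = u \<cdot> e"
    using projE[OF we(4) s(2), of "u \<cdot> e"] u we by auto
  have "b \<cdot> (l \<cdot> w) = zer W (tgt b)"
    using l we u t Ob pres_Ob[OF p] by (simp add: reassoc[OF l(2)] cmp_assoc)
  then obtain c where c: "hom c W A" "a \<cdot> c = l \<cdot> w"
    using ses_lift[OF ab(1), of "l \<cdot> w" W] l we ab by auto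
  obtain h where h: "hom h P A" "h \<cdot> w = c"
    using exz0E[OF E p c(1)] by metis
  have "(l \<boxminus> a \<cdot> h) \<cdot> w = zer W (src b)"
    using l we h s ab c by (simp add: plus_cmp neg_cmp cmp_assoc)
  then obtain r where r: "hom r X (src b)" "r \<cdot> e = l \<boxminus> a \<cdot> h"
    using ses_desc[OF we(1), of "l \<boxminus> a \<cdot> h" "src b"] l we h s ab by auto
  have "(b \<cdot> r) \<cdot> e = u \<cdot> e"
    using r l h s ab u we pres_Ob[OF p] by (simp add: cmp_assoc cmp_plus cmp_neg reassoc[OF s(6)])
  then have "b \<cdot> r = u"
    using epi_cancel[OF t(2), of "b \<cdot> r" "tgt b" u] r u s we by auto
  with r show ?thesis by (intro that) auto
qed

lemma exz0_of_lift:
  assumes Ob: "X \<in> Ob" and c: "copres Y I Z j q"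
    and l: "\<And>u. hom u X Z \<Longrightarrow> \<exists>v. hom v X I \<and> q \<cdot> v = u"
  shows "exz 0 X Y"
  unfolding exz.simps
proof (intro conjI allI impI)
  have jq: "ses j q" "hom j Y I" "hom q I Z" "inj I" using c by (auto simp: copres_def)
  show "X \<in> Ob" "Y \<in> Ob" using Ob jq by auto
  fix W P w e f assume p: "pres W P X w e" and f: "hom f W Y"
  from p have we: "ses w e" "hom w W P" "hom e P X" "proj P" by (auto simp: pres_def)
  note s = sesD[OF jq(1)] and t = sesD[OF we(1)]
  obtain m where m: "hom m P I" "m \<cdot> w = j \<cdot> f"
    using injE[OF jq(4) t(1), of "j \<cdot> f"] jq f we by auto
  have "(q \<cdot> m) \<cdot> w = zer W Z"
    using m jq s f we copres_Ob[OF c] by (simp add: cmp_assoc reassoc[OF s(6)])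
  then obtain n where n: "hom n X Z" "n \<cdot> e = q \<cdot> m"
    using ses_desc[OF we(1), of "q \<cdot> m" Z] m jq we by auto
  obtain r where r: "hom r X I" "q \<cdot> r = n" using l n by blast
  have "q \<cdot> (m \<boxminus> r \<cdot> e) = zer P Z"
    using m r n jq we by (simp add: cmp_plus cmp_neg reassoc[OF r(2)])
  then obtain k where k: "hom k P Y" "j \<cdot> k = m \<boxminus> r \<cdot> e"
    using ses_lift[OF jq(1), of "m \<boxminus> r \<cdot> e" P] m r jq we by auto
  have "j \<cdot> (k \<cdot> w) = j \<cdot> f"
    using k m r jq we t f pres_Ob[OF p] copres_Ob[OF c] by (simp add: reassoc[OF k(2)] plus_cmp neg_cmp cmp_assoc)
  then have "k \<cdot> w = f"
    using mono_cancel[OF s(1), of "k \<cdot> w" W f] k f jq we by auto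
  with k show "\<exists>h. hom h P Y \<and> h \<cdot> w = f" by blast
qed

text \<open>The definition tests all presentations of \<open>X\<close>; a single copresentation of
  \<open>Y\<close> decides the same question. This second description is the bridge to the opposite
  category.\<close>

lemma exz0_iff_lift:
  assumes Ob: "X \<in> Ob" and c: "copres Y I Z j q"
  shows "exz 0 X Y \<longleftrightarrow> (\<forall>u. hom u X Z \<longrightarrow> (\<exists>v. hom v X I \<and> q \<cdot> v = u))"
proof
  assume "exz 0 X Y"
  then show "\<forall>u. hom u X Z \<longrightarrow> (\<exists>v. hom v X I \<and> q \<cdot> v = u)"
    using exz0_lift[of X Y j q] c unfolding copres_def by metis
qed (use exz0_of_lift[OF assms] in blast)

lemma op_exz0:
  "precat.exz Ob Arr tgt src (\<lambda>g f. f \<cdot> g) (\<lambda>X Y. zer Y X) 0 Y X \<longleftrightarrow> exz 0 X Y"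
proof -
  interpret op: abcat Ob Arr tgt src "\<lambda>g f. f \<cdot> g" idn plus neg "\<lambda>X Y. zer Y X"
    by (rule op_abcat)
  show ?thesis
  proof (cases "X \<in> Ob \<and> Y \<in> Ob")
    case True
    then obtain I Z j q where c: "copres Y I Z j q" using copres_ex by metis
    have "op.exz 0 Y X \<longleftrightarrow> (\<forall>I Z j q. copres Y I Z j q \<longrightarrow> (\<forall>u. hom u X Z \<longrightarrow> (\<exists>v. hom v X I \<and> q \<cdot> v = u)))"
      using True unfolding op.exz.simps op_pres by blast
    also have "\<dots> \<longleftrightarrow> exz 0 X Y"
      using exz0_iff_lift[OF conjunct1[OF True]] c by blast
    finally show ?thesis .
  qed (use exz_Ob op.exz_Ob in blast)
qed

lemma exz0_iff_extend:
  assumes Ob: "Y \<in> Ob" and p: "pres W P X w e"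
  shows "exz 0 X Y \<longleftrightarrow> (\<forall>u. hom u W Y \<longrightarrow> (\<exists>v. hom v P Y \<and> v \<cdot> w = u))"
proof -
  interpret op: abcat Ob Arr tgt src "\<lambda>g f. f \<cdot> g" idn plus neg "\<lambda>X Y. zer Y X"
    by (rule op_abcat)
  show ?thesis
    using op.exz0_iff_lift[OF Ob, of X P W e w] p unfolding op_copres op_exz0 by blast
qed

text \<open>The two inductions need each other. Balancing a syzygy of X against a cosyzygy of Y
  describes vanishing by a fixed copresentation of Y, hence independently of the chosen presentation
  of X; this independence is what raising the degree requires. Raising the degree in turn gives the
  balance one degree higher.\<close>

lemma exz_shift_aux:
  "(\<forall>W P X w e Y I Z j q. pres W P X w e \<longrightarrow> copres Y I Z j q \<longrightarrow> exz n W Y = exz n X Z)"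
  "(\<forall>W P X w e Y. pres W P X w e \<longrightarrow> Y \<in> Ob \<longrightarrow> exz (Suc n) X Y = exz n W Y)"
proof (induction n)
  case 0
  show A: "\<forall>W P X w e Y I Z j q. pres W P X w e \<longrightarrow> copres Y I Z j q \<longrightarrow> exz 0 W Y = exz 0 X Z"
  proof (intro allI impI)
    fix W P X w e Y I Z j q assume p: "pres W P X w e" and c: "copres Y I Z j q"
    have we: "ses w e" "hom w W P" "hom e P X" "proj P" using p by (auto simp: pres_def)
    have jq: "ses j q" "hom j Y I" "hom q I Z" "inj I" using c by (auto simp: copres_def)
    have Ob: "W \<in> Ob" "Z \<in> Ob" using we jq by auto
    \<comment> \<open>Both sides say that \<open>u\<close> factors as W \<rightarrow> P
      \<rightarrow> I \<rightarrow> Z with the given outer maps: injectivity of I extends a lift to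
      P, projectivity of P lifts an extension to I.\<close>
    have "(\<exists>v. hom v W I \<and> q \<cdot> v = u) \<longleftrightarrow> (\<exists>v. hom v P Z \<and> v \<cdot> w = u)" if u: "hom u W Z" for u
    proof
      assume "\<exists>v. hom v W I \<and> q \<cdot> v = u"
      then obtain v where v: "hom v W I" "q \<cdot> v = u" by blast
      obtain h where "hom h P I" "h \<cdot> w = v"
        using injE[OF jq(4) sesD(1)[OF we(1)], of v] v we by auto
      then show "\<exists>v. hom v P Z \<and> v \<cdot> w = u"
        using v jq we by (intro exI[of _ "q \<cdot> h"]) (auto simp: cmp_assoc)
    next
      assume "\<exists>v. hom v P Z \<and> v \<cdot> w = u"
      then obtain v where v: "hom v P Z" "v \<cdot> w = u" by blast
      obtain h where "hom h P I" "q \<cdot> h = v"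
        using projE[OF we(4) sesD(2)[OF jq(1)], of v] v jq by auto
      then show "\<exists>v. hom v W I \<and> q \<cdot> v = u"
        using v jq we by (intro exI[of _ "h \<cdot> w"]) (auto simp: cmp_assoc[symmetric])
    qed
    then show "exz 0 W Y = exz 0 X Z"
      unfolding exz0_iff_lift[OF Ob(1) c] exz0_iff_extend[OF Ob(2) p] by blast
  qed
  show "\<forall>W P X w e Y. pres W P X w e \<longrightarrow> Y \<in> Ob \<longrightarrow> exz (Suc 0) X Y = exz 0 W Y"
  proof (intro allI impI)
    fix W P X w e Y assume p: "pres W P X w e" and Y: "Y \<in> Ob"
    obtain I Z j q where c: "copres Y I Z j q" using copres_ex[OF Y] by metis
    have "exz (Suc 0) X Y \<longleftrightarrow> X \<in> Ob \<and> (\<forall>W P w e. pres W P X w e \<longrightarrow> exz 0 W Y)"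
      using Y by (simp add: exz.simps(2))
    also have "\<dots> \<longleftrightarrow> exz 0 X Z"
      using A p c pres_Ob[OF p] by blast
    finally show "exz (Suc 0) X Y = exz 0 W Y"
      using A p c by blast
  qed
next
  case (Suc n)
  show A: "\<forall>W P X w e Y I Z j q. pres W P X w e \<longrightarrow> copres Y I Z j q \<longrightarrow> exz (Suc n) W Y = exz (Suc n) X Z"
  proof (intro allI impI)
    fix W P X w e Y I Z j q assume p: "pres W P X w e" and c: "copres Y I Z j q"
    obtain V R v r where p': "pres V R W v r" using pres_ex pres_Ob[OF p] by metis
    have "exz (Suc n) W Y = exz n V Y" using Suc(2) p' copres_Ob[OF c] by blast
    also have "\<dots> = exz n W Z" using Suc(1) p' c by blast
    also have "\<dots> = exz (Suc n) X Z" using Suc(2) p copres_Ob[OF c] by blast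
    finally show "exz (Suc n) W Y = exz (Suc n) X Z" .
  qed
  show "\<forall>W P X w e Y. pres W P X w e \<longrightarrow> Y \<in> Ob \<longrightarrow> exz (Suc (Suc n)) X Y = exz (Suc n) W Y"
  proof (intro allI impI)
    fix W P X w e Y assume p: "pres W P X w e" and Y: "Y \<in> Ob"
    obtain I Z j q where c: "copres Y I Z j q" using copres_ex[OF Y] by metis
    have "exz (Suc (Suc n)) X Y \<longleftrightarrow> X \<in> Ob \<and> Y \<in> Ob \<and> (\<forall>W P w e. pres W P X w e \<longrightarrow> exz (Suc n) W Y)"
      by (rule exz.simps)
    also have "\<dots> \<longleftrightarrow> exz (Suc n) X Z"
      using A p c pres_Ob[OF p] Y by blast
    finally show "exz (Suc (Suc n)) X Y = exz (Suc n) W Y"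
      using A p c by blast
  qed
qed

lemma exz_Suc_pres:
  assumes "pres W P X w e" "Y \<in> Ob"
  shows "exz (Suc n) X Y \<longleftrightarrow> exz n W Y"
  using exz_shift_aux(2) assms by blast

lemma exz_Suc_copres:
  assumes "copres Y I Z j q" "X \<in> Ob"
  shows "exz (Suc n) X Y \<longleftrightarrow> exz n X Z"
proof -
  obtain W P w e where p: "pres W P X w e" using pres_ex[OF assms(2)] by metis
  show ?thesis
    using exz_Suc_pres[OF p, of Y n] exz_shift_aux(1)[of n] p assms copres_Ob[OF assms(1)] by blast
qed

lemma op_exz:
  "precat.exz Ob Arr tgt src (\<lambda>g f. f \<cdot> g) (\<lambda>X Y. zer Y X) n Y X \<longleftrightarrow> exz n X Y"
proof -
  interpret op: abcat Ob Arr tgt src "\<lambda>g f. f \<cdot> g" idn plus neg "\<lambda>X Y. zer Y X"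
    by (rule op_abcat)
  show ?thesis
  proof (induction n arbitrary: X Y)
    case 0
    show ?case by (rule op_exz0)
  next
    case (Suc n)
    show ?case
    proof (cases "X \<in> Ob \<and> Y \<in> Ob")
      case True
      then obtain I Z j q where c: "copres Y I Z j q" using copres_ex by metis
      then have "op.pres Z I Y q j" by (simp add: op_pres)
      then have "op.exz (Suc n) Y X \<longleftrightarrow> exz n X Z"
        using op.exz_Suc_pres[of Z I Y q j X n] True Suc by simp
      then show ?thesis using exz_Suc_copres[OF c, of X n] True by simp
    qed (use exz_Ob op.exz_Ob in blast)
  qed
qed

section \<open>Long exact sequences in both variables\<close>

lemma exz0_kernel:
  assumes Ob: "X \<in> Ob" and ab: "ses a b" and E: "exz 0 X (src b)"
    and l: "\<And>u. hom u X (tgt b) \<Longrightarrow> \<exists>v. hom v X (src b) \<and> b \<cdot> v = u"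
  shows "exz 0 X (src a)"
  unfolding exz.simps
proof (intro conjI allI impI)
  note s = sesD[OF ab]
  show "X \<in> Ob" "src a \<in> Ob" using Ob s by auto
  fix W P w e f assume p: "pres W P X w e" and f: "hom f W (src a)"
  from p have we: "ses w e" "hom w W P" "hom e P X" "proj P" by (auto simp: pres_def)
  note t = sesD[OF we(1)]
  obtain h where h: "hom h P (src b)" "h \<cdot> w = a \<cdot> f"
  proof -
    have "hom (a \<cdot> f) W (src b)" using f s by auto
    then show ?thesis using exz0E[OF E p] that by metis
  qed
  have "(b \<cdot> h) \<cdot> w = zer W (tgt b)"
    using h s f we pres_Ob[OF p] by (simp add: cmp_assoc reassoc[OF s(6)])
  then obtain u where u: "hom u X (tgt b)" "u \<cdot> e = b \<cdot> h"
    using ses_desc[OF we(1), of "b \<cdot> h" "tgt b"] h s we by auto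
  obtain v where v: "hom v X (src b)" "b \<cdot> v = u" using l u by blast
  have "b \<cdot> (h \<boxminus> v \<cdot> e) = zer P (tgt b)"
    using h v u we s by (simp add: cmp_plus cmp_neg reassoc[OF v(2)])
  then obtain k where k: "hom k P (src a)" "a \<cdot> k = h \<boxminus> v \<cdot> e"
    using ses_lift[OF ab, of "h \<boxminus> v \<cdot> e" P] h v we by auto
  have "a \<cdot> (k \<cdot> w) = a \<cdot> f"
    using k h v we t f s pres_Ob[OF p] by (simp add: reassoc[OF k(2)] plus_cmp neg_cmp cmp_assoc)
  then have "k \<cdot> w = f"
    using mono_cancel[OF s(1), of "k \<cdot> w" W f] k f we by auto
  with k show "\<exists>h. hom h P (src a) \<and> h \<cdot> w = f" by blast
qed

lemma exz_SucI:
  assumes "pres W P X w e" "exz n W Y"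
  shows "exz (Suc n) X Y"
  using exz_Suc_pres[OF assms(1)] exz_Ob[OF assms(2)] assms(2) by blast

lemma exz_kernel:
  assumes ab: "ses a b" and "exz n X (tgt b)" "exz (Suc n) X (src b)"
  shows "exz (Suc n) X (src a)"
  using assms(2,3)
proof (induction n arbitrary: X)
  case 0
  note s = sesD[OF ab]
  obtain W P w e where p: "pres W P X w e" using pres_ex exz_Ob[OF 0(1)] by metis
  have we: "ses w e" "hom w W P" "hom e P X" "proj P" using p by (auto simp: pres_def)
  have "exz 0 W (src a)"
  proof (rule exz0_kernel[OF _ ab])
    show "W \<in> Ob" using we by auto
    show "exz 0 W (src b)" using exz_Suc_pres[OF p] 0 s by auto
    fix u assume u: "hom u W (tgt b)"
    obtain h where h: "hom h P (tgt b)" "h \<cdot> w = u" using exz0E[OF 0(1) p u] by metis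
    obtain l where l: "hom l P (src b)" "b \<cdot> l = h" using projE[OF we(4) s(2), of h] h by auto
    have "b \<cdot> (l \<cdot> w) = u" using h by (simp add: reassoc[OF l(2)])
    then show "\<exists>v. hom v W (src b) \<and> b \<cdot> v = u"
      using l we by (intro exI[of _ "l \<cdot> w"]) auto
  qed
  then show ?case by (rule exz_SucI[OF p])
next
  case (Suc n)
  obtain W P w e where p: "pres W P X w e" using pres_ex exz_Ob[OF Suc(2)] by metis
  show ?case
    using Suc exz_Suc_pres[OF p] sesD[OF ab] exz_SucI[OF p] by auto
qed

lemma exz_cokernel:
  assumes ab: "ses a b" and "exz n X (src b)" "exz (Suc n) X (src a)"
  shows "exz n X (tgt b)"
  using assms(2,3)
proof (induction n arbitrary: X)
  case 0
  note s = sesD[OF ab]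
  obtain W P w e where p: "pres W P X w e" using pres_ex exz_Ob[OF 0(1)] by metis
  have we: "ses w e" "hom w W P" "hom e P X" "proj P" using p by (auto simp: pres_def)
  have E: "exz 0 W (src a)" using exz_Suc_pres[OF p] 0 s by auto
  have "\<exists>v. hom v P (tgt b) \<and> v \<cdot> w = u" if u: "hom u W (tgt b)" for u
  proof -
    obtain f where f: "hom f W (src b)" "b \<cdot> f = u"
      using exz0_lift[OF E ab] u by metis
    obtain h where h: "hom h P (src b)" "h \<cdot> w = f" using exz0E[OF 0(1) p f(1)] by metis
    show ?thesis using h f s by (intro exI[of _ "b \<cdot> h"]) (auto simp: cmp_assoc)
  qed
  then show ?case using exz0_iff_extend[OF _ p, of "tgt b"] s by auto
next
  case (Suc n)
  obtain W P w e where p: "pres W P X w e" using pres_ex exz_Ob[OF Suc(2)] by metis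
  have "exz n W (src b)" "exz (Suc n) W (src a)"
    using Suc(2,3) exz_Suc_pres[OF p] exz_Ob by blast+
  then show ?case
    using Suc(1) exz_SucI[OF p] by blast
qed

lemma exz_middle:
  assumes ab: "ses a b" and "exz n X (src a)" "exz n X (tgt b)"
  shows "exz n X (src b)"
  using assms(2,3)
proof (induction n arbitrary: X)
  case 0
  note s = sesD[OF ab]
  obtain W P w e where p: "pres W P X w e" using pres_ex exz_Ob[OF 0(1)] by metis
  have we: "ses w e" "hom w W P" "hom e P X" "proj P" using p by (auto simp: pres_def)
  have "\<exists>v. hom v P (src b) \<and> v \<cdot> w = u" if u: "hom u W (src b)" for u
  proof -
    have "hom (b \<cdot> u) W (tgt b)" using u s by auto
    then obtain h where h: "hom h P (tgt b)" "h \<cdot> w = b \<cdot> u" using exz0E[OF 0(2) p] by metis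
    obtain l where l: "hom l P (src b)" "b \<cdot> l = h" using projE[OF we(4) s(2), of h] h by auto
    have "b \<cdot> (u \<boxminus> l \<cdot> w) = zer W (tgt b)"
      using l h u we s by (simp add: cmp_plus cmp_neg reassoc[OF l(2)])
    then obtain f where f: "hom f W (src a)" "a \<cdot> f = u \<boxminus> l \<cdot> w"
      using ses_lift[OF ab, of "u \<boxminus> l \<cdot> w" W] l u we by auto
    obtain k where k: "hom k P (src a)" "k \<cdot> w = f" using exz0E[OF 0(1) p f(1)] by metis
    have "(a \<cdot> k \<boxplus> l) \<cdot> w = (u \<boxminus> l \<cdot> w) \<boxplus> l \<cdot> w"
      using k f by (simp add: plus_cmp cmp_assoc)
    also have "\<dots> = u" using sub_plus_cancel[of u W "src b" "l \<cdot> w"] u l we by auto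
    finally show ?thesis using k l s by (intro exI[of _ "a \<cdot> k \<boxplus> l"]) auto
  qed
  then show ?case using exz0_iff_extend[OF _ p, of "src b"] s by auto
next
  case (Suc n)
  obtain W P w e where p: "pres W P X w e" using pres_ex exz_Ob[OF Suc(2)] by metis
  have "exz n W (src a)" "exz n W (tgt b)"
    using Suc(2,3) exz_Suc_pres[OF p] exz_Ob by blast+
  then show ?case
    using Suc(1) exz_SucI[OF p] by blast
qed

lemma exz_retract2:
  assumes s: "hom s Y' Y" and r: "hom r Y Y'" and rs: "r \<cdot> s = idn Y'" and "exz n X Y"
  shows "exz n X Y'"
  using assms(4)
proof (induction n arbitrary: X)
  case 0
  have "\<exists>h. hom h P Y' \<and> h \<cdot> w = f" if p: "pres W P X w e" and f: "hom f W Y'" for W P w e f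
  proof -
    have "hom (s \<cdot> f) W Y" using f s by auto
    then obtain h where h: "hom h P Y" "h \<cdot> w = s \<cdot> f" using exz0E[OF 0 p] by metis
    have "(r \<cdot> h) \<cdot> w = f" using h f s r by (simp add: cmp_assoc reassoc[OF rs])
    then show ?thesis using h r by (intro exI[of _ "r \<cdot> h"]) auto
  qed
  then show ?case using exz_Ob[OF 0] s by (auto simp: exz.simps(1))
next
  case (Suc n)
  then show ?case using s by (auto simp: exz.simps(2))
qed

lemma exz_kernel1:
  assumes ab: "ses a b" and "exz n (src b) Y" "exz (Suc n) (tgt b) Y"
  shows "exz n (src a) Y"
proof -
  interpret op: abcat Ob Arr tgt src "\<lambda>g f. f \<cdot> g" idn plus neg "\<lambda>X Y. zer Y X"
    by (rule op_abcat)
  show ?thesis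
    using op.exz_cokernel[of b a n Y] assms sesD[OF ab] unfolding op_ses op_exz by simp
qed

lemma exz_cokernel1:
  assumes ab: "ses a b" and "exz n (src a) Y" "exz (Suc n) (src b) Y"
  shows "exz (Suc n) (tgt b) Y"
proof -
  interpret op: abcat Ob Arr tgt src "\<lambda>g f. f \<cdot> g" idn plus neg "\<lambda>X Y. zer Y X"
    by (rule op_abcat)
  show ?thesis
    using op.exz_kernel[of b a n Y] assms sesD[OF ab] unfolding op_ses op_exz by simp
qed

lemma exz0_extend:
  assumes E: "exz 0 C Y" and ab: "ses a b" "tgt b = C" and u: "hom u (src a) Y"
  obtains v where "hom v (tgt a) Y" "v \<cdot> a = u"
proof -
  interpret op: abcat Ob Arr tgt src "\<lambda>g f. f \<cdot> g" idn plus neg "\<lambda>X Y. zer Y X"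
    by (rule op_abcat)
  show ?thesis
    using op.exz0_lift[of Y C b a u] assms that unfolding op_ses op_exz by metis
qed

lemma exz_middle1:
  assumes ab: "ses a b" and "exz n (src a) Y" "exz n (tgt b) Y"
  shows "exz n (src b) Y"
proof -
  interpret op: abcat Ob Arr tgt src "\<lambda>g f. f \<cdot> g" idn plus neg "\<lambda>X Y. zer Y X"
    by (rule op_abcat)
  show ?thesis
    using op.exz_middle[of b a n Y] assms sesD[OF ab] unfolding op_ses op_exz by simp
qed

lemma exz_retract1:
  assumes s: "hom s X' X" and r: "hom r X X'" and rs: "r \<cdot> s = idn X'" and "exz n X Y"
  shows "exz n X' Y"
proof -
  interpret op: abcat Ob Arr tgt src "\<lambda>g f. f \<cdot> g" idn plus neg "\<lambda>X Y. zer Y X"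
    by (rule op_abcat)
  show ?thesis
    using op.exz_retract2[of r X' X s n Y] assms unfolding op_exz by simp
qed

lemma addc_exz1:
  assumes "addc T X" "exz n T Y" shows "exz n X Y"
  using assms
proof induction
  case (addc_biprod X Z W i j p q)
  have "hom i X W" "hom q W Z" using addc_biprod by (auto simp: biprod_def)
  then show ?case
    using exz_middle1[OF biprod_ses[OF addc_biprod(3)]] addc_biprod by auto
qed (auto intro: exz_retract1)

lemma addc_exz2:
  assumes "addc T Y" "exz n X T" shows "exz n X Y"
  using assms
proof induction
  case (addc_biprod Y Z W i j p q)
  have "hom i Y W" "hom q W Z" using addc_biprod by (auto simp: biprod_def)
  then show ?case
    using exz_middle[OF biprod_ses[OF addc_biprod(3)]] addc_biprod by auto
qed (auto intro: exz_retract2)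

lemma exz_proj:
  assumes "proj P" "Y \<in> Ob" shows "exz n P Y"
  using assms(1)
proof (induction n arbitrary: P)
  case (0 P)
  then have P: "P \<in> Ob" by (simp add: proj_def)
  obtain I Z j q where c: "copres Y I Z j q" using copres_ex[OF assms(2)] by metis
  have "ses j q" "hom j Y I" "hom q I Z" using c by (auto simp: copres_def)
  then show ?case
    using exz0_of_lift[OF P c] projE[OF 0, of q] sesD(2)[of j q] by metis
next
  case (Suc n P)
  then have P: "P \<in> Ob" by (simp add: proj_def)
  obtain V R v r where p: "pres V R P v r" using pres_ex[OF P] by metis
  have vr: "ses v r" "hom v V R" "hom r R P" "proj R" using p by (auto simp: pres_def)
  note t = sesD[OF vr(1)]
  \<comment> \<open>The presentation of a projective object splits, so its syzygy V is a retract of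
    R, again projective, and the induction goes on with V.\<close>
  obtain s where s: "hom s P R" "r \<cdot> s = idn P"
    using projE[OF Suc(2) t(2), of "idn P"] P vr by auto
  have R: "R \<in> Ob" "V \<in> Ob" using vr by auto
  have "r \<cdot> (idn R \<boxminus> s \<cdot> r) = zer R P"
    using s vr R P by (simp add: cmp_plus cmp_neg reassoc[OF s(2)])
  then obtain u where u: "hom u R V" "v \<cdot> u = idn R \<boxminus> s \<cdot> r"
    using ses_lift[OF vr(1), of "idn R \<boxminus> s \<cdot> r" R] s vr R P by auto
  have "v \<cdot> (u \<cdot> v) = v \<cdot> idn V"
    using u s vr R P t(6) by (simp add: reassoc[OF u(2)] plus_cmp neg_cmp cmp_assoc)
  then have "u \<cdot> v = idn V"
    using mono_cancel[OF t(1), of "u \<cdot> v" V "idn V"] u vr R by auto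
  then have "proj V" using proj_retract[OF vr(4), of v V u] u vr by auto
  then show ?case using Suc(1) exz_SucI[OF p] by blast
qed

lemma exz_inj:
  assumes "inj I" "X \<in> Ob" shows "exz n X I"
proof -
  interpret op: abcat Ob Arr tgt src "\<lambda>g f. f \<cdot> g" idn plus neg "\<lambda>X Y. zer Y X"
    by (rule op_abcat)
  show ?thesis
    using op.exz_proj[of I X n] assms unfolding op_exz op_proj by simp
qed

lemma projI_exz:
  assumes "X \<in> Ob" "\<And>Y. Y \<in> Ob \<Longrightarrow> exz 0 X Y" shows "proj X"
  unfolding proj_def
proof (intro conjI allI impI)
  fix e f assume e: "epi e" and f: "hom f X (tgt e)"
  obtain m where m: "ses m e" using epi_ses[OF e] by auto
  then show "\<exists>h. hom h X (src e) \<and> e \<cdot> h = f"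
    using exz0_lift[OF assms(2) m refl f] sesD[OF m] by auto
qed (rule assms)

lemma injI_exz:
  assumes "Y \<in> Ob" "\<And>X. X \<in> Ob \<Longrightarrow> exz 0 X Y" shows "inj Y"
proof -
  interpret op: abcat Ob Arr tgt src "\<lambda>g f. f \<cdot> g" idn plus neg "\<lambda>X Y. zer Y X"
    by (rule op_abcat)
  show ?thesis
    using op.projI_exz[of Y] assms unfolding op_exz op_proj by simp
qed

text \<open>Raising the degree by one trades \<open>Y\<close> for its cosyzygy, so the hypothesis
  has to range over all second arguments.\<close>

lemma exz_mono_deg:
  assumes "\<And>Y. Y \<in> Ob \<Longrightarrow> exz n X Y" "n \<le> m" "Y \<in> Ob"
  shows "exz m X Y"
  using assms(2,3)
proof (induction arbitrary: Y rule: dec_induct)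
  case (step m)
  obtain I Z j q where c: "copres Y I Z j q" using copres_ex[OF step(4)] by metis
  have "X \<in> Ob" using exz_Ob assms(1)[OF step(4)] by blast
  then show ?case
    using exz_Suc_copres[OF c] step(3)[of Z] copres_Ob[OF c] by blast
qed (rule assms(1))

text \<open>Global dimension at most n, because \<open>exz n\<close> concerns degree n + 1.
  Vanishing in all higher degrees is then automatic, see \<open>glD\<close>.\<close>

definition gl where "gl n \<longleftrightarrow> (\<forall>X\<in>Ob. \<forall>Y\<in>Ob. exz n X Y)"

lemma op_gl: "abcat.gl Ob Arr tgt src (\<lambda>g f. f \<cdot> g) (\<lambda>X Y. zer Y X) n \<longleftrightarrow> gl n"
proof -
  interpret op: abcat Ob Arr tgt src "\<lambda>g f. f \<cdot> g" idn plus neg "\<lambda>X Y. zer Y X"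
    by (rule op_abcat)
  show ?thesis unfolding op.gl_def gl_def op_exz by blast
qed

lemma glD: "gl n \<Longrightarrow> n \<le> m \<Longrightarrow> X \<in> Ob \<Longrightarrow> Y \<in> Ob \<Longrightarrow> exz m X Y"
  using exz_mono_deg[of n X m Y] by (auto simp: gl_def)

end

section \<open>Tilting objects\<close>

context abcat
begin

text \<open>Surjectivity of Hom(P, p). If moreover the source of \<open>p\<close> lies in add P,
  then \<open>p\<close> is a right add P-approximation of its target.\<close>

definition lifts where
  "lifts p P \<longleftrightarrow> (\<forall>f. hom f P (tgt p) \<longrightarrow> (\<exists>h. hom h P (src p) \<and> p \<cdot> h = f))"

lemma liftsE:
  assumes "lifts p P" "hom f P (tgt p)"
  obtains h where "hom h P (src p)" "p \<cdot> h = f"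
  using assms unfolding lifts_def by metis

lemma addc_lifts:
  assumes "addc T X" "lifts p T" "p \<in> Arr"
  shows "lifts p X"
  using assms(1)
proof induction
  case addc_self
  show ?case by (rule assms(2))
next
  case (addc_biprod X Y Z i j pr q)
  have b: "hom i X Z" "hom j Y Z" "hom pr Z X" "hom q Z Y" "i \<cdot> pr \<boxplus> j \<cdot> q = idn Z"
    using addc_biprod(3) by (auto simp: biprod_def)
  show ?case
    unfolding lifts_def
  proof (intro allI impI)
    fix f assume f: "hom f Z (tgt p)"
    obtain g where g: "hom g X (src p)" "p \<cdot> g = f \<cdot> i"
      using liftsE[OF addc_biprod.IH(1), of "f \<cdot> i"] b f by auto
    obtain h where h: "hom h Y (src p)" "p \<cdot> h = f \<cdot> j"
      using liftsE[OF addc_biprod.IH(2), of "f \<cdot> j"] b f by auto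
    have "p \<cdot> (g \<cdot> pr \<boxplus> h \<cdot> q) = f \<cdot> (i \<cdot> pr \<boxplus> j \<cdot> q)"
      by (simp add: cmp_plus reassoc[OF g(2)] reassoc[OF h(2)] cmp_assoc)
    then have "p \<cdot> (g \<cdot> pr \<boxplus> h \<cdot> q) = f" using b f by simp
    then show "\<exists>h. hom h Z (src p) \<and> p \<cdot> h = f"
      using g h b by (intro exI[of _ "g \<cdot> pr \<boxplus> h \<cdot> q"]) auto
  qed
next
  case (addc_retract X s Y r)
  show ?case
    unfolding lifts_def
  proof (intro allI impI)
    fix f assume f: "hom f Y (tgt p)"
    obtain h where h: "hom h X (src p)" "p \<cdot> h = f \<cdot> r"
      using liftsE[OF addc_retract.IH, of "f \<cdot> r"] addc_retract f by auto
    have "p \<cdot> (h \<cdot> s) = f"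
      using h addc_retract f by (simp add: reassoc[OF h(2)] cmp_assoc)
    then show "\<exists>h. hom h Y (src p) \<and> p \<cdot> h = f"
      using h addc_retract by (intro exI[of _ "h \<cdot> s"]) auto
  qed
qed

text \<open>One copy of \<open>T\<close> is added for each of finitely many generators of Hom(T, X).
  The maps that lift through the resulting \<open>p\<close> are closed under sums and under
  precomposition with endomorphisms of \<open>T\<close>, hence exhaust Hom(T, X).\<close>

lemma approx:
  assumes T: "T \<in> Ob" and X: "X \<in> Ob"
  obtains p where "p \<in> Arr" "tgt p = X" "addc T (src p)" "lifts p T"
proof -
  obtain S where S: "finite S" "S \<subseteq> {f. hom f T X}"
    and gen: "\<And>N. S \<subseteq> N \<Longrightarrow> N \<subseteq> {f. hom f T X} \<Longrightarrow> zer T X \<in> N \<Longrightarrow> (\<forall>f\<in>N. \<forall>g\<in>N. f \<boxplus> g \<in> N) \<Longrightarrow>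
        (\<forall>f\<in>N. \<forall>h. hom h T T \<longrightarrow> f \<cdot> h \<in> N) \<Longrightarrow> (\<forall>f. hom f T X \<longrightarrow> f \<in> N)"
    using fgr[OF T X] unfolding fgr_def by auto
  have "\<exists>p. p \<in> Arr \<and> tgt p = X \<and> addc T (src p) \<and> (\<forall>f\<in>S. \<exists>h. hom h T (src p) \<and> p \<cdot> h = f)"
    using S
  proof (induction S)
    case empty
    show ?case
      using T X by (intro exI[of _ "zer T X"]) (auto intro: addc_self)
  next
    case (insert s S)
    then obtain p where p: "p \<in> Arr" "tgt p = X" "addc T (src p)"
      "\<And>f. f \<in> S \<Longrightarrow> \<exists>h. hom h T (src p) \<and> p \<cdot> h = f" by auto
    have s: "hom s T X" using insert by auto
    obtain Z i j pr q where bp: "biprod (src p) T Z i j pr q"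
      using biprod_ex[of "src p" T] p T by auto
    then have b: "hom i (src p) Z" "hom j T Z" "hom pr Z (src p)" "hom q Z T" "pr \<cdot> i = idn (src p)"
      "q \<cdot> j = idn T" "q \<cdot> i = zer (src p) T" "pr \<cdot> j = zer T (src p)"
      by (auto simp: biprod_def)
    let ?p = "p \<cdot> pr \<boxplus> s \<cdot> q"
    have pi: "?p \<cdot> i = p" and pj: "?p \<cdot> j = s"
      using b p s T X by (simp_all add: plus_cmp cmp_assoc)
    have "\<exists>h. hom h T Z \<and> ?p \<cdot> h = f" if fS: "f \<in> insert s S" for f
    proof (cases "f = s")
      case True
      then show ?thesis using pj b by (intro exI[of _ j]) auto
    next
      case False
      then obtain h where h: "hom h T (src p)" "p \<cdot> h = f" using p(4)[of f] fS by auto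
      then show ?thesis using b pi by (intro exI[of _ "i \<cdot> h"]) (auto simp: reassoc)
    qed
    then show ?case
      using b p s addc_biprod[OF p(3) addc_self[OF T] bp] by (intro exI[of _ ?p]) auto
  qed
  then obtain p where p: "p \<in> Arr" "tgt p = X" "addc T (src p)"
    "\<And>f. f \<in> S \<Longrightarrow> \<exists>h. hom h T (src p) \<and> p \<cdot> h = f" by auto
  let ?N = "{f. hom f T X \<and> (\<exists>h. hom h T (src p) \<and> p \<cdot> h = f)}"
  have "\<forall>f. hom f T X \<longrightarrow> f \<in> ?N"
  proof (rule gen)
    show "S \<subseteq> ?N" using S p by auto
    show "zer T X \<in> ?N"
      using p T X by (auto intro!: exI[of _ "zer T (src p)"])
    show "\<forall>f\<in>?N. \<forall>g\<in>?N. f \<boxplus> g \<in> ?N"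
    proof (intro ballI)
      fix f g assume "f \<in> ?N" "g \<in> ?N"
      then obtain h h' where "hom f T X" "hom g T X" "hom h T (src p)" "p \<cdot> h = f"
         "hom h' T (src p)" "p \<cdot> h' = g" by blast
      then show "f \<boxplus> g \<in> ?N" by (auto intro!: exI[of _ "h \<boxplus> h'"] simp: cmp_plus)
    qed
    show "\<forall>f\<in>?N. \<forall>h. hom h T T \<longrightarrow> f \<cdot> h \<in> ?N"
    proof (intro ballI allI impI)
      fix f h assume "f \<in> ?N" and h: "hom h T T"
      then obtain g where "hom f T X" "hom g T (src p)" "p \<cdot> g = f" by blast
      then show "f \<cdot> h \<in> ?N" using h by (auto intro!: exI[of _ "g \<cdot> h"] simp: cmp_assoc)
    qed
  qed auto
  then have "lifts p T" using p unfolding lifts_def by blast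
  with p show ?thesis by (intro that)
qed

text \<open>A map \<open>s\<close> that is both mono and epi is invertible: its cokernel vanishes
  since \<open>s\<close> is epi, so the identity factors through \<open>s\<close>. Kernels may
  therefore be exchanged along \<open>s\<close>.\<close>

lemma ses_iso:
  assumes k: "ses m e" and s: "hom s W (src m)" "epi s" and n: "mono (m \<cdot> s)"
  shows "ses (m \<cdot> s) e"
proof -
  note t = sesD[OF k]
  have W: "W \<in> Ob" "src m \<in> Ob" using s t by auto
  have "mono s"
    unfolding mono_def
  proof (intro conjI allI impI)
    fix u assume u: "u \<in> Arr" "tgt u = src s" "s \<cdot> u = zer (src u) (tgt s)"
    then have "(m \<cdot> s) \<cdot> u = zer (src u) (tgt (m \<cdot> s))" using s t W by (simp add: cmp_assoc)
    then show "u = zer (src u) (src s)" using n u s t unfolding mono_def by auto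
  qed (use s in auto)
  then obtain c where c: "ses s c" using mono_ses by auto
  note v = sesD[OF c]
  have "c = zer (src m) (tgt c)"
    using s v(4-6) unfolding epi_def by metis
  then have "c \<cdot> idn (src m) = zer (src m) (tgt c)"
    using s v by auto
  then obtain r where r: "hom r (src m) W" "s \<cdot> r = idn (src m)"
    using ses_lift[OF c, of "idn (src m)" "src m"] s v W by auto
  have "\<exists>v. hom v (src u) (src (m \<cdot> s)) \<and> (m \<cdot> s) \<cdot> v = u"
    if u: "u \<in> Arr" "tgt u = src e" "e \<cdot> u = zer (src u) (tgt e)" for u
  proof -
    obtain v where v: "hom v (src u) (src m)" "m \<cdot> v = u" using ses_lift[OF k, of u] u by auto
    then have "(m \<cdot> s) \<cdot> (r \<cdot> v) = u" by (simp add: cmp_assoc reassoc[OF r(2)])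
    then show ?thesis using r v s t by (intro exI[of _ "r \<cdot> v"]) auto
  qed
  moreover have "\<exists>v. hom v (tgt e) (tgt u) \<and> v \<cdot> e = u"
    if u: "u \<in> Arr" "src u = tgt (m \<cdot> s)" "u \<cdot> (m \<cdot> s) = zer (src (m \<cdot> s)) (tgt u)" for u
  proof -
    have "(u \<cdot> m) \<cdot> s = zer W (tgt u)" using u s t by (simp add: cmp_assoc)
    then have "u \<cdot> m = zer (src m) (tgt u)"
      using s u t unfolding epi_def by (metis cmp_Arr cmp_src cmp_tgt)
    then show ?thesis using ses_desc[OF k, of u "tgt u"] u s t by auto
  qed
  ultimately show ?thesis
    using n t s W by (auto simp: ses_def reassoc cmp_assoc[symmetric])
qed

end

text \<open>The coresolution of the generator \<open>G\<close> is cut into short exact sequences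
  through its cosyzygies \<open>Z i\<close>. Its last term appears as \<open>Z k\<close>, so that
  the remaining terms \<open>t i\<close>, with i < k, are all projective-injective. For k = 0 the
  data reduce to \<open>G\<close> lying in add T.\<close>

locale tilt = abcat +
  fixes T G :: 'a and k :: nat and Z t :: "nat \<Rightarrow> 'a" and a b :: "nat \<Rightarrow> 'b"
  assumes T_Ob: "T \<in> Ob"
    and pdT: "k \<le> n \<Longrightarrow> Y \<in> Ob \<Longrightarrow> exz n T Y"
    and rigid: "exz n T T"
    and cosyz: "i < k \<Longrightarrow> ses (a i) (b i)" "i < k \<Longrightarrow> hom (a i) (Z i) (t i)"
      "i < k \<Longrightarrow> hom (b i) (t i) (Z (Suc i))"
    and Z0: "Z 0 = G" and Zk: "addc T (Z k)"
    and t_pi: "i < k \<Longrightarrow> proj (t i)" "i < k \<Longrightarrow> inj (t i)" "i < k \<Longrightarrow> addc T (t i)"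
    and gen: "p \<in> Arr \<Longrightarrow> lifts p G \<Longrightarrow> epi p"
begin

text \<open>The right perpendicular class of \<open>T\<close>; on short exact sequences inside it
  Hom(T, -) is exact.\<close>

definition perp where "perp X \<longleftrightarrow> (\<forall>n. exz n T X)"

lemma perp_Ob: "perp X \<Longrightarrow> X \<in> Ob"
  using exz_Ob by (auto simp: perp_def)

lemma perp_addc: "addc T X \<Longrightarrow> perp X"
  unfolding perp_def using addc_exz2 rigid by blast

lemma Z_Ob: "i \<le> k \<Longrightarrow> Z i \<in> Ob"
  using src_Ob[of "a i"] cosyz(2)[of i] addc_Ob[OF Zk] by (cases "i = k") auto

lemma t_Ob: "i < k \<Longrightarrow> t i \<in> Ob"
  using tgt_Ob[of "a i"] cosyz(2)[of i] by auto

text \<open>Downward induction from \<open>Z k\<close>, which lies in add T; the terms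
  \<open>t i\<close> are projective and contribute no extensions.\<close>

lemma exz_Z:
  assumes "perp Y" "i \<le> k" shows "exz n (Z i) Y"
  using assms(2)
proof (induction arbitrary: n rule: inc_induct)
  case base
  show ?case using addc_exz1[OF Zk] assms(1) by (simp add: perp_def)
next
  case (step i)
  show ?case
    using exz_kernel1[OF cosyz(1)[OF step(2)], of n Y] cosyz(2,3)[OF step(2)] step(3)
      exz_proj[OF t_pi(1)[OF step(2)] perp_Ob[OF assms(1)]] by simp
qed

text \<open>It suffices to lift maps out of \<open>G\<close>. Such a map extends to
  \<open>t 0\<close>, because there are no extensions of \<open>Z 1\<close> by the target, and
  \<open>t 0\<close> lies in add T, where lifts exist. For k = 0 the generator itself lies in add
  T.\<close>

lemma lifts_epi:
  assumes X: "perp (tgt p)" and p: "p \<in> Arr" "lifts p T"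
  shows "epi p"
proof (rule gen[OF p(1)], unfold lifts_def, intro allI impI)
  fix f assume f: "hom f G (tgt p)"
  show "\<exists>h. hom h G (src p) \<and> p \<cdot> h = f"
  proof (cases "k = 0")
    case True
    then have "lifts p G" using addc_lifts[OF Zk p(2,1)] Z0 by simp
    then show ?thesis using f unfolding lifts_def by blast
  next
    case False
    then have k: "0 < k" by simp
    have "exz 0 (Z (Suc 0)) (tgt p)" using exz_Z[OF X] k by simp
    then obtain v where v: "hom v (t 0) (tgt p)" "v \<cdot> a 0 = f"
      using exz0_extend[OF _ cosyz(1)[OF k], of _ "tgt p" f] cosyz(2,3)[OF k] f Z0 by auto
    obtain h where h: "hom h (t 0) (src p)" "p \<cdot> h = v"
      using liftsE[OF addc_lifts[OF t_pi(3)[OF k] p(2,1)] v(1)] by metis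
    then show ?thesis
      using v cosyz(2)[OF k] Z0 by (intro exI[of _ "h \<cdot> a 0"]) (auto simp: reassoc)
  qed
qed

lemma perp_kernel:
  assumes s: "ses m p" and l: "lifts p T" and "perp (src p)" "perp (tgt p)"
  shows "perp (src m)"
  unfolding perp_def
proof
  fix n
  show "exz n T (src m)"
  proof (cases n)
    case 0
    have "exz 0 T (src m)"
      using exz0_kernel[OF T_Ob s] l assms(3) unfolding perp_def lifts_def by blast
    then show ?thesis using 0 by simp
  next
    case (Suc n')
    then show ?thesis using exz_kernel[OF s, of n' T] assms by (simp add: perp_def)
  qed
qed

text \<open>The kernel stays in the perpendicular class, so the construction can be iterated to a
  resolution by add T on which Hom(T, -) is exact.\<close>

lemma perp_approx:
  assumes X: "perp X"
  obtains m p where "ses m p" "tgt p = X" "addc T (src p)" "lifts p T" "perp (src m)"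
proof -
  obtain p where p: "p \<in> Arr" "tgt p = X" "addc T (src p)" "lifts p T"
    using approx[OF T_Ob perp_Ob[OF X]] by metis
  then have "epi p" using lifts_epi X by simp
  then obtain m where m: "ses m p" using epi_ses by auto
  then have "perp (src m)" using perp_kernel[OF m p(4)] p X perp_addc by simp
  with m p show ?thesis using that by blast
qed

text \<open>The terms \<open>t i\<close> being projective-injective, an object without extensions from \<open>Z k\<close> can be
  resolved \<open>k\<close> times by \<open>add (t 0)\<close>, which lowers its injective dimension by \<open>k\<close>.\<close>

lemma idim_drop:
  assumes g: "gl g"
  shows "j \<le> k \<Longrightarrow> W \<in> Ob \<Longrightarrow> (\<And>n. j \<le> n \<Longrightarrow> exz n (Z k) W) \<Longrightarrow> g \<le> m + (k - j) \<Longrightarrow> X \<in> Ob \<Longrightarrow>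
    exz m X W"
proof (induction arbitrary: W m rule: inc_induct)
  case base
  then show ?case using glD[OF g] by simp
next
  case (step j)
  have k: "0 < k" using step by simp
  \<comment> \<open>Going down from \<open>Z k\<close> lowers the degree by one at each projective
    \<open>t i\<close>. The index ends at \<open>exz 0 (Z 1) W\<close>, the condition for extending
    maps from G = Z 0 to \<open>t 0\<close>.\<close>
  have E: "exz (i - 1) (Z i) W" if "i \<le> k" "0 < i" for i
    using that
  proof (induction rule: inc_induct)
    case base
    show ?case using step by simp
  next
    case (step i)
    then show ?case
      using exz_kernel1[OF cosyz(1)[of i], of "i - 1" W] cosyz(2,3)[of i]
        exz_proj[OF t_pi(1)[of i] \<open>W \<in> Ob\<close>] by simp
  qed
  obtain p where p: "p \<in> Arr" "tgt p = W" "addc (t 0) (src p)" "lifts p (t 0)"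
    using approx[OF t_Ob[OF k] step(4)] by metis
  have "epi p"
  proof (rule gen[OF p(1)], unfold lifts_def, intro allI impI)
    fix f assume f: "hom f G (tgt p)"
    obtain v where v: "hom v (t 0) (tgt p)" "v \<cdot> a 0 = f"
      using exz0_extend[OF _ cosyz(1)[OF k], of _ "tgt p" f] E[of 1] cosyz(2,3)[OF k] f Z0 k p
      by auto
    obtain h where h: "hom h (t 0) (src p)" "p \<cdot> h = v"
      using liftsE[OF p(4) v(1)] by metis
    then show "\<exists>h. hom h G (src p) \<and> p \<cdot> h = f"
      using v cosyz(2)[OF k] Z0 by (intro exI[of _ "h \<cdot> a 0"]) (auto simp: reassoc)
  qed
  then obtain w where w: "ses w p" using epi_ses by auto
  have I: "exz n X (src p)" if "X \<in> Ob" for n X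
    using addc_exz2[OF p(3) exz_inj[OF t_pi(2)[OF k] that]] .
  \<comment> \<open>The kernel satisfies the hypothesis with \<open>Suc j\<close>. In exchange,
    \<open>src p\<close> being injective, a bound \<open>Suc m\<close> for the kernel is a bound
    \<open>m\<close> for \<open>W\<close>, so m + (k - j) is preserved.\<close>
  have "exz n (Z k) (src w)" if n: "Suc j \<le> n" for n
  proof -
    obtain n' where n': "n = Suc n'" "j \<le> n'" using n by (cases n) auto
    then show ?thesis
      using exz_kernel[OF w, of n' "Z k"] step(5)[of n'] I[OF Z_Ob] p by simp
  qed
  then have "exz (Suc m) X (src w)"
    using step(3)[of "src w" "Suc m"] step sesD(3)[OF w] by auto
  then show ?case using exz_cokernel[OF w, of m X] I[OF \<open>X \<in> Ob\<close>] p by simp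
qed

text \<open>The g-th cosyzygy of \<open>G\<close> is injective, hence the coresolution splits
  backwards from there and \<open>G\<close> itself is injective. Covers by add G then have injective
  source, and each passage to a quotient lowers the degree of vanishing by one.\<close>

lemma gl_small:
  assumes g: "gl g" "g < k"
  shows "gl 0"
proof -
  \<comment> \<open>The i-th cosyzygy has injective dimension at most g - i.\<close>
  have A: "exz n X (Z i)" if "i \<le> g" "g \<le> n + i" "X \<in> Ob" for i n X
    using that
  proof (induction i arbitrary: n)
    case 0
    then show ?case using glD[OF g(1)] Z_Ob by simp
  next
    case (Suc i)
    then have ik: "i < k" using g by simp
    show ?case
      using exz_cokernel[OF cosyz(1)[OF ik], of n X] cosyz(2,3)[OF ik] Suc
        exz_inj[OF t_pi(2)[OF ik]] by simp
  qed
  have "proj (Z i) \<and> inj (Z i)" if "i \<le> g" for i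
    using that
  proof (induction rule: inc_induct)
    case base
    have "inj (Z g)" using injI_exz[OF Z_Ob[of g]] A g by simp
    then obtain r where r: "hom r (t g) (Z g)" "r \<cdot> a g = idn (Z g)"
      using injE[OF _ sesD(1)[OF cosyz(1)[OF g(2)]], of "Z g" "idn (Z g)"]
        cosyz(2)[OF g(2)] Z_Ob[of g] g by auto
    then show ?case
      using proj_retract[OF t_pi(1)[OF g(2)], of "a g" "Z g" r] cosyz(2)[OF g(2)] \<open>inj (Z g)\<close> by auto
  next
    case (step i)
    then have ik: "i < k" using g by simp
    then have Zi: "Z i \<in> Ob" using Z_Ob by simp
    obtain r where r: "hom r (t i) (Z i)" "r \<cdot> a i = idn (Z i)"
      using exz0_extend[OF exz_proj[of "Z (Suc i)" "Z i" 0] cosyz(1)[OF ik], of "idn (Z i)"]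
        cosyz(2,3)[OF ik] step Zi by auto
    have "proj (Z i)"
      using proj_retract[OF t_pi(1)[OF ik], of "a i" "Z i" r] cosyz(2)[OF ik] r by auto
    moreover have "inj (Z i)"
      using injI_exz[OF Zi] exz_retract2[of "a i" "Z i" "t i" r 0] r cosyz(2)[OF ik]
        exz_inj[OF t_pi(2)[OF ik]] by auto
    ultimately show ?case ..
  qed
  then have G: "inj G" "G \<in> Ob" using Z0 Z_Ob[of 0] by auto
  \<comment> \<open>Every object is a quotient of an object of add G, which is injective, so degree
    \<open>Suc n\<close> vanishing on the kernel gives degree \<open>n\<close> vanishing on the
    quotient.\<close>
  have "gl n" if "gl (Suc n)" for n
    unfolding gl_def
  proof (intro ballI)
    fix X Y assume XY: "X \<in> Ob" "Y \<in> Ob"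
    obtain p where p: "p \<in> Arr" "tgt p = Y" "addc G (src p)" "lifts p G"
      using approx[OF G(2) XY(2)] by metis
    obtain w where w: "ses w p" using epi_ses gen[OF p(1,4)] by auto
    have "exz n X (src p)" by (rule addc_exz2[OF p(3) exz_inj[OF G(1) XY(1)]])
    then show "exz n X Y"
      using exz_cokernel[OF w, of n X] that XY p sesD(3)[OF w] by (auto simp: gl_def)
  qed
  then show ?thesis using g(1) by (induction g) auto
qed

end

text \<open>Exactness is asked only after applying Hom(T, -), which is what a projective resolution
  over B provides.\<close>

locale tilt_complex = tilt +
  fixes C :: "nat \<Rightarrow> 'a" and d :: "nat \<Rightarrow> 'b"
  assumes C: "addc T (C n)" and d: "hom (d n) (C (Suc n)) (C n)"
    and dd: "d n \<cdot> d (Suc n) = zer (C (Suc (Suc n))) (C n)"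
    and exact: "hom f T (C (Suc n)) \<Longrightarrow> d n \<cdot> f = zer T (C n) \<Longrightarrow>
      \<exists>h. hom h T (C (Suc (Suc n))) \<and> d (Suc n) \<cdot> h = f"
begin

lemma C_Ob: "C n \<in> Ob"
  by (rule addc_Ob[OF C])

lemma exact_addc:
  assumes "addc T X" "hom f X (C (Suc n))" "d n \<cdot> f = zer X (C n)"
  shows "\<exists>h. hom h X (C (Suc (Suc n))) \<and> d (Suc n) \<cdot> h = f"
  using assms
proof (induction arbitrary: f)
  case addc_self
  then show ?case using exact by blast
next
  case (addc_biprod X Y Z i j pr q)
  have b: "hom i X Z" "hom j Y Z" "hom pr Z X" "hom q Z Y" "i \<cdot> pr \<boxplus> j \<cdot> q = idn Z"
    using addc_biprod(3) by (auto simp: biprod_def)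
  have f: "hom f Z (C (Suc n))" "d n \<cdot> f = zer Z (C n)" using addc_biprod by auto
  have "hom (f \<cdot> i) X (C (Suc n))" "d n \<cdot> (f \<cdot> i) = zer X (C n)"
    using f b d[of n] C_Ob by (auto simp: reassoc[OF f(2)])
  then obtain g where g: "hom g X (C (Suc (Suc n)))" "d (Suc n) \<cdot> g = f \<cdot> i"
    using addc_biprod.IH(1) by blast
  have "hom (f \<cdot> j) Y (C (Suc n))" "d n \<cdot> (f \<cdot> j) = zer Y (C n)"
    using f b d[of n] C_Ob by (auto simp: reassoc[OF f(2)])
  then obtain h where h: "hom h Y (C (Suc (Suc n)))" "d (Suc n) \<cdot> h = f \<cdot> j"
    using addc_biprod.IH(2) by blast
  have "d (Suc n) \<cdot> (g \<cdot> pr \<boxplus> h \<cdot> q) = f \<cdot> (i \<cdot> pr \<boxplus> j \<cdot> q)"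
    by (simp add: cmp_plus reassoc[OF g(2)] reassoc[OF h(2)] cmp_assoc)
  then have "d (Suc n) \<cdot> (g \<cdot> pr \<boxplus> h \<cdot> q) = f" using b f by simp
  then show ?case
    using g h b by (intro exI[of _ "g \<cdot> pr \<boxplus> h \<cdot> q"]) auto
next
  case (addc_retract X s Y r)
  have "hom (f \<cdot> r) X (C (Suc n))" "d n \<cdot> (f \<cdot> r) = zer X (C n)"
    using addc_retract d[of n] C_Ob by (auto simp: reassoc[OF addc_retract.prems(2)])
  then obtain h where h: "hom h X (C (Suc (Suc n)))" "d (Suc n) \<cdot> h = f \<cdot> r"
    using addc_retract.IH by blast
  have "d (Suc n) \<cdot> (h \<cdot> s) = f"
    using h addc_retract by (simp add: reassoc[OF h(2)] cmp_assoc)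
  then show ?case
    using h addc_retract by (intro exI[of _ "h \<cdot> s"]) auto
qed

text \<open>For i = 0 this is exactness of the complex itself from degree k on, tested by the
  generator. Each step back along the coresolution costs one degree: a map from \<open>Z i\<close>
  is extended to \<open>t i\<close>, and the failure to be a cycle is a map from
  \<open>Z (Suc i)\<close> one degree lower.\<close>

lemma exact_Z:
  "i \<le> k \<Longrightarrow> k - i \<le> n \<Longrightarrow> hom f (Z i) (C (Suc n)) \<Longrightarrow> d n \<cdot> f = zer (Z i) (C n) \<Longrightarrow>
    \<exists>h. hom h (Z i) (C (Suc (Suc n))) \<and> d (Suc n) \<cdot> h = f"
proof (induction arbitrary: n f rule: inc_induct)
  case base
  then show ?case using exact_addc[OF Zk] by blast
next
  case (step i)
  then obtain n' where n': "n = Suc n'" "k - Suc i \<le> n'" by (cases n) auto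
  note c = cosyz(1)[OF step(2)] cosyz(2,3)[OF step(2)]
  note s = sesD[OF c(1)]
  have ob: "Z i \<in> Ob" "Z (Suc i) \<in> Ob" "t i \<in> Ob" using step Z_Ob t_Ob by auto
  have "exz 0 (Z (Suc i)) (C (Suc n))" using exz_Z perp_addc[OF C] step by simp
  then obtain f' where f': "hom f' (t i) (C (Suc n))" "f' \<cdot> a i = f"
    using exz0_extend[OF _ c(1), of _ "C (Suc n)" f] c step by metis
  have "(d n \<cdot> f') \<cdot> a i = zer (Z i) (C n)"
    using f' step by (simp add: cmp_assoc)
  \<comment> \<open>This is the failure of the extension \<open>f'\<close> to be a cycle. It is
    itself a cycle, so the induction hypothesis lifts it to \<open>v\<close>, and \<open>f'\<close>
    corrected by \<open>v\<close> is a cycle on \<open>t i\<close> in add T.\<close>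
  then obtain u where u: "hom u (Z (Suc i)) (C n)" "u \<cdot> b i = d n \<cdot> f'"
    using ses_desc[OF c(1), of "d n \<cdot> f'" "C n"] f' d[of n] c by auto
  have "(d n' \<cdot> u) \<cdot> b i = zer (Z (Suc i)) (C n') \<cdot> b i"
    using u f' d[of n] d[of n'] dd[of n'] n' c ob C_Ob by (simp add: cmp_assoc reassoc[OF dd])
  then have "d n' \<cdot> u = zer (Z (Suc i)) (C n')"
    using epi_cancel[OF s(2), of "d n' \<cdot> u" "C n'" "zer (Z (Suc i)) (C n')"] u d[of n'] n' c ob C_Ob
    by auto
  then obtain v where v: "hom v (Z (Suc i)) (C (Suc n))" "d n \<cdot> v = u"
    using step(3)[of n' u] u n' by auto
  have "d n \<cdot> (f' \<boxminus> v \<cdot> b i) = zer (t i) (C n)"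
    using f' v u d[of n] c by (simp add: cmp_plus cmp_neg reassoc[OF v(2)])
  then obtain w where w: "hom w (t i) (C (Suc (Suc n)))" "d (Suc n) \<cdot> w = f' \<boxminus> v \<cdot> b i"
    using exact_addc[OF t_pi(3)[OF step(2)], of "f' \<boxminus> v \<cdot> b i" n] f' v c by auto
  have "d (Suc n) \<cdot> (w \<cdot> a i) = f"
    using f' v c s ob C_Ob step by (simp add: reassoc[OF w(2)] plus_cmp neg_cmp cmp_assoc)
  then show ?case using w c by (intro exI[of _ "w \<cdot> a i"]) auto
qed

text \<open>The image of \<open>d g\<close> has injective dimension at most g - k. Shifting along
  the exact part of the complex, of length g - k, leaves no extension of the cokernel of the image
  inclusion by the image, so the inclusion splits.\<close>

lemma complex_split:
  assumes g: "gl g"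
  obtains m e r where "mono m" "hom e (C (Suc g)) (src m)" "tgt m = C g" "d g = m \<cdot> e" "lifts e T"
    "hom r (C g) (src m)" "r \<cdot> m = idn (src m)"
proof -
  have "\<exists>m e. mono m \<and> epi e \<and> src m = tgt e \<and> d n = m \<cdot> e" for n
    using factor d by blast
  then obtain m e where me: "\<And>n. mono (m n)" "\<And>n. epi (e n)" "\<And>n. src (m n) = tgt (e n)"
    "\<And>n. d n = m n \<cdot> e n" by metis
  define I where "I n = src (m n)" for n
  have m: "hom (m n) (I n) (C n)" and e: "hom (e n) (C (Suc n)) (I n)" for n
    using d[of n] me mono_Arr[OF me(1)] epi_Arr[OF me(2)] by (auto simp: I_def)
  have I_Ob: "I n \<in> Ob" for n using src_Ob[of "m n"] m[of n] by simp
  show ?thesis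
  proof (cases "k \<le> g")
    case True
    \<comment> \<open>The image of \<open>d (Suc n)\<close> is compared with the kernel
      \<open>c\<close> of \<open>e n\<close>. The comparison map is epi since, by
      \<open>exact_Z\<close> for i = 0, every map from \<open>G\<close> into the kernel lifts to the
      complex.\<close>
    have ses: "ses (m (Suc n)) (e n)" if n: "k \<le> n" for n
    proof -
      obtain c where c: "ses c (e n)" using epi_ses[OF me(2)] by blast
      note s = sesD[OF c]
      have "m n \<cdot> ((e n \<cdot> m (Suc n)) \<cdot> e (Suc n)) = zer (C (Suc (Suc n))) (C n)"
        using dd[of n] by (simp add: me(4) cmp_assoc)
      then have "(e n \<cdot> m (Suc n)) \<cdot> e (Suc n) = zer (C (Suc (Suc n))) (I n)"
        using me(1)[of n] m[of n] m[of "Suc n"] e[of n] e[of "Suc n"] unfolding mono_def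
        by (metis cmp_Arr cmp_src cmp_tgt)
      then have "e n \<cdot> m (Suc n) = zer (I (Suc n)) (I n)"
        using me(2)[of "Suc n"] m[of n] m[of "Suc n"] e[of n] e[of "Suc n"] unfolding epi_def
        by (metis cmp_Arr cmp_src cmp_tgt)
      then obtain s' where s': "hom s' (I (Suc n)) (src c)" "c \<cdot> s' = m (Suc n)"
        using ses_lift[OF c, of "m (Suc n)" "I (Suc n)"] m[of "Suc n"] e[of n] by auto
      have "epi (s' \<cdot> e (Suc n))"
      proof (rule gen)
        show "s' \<cdot> e (Suc n) \<in> Arr" using s' e[of "Suc n"] by auto
        show "lifts (s' \<cdot> e (Suc n)) G"
          unfolding lifts_def
        proof (intro allI impI)
          fix f assume "hom f G (tgt (s' \<cdot> e (Suc n)))"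
          then have f: "hom f G (src c)" using s' e[of "Suc n"] by auto
          have "d n \<cdot> (c \<cdot> f) = m n \<cdot> ((e n \<cdot> c) \<cdot> f)"
            by (simp add: me(4) cmp_assoc)
          also have "\<dots> = zer G (C n)" using s f e[of n] m[of n] I_Ob Z_Ob[of 0] Z0 by simp
          finally obtain h where h: "hom h G (C (Suc (Suc n)))" "d (Suc n) \<cdot> h = c \<cdot> f"
            using exact_Z[of 0 n "c \<cdot> f"] n f s e[of n] Z0 by auto
          have "c \<cdot> (s' \<cdot> (e (Suc n) \<cdot> h)) = c \<cdot> f"
            using h by (simp add: reassoc[OF s'(2)] me(4) cmp_assoc)
          then have "s' \<cdot> (e (Suc n) \<cdot> h) = f"
            using mono_cancel[OF s(1), of "s' \<cdot> (e (Suc n) \<cdot> h)" G f] s' f h e[of "Suc n"] by auto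
          then show "\<exists>h. hom h G (src (s' \<cdot> e (Suc n))) \<and> (s' \<cdot> e (Suc n)) \<cdot> h = f"
            using h s' e[of "Suc n"] by (intro exI[of _ h]) (auto simp: cmp_assoc)
        qed
      qed
      then have "epi s'"
        unfolding epi_def
      proof (intro conjI allI impI)
        fix u assume E: "s' \<cdot> e (Suc n) \<in> Arr \<and> (\<forall>u. u \<in> Arr \<longrightarrow> src u = tgt (s' \<cdot> e (Suc n)) \<longrightarrow>
          u \<cdot> (s' \<cdot> e (Suc n)) = zer (src (s' \<cdot> e (Suc n))) (tgt u) \<longrightarrow>
          u = zer (tgt (s' \<cdot> e (Suc n))) (tgt u))"
          and u: "u \<in> Arr" "src u = tgt s'" "u \<cdot> s' = zer (src s') (tgt u)"
        then have "u \<cdot> (s' \<cdot> e (Suc n)) = zer (src (s' \<cdot> e (Suc n))) (tgt u)"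
          using s' e[of "Suc n"] by (simp add: reassoc[OF u(3)])
        then show "u = zer (tgt s') (tgt u)" using E u s' e[of "Suc n"] by auto
      qed (use s' in auto)
      then show ?thesis using ses_iso[OF c s'(1)] s'(2) me(1) by simp
    qed
    \<comment> \<open>Degrees from k on vanish by the projective dimension of \<open>T\<close>.
      Lower degrees are reached by replacing \<open>I n\<close> with \<open>I (Suc n)\<close> while
      the degree grows by one.\<close>
    have perp: "perp (I n)" if n: "k \<le> n" for n
      unfolding perp_def
    proof
      fix j
      have "exz j T (I n)" if "k \<le> j \<or> j \<le> k" for j
      proof (cases "k \<le> j")
        case True
        then show ?thesis using pdT I_Ob by simp
      next
        case False
        then have "j \<le> k" by simp
        then show ?thesis using n
        proof (induction arbitrary: n rule: inc_induct)
          case base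
          show ?case using pdT I_Ob by simp
        next
          case (step j)
          then show ?case
            using exz_cokernel[OF ses[of n], of j T] m[of "Suc n"] e[of n] perp_addc[OF C]
            by (auto simp: perp_def)
        qed
      qed
      then show "exz j T (I n)" by (simp add: linorder_linear)
    qed
    \<comment> \<open>At n = k this is the bound g - k on the injective dimension of
      \<open>I g\<close>. Each further term of the complex, being in add T, lowers the degree by
      one, until degree one remains at n = g.\<close>
    have "\<exists>c. ses (m n) c \<and> exz (g - n) (tgt c) (I g)" if "k \<le> n" "n \<le> g" for n
      using that
    proof (induction n rule: dec_induct)
      case base
      obtain c where c: "ses (m k) c" using mono_ses[OF me(1)] by blast
      have "exz (g - k) (tgt c) (I g)"
        using idim_drop[OF g, of 0 "I g" "g - k" "tgt c"] I_Ob addc_exz1[OF Zk] perp[OF True]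
          sesD(4)[OF c] True by (auto simp: perp_def)
      with c show ?case by blast
    next
      case (step n)
      then obtain c where c: "ses (m n) c" "exz (g - n) (tgt c) (I g)" by auto
      have "exz (g - Suc n) (C n) (I g)"
        using addc_exz1[OF C] perp[OF True] by (auto simp: perp_def)
      then have "exz (g - Suc n) (I n) (I g)"
        using exz_kernel1[OF c(1), of "g - Suc n" "I g"] c(2) m[of n] sesD(5)[OF c(1)] step
        by (simp add: Suc_diff_Suc)
      then show ?case using ses[OF step(1)] e[of n] by auto
    qed
    then obtain c where c: "ses (m g) c" "exz 0 (tgt c) (I g)" using True by force
    obtain r where "hom r (C g) (I g)" "r \<cdot> m g = idn (I g)"
      using exz0_extend[OF c(2,1) refl, of "idn (I g)"] m[of g] I_Ob by auto
    moreover have "lifts (e g) T"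
      unfolding lifts_def
    proof (intro allI impI)
      fix f assume f: "hom f T (tgt (e g))"
      have "exz 0 T (I (Suc g))" using perp[of "Suc g"] True by (auto simp: perp_def)
      then show "\<exists>h. hom h T (src (e g)) \<and> e g \<cdot> h = f"
        using exz0_lift[OF _ ses[OF True]] m[of "Suc g"] f by metis
    qed
    ultimately show ?thesis
      using that[of "m g" "e g" r] me m[of g] e[of g] by auto
  next
    case False
    \<comment> \<open>Below k the counting fails, but \<open>gl 0\<close> says that all extensions
      vanish and every image inclusion splits.\<close>
    then have g0: "gl 0" using gl_small[OF g] by simp
    obtain c where c: "ses (m g) c" using mono_ses[OF me(1)] by blast
    have "exz 0 (tgt c) (I g)" using g0 sesD(4)[OF c] I_Ob by (auto simp: gl_def)
    then obtain r where "hom r (C g) (I g)" "r \<cdot> m g = idn (I g)"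
      using exz0_extend[OF _ c refl, of "I g" "idn (I g)"] m[of g] I_Ob by auto
    moreover have "lifts (e g) T"
      unfolding lifts_def
    proof (intro allI impI)
      fix f assume f: "hom f T (tgt (e g))"
      obtain w where w: "ses w (e g)" using epi_ses[OF me(2)] by blast
      have "exz 0 T (src w)" using g0 T_Ob sesD(3)[OF w] by (auto simp: gl_def)
      then show "\<exists>h. hom h T (src (e g)) \<and> e g \<cdot> h = f"
        using exz0_lift[OF _ w] f by metis
    qed
    ultimately show ?thesis
      using that[of "m g" "e g" r] me m[of g] e[of g] by auto
  qed
qed

end

section \<open>The functor represented by a tilting object\<close>

text \<open>Fullness and faithfulness are asked for maps out of \<open>T\<close> only, and spread
  from there to maps out of add T. For other sources Hom(T, -) may have neither property.\<close>

locale hom_functor = abcat Ob Arr src tgt cmp idn plus neg zer +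
    B: abcat ObB ArrB srcB tgtB cmpB idnB plusB negB zerB
  for Ob :: "'o set" and Arr :: "'m set" and src tgt :: "'m \<Rightarrow> 'o"
    and cmp :: "'m \<Rightarrow> 'm \<Rightarrow> 'm" (infixl "\<cdot>" 70)
    and idn :: "'o \<Rightarrow> 'm" and plus :: "'m \<Rightarrow> 'm \<Rightarrow> 'm" (infixl "\<boxplus>" 65)
    and neg :: "'m \<Rightarrow> 'm" and zer :: "'o \<Rightarrow> 'o \<Rightarrow> 'm"
    and ObB :: "'p set" and ArrB :: "'n set" and srcB tgtB :: "'n \<Rightarrow> 'p"
    and cmpB :: "'n \<Rightarrow> 'n \<Rightarrow> 'n" (infixl "\<circ>\<^sub>B" 70)
    and idnB :: "'p \<Rightarrow> 'n" and plusB :: "'n \<Rightarrow> 'n \<Rightarrow> 'n" (infixl "+\<^sub>B" 65)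
    and negB :: "'n \<Rightarrow> 'n" and zerB :: "'p \<Rightarrow> 'p \<Rightarrow> 'n" +
  fixes T :: 'o and Fo :: "'o \<Rightarrow> 'p" and Fa :: "'m \<Rightarrow> 'n"
  assumes FT_Ob: "T \<in> Ob"
    and Fo [simp]: "X \<in> Ob \<Longrightarrow> Fo X \<in> ObB"
    and Fa [simp]: "f \<in> Arr \<Longrightarrow> Fa f \<in> ArrB"
    and Fa_src [simp]: "f \<in> Arr \<Longrightarrow> srcB (Fa f) = Fo (src f)"
    and Fa_tgt [simp]: "f \<in> Arr \<Longrightarrow> tgtB (Fa f) = Fo (tgt f)"
    and Fa_cmp: "\<lbrakk>g \<in> Arr; f \<in> Arr; src g = tgt f\<rbrakk> \<Longrightarrow> Fa (g \<cdot> f) = Fa g \<circ>\<^sub>B Fa f"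
    and Fa_plus: "\<lbrakk>g \<in> Arr; f \<in> Arr; src g = src f; tgt g = tgt f\<rbrakk> \<Longrightarrow> Fa (g \<boxplus> f) = Fa g +\<^sub>B Fa f"
    and Fa_idn: "X \<in> Ob \<Longrightarrow> Fa (idn X) = idnB (Fo X)"
    and Fa_zer: "\<lbrakk>X \<in> Ob; Y \<in> Ob\<rbrakk> \<Longrightarrow> Fa (zer X Y) = zerB (Fo X) (Fo Y)"
    and full: "\<lbrakk>X \<in> Ob; B.hom u (Fo T) (Fo X)\<rbrakk> \<Longrightarrow> \<exists>f. hom f T X \<and> Fa f = u"
    and faithful: "\<lbrakk>hom f T X; hom g T X; Fa f = Fa g\<rbrakk> \<Longrightarrow> f = g"
    and FT_proj: "B.proj (Fo T)"
    and F_gen: "V \<in> ObB \<Longrightarrow> \<exists>X e. addc T X \<and> B.epi e \<and> B.hom e (Fo X) V"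
    and F_epi: "\<lbrakk>p \<in> Arr; lifts p T\<rbrakk> \<Longrightarrow> B.epi (Fa p)"
    and F_ses: "\<lbrakk>ses m p; lifts p T\<rbrakk> \<Longrightarrow> B.ses (Fa m) (Fa p)"
begin

lemma F_biprod:
  assumes "biprod X Y Z i j p q"
  shows "B.biprod (Fo X) (Fo Y) (Fo Z) (Fa i) (Fa j) (Fa p) (Fa q)"
proof -
  have b: "hom i X Z" "hom j Y Z" "hom p Z X" "hom q Z Y" "i \<cdot> p \<boxplus> j \<cdot> q = idn Z"
    "p \<cdot> i = idn X" "q \<cdot> j = idn Y" "q \<cdot> i = zer X Y" "p \<cdot> j = zer Y X"
    using assms by (auto simp: biprod_def)
  have "X \<in> Ob" "Y \<in> Ob" "Z \<in> Ob" using b by auto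
  then show ?thesis
    unfolding B.biprod_def using b by (simp add: Fa_cmp[symmetric] Fa_plus[symmetric] Fa_idn Fa_zer)
qed

lemma F_addc: "addc T X \<Longrightarrow> B.addc (Fo T) (Fo X)"
proof (induction rule: addc.induct)
  case addc_self
  show ?case using FT_Ob by (intro B.addc_self) simp
next
  case (addc_biprod X Y Z i j p q)
  show ?case by (rule B.addc_biprod[OF addc_biprod(4,5) F_biprod[OF addc_biprod(3)]])
next
  case (addc_retract X s Y r)
  have "Y \<in> Ob" using addc_retract by auto
  then show ?case
    using B.addc_retract[OF addc_retract(5), of "Fa s" "Fo Y" "Fa r"] addc_retract
    by (simp add: Fa_cmp[symmetric] Fa_idn)
qed

lemma F_proj: "addc T X \<Longrightarrow> B.proj (Fo X)"
  by (rule B.addc_proj[OF F_addc FT_proj])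

lemma full_addc:
  assumes "addc T W" "X \<in> Ob" "B.hom u (Fo W) (Fo X)"
  shows "\<exists>f. hom f W X \<and> Fa f = u"
  using assms(1,3)
proof (induction arbitrary: u)
  case addc_self
  then show ?case using full[OF assms(2)] by blast
next
  case (addc_biprod V W Z i j p q)
  have b: "hom i V Z" "hom j W Z" "hom p Z V" "hom q Z W" "i \<cdot> p \<boxplus> j \<cdot> q = idn Z"
    using addc_biprod(3) by (auto simp: biprod_def)
  have Z: "Z \<in> Ob" using b by auto
  obtain f where f: "hom f V X" "Fa f = u \<circ>\<^sub>B Fa i"
    using addc_biprod.IH(1)[of "u \<circ>\<^sub>B Fa i"] addc_biprod.prems b by auto
  obtain g where g: "hom g W X" "Fa g = u \<circ>\<^sub>B Fa j"
    using addc_biprod.IH(2)[of "u \<circ>\<^sub>B Fa j"] addc_biprod.prems b by auto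
  have "Fa (f \<cdot> p \<boxplus> g \<cdot> q) = u \<circ>\<^sub>B Fa (i \<cdot> p \<boxplus> j \<cdot> q)"
    using f g b(1-4) by (simp add: Fa_cmp Fa_plus B.cmp_plus B.cmp_assoc)
  then have "Fa (f \<cdot> p \<boxplus> g \<cdot> q) = u" using b Fa_idn[OF Z] addc_biprod.prems by simp
  then show ?case using f g b by (intro exI[of _ "f \<cdot> p \<boxplus> g \<cdot> q"]) auto
next
  case (addc_retract V s Y r)
  have Y: "Y \<in> Ob" using addc_retract by auto
  obtain f where f: "hom f V X" "Fa f = u \<circ>\<^sub>B Fa r"
  proof -
    have "B.hom (u \<circ>\<^sub>B Fa r) (Fo V) (Fo X)" using addc_retract by auto
    then show ?thesis using addc_retract.IH that by metis
  qed
  have "Fa (f \<cdot> s) = u \<circ>\<^sub>B Fa (r \<cdot> s)"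
    using f addc_retract(2,3) by (simp add: Fa_cmp B.cmp_assoc)
  then have "Fa (f \<cdot> s) = u" using addc_retract Fa_idn[OF Y] by simp
  then show ?case using f addc_retract by (intro exI[of _ "f \<cdot> s"]) auto
qed

lemma faithful_addc:
  assumes "addc T W" "hom f W X" "hom g W X" "Fa f = Fa g"
  shows "f = g"
  using assms
proof (induction arbitrary: f g)
  case addc_self
  then show ?case using faithful by blast
next
  case (addc_biprod V W Z i j p q)
  have b: "hom i V Z" "hom j W Z" "hom p Z V" "hom q Z W" "i \<cdot> p \<boxplus> j \<cdot> q = idn Z"
    using addc_biprod(3) by (auto simp: biprod_def)
  have "f \<cdot> i = g \<cdot> i"
    using addc_biprod.IH(1)[of "f \<cdot> i" "g \<cdot> i"] addc_biprod.prems b by (auto simp: Fa_cmp)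
  moreover have "f \<cdot> j = g \<cdot> j"
    using addc_biprod.IH(2)[of "f \<cdot> j" "g \<cdot> j"] addc_biprod.prems b by (auto simp: Fa_cmp)
  ultimately have "f \<cdot> (i \<cdot> p \<boxplus> j \<cdot> q) = g \<cdot> (i \<cdot> p \<boxplus> j \<cdot> q)"
    by (simp add: cmp_plus cmp_assoc[symmetric])
  then show ?case using b addc_biprod.prems by simp
next
  case (addc_retract V s Y r)
  have "f \<cdot> r = g \<cdot> r"
    using addc_retract.IH[of "f \<cdot> r" "g \<cdot> r"] addc_retract by (auto simp: Fa_cmp)
  then have "(f \<cdot> r) \<cdot> s = (g \<cdot> r) \<cdot> s" by simp
  then show ?case using addc_retract by (simp add: cmp_assoc)
qed

end

section \<open>Comparison of the global dimensions along the functor\<close>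

locale tilt_functor =
  hom_functor Ob Arr src tgt cmp idn plus neg zer ObB ArrB srcB tgtB cmpB idnB plusB negB zerB T Fo Fa +
  tilt Ob Arr src tgt cmp idn plus neg zer T G k Z t a b
  for Ob :: "'o set" and Arr :: "'m set" and src tgt :: "'m \<Rightarrow> 'o"
    and cmp :: "'m \<Rightarrow> 'm \<Rightarrow> 'm" (infixl "\<cdot>" 70)
    and idn :: "'o \<Rightarrow> 'm" and plus :: "'m \<Rightarrow> 'm \<Rightarrow> 'm" (infixl "\<boxplus>" 65)
    and neg :: "'m \<Rightarrow> 'm" and zer :: "'o \<Rightarrow> 'o \<Rightarrow> 'm"
    and ObB :: "'p set" and ArrB :: "'n set" and srcB tgtB :: "'n \<Rightarrow> 'p"
    and cmpB :: "'n \<Rightarrow> 'n \<Rightarrow> 'n" (infixl "\<circ>\<^sub>B" 70)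
    and idnB :: "'p \<Rightarrow> 'n" and plusB :: "'n \<Rightarrow> 'n \<Rightarrow> 'n" (infixl "+\<^sub>B" 65)
    and negB :: "'n \<Rightarrow> 'n" and zerB :: "'p \<Rightarrow> 'p \<Rightarrow> 'n"
    and T Fo Fa G k Z t a b
begin

text \<open>The splitting of the complex in degree g carries over to the resolution: its (g + 1)-st
  syzygy is a retract of the g-th term, so the g-th syzygy is projective.\<close>

theorem gl_upper:
  assumes g: "gl g" shows "B.gl g"
  unfolding B.gl_def
proof (intro ballI)
  fix U V assume U: "U \<in> ObB" and V: "V \<in> ObB"
  have "\<exists>X e m. addc T X \<and> B.hom e (Fo X) W \<and> B.ses m e" if "W \<in> ObB" for W
    using F_gen[OF that] B.epi_ses by metis
  then obtain x e m where xem: "\<And>W. W \<in> ObB \<Longrightarrow> addc T (x W)"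
    "\<And>W. W \<in> ObB \<Longrightarrow> B.hom (e W) (Fo (x W)) W" "\<And>W. W \<in> ObB \<Longrightarrow> B.ses (m W) (e W)"
    by metis
  define Y where "Y n = ((\<lambda>W. srcB (m W)) ^^ n) U" for n
  have Y0: "Y 0 = U" and YS: "Y (Suc n) = srcB (m (Y n))" for n
    by (simp_all add: Y_def)
  have Y: "Y n \<in> ObB" for n
  proof (induction n)
    case (Suc n)
    then show ?case using B.sesD(3)[OF xem(3)[OF Suc]] YS by simp
  qed (simp add: Y0 U)
  define C where "C n = x (Y n)" for n
  have C: "addc T (C n)" for n unfolding C_def using xem(1) Y by blast
  have C_Ob: "C n \<in> Ob" for n using addc_Ob[OF C] .
  have eY: "B.hom (e (Y n)) (Fo (C n)) (Y n)" and ses: "B.ses (m (Y n)) (e (Y n))" for n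
    using xem Y by (auto simp: C_def)
  have mY: "B.hom (m (Y n)) (Y (Suc n)) (Fo (C n))" for n
    using B.sesD(3,5)[OF ses[of n]] eY[of n] YS by simp
  \<comment> \<open>The differentials over B start at images of objects of add T, so fullness lifts
    them.\<close>
  have "\<exists>d. hom d (C (Suc n)) (C n) \<and> Fa d = m (Y n) \<circ>\<^sub>B e (Y (Suc n))" for n
    using full_addc[OF C C_Ob] eY[of "Suc n"] mY[of n] by auto
  then obtain d where dF: "\<And>n. hom (d n) (C (Suc n)) (C n)"
    "\<And>n. Fa (d n) = m (Y n) \<circ>\<^sub>B e (Y (Suc n))" by metis
  interpret tilt_complex Ob Arr src tgt cmp idn plus neg zer T G k Z t a b C d
  proof
    show "addc T (C n)" for n by (rule C)
    show "hom (d n) (C (Suc n)) (C n)" for n by (rule dF)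
    show "d n \<cdot> d (Suc n) = zer (C (Suc (Suc n))) (C n)" for n
    proof (rule faithful_addc[OF C])
      have "e (Y (Suc n)) \<circ>\<^sub>B m (Y (Suc n)) = zerB (Y (Suc (Suc n))) (Y (Suc n))"
        using B.sesD(6)[OF ses[of "Suc n"]] mY[of "Suc n"] eY[of "Suc n"] by simp
      then show "Fa (d n \<cdot> d (Suc n)) = Fa (zer (C (Suc (Suc n))) (C n))"
        using dF(1)[of n] dF(1)[of "Suc n"] C_Ob mY[of n] eY[of "Suc (Suc n)"] Y
        by (simp add: Fa_cmp Fa_zer dF(2) B.cmp_assoc B.reassoc)
    qed (use dF(1)[of n] dF(1)[of "Suc n"] C_Ob in auto)
    show "\<exists>h. hom h T (C (Suc (Suc n))) \<and> d (Suc n) \<cdot> h = f"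
      if f: "hom f T (C (Suc n))" "d n \<cdot> f = zer T (C n)" for n f
    proof -
      have F: "B.hom (Fa f) (Fo T) (Fo (C (Suc n)))" using f by auto
      have "Fa (d n) \<circ>\<^sub>B Fa f = zerB (Fo T) (Fo (C n))"
        using Fa_cmp[of "d n" f] f dF(1)[of n] FT_Ob C_Ob by (simp add: Fa_zer)
      then have "m (Y n) \<circ>\<^sub>B (e (Y (Suc n)) \<circ>\<^sub>B Fa f) = zerB (Fo T) (Fo (C n))"
        by (simp add: dF(2) B.cmp_assoc)
      then have "e (Y (Suc n)) \<circ>\<^sub>B Fa f = zerB (Fo T) (Y (Suc n))"
        using B.sesD(1)[OF ses[of n]] mY[of n] eY[of "Suc n"] F unfolding B.mono_def
        by (metis B.cmp_Arr B.cmp_src B.cmp_tgt)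
      then obtain v where v: "B.hom v (Fo T) (Y (Suc (Suc n)))" "m (Y (Suc n)) \<circ>\<^sub>B v = Fa f"
        using B.ses_lift[OF ses[of "Suc n"], of "Fa f" "Fo T"] F eY[of "Suc n"] mY[of "Suc n"]
        by auto
      obtain w where w: "B.hom w (Fo T) (Fo (C (Suc (Suc n))))" "e (Y (Suc (Suc n))) \<circ>\<^sub>B w = v"
        using B.projE[OF FT_proj B.sesD(2)[OF ses[of "Suc (Suc n)"]], of v] v eY[of "Suc (Suc n)"]
        by auto
      obtain h where h: "hom h T (C (Suc (Suc n)))" "Fa h = w"
        using full[OF C_Ob w(1)] by blast
      have "d (Suc n) \<cdot> h = f"
      proof (rule faithful)
        show "Fa (d (Suc n) \<cdot> h) = Fa f"
          using dF(1)[of "Suc n"] h w v by (simp add: Fa_cmp dF(2) B.cmp_assoc)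
      qed (use dF(1)[of "Suc n"] h f in auto)
      with h show ?thesis by blast
    qed
  qed
  obtain \<mu> \<epsilon> r where s: "mono \<mu>" "hom \<epsilon> (C (Suc g)) (src \<mu>)" "tgt \<mu> = C g" "d g = \<mu> \<cdot> \<epsilon>"
    "lifts \<epsilon> T" "hom r (C g) (src \<mu>)" "r \<cdot> \<mu> = idn (src \<mu>)"
    using complex_split[OF g] by metis
  have mu: "hom \<mu> (src \<mu>) (C g)" using s mono_Arr by simp
  have F: "Fa \<mu> \<circ>\<^sub>B Fa \<epsilon> = m (Y g) \<circ>\<^sub>B e (Y (Suc g))"
    using Fa_cmp[of \<mu> \<epsilon>] mu s(2,4) dF(2)[of g] by simp
  have Fr: "Fa r \<circ>\<^sub>B Fa \<mu> = idnB (Fo (src \<mu>))"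
    using Fa_cmp[of r \<mu>] mu s Fa_idn[of "src \<mu>"] by simp
  have Fe: "B.epi (Fa \<epsilon>)" using F_epi s by simp
  obtain c where c: "B.ses c (Fa \<epsilon>)" using B.epi_ses[OF Fe] by blast
  note cD = B.sesD[OF c]
  \<comment> \<open>Since \<open>m (Y g)\<close> is mono, \<open>e (Y (Suc g))\<close> kills the
    kernel of \<open>Fa \<epsilon>\<close> and therefore factors through it as \<phi>.\<close>
  have "m (Y g) \<circ>\<^sub>B (e (Y (Suc g)) \<circ>\<^sub>B c) = Fa \<mu> \<circ>\<^sub>B (Fa \<epsilon> \<circ>\<^sub>B c)"
    using F by (simp add: B.cmp_assoc[symmetric])
  also have "\<dots> = zerB (srcB c) (Fo (C g))"
    using cD(3-6) mu s(2) B.src_Ob[of c] by simp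
  finally have "e (Y (Suc g)) \<circ>\<^sub>B c = zerB (srcB c) (Y (Suc g))"
    using B.sesD(1)[OF ses[of g]] mY[of g] eY[of "Suc g"] cD(3,5) s(2) unfolding B.mono_def
    by (metis B.cmp_Arr B.cmp_src B.cmp_tgt Fa_src)
  then obtain \<phi> where p: "B.hom \<phi> (Fo (src \<mu>)) (Y (Suc g))" "\<phi> \<circ>\<^sub>B Fa \<epsilon> = e (Y (Suc g))"
    using B.ses_desc[OF c, of "e (Y (Suc g))" "Y (Suc g)"] eY[of "Suc g"] cD s(2) by auto
  \<comment> \<open>The retraction \<open>r\<close> of \<mu> followed by the comparison \<phi> is a
    retraction of \<open>m (Y g)\<close>: after composing with the epi \<open>e (Y (Suc g))\<close>
    both sides agree.\<close>
  let ?\<rho> = "\<phi> \<circ>\<^sub>B Fa r"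
  have rho: "B.hom ?\<rho> (Fo (C g)) (Y (Suc g))" using p s(6) by auto
  have "(?\<rho> \<circ>\<^sub>B m (Y g)) \<circ>\<^sub>B e (Y (Suc g)) = idnB (Y (Suc g)) \<circ>\<^sub>B e (Y (Suc g))"
    using F p eY[of "Suc g"] s(2) by (simp add: B.cmp_assoc F[symmetric] B.reassoc[OF Fr])
  then have id: "?\<rho> \<circ>\<^sub>B m (Y g) = idnB (Y (Suc g))"
    using B.epi_cancel[OF B.sesD(2)[OF ses[of "Suc g"]], of "?\<rho> \<circ>\<^sub>B m (Y g)" "Y (Suc g)" "idnB (Y (Suc g))"]
      rho mY[of g] eY[of "Suc g"] Y by auto
  have pres: "B.pres (Y (Suc n)) (Fo (C n)) (Y n) (m (Y n)) (e (Y n))" for n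
    using ses mY eY F_proj[OF C] by (simp add: B.pres_def)
  have "\<exists>v. B.hom v (Fo (C g)) V \<and> v \<circ>\<^sub>B m (Y g) = u" if u: "B.hom u (Y (Suc g)) V" for u
    using u rho id by (intro exI[of _ "u \<circ>\<^sub>B ?\<rho>"]) (auto simp del: B.cmp_assoc simp: B.cmp_assoc)
  then have "B.exz 0 (Y g) V" using B.exz0_iff_extend[OF V pres] by blast
  then have "B.exz n (Y (g - n)) V" if "n \<le> g" for n
    using that
  proof (induction n)
    case (Suc n)
    then show ?case
      using B.exz_SucI[OF pres[of "g - Suc n"], of n V] by (simp add: Suc_diff_Suc)
  qed simp
  from this[of g] show "B.exz g U V" by (simp add: Y0)
qed

text \<open>If the image of \<open>X\<close> is projective, an approximation of \<open>X\<close> by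
  add T splits already in the original category, and \<open>X\<close> inherits projective dimension
  at most k from \<open>T\<close>. Otherwise the approximation becomes a projective presentation
  over B, and its kernel takes over.\<close>

lemma perp_gl_lower:
  assumes "perp X" "\<And>V. V \<in> ObB \<Longrightarrow> B.exz n (Fo X) V" "Y \<in> Ob"
  shows "exz (k + n) X Y"
  using assms(1,2)
proof (induction n arbitrary: X)
  case 0
  obtain m p where p: "ses m p" "tgt p = X" "addc T (src p)" "lifts p T" "perp (src m)"
    using perp_approx[OF 0(1)] by metis
  obtain m' p' where p': "ses m' p'" "tgt p' = src m" "addc T (src p')" "lifts p' T"
    using perp_approx[OF p(5)] by metis
  note s = sesD[OF p(1)] and s' = sesD[OF p'(1)]
  have X: "X \<in> Ob" using perp_Ob[OF 0(1)] .
  have "B.proj (Fo X)" using B.projI_exz 0 X by simp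
  then obtain \<sigma> where sg: "B.hom \<sigma> (Fo X) (Fo (src p))" "Fa p \<circ>\<^sub>B \<sigma> = idnB (Fo X)"
    using B.projE[OF _ F_epi[OF s(4) p(4)], of _ "idnB (Fo X)"] X p s by auto
  obtain \<epsilon> where e: "hom \<epsilon> (src p) (src p)" "Fa \<epsilon> = \<sigma> \<circ>\<^sub>B Fa p"
    using full_addc[OF p(3), of "src p" "\<sigma> \<circ>\<^sub>B Fa p"] sg s p by auto
  \<comment> \<open>Vanishing of \<epsilon> on the kernel of \<open>p\<close> is tested after the
    second approximation \<open>p'\<close>, because faithfulness needs a source in add T.\<close>
  have "\<epsilon> \<cdot> m \<cdot> p' = zer (src p') (src p)"
  proof (rule faithful_addc[OF p'(3)])
    have "Fa p \<circ>\<^sub>B Fa m = zerB (Fo (src m)) (Fo X)"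
      using Fa_cmp[of p m] s p X Fa_zer[of "src m" X] by simp
    then have "Fa p \<circ>\<^sub>B (Fa m \<circ>\<^sub>B Fa p') = zerB (Fo (src p')) (Fo X)"
      using s' p' X by (simp add: B.reassoc)
    then show "Fa (\<epsilon> \<cdot> m \<cdot> p') = Fa (zer (src p') (src p))"
      using e s s' p' sg p by (simp add: Fa_cmp Fa_zer B.cmp_assoc)
  qed (use e s s' p' in auto)
  then have "\<epsilon> \<cdot> m = zer (src m) (src p)"
    using s'(2) e s p'(2) unfolding epi_def by (metis cmp_Arr cmp_src cmp_tgt)
  then obtain \<tau> where t: "hom \<tau> X (src p)" "\<tau> \<cdot> p = \<epsilon>"
    using ses_desc[OF p(1), of \<epsilon> "src p"] e s p by auto
  have "p \<cdot> \<epsilon> = p"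
  proof (rule faithful_addc[OF p(3)])
    show "Fa (p \<cdot> \<epsilon>) = Fa p"
      using e s p sg X by (simp add: Fa_cmp B.reassoc[OF sg(2)])
  qed (use e s p in auto)
  then have "(p \<cdot> \<tau>) \<cdot> p = idn X \<cdot> p" using t s p X by (simp add: cmp_assoc)
  then have "p \<cdot> \<tau> = idn X"
    using epi_cancel[OF s(2), of "p \<cdot> \<tau>" X "idn X"] t s p X by auto
  then show ?case
    using exz_retract1[of \<tau> X "src p" p k Y] t s p addc_exz1[OF p(3) pdT[of k Y]] assms(3) by simp
next
  case (Suc n)
  obtain m p where p: "ses m p" "tgt p = X" "addc T (src p)" "lifts p T" "perp (src m)"
    using perp_approx[OF Suc(2)] by metis
  note s = sesD[OF p(1)]
  have "B.pres (Fo (src m)) (Fo (src p)) (Fo X) (Fa m) (Fa p)"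
    using F_ses[OF p(1,4)] F_proj[OF p(3)] s p by (simp add: B.pres_def)
  then have "exz (k + n) (src m) Y"
    using Suc p(5) B.exz_Suc_pres by blast
  then show ?case
    using exz_cokernel1[OF p(1), of "k + n" Y] p(2) addc_exz1[OF p(3) pdT[of "Suc (k + n)" Y]]
      assms(3) by simp
qed

theorem gl_lower:
  assumes g: "B.gl n" shows "gl (k + n)"
proof -
  \<comment> \<open>Here \<open>j\<close> bounds the degrees in which extensions from
    \<open>T\<close> may survive. An injective cosyzygy lowers it by one, and j = k is granted to
    every object by the projective dimension of \<open>T\<close>.\<close>
  have A: "exz (k + n) X Y" if "X \<in> Ob" "\<And>i. j \<le> i \<Longrightarrow> exz i T X" "Y \<in> Ob" for X Y j
    using that
  proof (induction j arbitrary: X Y)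
    case 0
    then have "perp X" by (simp add: perp_def)
    then show ?case using perp_gl_lower 0 g by (auto simp: B.gl_def)
  next
    case (Suc j)
    obtain I W q r where c: "copres X I W q r" using copres_ex[OF Suc(2)] by metis
    have qr: "ses q r" "hom q X I" "hom r I W" "inj I" using c by (auto simp: copres_def)
    have Ob: "I \<in> Ob" "W \<in> Ob" using qr by auto
    have "perp I" using exz_inj[OF qr(4) T_Ob] by (simp add: perp_def)
    then have I: "exz (k + n) I Y" using perp_gl_lower Ob g Suc(4) by (auto simp: B.gl_def)
    have "exz i T W" if i: "j \<le> i" for i
      using exz_cokernel[OF qr(1), of i T] qr exz_inj[OF qr(4) T_Ob] Suc(3)[of "Suc i"] i by simp
    then have "exz (k + n) W V" if "V \<in> Ob" for V using Suc(1)[OF Ob(2)] that by blast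
    \<comment> \<open>The bound for the cosyzygy is needed one degree higher, so it must be known
      for all second arguments. This is why \<open>X\<close> does not end up with a bound larger
      than that of its cosyzygy.\<close>
    then have "exz (Suc (k + n)) W Y" using exz_mono_deg[of "k + n" W "Suc (k + n)" Y] Suc(4) by simp
    then show ?case using exz_kernel1[OF qr(1), of "k + n" Y] I qr by simp
  qed
  show ?thesis
    unfolding gl_def using A[where j = k, OF _ pdT] by blast
qed

end

section \<open>Modules\<close>

definition submod :: "('r, 'x) ring_scheme \<Rightarrow> ('r, 'm) module \<Rightarrow> 'm set \<Rightarrow> bool" where
  "submod R M N \<longleftrightarrow> N \<subseteq> carrier M \<and> \<zero>\<^bsub>M\<^esub> \<in> N \<and> (\<forall>x\<in>N. \<forall>y\<in>N. x \<oplus>\<^bsub>M\<^esub> y \<in> N) \<and>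
     (\<forall>r\<in>carrier R. \<forall>x\<in>N. r \<odot>\<^bsub>M\<^esub> x \<in> N)"

text \<open>Generation through submodules containing S, which avoids most computations with linear
  combinations; \<open>finitely_generated_iff\<close> makes the connection with them.\<close>

definition spans :: "('r, 'x) ring_scheme \<Rightarrow> ('r, 'm) module \<Rightarrow> 'm set \<Rightarrow> bool" where
  "spans R M S \<longleftrightarrow> (\<forall>N. submod R M N \<longrightarrow> S \<subseteq> N \<longrightarrow> carrier M \<subseteq> N)"

lemma submodD:
  assumes "submod R M N"
  shows "x \<in> N \<Longrightarrow> x \<in> carrier M" "\<zero>\<^bsub>M\<^esub> \<in> N" "x \<in> N \<Longrightarrow> y \<in> N \<Longrightarrow> x \<oplus>\<^bsub>M\<^esub> y \<in> N"
    "r \<in> carrier R \<Longrightarrow> x \<in> N \<Longrightarrow> r \<odot>\<^bsub>M\<^esub> x \<in> N"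
  using assms by (auto simp: submod_def)

section \<open>Submodules and finite generation\<close>

context left_module
begin

lemma smult_zero_l [simp]:
  assumes x: "x \<in> carrier M" shows "\<zero> \<odot>\<^bsub>M\<^esub> x = \<zero>\<^bsub>M\<^esub>"
proof -
  have c: "\<zero> \<odot>\<^bsub>M\<^esub> x \<in> carrier M" using x smult_closed by simp
  have "\<zero> \<odot>\<^bsub>M\<^esub> x \<oplus>\<^bsub>M\<^esub> \<zero> \<odot>\<^bsub>M\<^esub> x = \<zero> \<odot>\<^bsub>M\<^esub> x"
    using smult_l_distr[of \<zero> \<zero> x] x by simp
  then show ?thesis using c M.add.l_cancel_one by simp
qed

lemma smult_zero_r [simp]:
  assumes r: "r \<in> carrier R" shows "r \<odot>\<^bsub>M\<^esub> \<zero>\<^bsub>M\<^esub> = \<zero>\<^bsub>M\<^esub>"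
proof -
  have c: "r \<odot>\<^bsub>M\<^esub> \<zero>\<^bsub>M\<^esub> \<in> carrier M" using r smult_closed by simp
  have "r \<odot>\<^bsub>M\<^esub> \<zero>\<^bsub>M\<^esub> \<oplus>\<^bsub>M\<^esub> r \<odot>\<^bsub>M\<^esub> \<zero>\<^bsub>M\<^esub> = r \<odot>\<^bsub>M\<^esub> \<zero>\<^bsub>M\<^esub>"
    using smult_r_distr[of r "\<zero>\<^bsub>M\<^esub>" "\<zero>\<^bsub>M\<^esub>"] r by simp
  then show ?thesis using c M.add.l_cancel_one by simp
qed

lemma smult_minus_one:
  assumes x: "x \<in> carrier M" shows "(\<ominus> \<one>) \<odot>\<^bsub>M\<^esub> x = \<ominus>\<^bsub>M\<^esub> x"
proof -
  have "(\<ominus> \<one>) \<odot>\<^bsub>M\<^esub> x \<oplus>\<^bsub>M\<^esub> x = (\<ominus> \<one> \<oplus> \<one>) \<odot>\<^bsub>M\<^esub> x"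
    using x smult_l_distr[of "\<ominus> \<one>" \<one> x] smult_one by simp
  also have "\<dots> = \<zero>\<^bsub>M\<^esub>" using x by (simp add: R.l_neg)
  finally show ?thesis
    using M.minus_equality[of "(\<ominus> \<one>) \<odot>\<^bsub>M\<^esub> x" x] x smult_closed by simp
qed

lemma minus_plus_cancel: "x \<in> carrier M \<Longrightarrow> y \<in> carrier M \<Longrightarrow> (x \<ominus>\<^bsub>M\<^esub> y) \<oplus>\<^bsub>M\<^esub> y = x"
  by (simp add: a_minus_def M.a_assoc M.l_neg)

lemma minus_eq_zero: "x \<in> carrier M \<Longrightarrow> y \<in> carrier M \<Longrightarrow> x \<ominus>\<^bsub>M\<^esub> y = \<zero>\<^bsub>M\<^esub> \<longleftrightarrow> x = y"
  using minus_plus_cancel[of x y] by (auto simp: a_minus_def M.r_neg)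

lemma submod_neg: "submod R M N \<Longrightarrow> x \<in> N \<Longrightarrow> \<ominus>\<^bsub>M\<^esub> x \<in> N"
  using submodD(4)[of R M N "\<ominus> \<one>" x] submodD(1)[of R M N x] smult_minus_one by simp

lemma submod_minus: "submod R M N \<Longrightarrow> x \<in> N \<Longrightarrow> y \<in> N \<Longrightarrow> x \<ominus>\<^bsub>M\<^esub> y \<in> N"
  using submod_neg submodD(3)[of R M N x "\<ominus>\<^bsub>M\<^esub> y"] by (simp add: a_minus_def)

lemma submod_carrier: "submod R M (carrier M)"
  by (simp add: submod_def smult_closed)

text \<open>The map \<phi> need not be injective, so that quotients are covered as well as copies of
  a module on another type.\<close>

lemma left_module_image:
  assumes c: "carrier N = \<phi> ` carrier M" and z: "\<zero>\<^bsub>N\<^esub> = \<phi> \<zero>\<^bsub>M\<^esub>"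
    and a: "\<And>x y. x \<in> carrier M \<Longrightarrow> y \<in> carrier M \<Longrightarrow> \<phi> x \<oplus>\<^bsub>N\<^esub> \<phi> y = \<phi> (x \<oplus>\<^bsub>M\<^esub> y)"
    and s: "\<And>r x. r \<in> carrier R \<Longrightarrow> x \<in> carrier M \<Longrightarrow> r \<odot>\<^bsub>N\<^esub> \<phi> x = \<phi> (r \<odot>\<^bsub>M\<^esub> x)"
  shows "left_module R N"
proof -
  have "abelian_group N"
  proof (rule abelian_groupI)
    show "\<exists>y\<in>carrier N. y \<oplus>\<^bsub>N\<^esub> x = \<zero>\<^bsub>N\<^esub>" if x: "x \<in> carrier N" for x
    proof -
      obtain x' where x': "x' \<in> carrier M" "x = \<phi> x'" using x c by auto
      then have "\<phi> (\<ominus>\<^bsub>M\<^esub> x') \<oplus>\<^bsub>N\<^esub> x = \<zero>\<^bsub>N\<^esub>" using a z by (simp add: M.l_neg)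
      then show ?thesis using x' c by auto
    qed
  qed (auto simp: c z a M.a_assoc M.a_comm M.a_lcomm)
  then show ?thesis
    by (intro left_module.intro left_module_axioms.intro R.ring_axioms)
      (auto simp: c z a s smult_closed smult_l_distr smult_r_distr smult_assoc smult_one)
qed

lemma left_module_submod:
  assumes "submod R M N" shows "left_module R (M\<lparr>carrier := N\<rparr>)"
proof -
  note s = submodD[OF assms]
  have "abelian_group (M\<lparr>carrier := N\<rparr>)"
  proof (rule abelian_groupI)
    show "\<exists>y\<in>carrier (M\<lparr>carrier := N\<rparr>). y \<oplus>\<^bsub>M\<lparr>carrier := N\<rparr>\<^esub> x = \<zero>\<^bsub>M\<lparr>carrier := N\<rparr>\<^esub>"
      if "x \<in> carrier (M\<lparr>carrier := N\<rparr>)" for x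
      using that submod_neg[OF assms, of x] s(1) M.l_neg[of x] by auto
  qed (use s in \<open>auto simp: M.a_assoc M.a_comm M.a_lcomm\<close>)
  then show ?thesis
    using s by (intro left_module.intro left_module_axioms.intro R.ring_axioms)
      (auto simp: smult_closed smult_l_distr smult_r_distr smult_assoc smult_one)
qed

lemma submod_of_submod:
  assumes "submod R M N" "submod R (M\<lparr>carrier := N\<rparr>) L"
  shows "submod R M L"
  using assms by (auto simp: submod_def)

lemma submod_Int: "submod R M N \<Longrightarrow> submod R M L \<Longrightarrow> submod R M (N \<inter> L)"
  by (auto simp: submod_def)

lemma submod_sum:
  assumes N: "submod R M N" and L: "submod R M L"
  shows "submod R M {x \<oplus>\<^bsub>M\<^esub> y | x y. x \<in> N \<and> y \<in> L}"
  unfolding submod_def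
proof (intro conjI subsetI ballI)
  note n = submodD[OF N] and l = submodD[OF L]
  fix x assume "x \<in> {x \<oplus>\<^bsub>M\<^esub> y | x y. x \<in> N \<and> y \<in> L}"
  then obtain a b where x: "x = a \<oplus>\<^bsub>M\<^esub> b" "a \<in> N" "b \<in> L" by auto
  then show "x \<in> carrier M" using n l by simp
  {
    fix y assume "y \<in> {x \<oplus>\<^bsub>M\<^esub> y | x y. x \<in> N \<and> y \<in> L}"
    then obtain c d where y: "y = c \<oplus>\<^bsub>M\<^esub> d" "c \<in> N" "d \<in> L" by auto
    have "x \<oplus>\<^bsub>M\<^esub> y = (a \<oplus>\<^bsub>M\<^esub> c) \<oplus>\<^bsub>M\<^esub> (b \<oplus>\<^bsub>M\<^esub> d)"
      using x y n(1) l(1) by (simp add: M.a_assoc M.a_lcomm)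
    then show "x \<oplus>\<^bsub>M\<^esub> y \<in> {x \<oplus>\<^bsub>M\<^esub> y | x y. x \<in> N \<and> y \<in> L}"
      using x y n(3) l(3) by blast
  }
next
  note n = submodD[OF N] and l = submodD[OF L]
  fix r x assume r: "r \<in> carrier R" and "x \<in> {x \<oplus>\<^bsub>M\<^esub> y | x y. x \<in> N \<and> y \<in> L}"
  then obtain a b where x: "x = a \<oplus>\<^bsub>M\<^esub> b" "a \<in> N" "b \<in> L" by auto
  then have "r \<odot>\<^bsub>M\<^esub> x = r \<odot>\<^bsub>M\<^esub> a \<oplus>\<^bsub>M\<^esub> r \<odot>\<^bsub>M\<^esub> b"
    using r n(1) l(1) smult_r_distr by simp
  then show "r \<odot>\<^bsub>M\<^esub> x \<in> {x \<oplus>\<^bsub>M\<^esub> y | x y. x \<in> N \<and> y \<in> L}"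
    using x r n(4) l(4) by blast
next
  show "\<zero>\<^bsub>M\<^esub> \<in> {x \<oplus>\<^bsub>M\<^esub> y | x y. x \<in> N \<and> y \<in> L}"
    using submodD(2)[OF N] submodD(2)[OF L] by force
qed

lemma submod_line:
  assumes v: "v \<in> carrier M" shows "submod R M ((\<lambda>c. c \<odot>\<^bsub>M\<^esub> v) ` carrier R)"
  unfolding submod_def
proof (intro conjI ballI)
  show "\<zero>\<^bsub>M\<^esub> \<in> (\<lambda>c. c \<odot>\<^bsub>M\<^esub> v) ` carrier R" using v by (intro image_eqI[of _ _ \<zero>]) auto
qed (use v in \<open>auto simp: smult_closed smult_l_distr[symmetric] smult_assoc[symmetric]\<close>)

lemma smult_finsum:
  assumes "finite S" "f \<in> S \<rightarrow> carrier M" "r \<in> carrier R"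
  shows "r \<odot>\<^bsub>M\<^esub> (\<Oplus>\<^bsub>M\<^esub>s\<in>S. f s) = (\<Oplus>\<^bsub>M\<^esub>s\<in>S. r \<odot>\<^bsub>M\<^esub> f s)"
  using assms
proof (induction S)
  case (insert s S)
  then show ?case
    by (subst (1 2) M.finsum_insert) (auto simp: smult_r_distr smult_closed M.finsum_closed Pi_def)
qed simp

lemma finsum_submod:
  assumes "finite S" "submod R M N" "\<And>s. s \<in> S \<Longrightarrow> f s \<in> N"
  shows "(\<Oplus>\<^bsub>M\<^esub>s\<in>S. f s) \<in> N"
  using assms(1,3)
proof (induction S)
  case empty
  then show ?case using submodD(2)[OF assms(2)] by simp
next
  case (insert s S)
  then show ?case
    using submodD(1,3)[OF assms(2)] by (subst M.finsum_insert) (auto simp: Pi_def)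
qed

lemma finitely_generated_iff:
  "finitely_generated R M \<longleftrightarrow> (\<exists>S. finite S \<and> S \<subseteq> carrier M \<and> spans R M S)"
proof
  assume "finitely_generated R M"
  then obtain S where S: "finite S" "S \<subseteq> carrier M"
    and g: "\<And>x. x \<in> carrier M \<Longrightarrow> \<exists>c \<in> S \<rightarrow> carrier R. x = (\<Oplus>\<^bsub>M\<^esub>s\<in>S. c s \<odot>\<^bsub>M\<^esub> s)"
    unfolding finitely_generated_def by auto
  have "spans R M S"
    unfolding spans_def
  proof (intro allI impI subsetI)
    fix N x assume N: "submod R M N" "S \<subseteq> N" and x: "x \<in> carrier M"
    then obtain c where c: "c \<in> S \<rightarrow> carrier R" "x = (\<Oplus>\<^bsub>M\<^esub>s\<in>S. c s \<odot>\<^bsub>M\<^esub> s)"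
      using g by blast
    show "x \<in> N"
      unfolding c(2) by (rule finsum_submod[OF S(1) N(1)]) (use c N submodD(4)[OF N(1)] in auto)
  qed
  with S show "\<exists>S. finite S \<and> S \<subseteq> carrier M \<and> spans R M S" by blast
next
  assume "\<exists>S. finite S \<and> S \<subseteq> carrier M \<and> spans R M S"
  then obtain S where S: "finite S" "S \<subseteq> carrier M" and g: "spans R M S" by auto
  let ?N = "{(\<Oplus>\<^bsub>M\<^esub>s\<in>S. c s \<odot>\<^bsub>M\<^esub> s) | c. c \<in> S \<rightarrow> carrier R}"
  have cl: "(\<lambda>s. c s \<odot>\<^bsub>M\<^esub> s) \<in> S \<rightarrow> carrier M" if "c \<in> S \<rightarrow> carrier R" for c
    using that S smult_closed by auto
  have "submod R M ?N"
    unfolding submod_def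
  proof (intro conjI subsetI ballI)
    fix x assume "x \<in> ?N"
    then obtain c where c: "c \<in> S \<rightarrow> carrier R" "x = (\<Oplus>\<^bsub>M\<^esub>s\<in>S. c s \<odot>\<^bsub>M\<^esub> s)" by auto
    show "x \<in> carrier M" unfolding c(2) by (rule M.finsum_closed[OF cl[OF c(1)]])
  next
    have "(\<Oplus>\<^bsub>M\<^esub>s\<in>S. \<zero> \<odot>\<^bsub>M\<^esub> s) = \<zero>\<^bsub>M\<^esub>"
      using S by (intro M.add.finprod_one_eqI) auto
    then show "\<zero>\<^bsub>M\<^esub> \<in> ?N" by (auto intro!: exI[of _ "\<lambda>_. \<zero>"])
  next
    fix x y assume "x \<in> ?N" "y \<in> ?N"
    then obtain c e where c: "c \<in> S \<rightarrow> carrier R" "x = (\<Oplus>\<^bsub>M\<^esub>s\<in>S. c s \<odot>\<^bsub>M\<^esub> s)"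
      "e \<in> S \<rightarrow> carrier R" "y = (\<Oplus>\<^bsub>M\<^esub>s\<in>S. e s \<odot>\<^bsub>M\<^esub> s)" by auto
    have "x \<oplus>\<^bsub>M\<^esub> y = (\<Oplus>\<^bsub>M\<^esub>s\<in>S. c s \<odot>\<^bsub>M\<^esub> s \<oplus>\<^bsub>M\<^esub> e s \<odot>\<^bsub>M\<^esub> s)"
      using M.finsum_addf[OF cl cl] c by simp
    also have "\<dots> = (\<Oplus>\<^bsub>M\<^esub>s\<in>S. (c s \<oplus> e s) \<odot>\<^bsub>M\<^esub> s)"
      using c S by (intro M.finsum_cong') (auto intro!: smult_closed smult_l_distr[symmetric])
    finally show "x \<oplus>\<^bsub>M\<^esub> y \<in> ?N" using c by (auto intro!: exI[of _ "\<lambda>s. c s \<oplus> e s"])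
  next
    fix r x assume r: "r \<in> carrier R" and "x \<in> ?N"
    then obtain c where c: "c \<in> S \<rightarrow> carrier R" "x = (\<Oplus>\<^bsub>M\<^esub>s\<in>S. c s \<odot>\<^bsub>M\<^esub> s)" by auto
    have "r \<odot>\<^bsub>M\<^esub> x = (\<Oplus>\<^bsub>M\<^esub>s\<in>S. r \<odot>\<^bsub>M\<^esub> (c s \<odot>\<^bsub>M\<^esub> s))"
      unfolding c(2) by (rule smult_finsum[OF S(1) cl[OF c(1)] r])
    also have "\<dots> = (\<Oplus>\<^bsub>M\<^esub>s\<in>S. (r \<otimes> c s) \<odot>\<^bsub>M\<^esub> s)"
      using c S r by (intro M.finsum_cong') (auto intro!: smult_closed smult_assoc[symmetric])
    finally show "r \<odot>\<^bsub>M\<^esub> x \<in> ?N" using c r by (auto intro!: exI[of _ "\<lambda>s. r \<otimes> c s"])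
  qed
  moreover have "S \<subseteq> ?N"
  proof
    fix x assume x: "x \<in> S"
    have "(\<Oplus>\<^bsub>M\<^esub>s\<in>S. (if x = s then \<one> else \<zero>) \<odot>\<^bsub>M\<^esub> s) = (\<Oplus>\<^bsub>M\<^esub>s\<in>S. if x = s then s else \<zero>\<^bsub>M\<^esub>)"
      using S x by (intro M.finsum_cong') (auto simp: smult_one)
    also have "\<dots> = x"
      using M.finsum_singleton[OF x S(1), of "\<lambda>s. s"] S by auto
    finally show "x \<in> ?N"
      by (intro CollectI exI[of _ "\<lambda>s. if x = s then \<one> else \<zero>"]) auto
  qed
  ultimately have "carrier M \<subseteq> ?N" using g unfolding spans_def by blast
  then show "finitely_generated R M"
    unfolding finitely_generated_def using S by (intro exI[of _ S]) blast
qed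

end

lemma mod_homD:
  assumes "f \<in> mod_hom R M N"
  shows "x \<in> carrier M \<Longrightarrow> f x \<in> carrier N"
    "x \<in> carrier M \<Longrightarrow> y \<in> carrier M \<Longrightarrow> f (x \<oplus>\<^bsub>M\<^esub> y) = f x \<oplus>\<^bsub>N\<^esub> f y"
    "r \<in> carrier R \<Longrightarrow> x \<in> carrier M \<Longrightarrow> f (r \<odot>\<^bsub>M\<^esub> x) = r \<odot>\<^bsub>N\<^esub> f x"
    "f \<in> extensional (carrier M)"
  using assms by (auto simp: mod_hom_def PiE_def)

lemma mod_hom_restrictI:
  assumes "left_module R M" "\<And>x. x \<in> carrier M \<Longrightarrow> f x \<in> carrier N"
    "\<And>x y. x \<in> carrier M \<Longrightarrow> y \<in> carrier M \<Longrightarrow> f (x \<oplus>\<^bsub>M\<^esub> y) = f x \<oplus>\<^bsub>N\<^esub> f y"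
    "\<And>r x. r \<in> carrier R \<Longrightarrow> x \<in> carrier M \<Longrightarrow> f (r \<odot>\<^bsub>M\<^esub> x) = r \<odot>\<^bsub>N\<^esub> f x"
  shows "restrict f (carrier M) \<in> mod_hom R M N"
proof -
  interpret left_module R M by fact
  show ?thesis using assms(2-4) by (auto simp: mod_hom_def smult_closed)
qed

lemma mod_hom_eqI:
  assumes "f \<in> mod_hom R M N" "g \<in> mod_hom R M N'" "\<And>x. x \<in> carrier M \<Longrightarrow> f x = g x"
  shows "f = g"
  using extensionalityI[OF mod_homD(4)[OF assms(1)] mod_homD(4)[OF assms(2)]] assms(3) by blast

section \<open>Kernels and images of homomorphisms\<close>

locale module_pair = M: left_module R M + N: left_module R N
  for R :: "('r, 'x) ring_scheme" (structure) and M :: "('r, 'm) module"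
    and N :: "('r, 'n) module"
begin

lemma hom_zero [simp]:
  assumes "f \<in> mod_hom R M N" shows "f \<zero>\<^bsub>M\<^esub> = \<zero>\<^bsub>N\<^esub>"
proof -
  have "f \<zero>\<^bsub>M\<^esub> = f (\<zero> \<odot>\<^bsub>M\<^esub> \<zero>\<^bsub>M\<^esub>)" by simp
  also have "\<dots> = \<zero> \<odot>\<^bsub>N\<^esub> f \<zero>\<^bsub>M\<^esub>" by (rule mod_homD(3)[OF assms]) auto
  also have "\<dots> = \<zero>\<^bsub>N\<^esub>" using mod_homD(1)[OF assms] by simp
  finally show ?thesis .
qed

lemma hom_neg:
  assumes "f \<in> mod_hom R M N" "x \<in> carrier M" shows "f (\<ominus>\<^bsub>M\<^esub> x) = \<ominus>\<^bsub>N\<^esub> f x"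
  using mod_homD(3)[OF assms(1), of "\<ominus> \<one>" x] assms mod_homD(1)[OF assms]
  by (simp add: M.smult_minus_one N.smult_minus_one)

lemma hom_minus:
  assumes "f \<in> mod_hom R M N" "x \<in> carrier M" "y \<in> carrier M"
  shows "f (x \<ominus>\<^bsub>M\<^esub> y) = f x \<ominus>\<^bsub>N\<^esub> f y"
  using mod_homD(2)[OF assms(1), of x "\<ominus>\<^bsub>M\<^esub> y"] assms by (simp add: a_minus_def hom_neg)

lemma submod_image:
  assumes f: "f \<in> mod_hom R M N" and L: "submod R M L" shows "submod R N (f ` L)"
proof -
  have *: "f x \<oplus>\<^bsub>N\<^esub> f y = f (x \<oplus>\<^bsub>M\<^esub> y)" if "x \<in> L" "y \<in> L" for x y
    using mod_homD(2)[OF f] submodD(1)[OF L] that by simp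
  have **: "r \<odot>\<^bsub>N\<^esub> f x = f (r \<odot>\<^bsub>M\<^esub> x)" if "x \<in> L" "r \<in> carrier R" for x r
    using mod_homD(3)[OF f] submodD(1)[OF L] that by simp
  show ?thesis
    unfolding submod_def
    using mod_homD(1)[OF f] submodD[OF L] hom_zero[OF f]
    by (auto simp: * ** image_iff intro: rev_bexI)
qed

lemma submod_vimage:
  assumes f: "f \<in> mod_hom R M N" and L: "submod R N L"
  shows "submod R M {x \<in> carrier M. f x \<in> L}"
  unfolding submod_def using mod_homD[OF f] submodD[OF L] hom_zero[OF f]
  by (auto simp: M.smult_closed)

lemma submod_zero: "submod R N {\<zero>\<^bsub>N\<^esub>}"
  by (auto simp: submod_def)

lemma submod_kernel:
  assumes f: "f \<in> mod_hom R M N" shows "submod R M {x \<in> carrier M. f x = \<zero>\<^bsub>N\<^esub>}"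
  using submod_vimage[OF f submod_zero] by simp

lemma inj_on_kernel:
  assumes f: "f \<in> mod_hom R M N" and k: "\<And>x. x \<in> carrier M \<Longrightarrow> f x = \<zero>\<^bsub>N\<^esub> \<Longrightarrow> x = \<zero>\<^bsub>M\<^esub>"
  shows "inj_on f (carrier M)"
proof (rule inj_onI)
  fix x y assume xy: "x \<in> carrier M" "y \<in> carrier M" "f x = f y"
  then have "f (x \<ominus>\<^bsub>M\<^esub> y) = \<zero>\<^bsub>N\<^esub>"
    using hom_minus[OF f] mod_homD(1)[OF f] by (simp add: a_minus_def N.M.r_neg)
  then have "x \<ominus>\<^bsub>M\<^esub> y = \<zero>\<^bsub>M\<^esub>" using k xy by simp
  then show "x = y" using xy M.minus_eq_zero by blast
qed

text \<open>Generators of the kernel together with preimages of generators of the image. Phrasing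
  both conditions through submodules of the ambient modules avoids passing to subobjects.\<close>

lemma spans_extension:
  assumes f: "f \<in> mod_hom R M N"
    and S: "S \<subseteq> carrier M" "\<And>L. submod R M L \<Longrightarrow> S \<subseteq> L \<Longrightarrow> {x \<in> carrier M. f x = \<zero>\<^bsub>N\<^esub>} \<subseteq> L"
    and S': "S' \<subseteq> carrier M" "\<And>L. submod R N L \<Longrightarrow> f ` S' \<subseteq> L \<Longrightarrow> f ` carrier M \<subseteq> L"
  shows "spans R M (S \<union> S')"
  unfolding spans_def
proof (intro allI impI subsetI)
  fix L x assume L: "submod R M L" "S \<union> S' \<subseteq> L" and x: "x \<in> carrier M"
  have "f ` carrier M \<subseteq> f ` L"
    by (rule S'(2)) (use L submod_image[OF f] in auto)
  then obtain y where y: "y \<in> L" "f x = f y" using x by auto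
  note l = submodD[OF L(1)]
  have "f (x \<ominus>\<^bsub>M\<^esub> y) = \<zero>\<^bsub>N\<^esub>"
    using hom_minus[OF f x l(1)[OF y(1)]] y mod_homD(1)[OF f] l(1)
    by (simp add: a_minus_def N.M.r_neg)
  then have "x \<ominus>\<^bsub>M\<^esub> y \<in> L" using S(2)[OF L(1)] L x l(1)[OF y(1)] by auto
  then have "(x \<ominus>\<^bsub>M\<^esub> y) \<oplus>\<^bsub>M\<^esub> y \<in> L" using l(3) y by blast
  then show "x \<in> L" using x l(1)[OF y(1)] by (simp add: a_minus_def M.M.a_assoc M.M.l_neg)
qed

lemma finitely_generated_image:
  assumes f: "f \<in> mod_hom R M N" "f ` carrier M = carrier N" and M: "finitely_generated R M"
  shows "finitely_generated R N"
proof -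
  obtain S where S: "finite S" "S \<subseteq> carrier M" "spans R M S"
    using M M.finitely_generated_iff by auto
  have "spans R N (f ` S)"
    unfolding spans_def
  proof (intro allI impI subsetI)
    fix L y assume L: "submod R N L" "f ` S \<subseteq> L" and y: "y \<in> carrier N"
    obtain x where x: "x \<in> carrier M" "y = f x" using f(2) y by auto
    have "carrier M \<subseteq> {x \<in> carrier M. f x \<in> L}"
      using S(3)[unfolded spans_def] submod_vimage[OF f(1) L(1)] L(2) S(2) by blast
    then show "y \<in> L" using x by auto
  qed
  then show ?thesis
    unfolding N.finitely_generated_iff using S f by (intro exI[of _ "f ` S"]) auto
qed

end

section \<open>Vector spaces\<close>

lemma regular_simps [simp]:
  "carrier (regular R) = carrier R" "\<zero>\<^bsub>regular R\<^esub> = \<zero>\<^bsub>R\<^esub>"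
  "x \<oplus>\<^bsub>regular R\<^esub> y = x \<oplus>\<^bsub>R\<^esub> y" "x \<odot>\<^bsub>regular R\<^esub> y = x \<otimes>\<^bsub>R\<^esub> y"
  by (simp_all add: regular_def)

lemma left_module_regular:
  assumes "ring R" shows "left_module R (regular R)"
proof -
  interpret ring R by fact
  have "abelian_group (regular R)"
  proof (rule abelian_groupI)
    show "\<exists>y\<in>carrier (regular R). y \<oplus>\<^bsub>regular R\<^esub> x = \<zero>\<^bsub>regular R\<^esub>"
      if "x \<in> carrier (regular R)" for x
      using that l_neg[of x] by (intro bexI[of _ "\<ominus>\<^bsub>R\<^esub> x"]) auto
  qed (auto simp: a_assoc a_comm a_lcomm)
  then show ?thesis
    by (intro left_module.intro left_module_axioms.intro ring_axioms)
      (auto simp: l_distr r_distr m_assoc)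
qed

lemma (in left_module) finitely_generated_submod_iff:
  assumes U: "submod R M U"
  shows "finitely_generated R (M\<lparr>carrier := U\<rparr>) \<longleftrightarrow>
    (\<exists>F. finite F \<and> F \<subseteq> U \<and> (\<forall>N. submod R M N \<longrightarrow> F \<subseteq> N \<longrightarrow> U \<subseteq> N))"
proof -
  have "spans R (M\<lparr>carrier := U\<rparr>) F \<longleftrightarrow> (\<forall>N. submod R M N \<longrightarrow> F \<subseteq> N \<longrightarrow> U \<subseteq> N)" if F: "F \<subseteq> U" for F
  proof
    assume s: "spans R (M\<lparr>carrier := U\<rparr>) F"
    show "\<forall>N. submod R M N \<longrightarrow> F \<subseteq> N \<longrightarrow> U \<subseteq> N"
    proof (intro allI impI)
      fix N assume N: "submod R M N" "F \<subseteq> N"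
      have "submod R (M\<lparr>carrier := U\<rparr>) (N \<inter> U)"
        using submod_Int[OF N(1) U] by (auto simp: submod_def)
      then have "U \<subseteq> N \<inter> U" using s F N unfolding spans_def by force
      then show "U \<subseteq> N" by blast
    qed
  next
    assume "\<forall>N. submod R M N \<longrightarrow> F \<subseteq> N \<longrightarrow> U \<subseteq> N"
    then show "spans R (M\<lparr>carrier := U\<rparr>) F"
      unfolding spans_def using submod_of_submod[OF U] by auto
  qed
  then show ?thesis
    unfolding left_module.finitely_generated_iff[OF left_module_submod[OF U]] by auto
qed

locale vspace = left_module K V
  for K :: "('k, 'x) ring_scheme" (structure) and V :: "('k, 'v) module" +
  assumes field: "field K"
begin

lemma inverse_ex:
  assumes "c \<in> carrier K" "c \<noteq> \<zero>" obtains e where "e \<in> carrier K" "e \<otimes> c = \<one>"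
proof -
  interpret F: field K by (rule field)
  have "c \<in> Units K" using assms F.field_Units by simp
  then show ?thesis using that[of "inv c"] R.Units_l_inv R.Units_inv_closed by simp
qed

lemma scalar_minus_eq_zero:
  assumes "c \<in> carrier K" "e \<in> carrier K" shows "c \<ominus> e = \<zero> \<longleftrightarrow> c = e"
proof -
  have "(c \<ominus> e) \<oplus> e = c" using assms by (simp add: a_minus_def R.a_assoc R.l_neg)
  then show ?thesis using assms by (auto simp: a_minus_def R.r_neg)
qed

definition sp where "sp S = \<Inter>{N. submod K V N \<and> S \<subseteq> N}"

lemma sp_submod: "S \<subseteq> carrier V \<Longrightarrow> submod K V (sp S)"
  using submod_carrier unfolding sp_def submod_def by blast

lemma sp_inc: "S \<subseteq> sp S"
  by (auto simp: sp_def)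

lemma sp_least: "submod K V N \<Longrightarrow> S \<subseteq> N \<Longrightarrow> sp S \<subseteq> N"
  by (auto simp: sp_def)

lemma sp_insert:
  assumes v: "v \<in> carrier V" and S: "S \<subseteq> carrier V" and x: "x \<in> sp (insert v S)"
  obtains c s where "c \<in> carrier K" "s \<in> sp S" "x = c \<odot>\<^bsub>V\<^esub> v \<oplus>\<^bsub>V\<^esub> s"
proof -
  let ?N = "{x \<oplus>\<^bsub>V\<^esub> y | x y. x \<in> (\<lambda>c. c \<odot>\<^bsub>V\<^esub> v) ` carrier K \<and> y \<in> sp S}"
  note s = submodD[OF sp_submod[OF S]] and l = submodD[OF submod_line[OF v]]
  have "v = \<one> \<odot>\<^bsub>V\<^esub> v \<oplus>\<^bsub>V\<^esub> \<zero>\<^bsub>V\<^esub>" using v by (simp add: smult_one)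
  then have "v \<in> ?N" using s(2) by blast
  moreover have "S \<subseteq> ?N"
  proof
    fix y assume y: "y \<in> S"
    then have "y = \<zero>\<^bsub>V\<^esub> \<oplus>\<^bsub>V\<^esub> y" using S by auto
    then show "y \<in> ?N" using l(2) sp_inc y by blast
  qed
  ultimately have "sp (insert v S) \<subseteq> ?N"
    by (intro sp_least submod_sum submod_line sp_submod v S) auto
  then show ?thesis using x that by blast
qed

text \<open>Elimination on a spanning set: if \<open>U\<close> is not contained in the span without
  v, some w in \<open>U\<close> has an invertible coefficient at v, and subtracting multiples of w
  brings every element of \<open>U\<close> into the smaller span.\<close>

lemma submod_finitely_generated:
  assumes V: "finitely_generated K V" and U: "submod K V U"
  shows "finitely_generated K (V\<lparr>carrier := U\<rparr>)"
proof -
  obtain S where S: "finite S" "S \<subseteq> carrier V" "spans K V S"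
    using V finitely_generated_iff by auto
  have "carrier V \<subseteq> sp S" using S(3) sp_submod[OF S(2)] sp_inc unfolding spans_def by blast
  then have "U \<subseteq> sp S" using U by (auto simp: submod_def)
  have "\<exists>F. finite F \<and> F \<subseteq> U \<and> (\<forall>N. submod K V N \<longrightarrow> F \<subseteq> N \<longrightarrow> U \<subseteq> N)"
    using S(1,2) U \<open>U \<subseteq> sp S\<close>
  proof (induction S arbitrary: U)
    case empty
    have "sp {} \<subseteq> {\<zero>\<^bsub>V\<^esub>}" by (rule sp_least) (auto simp: submod_def)
    then have "U \<subseteq> {\<zero>\<^bsub>V\<^esub>}" using empty by blast
    then show ?case by (intro exI[of _ "{}"]) (auto simp: submod_def)
  next
    case (insert v S)
    have v: "v \<in> carrier V" and S: "S \<subseteq> carrier V" using insert by auto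
    note u = submodD[OF insert.prems(2)] and s = submodD[OF sp_submod[OF S]]
    obtain F where F: "finite F" "F \<subseteq> U \<inter> sp S"
      "\<And>N. submod K V N \<Longrightarrow> F \<subseteq> N \<Longrightarrow> U \<inter> sp S \<subseteq> N"
      using insert.IH[OF S submod_Int[OF insert.prems(2) sp_submod[OF S]]] by auto
    show ?case
    proof (cases "U \<subseteq> sp S")
      case True
      then show ?thesis using F by (intro exI[of _ F]) auto
    next
      case False
      then obtain w where w: "w \<in> U" "w \<notin> sp S" by auto
      then obtain c t where c: "c \<in> carrier K" "t \<in> sp S" "w = c \<odot>\<^bsub>V\<^esub> v \<oplus>\<^bsub>V\<^esub> t"
        using sp_insert[OF v S, of w] insert.prems(3) by auto
      have "c \<noteq> \<zero>" using c w s(1) v by auto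
      then obtain e where e: "e \<in> carrier K" "e \<otimes> c = \<one>" using inverse_ex c by metis
      have "U \<subseteq> N" if N: "submod K V N" "insert w F \<subseteq> N" for N
      proof
        fix x assume x: "x \<in> U"
        then obtain c' t' where c': "c' \<in> carrier K" "t' \<in> sp S" "x = c' \<odot>\<^bsub>V\<^esub> v \<oplus>\<^bsub>V\<^esub> t'"
          using sp_insert[OF v S, of x] insert.prems(3) by auto
        note n = submodD[OF N(1)]
        \<comment> \<open>With \<open>e\<close> the inverse of the v-coefficient of
          \<open>w\<close>, this multiple of \<open>w\<close> has the same v-coefficient as
          \<open>x\<close>.\<close>
        let ?r = "c' \<otimes> e"
        have r: "?r \<in> carrier K" using c' e by simp
        have tv: "t \<in> carrier V" "t' \<in> carrier V" "w \<in> carrier V" "x \<in> carrier V"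
          using c c' s(1) w x u(1) by auto
        have rc: "?r \<otimes> c = c'" using c c' e by (simp add: R.m_assoc)
        have "?r \<odot>\<^bsub>V\<^esub> w = c' \<odot>\<^bsub>V\<^esub> v \<oplus>\<^bsub>V\<^esub> ?r \<odot>\<^bsub>V\<^esub> t"
          using c(1) c(3) r v tv rc smult_r_distr[of ?r "c \<odot>\<^bsub>V\<^esub> v" t]
            smult_assoc[of ?r c v] by (simp add: smult_closed)
        then have "x \<ominus>\<^bsub>V\<^esub> ?r \<odot>\<^bsub>V\<^esub> w = t' \<ominus>\<^bsub>V\<^esub> ?r \<odot>\<^bsub>V\<^esub> t"
          using c'(1,3) v tv r smult_closed
          by (simp add: a_minus_def M.minus_add M.a_assoc M.a_lcomm M.r_neg1 M.r_neg2)
        also have "\<dots> \<in> sp S"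
          using submod_minus[OF sp_submod[OF S]] c c' s(4) r by blast
        finally have "x \<ominus>\<^bsub>V\<^esub> ?r \<odot>\<^bsub>V\<^esub> w \<in> U \<inter> sp S"
          using submod_minus[OF insert.prems(2)] x w u(4) r by blast
        then have "(x \<ominus>\<^bsub>V\<^esub> ?r \<odot>\<^bsub>V\<^esub> w) \<oplus>\<^bsub>V\<^esub> ?r \<odot>\<^bsub>V\<^esub> w \<in> N"
          using F(3)[OF N(1)] N n(3,4) r by blast
        then show "x \<in> N" using minus_plus_cancel tv r smult_closed by simp
      qed
      then show ?thesis using F w by (intro exI[of _ "insert w F"]) auto
    qed
  qed
  then show ?thesis using finitely_generated_submod_iff[OF U] by simp
qed

text \<open>A vector \<open>v\<close> outside \<open>U\<close> is independent of it, so the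
  extension may take any value there; it is given the value 0.\<close>

lemma functional_extend1:
  assumes U: "submod K V U" and f: "f \<in> mod_hom K (V\<lparr>carrier := U\<rparr>) (regular K)"
    and v: "v \<in> carrier V"
  shows "\<exists>U' g. submod K V U' \<and> U \<subseteq> U' \<and> v \<in> U' \<and> g \<in> mod_hom K (V\<lparr>carrier := U'\<rparr>) (regular K) \<and>
    (\<forall>x\<in>U. g x = f x)"
proof (cases "v \<in> U")
  case True
  then show ?thesis using U f by (intro exI[of _ U] exI[of _ f]) auto
next
  case False
  let ?U = "{x \<oplus>\<^bsub>V\<^esub> y | x y. x \<in> U \<and> y \<in> (\<lambda>c. c \<odot>\<^bsub>V\<^esub> v) ` carrier K}"
  have U': "submod K V ?U" by (rule submod_sum[OF U submod_line[OF v]])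
  note u = submodD[OF U] and u' = submodD[OF U']
  have uniq: "x = x' \<and> c = c'"
    if x: "x \<in> U" "x' \<in> U" and c: "c \<in> carrier K" "c' \<in> carrier K"
      and e: "x \<oplus>\<^bsub>V\<^esub> c \<odot>\<^bsub>V\<^esub> v = x' \<oplus>\<^bsub>V\<^esub> c' \<odot>\<^bsub>V\<^esub> v" for x x' c c'
  proof -
    have xc: "x \<in> carrier V" "x' \<in> carrier V" using x u by auto
    let ?d = "c \<ominus> c'"
    have d: "?d \<in> carrier K" using c by simp
    have "x \<oplus>\<^bsub>V\<^esub> ?d \<odot>\<^bsub>V\<^esub> v = (x \<oplus>\<^bsub>V\<^esub> c \<odot>\<^bsub>V\<^esub> v) \<oplus>\<^bsub>V\<^esub> (\<ominus> c') \<odot>\<^bsub>V\<^esub> v"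
      using c v xc by (simp add: a_minus_def smult_l_distr smult_closed M.a_assoc)
    also have "\<dots> = x' \<oplus>\<^bsub>V\<^esub> (c' \<oplus> \<ominus> c') \<odot>\<^bsub>V\<^esub> v"
      unfolding e using c v xc by (subst smult_l_distr) (simp_all add: smult_closed M.a_assoc)
    also have "\<dots> = x'" using c v xc by (simp add: R.r_neg)
    finally have *: "x \<oplus>\<^bsub>V\<^esub> ?d \<odot>\<^bsub>V\<^esub> v = x'" .
    have "?d = \<zero>"
    proof (rule ccontr)
      assume "?d \<noteq> \<zero>"
      then obtain i where i: "i \<in> carrier K" "i \<otimes> ?d = \<one>" using inverse_ex d by metis
      have "?d \<odot>\<^bsub>V\<^esub> v = (x \<oplus>\<^bsub>V\<^esub> ?d \<odot>\<^bsub>V\<^esub> v) \<ominus>\<^bsub>V\<^esub> x"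
        using xc v d smult_closed by (simp add: a_minus_def M.a_assoc M.a_comm[of _ "\<ominus>\<^bsub>V\<^esub> x"] M.r_neg1 M.a_lcomm M.r_neg M.r_neg2)
      then have "?d \<odot>\<^bsub>V\<^esub> v \<in> U" using * submod_minus[OF U x(2,1)] by simp
      then have "i \<odot>\<^bsub>V\<^esub> (?d \<odot>\<^bsub>V\<^esub> v) \<in> U" using u(4) i by blast
      then have "v \<in> U" using i d v smult_assoc[of i ?d v] smult_one by simp
      then show False using False by simp
    qed
    then have "c = c'" "x = x'"
      using * xc v scalar_minus_eq_zero[OF c] by simp_all
    then show ?thesis by simp
  qed
  \<comment> \<open>Well defined by \<open>uniq\<close>: the component in \<open>U\<close> is
    determined, and the multiple of \<open>v\<close> is ignored.\<close>
  define g where "g = (\<lambda>z\<in>?U. THE y. \<exists>x c. x \<in> U \<and> c \<in> carrier K \<and> z = x \<oplus>\<^bsub>V\<^esub> c \<odot>\<^bsub>V\<^esub> v \<and> y = f x)"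
  have g: "g (x \<oplus>\<^bsub>V\<^esub> c \<odot>\<^bsub>V\<^esub> v) = f x" if "x \<in> U" "c \<in> carrier K" for x c
  proof -
    have "x \<oplus>\<^bsub>V\<^esub> c \<odot>\<^bsub>V\<^esub> v \<in> ?U" using that by blast
    moreover have "(THE y. \<exists>x' c'. x' \<in> U \<and> c' \<in> carrier K \<and>
        x \<oplus>\<^bsub>V\<^esub> c \<odot>\<^bsub>V\<^esub> v = x' \<oplus>\<^bsub>V\<^esub> c' \<odot>\<^bsub>V\<^esub> v \<and> y = f x') = f x"
      using that uniq by (intro the_equality) blast+
    ultimately show ?thesis by (simp add: g_def)
  qed
  have gU: "g x = f x" if "x \<in> U" for x
    using g[OF that, of \<zero>] v u(1)[OF that] by simp
  have "g \<in> mod_hom K (V\<lparr>carrier := ?U\<rparr>) (regular K)"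
  proof -
    have "restrict g (carrier (V\<lparr>carrier := ?U\<rparr>)) \<in> mod_hom K (V\<lparr>carrier := ?U\<rparr>) (regular K)"
    proof (rule mod_hom_restrictI[OF left_module_submod[OF U']])
      fix z assume "z \<in> carrier (V\<lparr>carrier := ?U\<rparr>)"
      then obtain x c where z: "z = x \<oplus>\<^bsub>V\<^esub> c \<odot>\<^bsub>V\<^esub> v" "x \<in> U" "c \<in> carrier K" by auto
      then show "g z \<in> carrier (regular K)" using g mod_homD(1)[OF f] by simp
      have xv: "x \<in> carrier V" using z u by simp
      {
        fix z' assume "z' \<in> carrier (V\<lparr>carrier := ?U\<rparr>)"
        then obtain x' c' where z': "z' = x' \<oplus>\<^bsub>V\<^esub> c' \<odot>\<^bsub>V\<^esub> v" "x' \<in> U" "c' \<in> carrier K" by auto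
        have xv': "x' \<in> carrier V" using z' u by simp
        have "z \<oplus>\<^bsub>V\<^esub> z' = (x \<oplus>\<^bsub>V\<^esub> x') \<oplus>\<^bsub>V\<^esub> (c \<oplus> c') \<odot>\<^bsub>V\<^esub> v"
          using z z' v xv xv' by (simp add: smult_l_distr smult_closed M.a_assoc M.a_lcomm)
        then show "g (z \<oplus>\<^bsub>V\<lparr>carrier := ?U\<rparr>\<^esub> z') = g z \<oplus>\<^bsub>regular K\<^esub> g z'"
          using g z z' u(3) mod_homD(2)[OF f] by simp
      }
      fix r assume r: "r \<in> carrier K"
      have "r \<odot>\<^bsub>V\<^esub> z = r \<odot>\<^bsub>V\<^esub> x \<oplus>\<^bsub>V\<^esub> (r \<otimes> c) \<odot>\<^bsub>V\<^esub> v"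
        using z v xv r by (simp add: smult_r_distr smult_closed smult_assoc)
      then show "g (r \<odot>\<^bsub>V\<lparr>carrier := ?U\<rparr>\<^esub> z) = r \<odot>\<^bsub>regular K\<^esub> g z"
        using g z r u(4) mod_homD(3)[OF f] by simp
    qed
    moreover have "restrict g ?U = g" by (simp add: g_def)
    ultimately show ?thesis by simp
  qed
  moreover have "U \<subseteq> ?U"
  proof
    fix x assume "x \<in> U"
    moreover from this have "x = x \<oplus>\<^bsub>V\<^esub> \<zero> \<odot>\<^bsub>V\<^esub> v" using v u by simp
    ultimately show "x \<in> ?U" by blast
  qed
  moreover have "v = \<zero>\<^bsub>V\<^esub> \<oplus>\<^bsub>V\<^esub> \<one> \<odot>\<^bsub>V\<^esub> v" using v smult_one by simp
  then have "v \<in> ?U" using u(2) by blast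
  ultimately show ?thesis using U' gU by (intro exI[of _ ?U] exI[of _ g]) blast
qed

lemma functional_extend:
  assumes V: "finitely_generated K V" and U: "submod K V U"
    and f: "f \<in> mod_hom K (V\<lparr>carrier := U\<rparr>) (regular K)"
  obtains g where "g \<in> mod_hom K V (regular K)" "\<And>x. x \<in> U \<Longrightarrow> g x = f x"
proof -
  obtain S where S: "finite S" "S \<subseteq> carrier V" "spans K V S"
    using V finitely_generated_iff by auto
  have "\<exists>U' g. submod K V U' \<and> U \<subseteq> U' \<and> S \<subseteq> U' \<and> g \<in> mod_hom K (V\<lparr>carrier := U'\<rparr>) (regular K) \<and>
    (\<forall>x\<in>U. g x = f x)"
    using S(1,2)
  proof (induction S)
    case empty
    show ?case using U f by (intro exI[of _ U] exI[of _ f]) auto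
  next
    case (insert v S)
    then obtain U' g where g: "submod K V U'" "U \<subseteq> U'" "S \<subseteq> U'"
      "g \<in> mod_hom K (V\<lparr>carrier := U'\<rparr>) (regular K)" "\<forall>x\<in>U. g x = f x" by auto
    obtain U'' h where "submod K V U''" "U' \<subseteq> U''" "v \<in> U''"
      "h \<in> mod_hom K (V\<lparr>carrier := U''\<rparr>) (regular K)" "\<forall>x\<in>U'. h x = g x"
      using functional_extend1[OF g(1,4), of v] insert by auto
    then show ?case using g by (intro exI[of _ U''] exI[of _ h]) auto
  qed
  then obtain U' g where g: "submod K V U'" "S \<subseteq> U'"
      "g \<in> mod_hom K (V\<lparr>carrier := U'\<rparr>) (regular K)" "\<forall>x\<in>U. g x = f x" by auto
  then have "U' = carrier V" using S(3) unfolding spans_def by (auto simp: submod_def)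
  then show ?thesis using g that by simp
qed

text \<open>The coefficient functional on the line through \<open>v\<close>, extended to the whole
  space.\<close>

lemma separating_functional:
  assumes V: "finitely_generated K V" and v: "v \<in> carrier V" "v \<noteq> \<zero>\<^bsub>V\<^esub>"
  obtains g where "g \<in> mod_hom K V (regular K)" "g v \<noteq> \<zero>"
proof -
  let ?U = "(\<lambda>c. c \<odot>\<^bsub>V\<^esub> v) ` carrier K"
  have U: "submod K V ?U" by (rule submod_line[OF v(1)])
  have uniq: "c = c'" if c: "c \<in> carrier K" "c' \<in> carrier K" "c \<odot>\<^bsub>V\<^esub> v = c' \<odot>\<^bsub>V\<^esub> v" for c c'
  proof (rule ccontr)
    assume "c \<noteq> c'"
    then have "c \<ominus> c' \<noteq> \<zero>" using c scalar_minus_eq_zero by simp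
    then obtain i where i: "i \<in> carrier K" "i \<otimes> (c \<ominus> c') = \<one>" using inverse_ex[of "c \<ominus> c'"] c by auto
    have "(c \<ominus> c') \<odot>\<^bsub>V\<^esub> v = c' \<odot>\<^bsub>V\<^esub> v \<oplus>\<^bsub>V\<^esub> (\<ominus> c') \<odot>\<^bsub>V\<^esub> v"
      using c v by (simp add: a_minus_def smult_l_distr)
    also have "\<dots> = (c' \<oplus> \<ominus> c') \<odot>\<^bsub>V\<^esub> v"
      using c(2) v by (subst smult_l_distr) auto
    also have "\<dots> = \<zero>\<^bsub>V\<^esub>" using c v by (simp add: R.r_neg)
    finally have "i \<odot>\<^bsub>V\<^esub> ((c \<ominus> c') \<odot>\<^bsub>V\<^esub> v) = \<zero>\<^bsub>V\<^esub>" using i by simp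
    then show False using i c v smult_assoc[of i "c \<ominus> c'" v] smult_one by simp
  qed
  define f where "f = (\<lambda>x\<in>?U. THE c. c \<in> carrier K \<and> x = c \<odot>\<^bsub>V\<^esub> v)"
  have f: "f (c \<odot>\<^bsub>V\<^esub> v) = c" if "c \<in> carrier K" for c
    using that uniq by (auto simp: f_def intro!: the_equality)
  have "restrict f (carrier (V\<lparr>carrier := ?U\<rparr>)) \<in> mod_hom K (V\<lparr>carrier := ?U\<rparr>) (regular K)"
    by (rule mod_hom_restrictI[OF left_module_submod[OF U]])
      (use v f in \<open>auto simp: smult_l_distr[symmetric] smult_assoc[symmetric]\<close>)
  moreover have "restrict f ?U = f" by (simp add: f_def)
  ultimately have "f \<in> mod_hom K (V\<lparr>carrier := ?U\<rparr>) (regular K)" by simp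
  then obtain g where g: "g \<in> mod_hom K V (regular K)" "\<And>x. x \<in> ?U \<Longrightarrow> g x = f x"
    using functional_extend[OF V U] by metis
  have "g v = \<one>"
    using g(2)[of "\<one> \<odot>\<^bsub>V\<^esub> v"] f[of \<one>] smult_one[OF v(1)] R.one_closed by (metis imageI)
  moreover have "\<one> \<noteq> \<zero>"
    using v smult_one[OF v(1)] by auto
  ultimately show ?thesis using g that by simp
qed

text \<open>Chosen coefficients with respect to a finite spanning set. They need not depend linearly
  on the vector, since the map serves only to move the carrier to the fixed type.\<close>

lemma coordinate_injection:
  assumes V: "finitely_generated K V"
  shows "\<exists>\<phi> :: 'v \<Rightarrow> nat \<Rightarrow> 'k. inj_on \<phi> (carrier V)"
proof -
  obtain S where S: "finite S" "S \<subseteq> carrier V"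
    "\<forall>x\<in>carrier V. \<exists>c \<in> S \<rightarrow> carrier K. x = (\<Oplus>\<^bsub>V\<^esub>s\<in>S. c s \<odot>\<^bsub>V\<^esub> s)"
    using V unfolding finitely_generated_def by auto
  obtain e :: "'v \<Rightarrow> nat" where e: "inj_on e S"
    using finite_imp_inj_to_nat_seg[OF S(1)] by blast
  obtain c where c: "\<And>x. x \<in> carrier V \<Longrightarrow> c x \<in> S \<rightarrow> carrier K"
    "\<And>x. x \<in> carrier V \<Longrightarrow> x = (\<Oplus>\<^bsub>V\<^esub>s\<in>S. c x s \<odot>\<^bsub>V\<^esub> s)"
    using S(3) by metis
  have "inj_on (\<lambda>x n. c x (inv_into S e n)) (carrier V)"
  proof (rule inj_onI)
    fix x y assume xy: "x \<in> carrier V" "y \<in> carrier V"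
      "(\<lambda>n. c x (inv_into S e n)) = (\<lambda>n. c y (inv_into S e n))"
    have "c x s = c y s" if "s \<in> S" for s
      using fun_cong[OF xy(3), of "e s"] that e by simp
    then have "(\<Oplus>\<^bsub>V\<^esub>s\<in>S. c x s \<odot>\<^bsub>V\<^esub> s) = (\<Oplus>\<^bsub>V\<^esub>s\<in>S. c y s \<odot>\<^bsub>V\<^esub> s)"
      using c(1)[OF xy(2)] S smult_closed by (intro M.finsum_cong') (auto simp: Pi_def)
    then show "x = y" using c(2)[OF xy(1)] c(2)[OF xy(2)] by simp
  qed
  then show ?thesis by blast
qed

end

text \<open>A space of maps into a finite-dimensional space is finite-dimensional as soon as finitely many
  evaluations separate its elements.\<close>

lemma finitely_generated_evaluations:
  assumes "finite S" "vspace K H" "vspace K W" "finitely_generated K W"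
    and "\<And>s. s \<in> S \<Longrightarrow> ev s \<in> mod_hom K H W"
    and "\<And>h. h \<in> carrier H \<Longrightarrow> (\<And>s. s \<in> S \<Longrightarrow> ev s h = \<zero>\<^bsub>W\<^esub>) \<Longrightarrow> h = \<zero>\<^bsub>H\<^esub>"
  shows "finitely_generated K H"
  using assms(1,2,5,6)
proof (induction S arbitrary: H ev)
  case empty
  then interpret H: vspace K H by simp
  have "carrier H \<subseteq> {\<zero>\<^bsub>H\<^esub>}" using empty by auto
  then show ?case
    unfolding H.finitely_generated_iff spans_def by (intro exI[of _ "{}"]) (auto simp: submod_def)
next
  case (insert s S)
  interpret H: vspace K H by fact
  interpret W: vspace K W by fact
  interpret module_pair K H W ..
  have s: "ev s \<in> mod_hom K H W" using insert by simp
  let ?N = "{h \<in> carrier H. ev s h = \<zero>\<^bsub>W\<^esub>}"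
  have N: "submod K H ?N" by (rule submod_kernel[OF s])
  have vN: "vspace K (H\<lparr>carrier := ?N\<rparr>)"
    by (intro vspace.intro vspace_axioms.intro H.left_module_submod N H.field)
  have res: "restrict (ev t) ?N \<in> mod_hom K (H\<lparr>carrier := ?N\<rparr>) W" if "t \<in> S" for t
    using mod_hom_restrictI[OF H.left_module_submod[OF N], of "ev t" W]
      mod_homD[OF insert.prems(2)[of t]] that by simp
  \<comment> \<open>On the kernel of one evaluation the remaining ones still separate elements, so
    the induction hypothesis applies; the image is a subspace of \<open>W\<close>.\<close>
  have "finitely_generated K (H\<lparr>carrier := ?N\<rparr>)"
    by (rule insert.IH[OF vN res]) (use insert.prems(3) in auto)
  then obtain F where F: "finite F" "F \<subseteq> ?N" "\<And>L. submod K H L \<Longrightarrow> F \<subseteq> L \<Longrightarrow> ?N \<subseteq> L"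
    using H.finitely_generated_submod_iff[OF N] by auto
  have I: "submod K W (ev s ` carrier H)" by (rule submod_image[OF s H.submod_carrier])
  have "finitely_generated K (W\<lparr>carrier := ev s ` carrier H\<rparr>)"
    by (rule W.submod_finitely_generated[OF assms(4) I])
  then obtain F' where F': "finite F'" "F' \<subseteq> ev s ` carrier H"
    "\<And>L. submod K W L \<Longrightarrow> F' \<subseteq> L \<Longrightarrow> ev s ` carrier H \<subseteq> L"
    using W.finitely_generated_submod_iff[OF I] by auto
  obtain E where E: "finite E" "E \<subseteq> carrier H" "F' = ev s ` E"
    using finite_subset_image[OF F'(1,2)] by auto
  have "spans K H (F \<union> E)"
    by (rule spans_extension[OF s]) (use F F' E in auto)
  then show ?case
    unfolding H.finitely_generated_iff using F E by (intro exI[of _ "F \<union> E"]) auto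
qed

section \<open>Finite-dimensional algebras\<close>

context module_pair
begin

lemma hom_lift_inj:
  assumes X: "left_module R X" and m: "m \<in> mod_hom R M N" "inj_on m (carrier M)"
    and u: "u \<in> mod_hom R X N" "u ` carrier X \<subseteq> m ` carrier M"
  obtains v where "v \<in> mod_hom R X M" "\<And>x. x \<in> carrier X \<Longrightarrow> m (v x) = u x"
proof -
  interpret X: left_module R X by fact
  let ?i = "inv_into (carrier M) m"
  have i: "?i (u x) \<in> carrier M" "m (?i (u x)) = u x" if "x \<in> carrier X" for x
  proof -
    have "u x \<in> m ` carrier M" using u(2) that by blast
    then show "?i (u x) \<in> carrier M" "m (?i (u x)) = u x" by (rule inv_into_into, rule f_inv_into_f)
  qed
  have e: "?i (m y) = y" if "y \<in> carrier M" for y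
    using m(2) that by simp
  have "restrict (\<lambda>x. ?i (u x)) (carrier X) \<in> mod_hom R X M"
  proof (rule mod_hom_restrictI[OF X])
    fix x y assume xy: "x \<in> carrier X" "y \<in> carrier X"
    show "?i (u (x \<oplus>\<^bsub>X\<^esub> y)) = ?i (u x) \<oplus>\<^bsub>M\<^esub> ?i (u y)"
      using mod_homD(2)[OF m(1), of "?i (u x)" "?i (u y)"] i xy mod_homD(2)[OF u(1) xy]
        e[of "?i (u x) \<oplus>\<^bsub>M\<^esub> ?i (u y)"] by simp
  next
    fix r x assume rx: "r \<in> carrier R" "x \<in> carrier X"
    show "?i (u (r \<odot>\<^bsub>X\<^esub> x)) = r \<odot>\<^bsub>M\<^esub> ?i (u x)"
      using mod_homD(3)[OF m(1), of r "?i (u x)"] i rx mod_homD(3)[OF u(1) rx]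
        e[of "r \<odot>\<^bsub>M\<^esub> ?i (u x)"] M.smult_closed by simp
  qed (rule i)
  then show ?thesis using that i by simp
qed

lemma hom_desc_surj:
  assumes X: "left_module R X" and e: "e \<in> mod_hom R M N" "e ` carrier M = carrier N"
    and u: "u \<in> mod_hom R M X" "\<And>x. x \<in> carrier M \<Longrightarrow> e x = \<zero>\<^bsub>N\<^esub> \<Longrightarrow> u x = \<zero>\<^bsub>X\<^esub>"
  obtains v where "v \<in> mod_hom R N X" "\<And>x. x \<in> carrier M \<Longrightarrow> v (e x) = u x"
proof -
  interpret X: left_module R X by fact
  interpret MX: module_pair R M X ..
  let ?i = "inv_into (carrier M) e"
  have i: "?i y \<in> carrier M" "e (?i y) = y" if "y \<in> carrier N" for y
    using inv_into_into[of y e "carrier M"] f_inv_into_f[of y e "carrier M"] e(2) that by simp_all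
  have v: "u (?i (e x)) = u x" if x: "x \<in> carrier M" for x
  proof -
    have ex: "e x \<in> carrier N" using mod_homD(1)[OF e(1) x] .
    have "e (?i (e x) \<ominus>\<^bsub>M\<^esub> x) = \<zero>\<^bsub>N\<^esub>"
      using hom_minus[OF e(1) i(1)[OF ex] x] i(2)[OF ex] ex N.minus_eq_zero by simp
    then have "u (?i (e x) \<ominus>\<^bsub>M\<^esub> x) = \<zero>\<^bsub>X\<^esub>" using u(2) i(1)[OF ex] x by simp
    then show ?thesis
      using MX.hom_minus[OF u(1) i(1)[OF ex] x] X.minus_eq_zero mod_homD(1)[OF u(1)] i(1)[OF ex] x
      by simp
  qed
  have "restrict (\<lambda>y. u (?i y)) (carrier N) \<in> mod_hom R N X"
  proof (rule mod_hom_restrictI[OF N.left_module_axioms])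
    show "u (?i y) \<in> carrier X" if "y \<in> carrier N" for y
      using mod_homD(1)[OF u(1)] i(1) that by blast
  next
    fix x y assume xy: "x \<in> carrier N" "y \<in> carrier N"
    show "u (?i (x \<oplus>\<^bsub>N\<^esub> y)) = u (?i x) \<oplus>\<^bsub>X\<^esub> u (?i y)"
      using mod_homD(2)[OF e(1), of "?i x" "?i y"] mod_homD(2)[OF u(1), of "?i x" "?i y"] i xy
        v[of "?i x \<oplus>\<^bsub>M\<^esub> ?i y"] by simp
  next
    fix r x assume rx: "r \<in> carrier R" "x \<in> carrier N"
    show "u (?i (r \<odot>\<^bsub>N\<^esub> x)) = r \<odot>\<^bsub>X\<^esub> u (?i x)"
      using mod_homD(3)[OF e(1), of r "?i x"] mod_homD(3)[OF u(1), of r "?i x"] i rx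
        v[of "r \<odot>\<^bsub>M\<^esub> ?i x"] M.smult_closed by simp
  qed
  then show ?thesis using that v mod_homD(1)[OF e(1)] by simp
qed

end

lemma mod_hom_compose:
  assumes "left_module R L" "g \<in> mod_hom R M N" "f \<in> mod_hom R L M"
  shows "compose (carrier L) g f \<in> mod_hom R L N"
  unfolding compose_def
  by (rule mod_hom_restrictI[OF assms(1)]) (auto simp: mod_homD(1-3)[OF assms(2)] mod_homD(1-3)[OF assms(3)])

text \<open>Quotients are modelled on systems of representatives, so that they live on the same type.\<close>

definition rep :: "('r, 'm) module \<Rightarrow> 'm set \<Rightarrow> 'm \<Rightarrow> 'm" where
  "rep M N x = (SOME y. y \<in> carrier M \<and> x \<ominus>\<^bsub>M\<^esub> y \<in> N)"

definition quot :: "('r, 'm) module \<Rightarrow> 'm set \<Rightarrow> ('r, 'm) module" where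
  "quot M N = \<lparr>carrier = rep M N ` carrier M, mult = undefined, one = undefined,
     zero = rep M N \<zero>\<^bsub>M\<^esub>, add = (\<lambda>x y. rep M N (x \<oplus>\<^bsub>M\<^esub> y)),
     smult = (\<lambda>r x. rep M N (r \<odot>\<^bsub>M\<^esub> x))\<rparr>"

context left_module
begin

lemma rep:
  assumes N: "submod R M N" and x: "x \<in> carrier M"
  shows "rep M N x \<in> carrier M" "x \<ominus>\<^bsub>M\<^esub> rep M N x \<in> N"
proof -
  have "\<exists>y. y \<in> carrier M \<and> x \<ominus>\<^bsub>M\<^esub> y \<in> N"
    using x submodD(2)[OF N] by (intro exI[of _ x]) (simp add: a_minus_def M.r_neg)
  from someI_ex[OF this] show "rep M N x \<in> carrier M" "x \<ominus>\<^bsub>M\<^esub> rep M N x \<in> N"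
    by (auto simp: rep_def)
qed

lemma submod_diff_cong:
  assumes N: "submod R M N" and c: "x \<in> carrier M" "y \<in> carrier M" "z \<in> carrier M"
    and d: "x \<ominus>\<^bsub>M\<^esub> y \<in> N"
  shows "x \<ominus>\<^bsub>M\<^esub> z \<in> N \<longleftrightarrow> y \<ominus>\<^bsub>M\<^esub> z \<in> N"
proof
  assume "x \<ominus>\<^bsub>M\<^esub> z \<in> N"
  then have "(x \<ominus>\<^bsub>M\<^esub> z) \<ominus>\<^bsub>M\<^esub> (x \<ominus>\<^bsub>M\<^esub> y) \<in> N" using d by (rule submod_minus[OF N])
  moreover have "(x \<ominus>\<^bsub>M\<^esub> z) \<ominus>\<^bsub>M\<^esub> (x \<ominus>\<^bsub>M\<^esub> y) = y \<ominus>\<^bsub>M\<^esub> z"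
    using c by (simp add: a_minus_def M.minus_add M.a_assoc M.a_lcomm M.r_neg M.r_neg2 M.a_comm)
  ultimately show "y \<ominus>\<^bsub>M\<^esub> z \<in> N" by simp
next
  assume "y \<ominus>\<^bsub>M\<^esub> z \<in> N"
  then have "(x \<ominus>\<^bsub>M\<^esub> y) \<oplus>\<^bsub>M\<^esub> (y \<ominus>\<^bsub>M\<^esub> z) \<in> N" using d submodD(3)[OF N] by blast
  moreover have "(x \<ominus>\<^bsub>M\<^esub> y) \<oplus>\<^bsub>M\<^esub> (y \<ominus>\<^bsub>M\<^esub> z) = x \<ominus>\<^bsub>M\<^esub> z"
    using c by (simp add: a_minus_def M.a_assoc M.r_neg1)
  ultimately show "x \<ominus>\<^bsub>M\<^esub> z \<in> N" by simp
qed

lemma rep_eq_iff: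
  assumes N: "submod R M N" and x: "x \<in> carrier M" "y \<in> carrier M"
  shows "rep M N x = rep M N y \<longleftrightarrow> x \<ominus>\<^bsub>M\<^esub> y \<in> N"
proof
  assume e: "rep M N x = rep M N y"
  have "y \<ominus>\<^bsub>M\<^esub> rep M N x \<in> N" using rep[OF N x(2)] e by simp
  then have "\<ominus>\<^bsub>M\<^esub> (y \<ominus>\<^bsub>M\<^esub> rep M N x) \<in> N" by (rule submod_neg[OF N])
  then have "rep M N x \<ominus>\<^bsub>M\<^esub> y \<in> N"
    using x rep[OF N x(1)] by (simp add: a_minus_def M.minus_add M.a_comm)
  then show "x \<ominus>\<^bsub>M\<^esub> y \<in> N"
    using submod_diff_cong[OF N x(1) rep(1)[OF N x(1)] x(2) rep(2)[OF N x(1)]] by simp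
next
  assume "x \<ominus>\<^bsub>M\<^esub> y \<in> N"
  then have "(\<lambda>z. z \<in> carrier M \<and> x \<ominus>\<^bsub>M\<^esub> z \<in> N) = (\<lambda>z. z \<in> carrier M \<and> y \<ominus>\<^bsub>M\<^esub> z \<in> N)"
    using submod_diff_cong[OF N x] by blast
  then show "rep M N x = rep M N y" by (simp add: rep_def)
qed

lemma quot:
  assumes N: "submod R M N"
  shows "left_module R (quot M N)" "restrict (rep M N) (carrier M) \<in> mod_hom R M (quot M N)"
    "restrict (rep M N) (carrier M) ` carrier M = carrier (quot M N)"
    "\<And>x. x \<in> carrier M \<Longrightarrow> rep M N x = \<zero>\<^bsub>quot M N\<^esub> \<longleftrightarrow> x \<in> N"
proof -
  have a: "rep M N (rep M N x \<oplus>\<^bsub>M\<^esub> rep M N y) = rep M N (x \<oplus>\<^bsub>M\<^esub> y)"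
    if xy: "x \<in> carrier M" "y \<in> carrier M" for x y
  proof -
    note r = rep[OF N xy(1)] rep[OF N xy(2)]
    have "(x \<ominus>\<^bsub>M\<^esub> rep M N x) \<oplus>\<^bsub>M\<^esub> (y \<ominus>\<^bsub>M\<^esub> rep M N y) \<in> N"
      using r submodD(3)[OF N] by blast
    moreover have "(x \<ominus>\<^bsub>M\<^esub> rep M N x) \<oplus>\<^bsub>M\<^esub> (y \<ominus>\<^bsub>M\<^esub> rep M N y) =
        (x \<oplus>\<^bsub>M\<^esub> y) \<ominus>\<^bsub>M\<^esub> (rep M N x \<oplus>\<^bsub>M\<^esub> rep M N y)"
      using xy r by (simp add: a_minus_def M.minus_add M.a_assoc M.a_lcomm)
    ultimately have "rep M N (x \<oplus>\<^bsub>M\<^esub> y) = rep M N (rep M N x \<oplus>\<^bsub>M\<^esub> rep M N y)"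
      using rep_eq_iff[OF N] xy r by simp
    then show ?thesis by simp
  qed
  have s: "rep M N (r \<odot>\<^bsub>M\<^esub> rep M N x) = rep M N (r \<odot>\<^bsub>M\<^esub> x)"
    if rx: "r \<in> carrier R" "x \<in> carrier M" for r x
  proof -
    note p = rep[OF N rx(2)]
    have "r \<odot>\<^bsub>M\<^esub> (x \<ominus>\<^bsub>M\<^esub> rep M N x) \<in> N"
      using p submodD(4)[OF N] rx by blast
    moreover have "\<ominus>\<^bsub>M\<^esub> (r \<odot>\<^bsub>M\<^esub> rep M N x) = r \<odot>\<^bsub>M\<^esub> \<ominus>\<^bsub>M\<^esub> rep M N x"
    proof -
      have "r \<odot>\<^bsub>M\<^esub> \<ominus>\<^bsub>M\<^esub> rep M N x \<oplus>\<^bsub>M\<^esub> r \<odot>\<^bsub>M\<^esub> rep M N x = \<zero>\<^bsub>M\<^esub>"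
        using p rx smult_r_distr[of r "\<ominus>\<^bsub>M\<^esub> rep M N x" "rep M N x"] by (simp add: M.l_neg)
      then show ?thesis
        using M.minus_equality[of "r \<odot>\<^bsub>M\<^esub> \<ominus>\<^bsub>M\<^esub> rep M N x" "r \<odot>\<^bsub>M\<^esub> rep M N x"] p rx smult_closed by simp
    qed
    ultimately have "rep M N (r \<odot>\<^bsub>M\<^esub> x) = rep M N (r \<odot>\<^bsub>M\<^esub> rep M N x)"
      using rep_eq_iff[OF N, of "r \<odot>\<^bsub>M\<^esub> x" "r \<odot>\<^bsub>M\<^esub> rep M N x"] rx p smult_closed
      by (simp add: a_minus_def smult_r_distr)
    then show ?thesis by simp
  qed
  show "left_module R (quot M N)"
    by (rule left_module_image[of _ "rep M N"]) (auto simp: quot_def a s)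
  show "restrict (rep M N) (carrier M) \<in> mod_hom R M (quot M N)"
    by (rule mod_hom_restrictI[OF left_module_axioms]) (auto simp: quot_def a s)
  show "restrict (rep M N) (carrier M) ` carrier M = carrier (quot M N)"
    by (simp add: quot_def)
  show "rep M N x = \<zero>\<^bsub>quot M N\<^esub> \<longleftrightarrow> x \<in> N" if x: "x \<in> carrier M" for x
    using rep_eq_iff[OF N x, of "\<zero>\<^bsub>M\<^esub>"] x M.minus_equality[of "\<zero>\<^bsub>M\<^esub>" "\<zero>\<^bsub>M\<^esub>"]
    by (simp add: quot_def a_minus_def)
qed

end

definition prod_module :: "('r, 'm) module \<Rightarrow> ('r, 'n) module \<Rightarrow> ('r, 'm \<times> 'n) module" where
  "prod_module M N = \<lparr>carrier = carrier M \<times> carrier N, mult = undefined, one = undefined,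
     zero = (\<zero>\<^bsub>M\<^esub>, \<zero>\<^bsub>N\<^esub>), add = (\<lambda>x y. (fst x \<oplus>\<^bsub>M\<^esub> fst y, snd x \<oplus>\<^bsub>N\<^esub> snd y)),
     smult = (\<lambda>r x. (r \<odot>\<^bsub>M\<^esub> fst x, r \<odot>\<^bsub>N\<^esub> snd x))\<rparr>"

lemma prod_module_simps [simp]:
  "carrier (prod_module M N) = carrier M \<times> carrier N"
  "\<zero>\<^bsub>prod_module M N\<^esub> = (\<zero>\<^bsub>M\<^esub>, \<zero>\<^bsub>N\<^esub>)"
  "x \<oplus>\<^bsub>prod_module M N\<^esub> y = (fst x \<oplus>\<^bsub>M\<^esub> fst y, snd x \<oplus>\<^bsub>N\<^esub> snd y)"
  "r \<odot>\<^bsub>prod_module M N\<^esub> x = (r \<odot>\<^bsub>M\<^esub> fst x, r \<odot>\<^bsub>N\<^esub> snd x)"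
  by (simp_all add: prod_module_def)

context module_pair
begin

lemma left_module_prod: "left_module R (prod_module M N)"
proof -
  have "abelian_group (prod_module M N)"
  proof (rule abelian_groupI)
    show "\<exists>y\<in>carrier (prod_module M N). y \<oplus>\<^bsub>prod_module M N\<^esub> x = \<zero>\<^bsub>prod_module M N\<^esub>"
      if "x \<in> carrier (prod_module M N)" for x
      using that by (intro bexI[of _ "(\<ominus>\<^bsub>M\<^esub> fst x, \<ominus>\<^bsub>N\<^esub> snd x)"]) (auto simp: M.M.l_neg N.M.l_neg)
  qed (auto simp: M.M.a_ac N.M.a_ac)
  then show ?thesis
    by (intro left_module.intro left_module_axioms.intro M.R.ring_axioms)
      (auto simp: M.smult_closed N.smult_closed M.smult_l_distr N.smult_l_distr M.smult_r_distr
        N.smult_r_distr M.smult_assoc N.smult_assoc M.smult_one N.smult_one)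
qed

lemma finitely_generated_prod:
  assumes M: "finitely_generated R M" and N: "finitely_generated R N"
  shows "finitely_generated R (prod_module M N)"
proof -
  interpret P: left_module R "prod_module M N" by (rule left_module_prod)
  obtain S where S: "finite S" "S \<subseteq> carrier M" "spans R M S"
    using M M.finitely_generated_iff by auto
  obtain S' where S': "finite S'" "S' \<subseteq> carrier N" "spans R N S'"
    using N N.finitely_generated_iff by auto
  let ?S = "(\<lambda>x. (x, \<zero>\<^bsub>N\<^esub>)) ` S \<union> Pair \<zero>\<^bsub>M\<^esub> ` S'"
  have "spans R (prod_module M N) ?S"
    unfolding spans_def
  proof (intro allI impI subsetI)
    fix L z assume L: "submod R (prod_module M N) L" "?S \<subseteq> L" and z: "z \<in> carrier (prod_module M N)"
    note l = submodD[OF L(1)]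
    have "submod R M {x \<in> carrier M. (x, \<zero>\<^bsub>N\<^esub>) \<in> L}"
      unfolding submod_def using l(2) l(3)[of "(_, \<zero>\<^bsub>N\<^esub>)" "(_, \<zero>\<^bsub>N\<^esub>)"] l(4)[of _ "(_, \<zero>\<^bsub>N\<^esub>)"]
      by (auto simp: M.smult_closed)
    then have 1: "(x, \<zero>\<^bsub>N\<^esub>) \<in> L" if "x \<in> carrier M" for x
      using S L(2) that unfolding spans_def by blast
    have "submod R N {x \<in> carrier N. (\<zero>\<^bsub>M\<^esub>, x) \<in> L}"
      unfolding submod_def using l(2) l(3)[of "(\<zero>\<^bsub>M\<^esub>, _)" "(\<zero>\<^bsub>M\<^esub>, _)"] l(4)[of _ "(\<zero>\<^bsub>M\<^esub>, _)"]
      by (auto simp: N.smult_closed)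
    then have 2: "(\<zero>\<^bsub>M\<^esub>, x) \<in> L" if "x \<in> carrier N" for x
      using S' L(2) that unfolding spans_def by blast
    show "z \<in> L"
      using l(3)[OF 1[of "fst z"] 2[of "snd z"]] z by auto
  qed
  then show ?thesis
    unfolding P.finitely_generated_iff using S S' by (intro exI[of _ ?S]) auto
qed

end

section \<open>Restriction of scalars to the ground field\<close>

locale fdalg =
  fixes K :: "'k ring" and A :: "('k, 'a) module"
  assumes fd: "fin_dim_algebra K A"
begin

sublocale K: field K
  using fd by (simp add: fin_dim_algebra_def)

sublocale A: ring A
  using fd by (simp add: fin_dim_algebra_def)

sublocale KA: vspace K A
  using fd
  by (intro vspace.intro vspace_axioms.intro K.field_axioms)
    (simp add: fin_dim_algebra_def left_module_iff_module[OF K.is_cring])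

lemma smult_mult:
  assumes "c \<in> carrier K" "x \<in> carrier A" "y \<in> carrier A"
  shows "c \<odot>\<^bsub>A\<^esub> (x \<otimes>\<^bsub>A\<^esub> y) = (c \<odot>\<^bsub>A\<^esub> x) \<otimes>\<^bsub>A\<^esub> y" "c \<odot>\<^bsub>A\<^esub> (x \<otimes>\<^bsub>A\<^esub> y) = x \<otimes>\<^bsub>A\<^esub> (c \<odot>\<^bsub>A\<^esub> y)"
  using fd assms unfolding fin_dim_algebra_def by blast+

lemma fg_KA: "finitely_generated K A"
  using fd by (simp add: fin_dim_algebra_def)

abbreviation sc where "sc c \<equiv> c \<odot>\<^bsub>A\<^esub> \<one>\<^bsub>A\<^esub>"

lemma sc_closed: "c \<in> carrier K \<Longrightarrow> sc c \<in> carrier A"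
  by (simp add: KA.smult_closed)

lemma sc_mult: "c \<in> carrier K \<Longrightarrow> x \<in> carrier A \<Longrightarrow> sc c \<otimes>\<^bsub>A\<^esub> x = c \<odot>\<^bsub>A\<^esub> x"
  using smult_mult(1)[of c "\<one>\<^bsub>A\<^esub>" x] by simp

lemma sc_comm: "c \<in> carrier K \<Longrightarrow> x \<in> carrier A \<Longrightarrow> x \<otimes>\<^bsub>A\<^esub> sc c = sc c \<otimes>\<^bsub>A\<^esub> x"
  using smult_mult(2)[of c x "\<one>\<^bsub>A\<^esub>"] sc_mult by simp

text \<open>Restriction of scalars along \<open>sc\<close>, whose values are central by
  \<open>sc_comm\<close>. Dimension arguments for modules over \<open>A\<close> are made on this
  vector space.\<close>

definition KM :: "('a, 'm) module \<Rightarrow> ('k, 'm) module" where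
  "KM M = \<lparr>carrier = carrier M, mult = mult M, one = one M, zero = zero M, add = add M,
     smult = (\<lambda>c x. sc c \<odot>\<^bsub>M\<^esub> x)\<rparr>"

lemma KM_simps [simp]:
  "carrier (KM M) = carrier M" "\<zero>\<^bsub>KM M\<^esub> = \<zero>\<^bsub>M\<^esub>" "x \<oplus>\<^bsub>KM M\<^esub> y = x \<oplus>\<^bsub>M\<^esub> y"
  "c \<odot>\<^bsub>KM M\<^esub> x = sc c \<odot>\<^bsub>M\<^esub> x" "KM (M\<lparr>carrier := N\<rparr>) = (KM M)\<lparr>carrier := N\<rparr>"
  by (simp_all add: KM_def)

lemma KM_vspace:
  assumes "left_module A M" shows "vspace K (KM M)"
proof -
  interpret M: left_module A M by fact
  have "abelian_group (KM M)"
  proof (rule abelian_groupI)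
    show "\<exists>y\<in>carrier (KM M). y \<oplus>\<^bsub>KM M\<^esub> x = \<zero>\<^bsub>KM M\<^esub>" if "x \<in> carrier (KM M)" for x
      using that M.M.l_neg by (intro bexI[of _ "\<ominus>\<^bsub>M\<^esub> x"]) auto
  qed (auto simp: M.M.a_ac)
  moreover have "sc (c \<otimes>\<^bsub>K\<^esub> e) = sc c \<otimes>\<^bsub>A\<^esub> sc e" if "c \<in> carrier K" "e \<in> carrier K" for c e
    using that sc_mult sc_closed KA.smult_assoc by simp
  ultimately show ?thesis
    by (intro vspace.intro vspace_axioms.intro left_module.intro left_module_axioms.intro
        K.ring_axioms K.field_axioms)
      (auto simp: sc_closed M.smult_closed KA.smult_l_distr M.smult_l_distr M.smult_r_distr
        M.smult_assoc[symmetric] M.smult_one KA.smult_one)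
qed

lemma submod_KM: "submod A M N \<Longrightarrow> submod K (KM M) N"
  by (auto simp: submod_def sc_closed)

lemma mod_hom_KM: "f \<in> mod_hom A M N \<Longrightarrow> f \<in> mod_hom K (KM M) (KM N)"
  by (auto simp: mod_hom_def sc_closed)

text \<open>If U spans the algebra over the field and S generates the module over the algebra, the
  products of elements of U and S span the module over the field.\<close>

lemma finitely_generated_KM:
  assumes M: "left_module A M"
  shows "finitely_generated A M \<longleftrightarrow> finitely_generated K (KM M)"
proof -
  interpret M: left_module A M by fact
  interpret KM: vspace K "KM M" by (rule KM_vspace[OF M])
  show ?thesis
  proof
    assume "finitely_generated K (KM M)"
    then obtain S where S: "finite S" "S \<subseteq> carrier M" "spans K (KM M) S"
      using KM.finitely_generated_iff by auto
    have "spans A M S"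
      using S(3) submod_KM unfolding spans_def by auto
    then show "finitely_generated A M" using S M.finitely_generated_iff by auto
  next
    assume "finitely_generated A M"
    then obtain S where S: "finite S" "S \<subseteq> carrier M" "spans A M S"
      using M.finitely_generated_iff by auto
    obtain U where U: "finite U" "U \<subseteq> carrier A" "spans K A U"
      using fg_KA KA.finitely_generated_iff by auto
    let ?S = "(\<lambda>(u, s). u \<odot>\<^bsub>M\<^esub> s) ` (U \<times> S)"
    have "spans K (KM M) ?S"
      unfolding spans_def
    proof (intro allI impI)
      fix N assume N: "submod K (KM M) N" "?S \<subseteq> N"
      note n = submodD[OF N(1)]
      have 1: "a \<odot>\<^bsub>M\<^esub> s \<in> N" if a: "a \<in> carrier A" and s: "s \<in> S" for a s
      proof -
        have sM: "s \<in> carrier M" using s S by auto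
        have "submod K A {a \<in> carrier A. a \<odot>\<^bsub>M\<^esub> s \<in> N}"
          unfolding submod_def
        proof (intro conjI ballI)
          fix r x assume r: "r \<in> carrier K" and x: "x \<in> {a \<in> carrier A. a \<odot>\<^bsub>M\<^esub> s \<in> N}"
          have "(r \<odot>\<^bsub>A\<^esub> x) \<odot>\<^bsub>M\<^esub> s = sc r \<odot>\<^bsub>M\<^esub> (x \<odot>\<^bsub>M\<^esub> s)"
            using r x sM sc_mult sc_closed M.smult_assoc[of "sc r" x s] by simp
          then show "r \<odot>\<^bsub>A\<^esub> x \<in> {a \<in> carrier A. a \<odot>\<^bsub>M\<^esub> s \<in> N}"
            using n(4)[OF r] x r KA.smult_closed by auto
        qed (use n(2,3) sM in \<open>auto simp: M.smult_l_distr\<close>)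
        moreover have "U \<subseteq> {a \<in> carrier A. a \<odot>\<^bsub>M\<^esub> s \<in> N}" using U N(2) s by auto
        ultimately show ?thesis using U(3) a unfolding spans_def by blast
      qed
      \<comment> \<open>The largest \<open>A\<close>-submodule inside the subspace \<open>N\<close>.
        It contains S, hence is everything.\<close>
      have "submod A M {x \<in> carrier M. \<forall>a\<in>carrier A. a \<odot>\<^bsub>M\<^esub> x \<in> N}"
        unfolding submod_def using n(2,3)
        by (auto simp: M.smult_closed M.smult_r_distr M.smult_assoc[symmetric])
      then have "carrier M \<subseteq> {x \<in> carrier M. \<forall>a\<in>carrier A. a \<odot>\<^bsub>M\<^esub> x \<in> N}"
        using S 1 unfolding spans_def by blast
      then show "carrier (KM M) \<subseteq> N"
        using M.smult_one A.one_closed by force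
    qed
    moreover have "?S \<subseteq> carrier (KM M)" using S U M.smult_closed by auto
    ultimately show "finitely_generated K (KM M)"
      unfolding KM.finitely_generated_iff using S U by (intro exI[of _ ?S]) auto
  qed
qed

text \<open>Finite generation passes to submodules because it amounts to finite dimension, where
  elimination applies.\<close>

lemma fg_submod:
  assumes M: "fg_module A M" and N: "submod A M N"
  shows "fg_module A (M\<lparr>carrier := N\<rparr>)"
proof -
  interpret M: left_module A M using M by (simp add: fg_module_def)
  interpret V: vspace K "KM M" by (rule KM_vspace) (rule M.left_module_axioms)
  have l: "left_module A (M\<lparr>carrier := N\<rparr>)" by (rule M.left_module_submod[OF N])
  have "finitely_generated K (KM M)"
    using finitely_generated_KM[OF M.left_module_axioms] M by (simp add: fg_module_def)
  then have "finitely_generated K (KM (M\<lparr>carrier := N\<rparr>))"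
    using V.submod_finitely_generated[OF _ submod_KM[OF N]] by simp
  then show ?thesis
    using finitely_generated_KM[OF l] l by (simp add: fg_module_def)
qed

section \<open>Copies of modules on the fixed carrier type\<close>

definition cp :: "('a, 'm) module \<Rightarrow> 'm \<Rightarrow> nat \<Rightarrow> 'k" where
  "cp M = (SOME \<phi>. inj_on \<phi> (carrier M))"

definition uncp :: "('a, 'm) module \<Rightarrow> (nat \<Rightarrow> 'k) \<Rightarrow> 'm" where
  "uncp M = inv_into (carrier M) (cp M)"

text \<open>The operations are carried over by \<open>cp\<close>, so an arbitrary injection suffices
  and becomes an isomorphism by construction.\<close>

definition copy :: "('a, 'm) module \<Rightarrow> ('k, 'a) fmodule" where
  "copy M = \<lparr>carrier = cp M ` carrier M, mult = undefined, one = undefined,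
     zero = cp M \<zero>\<^bsub>M\<^esub>, add = (\<lambda>x y. cp M (uncp M x \<oplus>\<^bsub>M\<^esub> uncp M y)),
     smult = (\<lambda>r x. cp M (r \<odot>\<^bsub>M\<^esub> uncp M x))\<rparr>"

lemma fg_moduleD: "fg_module A M \<Longrightarrow> left_module A M" "fg_module A M \<Longrightarrow> finitely_generated A M"
  by (simp_all add: fg_module_def)

lemma cp_inj:
  assumes "fg_module A M" shows "inj_on (cp M) (carrier M)"
proof -
  interpret V: vspace K "KM M" by (rule KM_vspace[OF fg_moduleD(1)[OF assms]])
  have "\<exists>\<phi> :: _ \<Rightarrow> nat \<Rightarrow> 'k. inj_on \<phi> (carrier M)"
    using V.coordinate_injection finitely_generated_KM[of M] fg_moduleD[OF assms] by simp
  then show ?thesis unfolding cp_def by (rule someI_ex)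
qed

lemma uncp_cp [simp]: "fg_module A M \<Longrightarrow> x \<in> carrier M \<Longrightarrow> uncp M (cp M x) = x"
  by (simp add: uncp_def inv_into_f_f[OF cp_inj])

lemma cp_uncp [simp]: "x \<in> carrier (copy M) \<Longrightarrow> cp M (uncp M x) = x"
  by (simp add: uncp_def copy_def f_inv_into_f)

lemma cp_closed [simp]: "x \<in> carrier M \<Longrightarrow> cp M x \<in> carrier (copy M)"
  by (simp add: copy_def)

lemma uncp_closed [simp]: "x \<in> carrier (copy M) \<Longrightarrow> uncp M x \<in> carrier M"
  by (simp add: copy_def uncp_def inv_into_into)

lemma left_module_copy:
  assumes M: "fg_module A M" shows "left_module A (copy M)"
proof -
  interpret left_module A M by (rule fg_moduleD(1)[OF M])
  show ?thesis
    by (rule left_module_image[of _ "cp M"]) (auto simp: copy_def M)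
qed

lemma cp_hom: "fg_module A M \<Longrightarrow> restrict (cp M) (carrier M) \<in> mod_hom A M (copy M)"
  by (rule mod_hom_restrictI[OF fg_moduleD(1)]) (auto simp: copy_def)

lemma uncp_add:
  assumes "fg_module A M" "x \<in> carrier (copy M)" "y \<in> carrier (copy M)"
  shows "uncp M (x \<oplus>\<^bsub>copy M\<^esub> y) = uncp M x \<oplus>\<^bsub>M\<^esub> uncp M y"
proof -
  interpret left_module A M by (rule fg_moduleD(1)[OF assms(1)])
  have "x \<oplus>\<^bsub>copy M\<^esub> y = cp M (uncp M x \<oplus>\<^bsub>M\<^esub> uncp M y)" by (simp add: copy_def)
  then show ?thesis using assms by simp
qed

lemma uncp_smult:
  assumes "fg_module A M" "r \<in> carrier A" "x \<in> carrier (copy M)"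
  shows "uncp M (r \<odot>\<^bsub>copy M\<^esub> x) = r \<odot>\<^bsub>M\<^esub> uncp M x"
proof -
  interpret left_module A M by (rule fg_moduleD(1)[OF assms(1)])
  have "r \<odot>\<^bsub>copy M\<^esub> x = cp M (r \<odot>\<^bsub>M\<^esub> uncp M x)" by (simp add: copy_def)
  then show ?thesis using assms smult_closed by simp
qed

lemma uncp_hom:
  assumes "fg_module A M"
  shows "restrict (uncp M) (carrier (copy M)) \<in> mod_hom A (copy M) M"
  by (rule mod_hom_restrictI[OF left_module_copy[OF assms]])
    (auto simp: uncp_add[OF assms] uncp_smult[OF assms])

lemma fg_copy:
  assumes M: "fg_module A M" shows "fg_module A (copy M)"
proof -
  interpret M: left_module A M by (rule fg_moduleD(1)[OF M])
  interpret C: left_module A "copy M" by (rule left_module_copy[OF M])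
  interpret module_pair A M "copy M" ..
  have "finitely_generated A (copy M)"
    by (rule finitely_generated_image[OF cp_hom[OF M] _ fg_moduleD(2)[OF M]]) (auto simp: copy_def)
  then show ?thesis by (simp add: fg_module_def C.left_module_axioms)
qed

end

section \<open>The category of finite-dimensional modules\<close>

lemma (in left_module) zero_in: "\<zero>\<^bsub>M\<^esub> \<in> carrier M"
  by simp

lemma (in left_module) smult_minus_r:
  assumes "r \<in> carrier R" "x \<in> carrier M"
  shows "r \<odot>\<^bsub>M\<^esub> \<ominus>\<^bsub>M\<^esub> x = \<ominus>\<^bsub>M\<^esub> (r \<odot>\<^bsub>M\<^esub> x)"
proof -
  have "r \<odot>\<^bsub>M\<^esub> \<ominus>\<^bsub>M\<^esub> x \<oplus>\<^bsub>M\<^esub> r \<odot>\<^bsub>M\<^esub> x = \<zero>\<^bsub>M\<^esub>"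
    using assms smult_r_distr[of r "\<ominus>\<^bsub>M\<^esub> x" x] by (simp add: M.l_neg)
  then show ?thesis
    using M.minus_equality[of "r \<odot>\<^bsub>M\<^esub> \<ominus>\<^bsub>M\<^esub> x" "r \<odot>\<^bsub>M\<^esub> x"] assms smult_closed by simp
qed

context module_pair
begin

lemma hom_plus:
  assumes f: "f \<in> mod_hom R M N" and g: "g \<in> mod_hom R M N"
  shows "(\<lambda>x\<in>carrier M. f x \<oplus>\<^bsub>N\<^esub> g x) \<in> mod_hom R M N"
  by (rule mod_hom_restrictI[OF M.left_module_axioms])
    (auto simp: mod_homD[OF f] mod_homD[OF g] N.M.a_ac N.smult_r_distr)

lemma hom_zero_map: "(\<lambda>x\<in>carrier M. \<zero>\<^bsub>N\<^esub>) \<in> mod_hom R M N"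
  by (rule mod_hom_restrictI[OF M.left_module_axioms]) auto

lemma hom_uminus:
  assumes f: "f \<in> mod_hom R M N"
  shows "(\<lambda>x\<in>carrier M. \<ominus>\<^bsub>N\<^esub> f x) \<in> mod_hom R M N"
  by (rule mod_hom_restrictI[OF M.left_module_axioms])
    (auto simp: mod_homD[OF f] N.M.minus_add N.M.a_comm N.smult_minus_r)

end

text \<open>Source and target are part of an arrow, since the underlying function determines neither
  of the two module structures.\<close>

type_synonym ('k, 'a) arrow =
  "('k, 'a) fmodule \<times> ((nat \<Rightarrow> 'k) \<Rightarrow> (nat \<Rightarrow> 'k)) \<times> ('k, 'a) fmodule"

definition asrc :: "('k, 'a) arrow \<Rightarrow> ('k, 'a) fmodule" where "asrc a = fst a"
definition afun :: "('k, 'a) arrow \<Rightarrow> (nat \<Rightarrow> 'k) \<Rightarrow> (nat \<Rightarrow> 'k)" where "afun a = fst (snd a)"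
definition atgt :: "('k, 'a) arrow \<Rightarrow> ('k, 'a) fmodule" where "atgt a = snd (snd a)"

lemma arrow_simps [simp]: "asrc (M, f, N) = M" "afun (M, f, N) = f" "atgt (M, f, N) = N"
  by (simp_all add: asrc_def afun_def atgt_def)

text \<open>A value that is not an arrow, so that associativity and distributivity hold unconditionally.\<close>

definition junk :: "('k, 'a) arrow" where
  "junk = (\<lparr>carrier = {}, mult = undefined, one = undefined, zero = undefined, add = undefined,
     smult = undefined\<rparr>, undefined, undefined)"

section \<open>The additive category of finitely generated modules\<close>

context fdalg
begin

definition Obs :: "('k, 'a) fmodule set" where "Obs = {M. fg_module A M}"

definition Arrs :: "('k, 'a) arrow set" where
  "Arrs = {a. asrc a \<in> Obs \<and> atgt a \<in> Obs \<and> afun a \<in> mod_hom A (asrc a) (atgt a)}"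

definition ccmp :: "('k, 'a) arrow \<Rightarrow> ('k, 'a) arrow \<Rightarrow> ('k, 'a) arrow" where
  "ccmp b a = (if b \<in> Arrs \<and> a \<in> Arrs \<and> asrc b = atgt a
     then (asrc a, compose (carrier (asrc a)) (afun b) (afun a), atgt b) else junk)"

definition cidn :: "('k, 'a) fmodule \<Rightarrow> ('k, 'a) arrow" where
  "cidn M = (M, \<lambda>x\<in>carrier M. x, M)"

definition cplus :: "('k, 'a) arrow \<Rightarrow> ('k, 'a) arrow \<Rightarrow> ('k, 'a) arrow" where
  "cplus a b = (if a \<in> Arrs \<and> b \<in> Arrs \<and> asrc a = asrc b \<and> atgt a = atgt b
     then (asrc a, \<lambda>x\<in>carrier (asrc a). afun a x \<oplus>\<^bsub>atgt a\<^esub> afun b x, atgt a) else junk)"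

definition cneg :: "('k, 'a) arrow \<Rightarrow> ('k, 'a) arrow" where
  "cneg a = (if a \<in> Arrs
     then (asrc a, \<lambda>x\<in>carrier (asrc a). \<ominus>\<^bsub>atgt a\<^esub> afun a x, atgt a) else junk)"

definition czer :: "('k, 'a) fmodule \<Rightarrow> ('k, 'a) fmodule \<Rightarrow> ('k, 'a) arrow" where
  "czer M N = (M, \<lambda>x\<in>carrier M. \<zero>\<^bsub>N\<^esub>, N)"

lemma ObsD: "M \<in> Obs \<Longrightarrow> fg_module A M" "M \<in> Obs \<Longrightarrow> left_module A M"
  by (simp_all add: Obs_def fg_module_def)

lemma ArrsD:
  assumes "a \<in> Arrs"
  shows "asrc a \<in> Obs" "atgt a \<in> Obs" "afun a \<in> mod_hom A (asrc a) (atgt a)"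
    "x \<in> carrier (asrc a) \<Longrightarrow> afun a x \<in> carrier (atgt a)" "module_pair A (asrc a) (atgt a)"
proof -
  show *: "asrc a \<in> Obs" "atgt a \<in> Obs" "afun a \<in> mod_hom A (asrc a) (atgt a)"
    using assms by (simp_all add: Arrs_def)
  show "x \<in> carrier (asrc a) \<Longrightarrow> afun a x \<in> carrier (atgt a)" by (rule mod_homD(1)[OF *(3)])
  show "module_pair A (asrc a) (atgt a)" using * by (intro module_pair.intro ObsD(2))
qed

lemma Arrs_iff: "(M, f, N) \<in> Arrs \<longleftrightarrow> M \<in> Obs \<and> N \<in> Obs \<and> f \<in> mod_hom A M N"
  by (simp add: Arrs_def)

text \<open>The source of \<open>junk\<close> has empty carrier, whereas a module contains its
  zero.\<close>

lemma junk_notin [simp]: "junk \<notin> Arrs"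
proof
  assume "junk \<in> Arrs"
  from left_module.zero_in[OF ObsD(2)[OF ArrsD(1)[OF this]]]
  show False by (simp add: junk_def)
qed

lemma afun_closed [simp]:
  "\<lbrakk>a \<in> Arrs; atgt a = N; x \<in> carrier (asrc a)\<rbrakk> \<Longrightarrow> afun a x \<in> carrier N"
  using ArrsD(4)[of a x] by simp

lemma arr_eqI:
  assumes "a \<in> Arrs" "b \<in> Arrs" "asrc a = asrc b" "atgt a = atgt b"
    "\<And>x. x \<in> carrier (asrc b) \<Longrightarrow> afun a x = afun b x"
  shows "a = b"
proof -
  have "afun a = afun b"
    using ArrsD(3)[OF assms(1)] ArrsD(3)[OF assms(2)] assms
    by (intro mod_hom_eqI[of "afun a" A "asrc a" "atgt a" "afun b" "atgt b"]) auto
  then show ?thesis using assms(3,4) by (simp add: asrc_def atgt_def afun_def prod_eq_iff)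
qed

lemma ccmp_Arrs [simp]:
  assumes "b \<in> Arrs" "a \<in> Arrs" "asrc b = atgt a"
  shows "ccmp b a \<in> Arrs" "asrc (ccmp b a) = asrc a" "atgt (ccmp b a) = atgt b"
    "x \<in> carrier (asrc a) \<Longrightarrow> afun (ccmp b a) x = afun b (afun a x)"
  using assms mod_hom_compose[OF ObsD(2)[OF ArrsD(1)[OF assms(2)]], of "afun b" "atgt a" "atgt b" "afun a"]
    ArrsD(1-3)[OF assms(1)] ArrsD(1-3)[OF assms(2)]
  by (simp_all add: ccmp_def Arrs_iff compose_def)

lemma ccmp_junk: "\<not> (b \<in> Arrs \<and> a \<in> Arrs \<and> asrc b = atgt a) \<Longrightarrow> ccmp b a = junk"
  by (auto simp: ccmp_def)

lemma ccmp_ArrsE: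
  assumes "ccmp b a \<in> Arrs" shows "b \<in> Arrs \<and> a \<in> Arrs \<and> asrc b = atgt a"
  using assms ccmp_junk[of b a] junk_notin by metis

lemma cplus_Arrs [simp]:
  assumes "b \<in> Arrs" "a \<in> Arrs" "asrc b = asrc a" "atgt b = atgt a"
  shows "cplus b a \<in> Arrs" "asrc (cplus b a) = asrc a" "atgt (cplus b a) = atgt a"
    "x \<in> carrier (asrc a) \<Longrightarrow> afun (cplus b a) x = afun b x \<oplus>\<^bsub>atgt a\<^esub> afun a x"
  using assms module_pair.hom_plus[OF ArrsD(5)[OF assms(2)], of "afun b" "afun a"]
    ArrsD(1-3)[OF assms(1)] ArrsD(1-3)[OF assms(2)]
  by (simp_all add: cplus_def Arrs_iff)

lemma cplus_junk: "\<not> (b \<in> Arrs \<and> a \<in> Arrs \<and> asrc b = asrc a \<and> atgt b = atgt a) \<Longrightarrow> cplus b a = junk"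
  by (auto simp: cplus_def)

lemma cneg_Arrs [simp]:
  assumes "a \<in> Arrs"
  shows "cneg a \<in> Arrs" "asrc (cneg a) = asrc a" "atgt (cneg a) = atgt a"
    "x \<in> carrier (asrc a) \<Longrightarrow> afun (cneg a) x = \<ominus>\<^bsub>atgt a\<^esub> afun a x"
  using assms module_pair.hom_uminus[OF ArrsD(5)[OF assms], of "afun a"] ArrsD(1-3)[OF assms]
  by (simp_all add: cneg_def Arrs_iff)

lemma cneg_junk: "a \<notin> Arrs \<Longrightarrow> cneg a = junk"
  by (auto simp: cneg_def)

lemma czer_Arrs [simp]:
  assumes "M \<in> Obs" "N \<in> Obs"
  shows "czer M N \<in> Arrs" "asrc (czer M N) = M" "atgt (czer M N) = N"
    "x \<in> carrier M \<Longrightarrow> afun (czer M N) x = \<zero>\<^bsub>N\<^esub>"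
  using assms module_pair.hom_zero_map[OF module_pair.intro[OF ObsD(2)[OF assms(1)] ObsD(2)[OF assms(2)]]]
  by (auto simp: czer_def Arrs_iff)

lemma cidn_Arrs [simp]:
  assumes "M \<in> Obs"
  shows "cidn M \<in> Arrs" "asrc (cidn M) = M" "atgt (cidn M) = M"
    "x \<in> carrier M \<Longrightarrow> afun (cidn M) x = x"
proof -
  interpret left_module A M by (rule ObsD(2)[OF assms])
  have "(\<lambda>x\<in>carrier M. x) \<in> mod_hom A M M"
    by (rule mod_hom_restrictI[OF left_module_axioms]) auto
  then show "cidn M \<in> Arrs" using assms by (simp add: cidn_def Arrs_iff)
qed (simp_all add: cidn_def)

lemma ccmp_assoc: "ccmp (ccmp h g) f = ccmp h (ccmp g f)"
proof (cases "h \<in> Arrs \<and> g \<in> Arrs \<and> f \<in> Arrs \<and> asrc h = atgt g \<and> asrc g = atgt f")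
  case True
  then show ?thesis by (intro arr_eqI) auto
next
  case False
  have 1: "ccmp (ccmp h g) f = junk"
  proof (cases "h \<in> Arrs \<and> g \<in> Arrs \<and> asrc h = atgt g")
    case True
    then show ?thesis using False by (intro ccmp_junk) auto
  qed (simp add: ccmp_junk)
  have 2: "ccmp h (ccmp g f) = junk"
  proof (cases "g \<in> Arrs \<and> f \<in> Arrs \<and> asrc g = atgt f")
    case True
    then show ?thesis using False by (intro ccmp_junk) auto
  qed (simp add: ccmp_junk)
  show ?thesis using 1 2 by simp
qed

lemma mod_laws:
  assumes "M \<in> Obs"
  shows "\<lbrakk>x \<in> carrier M; y \<in> carrier M\<rbrakk> \<Longrightarrow> x \<oplus>\<^bsub>M\<^esub> y = y \<oplus>\<^bsub>M\<^esub> x"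
    "\<lbrakk>x \<in> carrier M; y \<in> carrier M; z \<in> carrier M\<rbrakk> \<Longrightarrow> (x \<oplus>\<^bsub>M\<^esub> y) \<oplus>\<^bsub>M\<^esub> z = x \<oplus>\<^bsub>M\<^esub> (y \<oplus>\<^bsub>M\<^esub> z)"
    "x \<in> carrier M \<Longrightarrow> x \<oplus>\<^bsub>M\<^esub> \<ominus>\<^bsub>M\<^esub> x = \<zero>\<^bsub>M\<^esub>" "x \<in> carrier M \<Longrightarrow> x \<oplus>\<^bsub>M\<^esub> \<zero>\<^bsub>M\<^esub> = x"
proof -
  interpret M: left_module A M by (rule ObsD(2)[OF assms(1)])
  show "\<lbrakk>x \<in> carrier M; y \<in> carrier M\<rbrakk> \<Longrightarrow> x \<oplus>\<^bsub>M\<^esub> y = y \<oplus>\<^bsub>M\<^esub> x"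
    "\<lbrakk>x \<in> carrier M; y \<in> carrier M; z \<in> carrier M\<rbrakk> \<Longrightarrow> (x \<oplus>\<^bsub>M\<^esub> y) \<oplus>\<^bsub>M\<^esub> z = x \<oplus>\<^bsub>M\<^esub> (y \<oplus>\<^bsub>M\<^esub> z)"
    "x \<in> carrier M \<Longrightarrow> x \<oplus>\<^bsub>M\<^esub> \<ominus>\<^bsub>M\<^esub> x = \<zero>\<^bsub>M\<^esub>" "x \<in> carrier M \<Longrightarrow> x \<oplus>\<^bsub>M\<^esub> \<zero>\<^bsub>M\<^esub> = x"
    by (auto simp: M.M.a_ac M.M.r_neg)
qed

lemma afun_add:
  assumes "a \<in> Arrs" "x \<in> carrier (asrc a)" "y \<in> carrier (asrc a)"
  shows "afun a (x \<oplus>\<^bsub>asrc a\<^esub> y) = afun a x \<oplus>\<^bsub>atgt a\<^esub> afun a y"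
  using mod_homD(2)[OF ArrsD(3)[OF assms(1)]] assms by simp

lemma afun_smult:
  assumes "a \<in> Arrs" "x \<in> carrier (asrc a)" "r \<in> carrier A"
  shows "afun a (r \<odot>\<^bsub>asrc a\<^esub> x) = r \<odot>\<^bsub>atgt a\<^esub> afun a x"
  using mod_homD(3)[OF ArrsD(3)[OF assms(1)]] assms by simp

lemma afun_zero: "a \<in> Arrs \<Longrightarrow> afun a \<zero>\<^bsub>asrc a\<^esub> = \<zero>\<^bsub>atgt a\<^esub>"
  using module_pair.hom_zero[OF ArrsD(5) ArrsD(3)] .

lemma afun_neg:
  "a \<in> Arrs \<Longrightarrow> x \<in> carrier (asrc a) \<Longrightarrow> afun a (\<ominus>\<^bsub>asrc a\<^esub> x) = \<ominus>\<^bsub>atgt a\<^esub> afun a x"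
  using module_pair.hom_neg[OF ArrsD(5) ArrsD(3)] .

lemma ccmp_cplus: "ccmp h (cplus f g) = cplus (ccmp h f) (ccmp h g)"
proof (cases "h \<in> Arrs \<and> f \<in> Arrs \<and> g \<in> Arrs \<and> asrc f = asrc g \<and> atgt f = atgt g \<and> asrc h = atgt g")
  case True
  then show ?thesis
  proof (intro arr_eqI)
    fix x assume "x \<in> carrier (asrc (cplus (ccmp h f) (ccmp h g)))"
    with True have x: "x \<in> carrier (asrc g)" by simp
    show "afun (ccmp h (cplus f g)) x = afun (cplus (ccmp h f) (ccmp h g)) x"
      using True x afun_add[of h "afun f x" "afun g x"] by simp
  qed (use True in auto)
next
  case False
  have 1: "ccmp h (cplus f g) = junk"
  proof (cases "f \<in> Arrs \<and> g \<in> Arrs \<and> asrc f = asrc g \<and> atgt f = atgt g")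
    case True
    then show ?thesis using False by (intro ccmp_junk) auto
  qed (simp add: ccmp_junk cplus_junk)
  have 2: "cplus (ccmp h f) (ccmp h g) = junk"
  proof (rule cplus_junk, rule notI, elim conjE)
    assume "ccmp h f \<in> Arrs" "ccmp h g \<in> Arrs" "asrc (ccmp h f) = asrc (ccmp h g)"
    with False ccmp_ArrsE[of h f] ccmp_ArrsE[of h g] show False by simp
  qed
  show ?thesis using 1 2 by simp
qed

lemma cplus_ccmp: "ccmp (cplus f g) h = cplus (ccmp f h) (ccmp g h)"
proof (cases "h \<in> Arrs \<and> f \<in> Arrs \<and> g \<in> Arrs \<and> asrc f = asrc g \<and> atgt f = atgt g \<and> atgt h = asrc g")
  case True
  then show ?thesis
    by (intro arr_eqI) auto
next
  case False
  have 1: "ccmp (cplus f g) h = junk"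
  proof (cases "f \<in> Arrs \<and> g \<in> Arrs \<and> asrc f = asrc g \<and> atgt f = atgt g")
    case True
    then show ?thesis using False by (intro ccmp_junk) auto
  qed (simp add: ccmp_junk cplus_junk)
  have 2: "cplus (ccmp f h) (ccmp g h) = junk"
  proof (rule cplus_junk, rule notI, elim conjE)
    assume "ccmp f h \<in> Arrs" "ccmp g h \<in> Arrs" "atgt (ccmp f h) = atgt (ccmp g h)"
    with False ccmp_ArrsE[of f h] ccmp_ArrsE[of g h] show False by simp
  qed
  show ?thesis using 1 2 by simp
qed

lemma cplus_assoc: "cplus (cplus f g) h = cplus f (cplus g h)"
proof (cases "f \<in> Arrs \<and> g \<in> Arrs \<and> h \<in> Arrs \<and> asrc f = asrc g \<and> atgt f = atgt g \<and>
    asrc h = asrc g \<and> atgt h = atgt g")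
  case True
  then show ?thesis
  proof (intro arr_eqI)
    fix x assume "x \<in> carrier (asrc (cplus f (cplus g h)))"
    with True have x: "x \<in> carrier (asrc g)" by simp
    show "afun (cplus (cplus f g) h) x = afun (cplus f (cplus g h)) x"
      using True x mod_laws(2)[OF ArrsD(2)[of g], of "afun f x" "afun g x" "afun h x"] by simp
  qed (use True in auto)
next
  case False
  have 1: "cplus (cplus f g) h = junk"
  proof (cases "f \<in> Arrs \<and> g \<in> Arrs \<and> asrc f = asrc g \<and> atgt f = atgt g")
    case True
    then show ?thesis using False by (intro cplus_junk) auto
  qed (simp add: cplus_junk)
  have 2: "cplus f (cplus g h) = junk"
  proof (cases "g \<in> Arrs \<and> h \<in> Arrs \<and> asrc g = asrc h \<and> atgt g = atgt h")
    case True
    then show ?thesis using False by (intro cplus_junk) auto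
  qed (simp add: cplus_junk)
  show ?thesis using 1 2 by simp
qed

lemma cplus_comm: "cplus f g = cplus g f"
proof (cases "f \<in> Arrs \<and> g \<in> Arrs \<and> asrc f = asrc g \<and> atgt f = atgt g")
  case True
  then show ?thesis
  proof (intro arr_eqI)
    fix x assume "x \<in> carrier (asrc (cplus g f))"
    with True have x: "x \<in> carrier (asrc g)" by simp
    show "afun (cplus f g) x = afun (cplus g f) x"
      using True x mod_laws(1)[OF ArrsD(2)[of g], of "afun f x" "afun g x"] by simp
  qed (use True in auto)
qed (auto simp: cplus_junk)

lemma ccmp_cneg: "ccmp h (cneg f) = cneg (ccmp h f)"
proof (cases "h \<in> Arrs \<and> f \<in> Arrs \<and> asrc h = atgt f")
  case True
  then show ?thesis
  proof (intro arr_eqI)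
    fix x assume "x \<in> carrier (asrc (cneg (ccmp h f)))"
    with True have x: "x \<in> carrier (asrc f)" by simp
    show "afun (ccmp h (cneg f)) x = afun (cneg (ccmp h f)) x"
      using True x afun_neg[of h "afun f x"] by simp
  qed (use True in auto)
next
  case False
  then have "ccmp h (cneg f) = junk" by (intro ccmp_junk) (cases "f \<in> Arrs"; auto simp: cneg_junk)
  then show ?thesis using False by (simp add: ccmp_junk cneg_junk)
qed

lemma cneg_ccmp: "ccmp (cneg h) f = cneg (ccmp h f)"
proof (cases "h \<in> Arrs \<and> f \<in> Arrs \<and> asrc h = atgt f")
  case True
  then show ?thesis
    by (intro arr_eqI) auto
next
  case False
  then have "ccmp (cneg h) f = junk" by (intro ccmp_junk) (cases "h \<in> Arrs"; auto simp: cneg_junk)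
  then show ?thesis using False by (simp add: ccmp_junk cneg_junk)
qed

sublocale mc: precat Obs Arrs asrc atgt ccmp cidn cplus cneg czer
proof
  show "cplus f (cneg f) = czer (asrc f) (atgt f)" if "f \<in> Arrs" for f
    using that by (intro arr_eqI) (auto simp: ArrsD mod_laws(3))
  show "cplus f (czer X Y) = f" if "f \<in> Arrs" "asrc f = X" "atgt f = Y" for f X Y
    using that by (intro arr_eqI) (auto simp: ArrsD mod_laws(4))
  show "ccmp f (czer X Y) = czer X (atgt f)" if "f \<in> Arrs" "asrc f = Y" "X \<in> Obs" for f X Y
    using that afun_zero[of f] by (intro arr_eqI) (auto simp: ArrsD)
  show "ccmp (czer X Y) f = czer (asrc f) Y" if "f \<in> Arrs" "atgt f = X" "Y \<in> Obs" for f X Y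
    using that by (intro arr_eqI) (auto simp: ArrsD)
  show "ccmp f (cidn X) = f" if "f \<in> Arrs" "asrc f = X" for f X
    using that by (intro arr_eqI) (auto simp: ArrsD)
  show "ccmp (cidn X) f = f" if "f \<in> Arrs" "atgt f = X" for f X
    using that by (intro arr_eqI) (auto simp: ArrsD)
  show "cplus f g = cplus g f" for f g by (rule cplus_comm)
qed (auto simp: ArrsD ccmp_assoc cplus_assoc ccmp_cplus cplus_ccmp ccmp_cneg cneg_ccmp)

text \<open>The categorical condition is tested on the inclusion of the kernel, which is an object
  because submodules are again finitely generated.\<close>

lemma mono_iff: "mc.mono a \<longleftrightarrow> a \<in> Arrs \<and> inj_on (afun a) (carrier (asrc a))"
proof
  assume m: "mc.mono a"
  then have a: "a \<in> Arrs" by (simp add: mc.mono_def)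
  interpret module_pair A "asrc a" "atgt a" by (rule ArrsD(5)[OF a])
  let ?N = "{x \<in> carrier (asrc a). afun a x = \<zero>\<^bsub>atgt a\<^esub>}"
  have N: "submod A (asrc a) ?N" by (rule submod_kernel[OF ArrsD(3)[OF a]])
  let ?M = "(asrc a)\<lparr>carrier := ?N\<rparr>"
  have M: "?M \<in> Obs" using fg_submod[OF ObsD(1)[OF ArrsD(1)[OF a]] N] by (simp add: Obs_def)
  let ?u = "(?M, \<lambda>x\<in>?N. x, asrc a)"
  have u: "?u \<in> Arrs"
    using mod_hom_restrictI[OF ObsD(2)[OF M], of "\<lambda>x. x" "asrc a"] M ArrsD(1)[OF a]
    by (auto simp: Arrs_iff)
  have "ccmp a ?u = czer ?M (atgt a)"
    using a u M ArrsD[OF a] by (intro arr_eqI) auto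
  then have z: "?u = czer ?M (asrc a)" using m u a unfolding mc.mono_def by auto
  have "inj_on (afun a) (carrier (asrc a))"
  proof (rule inj_on_kernel[OF ArrsD(3)[OF a]])
    fix x assume x: "x \<in> carrier (asrc a)" "afun a x = \<zero>\<^bsub>atgt a\<^esub>"
    then have "afun ?u x = afun (czer ?M (asrc a)) x" using z by simp
    then show "x = \<zero>\<^bsub>asrc a\<^esub>" using x by (simp add: czer_def)
  qed
  with a show "a \<in> Arrs \<and> inj_on (afun a) (carrier (asrc a))" by simp
next
  assume a: "a \<in> Arrs \<and> inj_on (afun a) (carrier (asrc a))"
  show "mc.mono a"
    unfolding mc.mono_def
  proof (intro conjI allI impI)
    fix u assume u: "u \<in> Arrs" "atgt u = asrc a" "ccmp a u = czer (asrc u) (atgt a)"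
    show "u = czer (asrc u) (asrc a)"
    proof (rule arr_eqI)
      fix x assume "x \<in> carrier (asrc (czer (asrc u) (asrc a)))"
      then have x: "x \<in> carrier (asrc u)" using u a ArrsD by simp
      have "afun a (afun u x) = afun (ccmp a u) x" using u(1,2) a x by simp
      also have "\<dots> = afun a \<zero>\<^bsub>asrc a\<^esub>" using u a x ArrsD afun_zero by simp
      finally have "afun u x = \<zero>\<^bsub>asrc a\<^esub>"
        using a ArrsD(4)[OF u(1) x] u(2) left_module.zero_in[OF ObsD(2)[OF ArrsD(1)[of a]]]
        by (auto dest: inj_onD)
      then show "afun u x = afun (czer (asrc u) (asrc a)) x" using x u a ArrsD by simp
    qed (use u a ArrsD in auto)
  qed (use a in auto)
qed

text \<open>The categorical condition is tested on the projection to the quotient by the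
  image.\<close>

lemma epi_iff: "mc.epi a \<longleftrightarrow> a \<in> Arrs \<and> afun a ` carrier (asrc a) = carrier (atgt a)"
proof
  assume m: "mc.epi a"
  then have a: "a \<in> Arrs" by (simp add: mc.epi_def)
  interpret module_pair A "asrc a" "atgt a" by (rule ArrsD(5)[OF a])
  let ?I = "afun a ` carrier (asrc a)"
  have I: "submod A (atgt a) ?I" by (rule submod_image[OF ArrsD(3)[OF a] M.submod_carrier])
  note q = N.quot[OF I]
  interpret Q: module_pair A "atgt a" "quot (atgt a) ?I"
    by (intro module_pair.intro N.left_module_axioms q)
  have Q: "quot (atgt a) ?I \<in> Obs"
    using Q.finitely_generated_image[OF q(2,3)] q(1) ObsD(1)[OF ArrsD(2)[OF a]]
    by (simp add: Obs_def fg_module_def)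
  let ?u = "(atgt a, restrict (rep (atgt a) ?I) (carrier (atgt a)), quot (atgt a) ?I)"
  have u: "?u \<in> Arrs" using Q q(2) ArrsD(2)[OF a] by (simp add: Arrs_iff)
  have "ccmp ?u a = czer (asrc a) (quot (atgt a) ?I)"
    using a u Q ArrsD[OF a] q(4) by (intro arr_eqI) (auto simp: ArrsD)
  then have z: "?u = czer (atgt a) (quot (atgt a) ?I)" using m u a unfolding mc.epi_def by auto
  have "carrier (atgt a) \<subseteq> ?I"
  proof
    fix x assume x: "x \<in> carrier (atgt a)"
    then have "afun ?u x = afun (czer (atgt a) (quot (atgt a) ?I)) x" using z by simp
    then show "x \<in> ?I" using x q(4) by (simp add: czer_def)
  qed
  then show "a \<in> Arrs \<and> ?I = carrier (atgt a)" using a ArrsD(4)[OF a] by auto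
next
  assume a: "a \<in> Arrs \<and> afun a ` carrier (asrc a) = carrier (atgt a)"
  show "mc.epi a"
    unfolding mc.epi_def
  proof (intro conjI allI impI)
    fix u assume u: "u \<in> Arrs" "asrc u = atgt a" "ccmp u a = czer (asrc a) (atgt u)"
    show "u = czer (atgt a) (atgt u)"
    proof (rule arr_eqI)
      fix x assume "x \<in> carrier (asrc (czer (atgt a) (atgt u)))"
      then have x: "x \<in> carrier (atgt a)" using u a ArrsD by simp
      then obtain y where y: "y \<in> carrier (asrc a)" "x = afun a y" using a by auto
      have "afun u x = afun (ccmp u a) y" using u(1,2) a y by simp
      also have "\<dots> = \<zero>\<^bsub>atgt u\<^esub>" using u a y ArrsD by simp
      finally show "afun u x = afun (czer (atgt a) (atgt u)) x" using x u a ArrsD by simp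
    qed (use u a ArrsD in auto)
  qed (use a in auto)
qed

lemma ses_iff:
  "mc.ses m e \<longleftrightarrow> m \<in> Arrs \<and> e \<in> Arrs \<and> atgt m = asrc e \<and> inj_on (afun m) (carrier (asrc m)) \<and>
     afun e ` carrier (asrc e) = carrier (atgt e) \<and>
     afun m ` carrier (asrc m) = {x \<in> carrier (asrc e). afun e x = \<zero>\<^bsub>atgt e\<^esub>}"
  (is "?L \<longleftrightarrow> ?R")
proof
  assume s: ?L
  note sD = mc.sesD[OF s]
  have "afun e (afun m x) = \<zero>\<^bsub>atgt e\<^esub>" if x: "x \<in> carrier (asrc m)" for x
  proof -
    have "afun e (afun m x) = afun (ccmp e m) x" using sD(3-5) x by simp
    then show ?thesis unfolding sD(6) using x sD ArrsD by simp
  qed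
  moreover have "x \<in> afun m ` carrier (asrc m)"
    if x: "x \<in> carrier (asrc e)" "afun e x = \<zero>\<^bsub>atgt e\<^esub>" for x
  proof -
    interpret module_pair A "asrc e" "atgt e" by (rule ArrsD(5)[OF sD(4)])
    let ?N = "{x \<in> carrier (asrc e). afun e x = \<zero>\<^bsub>atgt e\<^esub>}"
    have N: "submod A (asrc e) ?N" by (rule submod_kernel[OF ArrsD(3)[OF sD(4)]])
    let ?M = "(asrc e)\<lparr>carrier := ?N\<rparr>"
    have M: "?M \<in> Obs" using fg_submod[OF ObsD(1)[OF ArrsD(1)[OF sD(4)]] N] by (simp add: Obs_def)
    let ?u = "(?M, \<lambda>x\<in>?N. x, asrc e)"
    have u: "?u \<in> Arrs"
      using mod_hom_restrictI[OF ObsD(2)[OF M], of "\<lambda>x. x" "asrc e"] M ArrsD(1)[OF sD(4)]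
      by (auto simp: Arrs_iff)
    have "ccmp e ?u = czer ?M (atgt e)"
      using sD u M ArrsD[OF sD(4)] by (intro arr_eqI) auto
    then obtain v where v: "mc.hom v ?M (asrc m)" "ccmp m v = ?u"
      using mc.ses_lift[OF s, of ?u ?M] u by auto
    have "x = afun (ccmp m v) x" using v(2) x by simp
    also have "\<dots> = afun m (afun v x)" using sD v x by (subst ccmp_Arrs(4)) auto
    finally show ?thesis using ArrsD(4)[of v x] v x by auto
  qed
  ultimately show ?R
    using sD mono_iff epi_iff ArrsD(4)[OF sD(3)] by auto
next
  assume r: ?R
  then have m: "m \<in> Arrs" and e: "e \<in> Arrs" and me: "atgt m = asrc e"
    and k: "afun m ` carrier (asrc m) = {x \<in> carrier (asrc e). afun e x = \<zero>\<^bsub>atgt e\<^esub>}"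
    and i: "inj_on (afun m) (carrier (asrc m))" and s: "afun e ` carrier (asrc e) = carrier (atgt e)"
    by auto
  show ?L
    unfolding mc.ses_def
  proof (intro conjI allI impI)
    show "mc.mono m" "mc.epi e" using r mono_iff epi_iff by auto
    show "atgt m = asrc e" by (rule me)
    show "ccmp e m = czer (asrc m) (atgt e)"
      using m e me k ArrsD by (intro arr_eqI) auto
    fix u assume u: "u \<in> Arrs"
    {
      assume u': "atgt u = asrc e" "ccmp e u = czer (asrc u) (atgt e)"
      have "afun u ` carrier (asrc u) \<subseteq> afun m ` carrier (asrc m)"
      proof
        fix y assume "y \<in> afun u ` carrier (asrc u)"
        then obtain x where x: "x \<in> carrier (asrc u)" "y = afun u x" by auto
        have "afun e y = afun (ccmp e u) x" using u u'(1) e x by simp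
        then show "y \<in> afun m ` carrier (asrc m)"
          unfolding k u'(2) using x u u' e ArrsD by simp
      qed
      then obtain v where v: "v \<in> mod_hom A (asrc u) (asrc m)"
        "\<And>x. x \<in> carrier (asrc u) \<Longrightarrow> afun m (v x) = afun u x"
        using module_pair.hom_lift_inj[OF ArrsD(5)[OF m] ObsD(2)[OF ArrsD(1)[OF u]] ArrsD(3)[OF m] i]
          ArrsD(3)[OF u] u'(1) me by metis
      then have "mc.hom (asrc u, v, asrc m) (asrc u) (asrc m)"
        using u m ArrsD(1) by (simp add: Arrs_iff)
      moreover from this have "ccmp m (asrc u, v, asrc m) = u"
        using m u v u' me by (intro arr_eqI) auto
      ultimately show "\<exists>v. mc.hom v (asrc u) (asrc m) \<and> ccmp m v = u" by blast
    next
      assume u': "asrc u = atgt m" "ccmp u m = czer (asrc m) (atgt u)"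
      have "afun u x = \<zero>\<^bsub>atgt u\<^esub>" if x: "x \<in> carrier (asrc e)" "afun e x = \<zero>\<^bsub>atgt e\<^esub>" for x
      proof -
        have "x \<in> afun m ` carrier (asrc m)" using k x by blast
        then obtain y where y: "y \<in> carrier (asrc m)" "x = afun m y" by auto
        have "afun u x = afun (ccmp u m) y" using u u'(1) m y by simp
        then show ?thesis unfolding u'(2) using y u u' m ArrsD by simp
      qed
      then obtain v where v: "v \<in> mod_hom A (atgt e) (atgt u)"
        "\<And>x. x \<in> carrier (asrc e) \<Longrightarrow> v (afun e x) = afun u x"
        using module_pair.hom_desc_surj[OF ArrsD(5)[OF e] ObsD(2)[OF ArrsD(2)[OF u]] ArrsD(3)[OF e] s]
          ArrsD(3)[OF u] u'(1) me by metis
      then have "mc.hom (atgt e, v, atgt u) (atgt e) (atgt u)"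
        using u e ArrsD(2) by (simp add: Arrs_iff)
      moreover from this have "ccmp (atgt e, v, atgt u) e = u"
        using e u v u' me by (intro arr_eqI) auto
      ultimately show "\<exists>v. mc.hom v (atgt e) (atgt u) \<and> ccmp v e = u" by blast
    }
  qed
qed

end

lemma compose_apply: "x \<in> S \<Longrightarrow> compose S g f x = g (f x)"
  by (simp add: compose_def)

section \<open>Factorizations, kernels, cokernels and biproducts\<close>

context fdalg
begin

lemma submodule_Obs:
  assumes "M \<in> Obs" "submod A M N"
  shows "M\<lparr>carrier := N\<rparr> \<in> Obs" "(M\<lparr>carrier := N\<rparr>, \<lambda>x\<in>N. x, M) \<in> Arrs"
proof -
  show O: "M\<lparr>carrier := N\<rparr> \<in> Obs" using fg_submod[OF ObsD(1)] assms by (simp add: Obs_def)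
  have "N \<subseteq> carrier M" using assms(2) by (simp add: submod_def)
  then show "(M\<lparr>carrier := N\<rparr>, \<lambda>x\<in>N. x, M) \<in> Arrs"
    using mod_hom_restrictI[OF ObsD(2)[OF O], of "\<lambda>x. x" M] O assms(1)
    by (auto simp: Arrs_iff)
qed

lemma quotient_Obs:
  assumes M: "M \<in> Obs" and N: "submod A M N"
  shows "quot M N \<in> Obs" "(M, restrict (rep M N) (carrier M), quot M N) \<in> Arrs"
proof -
  interpret M: left_module A M by (rule ObsD(2)[OF M])
  note q = M.quot[OF N]
  interpret Q: module_pair A M "quot M N"
    by (intro module_pair.intro M.left_module_axioms q)
  show Q: "quot M N \<in> Obs"
    using Q.finitely_generated_image[OF q(2,3)] q(1) ObsD(1)[OF M]
    by (simp add: Obs_def fg_module_def)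
  show "(M, restrict (rep M N) (carrier M), quot M N) \<in> Arrs"
    using Q M q(2) by (simp add: Arrs_iff)
qed

lemma inst_factor:
  assumes a: "a \<in> Arrs"
  shows "\<exists>m e. mc.mono m \<and> mc.epi e \<and> asrc m = atgt e \<and> a = ccmp m e"
proof -
  interpret module_pair A "asrc a" "atgt a" by (rule ArrsD(5)[OF a])
  let ?I = "afun a ` carrier (asrc a)"
  have I: "submod A (atgt a) ?I" by (rule submod_image[OF ArrsD(3)[OF a] M.submod_carrier])
  note s = submodule_Obs[OF ArrsD(2)[OF a] I]
  let ?M = "(atgt a)\<lparr>carrier := ?I\<rparr>"
  let ?m = "(?M, \<lambda>x\<in>?I. x, atgt a)" and ?e = "(asrc a, afun a, ?M)"
  have e: "?e \<in> Arrs"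
    using ArrsD(3)[OF a] ArrsD(1)[OF a] s(1) by (auto simp: Arrs_iff mod_hom_def)
  have "mc.mono ?m" using s by (auto simp: mono_iff intro: inj_onI)
  moreover have "mc.epi ?e" using e by (simp add: epi_iff)
  moreover have "a = ccmp ?m ?e"
    using a s e by (intro arr_eqI) auto
  ultimately show ?thesis by (intro exI[of _ ?m] exI[of _ ?e]) simp
qed

lemma inst_mono_ses:
  assumes m: "mc.mono m" shows "\<exists>e. mc.ses m e"
proof -
  have a: "m \<in> Arrs" "inj_on (afun m) (carrier (asrc m))" using m mono_iff by auto
  interpret module_pair A "asrc m" "atgt m" by (rule ArrsD(5)[OF a(1)])
  let ?I = "afun m ` carrier (asrc m)"
  have I: "submod A (atgt m) ?I" by (rule submod_image[OF ArrsD(3)[OF a(1)] M.submod_carrier])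
  note q = N.quot[OF I] and Q = quotient_Obs[OF ArrsD(2)[OF a(1)] I]
  have "mc.ses m (atgt m, restrict (rep (atgt m) ?I) (carrier (atgt m)), quot (atgt m) ?I)"
    unfolding ses_iff using a Q q(3,4) by auto
  then show ?thesis by blast
qed

lemma inst_epi_ses:
  assumes e: "mc.epi e" shows "\<exists>m. mc.ses m e"
proof -
  have a: "e \<in> Arrs" "afun e ` carrier (asrc e) = carrier (atgt e)" using e epi_iff by auto
  interpret module_pair A "asrc e" "atgt e" by (rule ArrsD(5)[OF a(1)])
  let ?N = "{x \<in> carrier (asrc e). afun e x = \<zero>\<^bsub>atgt e\<^esub>}"
  have N: "submod A (asrc e) ?N" by (rule submod_kernel[OF ArrsD(3)[OF a(1)]])
  note s = submodule_Obs[OF ArrsD(1)[OF a(1)] N]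
  have "mc.ses ((asrc e)\<lparr>carrier := ?N\<rparr>, \<lambda>x\<in>?N. x, asrc e) e"
    unfolding ses_iff using a s by (auto intro: inj_onI)
  then show ?thesis by blast
qed

lemma inst_zero_object: "\<exists>Z\<in>Obs. cidn Z = czer Z Z"
proof -
  let ?Z = "\<lparr>carrier = {undefined}, mult = undefined, one = undefined, zero = undefined,
     add = \<lambda>_ _. undefined, smult = \<lambda>_ _. undefined\<rparr> :: ('k, 'a) fmodule"
  have "abelian_group ?Z" by (rule abelian_groupI) auto
  then have Z: "left_module A ?Z"
    by (intro left_module.intro left_module_axioms.intro A.ring_axioms) auto
  interpret left_module A ?Z by (rule Z)
  have "finitely_generated A ?Z"
    unfolding finitely_generated_iff spans_def by (intro exI[of _ "{}"]) (auto simp: submod_def)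
  then have "?Z \<in> Obs" using Z by (simp add: Obs_def fg_module_def)
  moreover have "cidn ?Z = czer ?Z ?Z" by (auto simp: cidn_def czer_def)
  ultimately show ?thesis by blast
qed

text \<open>The product is formed on pairs and copied back; the structure maps are conjugated by
  \<open>cp\<close> and \<open>uncp\<close>.\<close>

lemma inst_biprod:
  assumes X: "X \<in> Obs" and Y: "Y \<in> Obs"
  shows "\<exists>Z i j p q. mc.biprod X Y Z i j p q"
proof -
  interpret module_pair A X Y by (intro module_pair.intro ObsD(2) X Y)
  let ?P = "prod_module X Y"
  have P: "fg_module A ?P"
    using left_module_prod finitely_generated_prod ObsD(1)[OF X] ObsD(1)[OF Y]
    by (simp add: fg_module_def)
  interpret P: left_module A ?P by (rule left_module_prod)
  let ?Z = "copy ?P"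
  have Z: "?Z \<in> Obs" using fg_copy[OF P] by (simp add: Obs_def)
  have c1: "cp ?P x \<oplus>\<^bsub>?Z\<^esub> cp ?P y = cp ?P (x \<oplus>\<^bsub>?P\<^esub> y)" if "x \<in> carrier ?P" "y \<in> carrier ?P" for x y
    using that P by (simp add: copy_def)
  have c2: "r \<odot>\<^bsub>?Z\<^esub> cp ?P x = cp ?P (r \<odot>\<^bsub>?P\<^esub> x)" if "r \<in> carrier A" "x \<in> carrier ?P" for x r
    using that P by (simp add: copy_def)
  note c = c1 c2
  let ?i = "(X, \<lambda>x\<in>carrier X. cp ?P (x, \<zero>\<^bsub>Y\<^esub>), ?Z)" and ?j = "(Y, \<lambda>y\<in>carrier Y. cp ?P (\<zero>\<^bsub>X\<^esub>, y), ?Z)"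
  let ?p = "(?Z, \<lambda>z\<in>carrier ?Z. fst (uncp ?P z), X)" and ?q = "(?Z, \<lambda>z\<in>carrier ?Z. snd (uncp ?P z), Y)"
  have i: "?i \<in> Arrs"
    using mod_hom_restrictI[OF M.left_module_axioms, of "\<lambda>x. cp ?P (x, \<zero>\<^bsub>Y\<^esub>)" ?Z] X Z
    by (simp add: Arrs_iff c)
  have j: "?j \<in> Arrs"
    using mod_hom_restrictI[OF N.left_module_axioms, of "\<lambda>x. cp ?P (\<zero>\<^bsub>X\<^esub>, x)" ?Z] Y Z
    by (simp add: Arrs_iff c)
  have u: "fst (uncp ?P z) \<in> carrier X" "snd (uncp ?P z) \<in> carrier Y" if "z \<in> carrier ?Z" for z
    using uncp_closed[OF that] by auto
  have p: "?p \<in> Arrs"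
    using mod_hom_restrictI[OF ObsD(2)[OF Z], of "\<lambda>z. fst (uncp ?P z)" X] X Z u
    by (simp add: Arrs_iff uncp_add[OF P] uncp_smult[OF P])
  have q: "?q \<in> Arrs"
    using mod_hom_restrictI[OF ObsD(2)[OF Z], of "\<lambda>z. snd (uncp ?P z)" Y] Y Z u
    by (simp add: Arrs_iff uncp_add[OF P] uncp_smult[OF P])
  have uc: "uncp ?P (cp ?P (x, y)) = (x, y)" if "x \<in> carrier X" "y \<in> carrier Y" for x y
    using that P by simp
  have cc: "cp ?P (x, y) \<in> carrier ?Z" if "x \<in> carrier X" "y \<in> carrier Y" for x y
    using that by simp
  have "mc.biprod X Y ?Z ?i ?j ?p ?q"
    unfolding mc.biprod_def
  proof (intro conjI)
    show "ccmp ?p ?i = cidn X" using i p X uc cc by (intro arr_eqI) auto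
    show "ccmp ?q ?j = cidn Y" using j q Y uc cc by (intro arr_eqI) auto
    show "ccmp ?q ?i = czer X Y" using i q X Y uc cc by (intro arr_eqI) auto
    show "ccmp ?p ?j = czer Y X" using j p X Y uc cc by (intro arr_eqI) auto
    show "cplus (ccmp ?i ?p) (ccmp ?j ?q) = cidn ?Z"
    proof (rule arr_eqI)
      fix z assume "z \<in> carrier (asrc (cidn ?Z))"
      then have z: "z \<in> carrier ?Z" using Z by simp
      have "cp ?P (fst (uncp ?P z), \<zero>\<^bsub>Y\<^esub>) \<oplus>\<^bsub>?Z\<^esub> cp ?P (\<zero>\<^bsub>X\<^esub>, snd (uncp ?P z)) = z"
        using u[OF z] z by (simp add: c)
      then show "afun (cplus (ccmp ?i ?p) (ccmp ?j ?q)) z = afun (cidn ?Z) z"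
        using i j p q Z z u[OF z] by simp
    qed (use i j p q Z in auto)
  qed (use i j p q in auto)
  then show ?thesis by blast
qed

section \<open>The regular module as a projective generator\<close>

lemma fg_regular: "fg_module A (regular A)"
proof -
  interpret left_module A "regular A" by (rule left_module_regular[OF A.ring_axioms])
  obtain S where S: "finite S" "S \<subseteq> carrier A" "spans K A S"
    using fg_KA KA.finitely_generated_iff by auto
  have "submod K A N" if N: "submod A (regular A) N" for N
    unfolding submod_def
  proof (intro conjI ballI)
    fix r x assume "r \<in> carrier K" "x \<in> N"
    then show "r \<odot>\<^bsub>A\<^esub> x \<in> N"
      using submodD(4)[OF N, of "sc r" x] submodD(1)[OF N] sc_closed sc_mult by simp
  qed (use submodD[OF N] in auto)
  then have "spans A (regular A) S" using S(3) by (auto simp: spans_def)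
  then show ?thesis
    unfolding fg_module_def finitely_generated_iff using S left_module_axioms by auto
qed

definition G :: "('k, 'a) fmodule" where "G = copy (regular A)"

lemma G_Obs: "G \<in> Obs"
  using fg_copy[OF fg_regular] by (simp add: Obs_def G_def)

definition gen_elem :: "nat \<Rightarrow> 'k" where "gen_elem = cp (regular A) \<one>\<^bsub>A\<^esub>"

text \<open>The map out of the free module of rank one that sends the generator
  \<open>gen_elem\<close> to \<open>m\<close>.\<close>

definition pt :: "('k, 'a) fmodule \<Rightarrow> (nat \<Rightarrow> 'k) \<Rightarrow> ('k, 'a) arrow" where
  "pt M m = (G, \<lambda>g\<in>carrier G. uncp (regular A) g \<odot>\<^bsub>M\<^esub> m, M)"

lemma gen_elem: "gen_elem \<in> carrier G" "uncp (regular A) gen_elem = \<one>\<^bsub>A\<^esub>"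
  using fg_regular by (simp_all add: gen_elem_def G_def)

lemma uncp_G [simp]: "g \<in> carrier G \<Longrightarrow> uncp (regular A) g \<in> carrier A"
  using uncp_closed[of g "regular A"] by (simp add: G_def)

lemma pt_hom:
  assumes M: "left_module A M" and m: "m \<in> carrier M"
  shows "(\<lambda>g\<in>carrier G. uncp (regular A) g \<odot>\<^bsub>M\<^esub> m) \<in> mod_hom A G M"
proof -
  interpret M: left_module A M by (rule M)
  show ?thesis
    by (rule mod_hom_restrictI[OF ObsD(2)[OF G_Obs]])
      (use m uncp_add[OF fg_regular] uncp_smult[OF fg_regular] in
        \<open>auto simp: G_def[symmetric] M.smult_closed M.smult_l_distr M.smult_assoc\<close>)
qed

lemma pt:
  assumes M: "M \<in> Obs" and m: "m \<in> carrier M"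
  shows "mc.hom (pt M m) G M" "afun (pt M m) gen_elem = m"
    "g \<in> carrier G \<Longrightarrow> afun (pt M m) g = uncp (regular A) g \<odot>\<^bsub>M\<^esub> m"
proof -
  interpret M: left_module A M by (rule ObsD(2)[OF M])
  show "mc.hom (pt M m) G M" using pt_hom[OF ObsD(2)[OF M] m] M G_Obs by (simp add: pt_def Arrs_iff)
  show "afun (pt M m) gen_elem = m" using m gen_elem M.smult_one by (simp add: pt_def)
  show "g \<in> carrier G \<Longrightarrow> afun (pt M m) g = uncp (regular A) g \<odot>\<^bsub>M\<^esub> m" by (simp add: pt_def)
qed

lemma G_smult_gen: "g \<in> carrier G \<Longrightarrow> g = uncp (regular A) g \<odot>\<^bsub>G\<^esub> gen_elem"
  using fg_regular by (simp add: G_def gen_elem_def copy_def[of "regular A"])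

lemma pt_unique:
  assumes f: "mc.hom f G M" shows "f = pt M (afun f gen_elem)"
proof -
  have M: "M \<in> Obs" "afun f gen_elem \<in> carrier M" using f ArrsD(2)[of f] gen_elem by auto
  show ?thesis
  proof (rule arr_eqI)
    fix g assume "g \<in> carrier (asrc (pt M (afun f gen_elem)))"
    then have g: "g \<in> carrier G" using pt[OF M] by simp
    have "afun f g = afun f (uncp (regular A) g \<odot>\<^bsub>asrc f\<^esub> gen_elem)"
      using G_smult_gen[OF g] f by simp
    also have "\<dots> = uncp (regular A) g \<odot>\<^bsub>atgt f\<^esub> afun f gen_elem"
      by (rule afun_smult) (use f g gen_elem in auto)
    finally show "afun f g = afun (pt M (afun f gen_elem)) g"
      using pt(3)[OF M g] f by simp
  qed (use f pt[OF M] in auto)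
qed

lemma G_proj: "mc.proj G"
  unfolding mc.proj_def
proof (intro conjI allI impI)
  fix e f assume e: "mc.epi e" and f: "mc.hom f G (atgt e)"
  have e': "e \<in> Arrs" "afun e ` carrier (asrc e) = carrier (atgt e)" using e epi_iff by auto
  have "afun f gen_elem \<in> carrier (atgt e)" using f gen_elem by simp
  then obtain x where x: "x \<in> carrier (asrc e)" "afun f gen_elem = afun e x" using e' by auto
  note p = pt[OF ArrsD(1)[OF e'(1)] x(1)]
  have "mc.hom (ccmp e (pt (asrc e) x)) G (atgt e)" using e' p(1) by auto
  then have "ccmp e (pt (asrc e) x) = pt (atgt e) (afun (ccmp e (pt (asrc e) x)) gen_elem)"
    by (rule pt_unique)
  also have "\<dots> = pt (atgt e) (afun f gen_elem)"
    using e' p gen_elem x by simp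
  also have "\<dots> = f" using pt_unique[OF f] by simp
  finally show "\<exists>h. mc.hom h G (asrc e) \<and> ccmp e h = f" using p(1) by blast
qed (rule G_Obs)

text \<open>Maps out of \<open>G\<close> are the elements of a module, so lifting all of them is
  surjectivity.\<close>

lemma G_gen:
  assumes p: "p \<in> Arrs" and l: "\<And>f. mc.hom f G (atgt p) \<Longrightarrow> \<exists>h. mc.hom h G (asrc p) \<and> ccmp p h = f"
  shows "mc.epi p"
proof -
  have "y \<in> afun p ` carrier (asrc p)" if y: "y \<in> carrier (atgt p)" for y
  proof -
    note t = pt[OF ArrsD(2)[OF p] y]
    obtain h where h: "mc.hom h G (asrc p)" "ccmp p h = pt (atgt p) y" using l t by blast
    have "y = afun (ccmp p h) gen_elem" using t h by simp
    also have "\<dots> = afun p (afun h gen_elem)" using p h(1) gen_elem by simp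
    finally show ?thesis using h(1) gen_elem by auto
  qed
  then show ?thesis using p ArrsD(4)[OF p] by (auto simp: epi_iff)
qed

text \<open>One copy of \<open>G\<close> per generator of \<open>X\<close>, added by biproducts as
  in \<open>approx\<close>.\<close>

lemma addc_G_epi:
  assumes X: "X \<in> Obs" shows "\<exists>e. mc.epi e \<and> atgt e = X \<and> mc.addc G (asrc e)"
proof -
  interpret X: left_module A X by (rule ObsD(2)[OF X])
  obtain S where S: "finite S" "S \<subseteq> carrier X" "spans A X S"
    using ObsD(1)[OF X] X.finitely_generated_iff by (auto simp: fg_module_def)
  have "\<exists>e. e \<in> Arrs \<and> atgt e = X \<and> mc.addc G (asrc e) \<and> S \<subseteq> afun e ` carrier (asrc e)"
    using S(1,2)
  proof (induction S)
    case empty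
    show ?case
      using G_Obs X by (intro exI[of _ "czer G X"]) (auto intro: mc.addc_self)
  next
    case (insert s S)
    then obtain e where e: "e \<in> Arrs" "atgt e = X" "mc.addc G (asrc e)" "S \<subseteq> afun e ` carrier (asrc e)"
      by auto
    have s: "s \<in> carrier X" using insert by simp
    obtain Z i j p q where bp: "mc.biprod (asrc e) G Z i j p q"
      using inst_biprod[OF ArrsD(1)[OF e(1)] G_Obs] by auto
    then have b: "mc.hom i (asrc e) Z" "mc.hom j G Z" "mc.hom p Z (asrc e)" "mc.hom q Z G"
      "ccmp p i = cidn (asrc e)" "ccmp q j = cidn G" "ccmp q i = czer (asrc e) G" "ccmp p j = czer G (asrc e)"
      by (auto simp: mc.biprod_def)
    note t = pt[OF X s]
    let ?e = "cplus (ccmp e p) (ccmp (pt X s) q)"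
    have e': "mc.hom ?e Z X" using e b t by auto
    have ei: "ccmp ?e i = e" and ej: "ccmp ?e j = pt X s"
      using b e t X G_Obs by (simp_all add: mc.plus_cmp mc.cmp_assoc)
    have im: "afun ?e (afun k x) = afun (ccmp ?e k) x" if "mc.hom k W Z" "x \<in> carrier W" for k W x
      using that e' by simp
    have "afun e x \<in> afun ?e ` carrier Z" if x: "x \<in> carrier (asrc e)" for x
      using im[OF b(1) x] unfolding ei using b(1) x by (metis afun_closed imageI)
    moreover have "s \<in> afun ?e ` carrier Z"
      using im[OF b(2) gen_elem(1)] t(2) unfolding ej using b(2) gen_elem(1) by (metis afun_closed imageI)
    ultimately have "insert s S \<subseteq> afun ?e ` carrier (asrc ?e)" using e(4) e' by auto
    then show ?case
      using e' mc.addc_biprod[OF e(3) mc.addc_self[OF G_Obs] bp] by (intro exI[of _ ?e]) auto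
  qed
  then obtain e where e: "e \<in> Arrs" "atgt e = X" "mc.addc G (asrc e)" "S \<subseteq> afun e ` carrier (asrc e)"
    by auto
  interpret module_pair A "asrc e" "atgt e" by (rule ArrsD(5)[OF e(1)])
  have "submod A X (afun e ` carrier (asrc e))"
    using submod_image[OF ArrsD(3)[OF e(1)] M.submod_carrier] e(2) by simp
  then have "mc.epi e" using S(3) e ArrsD(4)[OF e(1)] unfolding spans_def epi_iff by blast
  then show ?thesis using e by blast
qed

section \<open>Hom spaces are finite-dimensional\<close>

definition homK :: "('a, 'm) module \<Rightarrow> ('a, 'n) module \<Rightarrow> ('k, 'm \<Rightarrow> 'n) module" where
  "homK M N = \<lparr>carrier = mod_hom A M N, mult = undefined, one = undefined,
     zero = (\<lambda>x\<in>carrier M. \<zero>\<^bsub>N\<^esub>), add = (\<lambda>f g. \<lambda>x\<in>carrier M. f x \<oplus>\<^bsub>N\<^esub> g x),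
     smult = (\<lambda>c f. \<lambda>x\<in>carrier M. sc c \<odot>\<^bsub>N\<^esub> f x)\<rparr>"

lemma sc_hom:
  assumes N: "left_module A N" and c: "c \<in> carrier K"
  shows "(\<lambda>x\<in>carrier N. sc c \<odot>\<^bsub>N\<^esub> x) \<in> mod_hom A N N"
proof -
  interpret N: left_module A N by (rule N)
  show ?thesis
    using c sc_closed sc_comm
    by (intro mod_hom_restrictI[OF N])
      (auto simp: N.smult_closed N.smult_r_distr N.smult_assoc[symmetric])
qed

lemma homK_vspace:
  assumes M: "left_module A M" and N: "left_module A N"
  shows "vspace K (homK M N)"
proof -
  interpret module_pair A M N by (intro module_pair.intro M N)
  interpret KN: vspace K "KM N" by (rule KM_vspace[OF N])
  have ext: "f = g" if "f \<in> mod_hom A M N" "g \<in> mod_hom A M N" "\<And>x. x \<in> carrier M \<Longrightarrow> f x = g x" for f g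
    using mod_hom_eqI[OF that] .
  have sm: "(\<lambda>x\<in>carrier M. sc c \<odot>\<^bsub>N\<^esub> f x) \<in> mod_hom A M N" if f: "f \<in> mod_hom A M N" and c: "c \<in> carrier K" for c f
    using mod_hom_compose[OF M sc_hom[OF N c] f] mod_homD(1)[OF f]
    by (simp add: compose_def cong: restrict_cong)
  have ag: "abelian_group (homK M N)"
  proof (rule abelian_groupI)
    show "\<exists>g\<in>carrier (homK M N). g \<oplus>\<^bsub>homK M N\<^esub> f = \<zero>\<^bsub>homK M N\<^esub>" if f: "f \<in> carrier (homK M N)" for f
      using f hom_uminus[of f] mod_homD(1)[of f A M N]
      by (intro bexI[of _ "\<lambda>x\<in>carrier M. \<ominus>\<^bsub>N\<^esub> f x"])
        (auto simp: homK_def N.M.l_neg intro!: restrict_ext)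
    show "f \<oplus>\<^bsub>homK M N\<^esub> g \<oplus>\<^bsub>homK M N\<^esub> h = f \<oplus>\<^bsub>homK M N\<^esub> (g \<oplus>\<^bsub>homK M N\<^esub> h)"
      if "f \<in> carrier (homK M N)" "g \<in> carrier (homK M N)" "h \<in> carrier (homK M N)" for f g h
      using that mod_homD(1)[of _ A M N] by (auto simp: homK_def N.M.a_assoc intro!: restrict_ext)
    show "f \<oplus>\<^bsub>homK M N\<^esub> g = g \<oplus>\<^bsub>homK M N\<^esub> f"
      if "f \<in> carrier (homK M N)" "g \<in> carrier (homK M N)" for f g
      using that mod_homD(1)[of _ A M N] N.M.a_comm by (auto simp: homK_def intro!: restrict_ext)
    show "\<zero>\<^bsub>homK M N\<^esub> \<oplus>\<^bsub>homK M N\<^esub> f = f" if "f \<in> carrier (homK M N)" for f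
    proof -
      have f: "f \<in> mod_hom A M N" using that by (simp add: homK_def)
      have "(\<lambda>x\<in>carrier M. (\<lambda>x\<in>carrier M. \<zero>\<^bsub>N\<^esub>) x \<oplus>\<^bsub>N\<^esub> f x) = f"
        by (rule ext[OF hom_plus[OF hom_zero_map f] f]) (simp add: mod_homD(1)[OF f])
      then show ?thesis by (simp add: homK_def)
    qed
  qed (auto simp: homK_def hom_plus hom_zero_map)
  show ?thesis
    by (intro vspace.intro vspace_axioms.intro left_module.intro left_module_axioms.intro
        K.ring_axioms K.field_axioms ag)
      (auto simp: homK_def sm mod_homD(1)[of _ A M N] KN.smult_l_distr[simplified]
        KN.smult_r_distr[simplified] KN.smult_assoc[simplified] KN.smult_one[simplified]
        sc_closed N.smult_closed intro!: restrict_ext ext hom_plus sm)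
qed

end

context fdalg
begin

text \<open>Evaluations at finitely many generators of \<open>M\<close> separate
  homomorphisms.\<close>

lemma fg_homK:
  assumes M: "fg_module A M" and N: "fg_module A N"
  shows "finitely_generated K (homK M N)"
proof -
  note lM = fg_moduleD(1)[OF M] and lN = fg_moduleD(1)[OF N]
  interpret module_pair A M N by (intro module_pair.intro lM lN)
  interpret H: vspace K "homK M N" by (rule homK_vspace[OF lM lN])
  obtain S where S: "finite S" "S \<subseteq> carrier M" "spans A M S"
    using fg_moduleD(2)[OF M] M.finitely_generated_iff by auto
  show ?thesis
  proof (rule finitely_generated_evaluations[OF S(1) homK_vspace[OF lM lN] KM_vspace[OF lN]])
    show "finitely_generated K (KM N)"
      using finitely_generated_KM[OF lN] fg_moduleD(2)[OF N] by simp
    show "restrict (\<lambda>f. f s) (carrier (homK M N)) \<in> mod_hom K (homK M N) (KM N)" if "s \<in> S" for s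
      using that S(2)
      by (intro mod_hom_restrictI[OF H.left_module_axioms]) (auto simp: homK_def mod_homD(1)[of _ A M N])
    fix h assume h: "h \<in> carrier (homK M N)"
      and z: "\<And>s. s \<in> S \<Longrightarrow> restrict (\<lambda>f. f s) (carrier (homK M N)) h = \<zero>\<^bsub>KM N\<^esub>"
    have hh: "h \<in> mod_hom A M N" using h by (simp add: homK_def)
    have "carrier M \<subseteq> {x \<in> carrier M. h x = \<zero>\<^bsub>N\<^esub>}"
      using S submod_kernel[OF hh] z h unfolding spans_def by auto
    then have "h = (\<lambda>x\<in>carrier M. \<zero>\<^bsub>N\<^esub>)"
      by (intro mod_hom_eqI[OF hh hom_zero_map]) auto
    then show "h = \<zero>\<^bsub>homK M N\<^esub>" by (simp add: homK_def)
  qed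
qed

text \<open>Hom(X, Y) is finitely generated already over the field. Scalars act through
  endomorphisms of \<open>X\<close> as well as of \<open>Y\<close>, so the same generators serve
  both \<open>fgr\<close> and \<open>fgl\<close>.\<close>

lemma inst_fg_aux:
  assumes X: "X \<in> Obs" and Y: "Y \<in> Obs"
  obtains S where "finite S" "S \<subseteq> {f. mc.hom f X Y}"
    "\<And>N. S \<subseteq> N \<Longrightarrow> czer X Y \<in> N \<Longrightarrow> \<forall>f\<in>N. \<forall>g\<in>N. cplus f g \<in> N \<Longrightarrow>
       (\<And>c f. c \<in> carrier K \<Longrightarrow> mc.hom f X Y \<Longrightarrow> f \<in> N \<Longrightarrow>
          (X, \<lambda>x\<in>carrier X. sc c \<odot>\<^bsub>Y\<^esub> afun f x, Y) \<in> N) \<Longrightarrow>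
       (\<forall>f. mc.hom f X Y \<longrightarrow> f \<in> N)"
proof -
  note lX = ObsD(2)[OF X] and lY = ObsD(2)[OF Y]
  interpret H: vspace K "homK X Y" by (rule homK_vspace[OF lX lY])
  obtain F where F: "finite F" "F \<subseteq> mod_hom A X Y" "spans K (homK X Y) F"
    using fg_homK[OF ObsD(1)[OF X] ObsD(1)[OF Y]] H.finitely_generated_iff by (auto simp: homK_def)
  let ?S = "(\<lambda>f. (X, f, Y)) ` F"
  have "f \<in> N" if S: "?S \<subseteq> N" and z: "czer X Y \<in> N" and a: "\<forall>f\<in>N. \<forall>g\<in>N. cplus f g \<in> N"
    and s: "\<And>c f. c \<in> carrier K \<Longrightarrow> mc.hom f X Y \<Longrightarrow> f \<in> N \<Longrightarrow>
      (X, \<lambda>x\<in>carrier X. sc c \<odot>\<^bsub>Y\<^esub> afun f x, Y) \<in> N" and f: "mc.hom f X Y" for N f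
  proof -
    let ?N = "{f \<in> mod_hom A X Y. (X, f, Y) \<in> N}"
    have "submod K (homK X Y) ?N"
      unfolding submod_def
    proof (intro conjI ballI)
      show "?N \<subseteq> carrier (homK X Y)" by (auto simp: homK_def)
      show "\<zero>\<^bsub>homK X Y\<^esub> \<in> ?N"
        using z czer_Arrs(1)[OF X Y] by (auto simp: homK_def czer_def Arrs_iff)
      fix g assume g: "g \<in> ?N"
      then have g': "(X, g, Y) \<in> Arrs" using X Y by (simp add: Arrs_iff)
      {
        fix h assume h: "h \<in> ?N"
        then have h': "(X, h, Y) \<in> Arrs" using X Y by (simp add: Arrs_iff)
        have "cplus (X, g, Y) (X, h, Y) \<in> N" using a g h by blast
        then have "g \<oplus>\<^bsub>homK X Y\<^esub> h \<in> mod_hom A X Y \<and> (X, g \<oplus>\<^bsub>homK X Y\<^esub> h, Y) \<in> N"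
          using g' h' cplus_Arrs(1)[OF g' h'] by (simp add: cplus_def homK_def Arrs_iff)
        then show "g \<oplus>\<^bsub>homK X Y\<^esub> h \<in> ?N" by simp
      }
      fix c assume c: "c \<in> carrier K"
      have "(X, c \<odot>\<^bsub>homK X Y\<^esub> g, Y) \<in> N" using s[OF c, of "(X, g, Y)"] g g' by (simp add: homK_def)
      moreover have "c \<odot>\<^bsub>homK X Y\<^esub> g \<in> carrier (homK X Y)"
        by (rule H.smult_closed[OF c]) (use g in \<open>simp add: homK_def\<close>)
      ultimately show "c \<odot>\<^bsub>homK X Y\<^esub> g \<in> ?N" by (simp add: homK_def)
    qed
    moreover have "F \<subseteq> ?N" using F(2) S by auto
    ultimately have "mod_hom A X Y \<subseteq> ?N" using F(3) unfolding spans_def by (simp add: homK_def)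
    moreover have "afun f \<in> mod_hom A X Y" "f = (X, afun f, Y)"
      using f ArrsD(3)[of f] by (auto simp: asrc_def atgt_def afun_def)
    ultimately show ?thesis by auto
  qed
  moreover have "?S \<subseteq> {f. mc.hom f X Y}" using F(2) X Y by (auto simp: Arrs_iff)
  ultimately show ?thesis using that[of ?S] F(1) by blast
qed

lemma sc_arrow:
  assumes "X \<in> Obs" "c \<in> carrier K"
  shows "mc.hom (X, \<lambda>x\<in>carrier X. sc c \<odot>\<^bsub>X\<^esub> x, X) X X"
  using sc_hom[OF ObsD(2)[OF assms(1)] assms(2)] assms by (simp add: Arrs_iff)

lemma inst_fgr:
  assumes X: "X \<in> Obs" and Y: "Y \<in> Obs" shows "mc.fgr X Y"
proof -
  obtain S where S: "finite S" "S \<subseteq> {f. mc.hom f X Y}"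
    "\<And>N. S \<subseteq> N \<Longrightarrow> czer X Y \<in> N \<Longrightarrow> \<forall>f\<in>N. \<forall>g\<in>N. cplus f g \<in> N \<Longrightarrow>
       (\<And>c f. c \<in> carrier K \<Longrightarrow> mc.hom f X Y \<Longrightarrow> f \<in> N \<Longrightarrow>
          (X, \<lambda>x\<in>carrier X. sc c \<odot>\<^bsub>Y\<^esub> afun f x, Y) \<in> N) \<Longrightarrow> (\<forall>f. mc.hom f X Y \<longrightarrow> f \<in> N)"
    using inst_fg_aux[OF X Y] by blast
  show ?thesis
    unfolding mc.fgr_def
  proof (intro exI[of _ S] conjI allI impI S(1,2))
    fix N f assume N: "S \<subseteq> N" "czer X Y \<in> N" "\<forall>f\<in>N. \<forall>g\<in>N. cplus f g \<in> N"
      and s: "\<forall>f\<in>N. \<forall>h. mc.hom h X X \<longrightarrow> ccmp f h \<in> N" and f: "mc.hom f X Y"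
    have "(X, \<lambda>x\<in>carrier X. sc c \<odot>\<^bsub>Y\<^esub> afun f x, Y) \<in> N"
      if c: "c \<in> carrier K" and f: "mc.hom f X Y" "f \<in> N" for c f
    proof -
      let ?h = "(X, \<lambda>x\<in>carrier X. sc c \<odot>\<^bsub>X\<^esub> x, X)"
      have h: "mc.hom ?h X X" by (rule sc_arrow[OF X c])
      have sx: "sc c \<odot>\<^bsub>X\<^esub> x \<in> carrier X" if "x \<in> carrier X" for x
        using left_module.smult_closed[OF ObsD(2)[OF X]] sc_closed[OF c] that by blast
      have "ccmp f ?h = (X, compose (carrier X) (afun f) (\<lambda>x\<in>carrier X. sc c \<odot>\<^bsub>X\<^esub> x), Y)"
        using f h by (simp add: ccmp_def)
      also have "\<dots> = (X, \<lambda>x\<in>carrier X. sc c \<odot>\<^bsub>Y\<^esub> afun f x, Y)"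
        using afun_smult[of f _ "sc c"] f sc_closed[OF c] by (auto simp: compose_def intro!: restrict_ext)
      finally show ?thesis using s f(2) h by metis
    qed
    then show "f \<in> N" using S(3)[OF N] f by blast
  qed
qed

lemma inst_fgl:
  assumes X: "X \<in> Obs" and Y: "Y \<in> Obs" shows "mc.fgl X Y"
proof -
  obtain S where S: "finite S" "S \<subseteq> {f. mc.hom f X Y}"
    "\<And>N. S \<subseteq> N \<Longrightarrow> czer X Y \<in> N \<Longrightarrow> \<forall>f\<in>N. \<forall>g\<in>N. cplus f g \<in> N \<Longrightarrow>
       (\<And>c f. c \<in> carrier K \<Longrightarrow> mc.hom f X Y \<Longrightarrow> f \<in> N \<Longrightarrow>
          (X, \<lambda>x\<in>carrier X. sc c \<odot>\<^bsub>Y\<^esub> afun f x, Y) \<in> N) \<Longrightarrow> (\<forall>f. mc.hom f X Y \<longrightarrow> f \<in> N)"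
    using inst_fg_aux[OF X Y] by blast
  show ?thesis
    unfolding mc.fgl_def
  proof (intro exI[of _ S] conjI allI impI S(1,2))
    fix N f assume N: "S \<subseteq> N" "czer X Y \<in> N" "\<forall>f\<in>N. \<forall>g\<in>N. cplus f g \<in> N"
      and s: "\<forall>f\<in>N. \<forall>h. mc.hom h Y Y \<longrightarrow> ccmp h f \<in> N" and f: "mc.hom f X Y"
    have "(X, \<lambda>x\<in>carrier X. sc c \<odot>\<^bsub>Y\<^esub> afun f x, Y) \<in> N"
      if c: "c \<in> carrier K" and f: "mc.hom f X Y" "f \<in> N" for c f
    proof -
      let ?h = "(Y, \<lambda>x\<in>carrier Y. sc c \<odot>\<^bsub>Y\<^esub> x, Y)"
      have h: "mc.hom ?h Y Y" by (rule sc_arrow[OF Y c])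
      have "ccmp ?h f = (X, \<lambda>x\<in>carrier X. sc c \<odot>\<^bsub>Y\<^esub> afun f x, Y)"
        using f h by (auto simp: ccmp_def compose_def intro!: restrict_ext)
      then show ?thesis using s f(2) h by metis
    qed
    then show "f \<in> N" using S(3)[OF N] f by blast
  qed
qed

section \<open>The dual of the regular module as an injective cogenerator\<close>

abbreviation DR where "DR \<equiv> dual_regular K A"

lemma DR_simps [simp]:
  "carrier DR = mod_hom K A (regular K)" "\<zero>\<^bsub>DR\<^esub> = (\<lambda>x\<in>carrier A. \<zero>\<^bsub>K\<^esub>)"
  "f \<oplus>\<^bsub>DR\<^esub> g = (\<lambda>x\<in>carrier A. f x \<oplus>\<^bsub>K\<^esub> g x)" "a \<odot>\<^bsub>DR\<^esub> f = (\<lambda>x\<in>carrier A. f (x \<otimes>\<^bsub>A\<^esub> a))"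
  by (simp_all add: dual_regular_def)

lemma regK: "left_module K (regular K)"
  by (rule left_module_regular[OF K.ring_axioms])

lemma left_module_DR: "left_module A DR"
proof -
  interpret P: module_pair K A "regular K" by (intro module_pair.intro KA.left_module_axioms regK)
  have sm: "(\<lambda>x\<in>carrier A. f (x \<otimes>\<^bsub>A\<^esub> a)) \<in> mod_hom K A (regular K)"
    if f: "f \<in> mod_hom K A (regular K)" and a: "a \<in> carrier A" for f a
    using a mod_homD[OF f]
    by (intro mod_hom_restrictI[OF KA.left_module_axioms])
      (auto simp: A.l_distr smult_mult(1)[symmetric])
  have pl: "(\<lambda>x\<in>carrier A. f x \<oplus>\<^bsub>K\<^esub> g x) \<in> mod_hom K A (regular K)"
    if "f \<in> mod_hom K A (regular K)" "g \<in> mod_hom K A (regular K)" for f g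
    using P.hom_plus[OF that] by simp
  have D: "f x \<in> carrier K" if "f \<in> mod_hom K A (regular K)" "x \<in> carrier A" for f x
    using mod_homD(1)[OF that] by simp
  have ext: "f = g" if "f \<in> mod_hom K A (regular K)" "g \<in> mod_hom K A (regular K)"
    "\<And>x. x \<in> carrier A \<Longrightarrow> f x = g x" for f g
    using mod_hom_eqI[OF that] .
  have zm: "(\<lambda>x\<in>carrier A. \<zero>\<^bsub>K\<^esub>) \<in> mod_hom K A (regular K)"
    using P.hom_zero_map by simp
  have ag: "abelian_group DR"
  proof (rule abelian_groupI)
    show "\<exists>g\<in>carrier DR. g \<oplus>\<^bsub>DR\<^esub> f = \<zero>\<^bsub>DR\<^esub>" if "f \<in> carrier DR" for f
    proof -
      have f: "f \<in> mod_hom K A (regular K)" using that by simp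
      have "restrict (\<lambda>x. \<ominus>\<^bsub>K\<^esub> f x) (carrier A) \<in> mod_hom K A (regular K)"
        using mod_homD[OF f]
        by (intro mod_hom_restrictI[OF KA.left_module_axioms]) (auto simp: K.minus_add K.a_comm K.r_minus)
      then show ?thesis
        using D[OF f] by (intro bexI[of _ "\<lambda>x\<in>carrier A. \<ominus>\<^bsub>K\<^esub> f x"]) (auto simp: K.l_neg intro!: restrict_ext)
    qed
    show "f \<oplus>\<^bsub>DR\<^esub> g \<oplus>\<^bsub>DR\<^esub> h = f \<oplus>\<^bsub>DR\<^esub> (g \<oplus>\<^bsub>DR\<^esub> h)"
      if "f \<in> carrier DR" "g \<in> carrier DR" "h \<in> carrier DR" for f g h
      using that D by (auto simp: K.a_assoc intro!: restrict_ext)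
    show "f \<oplus>\<^bsub>DR\<^esub> g = g \<oplus>\<^bsub>DR\<^esub> f" if "f \<in> carrier DR" "g \<in> carrier DR" for f g
      using that D K.a_comm by (auto intro!: restrict_ext)
    show "\<zero>\<^bsub>DR\<^esub> \<oplus>\<^bsub>DR\<^esub> f = f" if "f \<in> carrier DR" for f
    proof -
      have f: "f \<in> mod_hom K A (regular K)" using that by simp
      have "(\<lambda>x\<in>carrier A. (\<lambda>x\<in>carrier A. \<zero>\<^bsub>K\<^esub>) x \<oplus>\<^bsub>K\<^esub> f x) = f"
        by (rule ext[OF pl[OF zm f] f]) (simp add: D[OF f])
      then show ?thesis by simp
    qed
  qed (auto simp: pl zm)
  have one: "(\<lambda>x\<in>carrier A. f (x \<otimes>\<^bsub>A\<^esub> \<one>\<^bsub>A\<^esub>)) = f" if f: "f \<in> mod_hom K A (regular K)" for f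
    by (rule ext[OF sm[OF f A.one_closed] f]) simp
  show ?thesis
    by (intro left_module.intro left_module_axioms.intro A.ring_axioms ag)
      (auto simp: sm one A.r_distr A.m_assoc mod_homD(2)[of _ K A "regular K"] intro!: restrict_ext)
qed

lemma fg_DR: "fg_module A DR"
proof -
  obtain U where U: "finite U" "U \<subseteq> carrier A" "spans K A U"
    using fg_KA KA.finitely_generated_iff by auto
  interpret V: vspace K "KM DR" by (rule KM_vspace[OF left_module_DR])
  interpret RK: left_module K "regular K" by (rule regK)
  have W: "vspace K (regular K)" by (intro vspace.intro vspace_axioms.intro regK K.field_axioms)
  interpret P: module_pair K A "regular K" by (intro module_pair.intro KA.left_module_axioms regK)
  have "finitely_generated K (KM DR)"
  proof (rule finitely_generated_evaluations[OF U(1) V.vspace_axioms W])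
    have "spans K (regular K) {\<one>\<^bsub>K\<^esub>}"
      unfolding spans_def submod_def by force
    then show "finitely_generated K (regular K)"
      unfolding RK.finitely_generated_iff by (intro exI[of _ "{\<one>\<^bsub>K\<^esub>}"]) auto
    show "restrict (\<lambda>f. f u) (carrier (KM DR)) \<in> mod_hom K (KM DR) (regular K)" if "u \<in> U" for u
    proof (rule mod_hom_restrictI[OF V.left_module_axioms])
      have u: "u \<in> carrier A" using that U by auto
      show "f u \<in> carrier (regular K)" if "f \<in> carrier (KM DR)" for f
        using that mod_homD(1)[OF _ u, of f K "regular K"] by simp
      show "(f \<oplus>\<^bsub>KM DR\<^esub> g) u = f u \<oplus>\<^bsub>regular K\<^esub> g u" for f g using u by simp
      show "(c \<odot>\<^bsub>KM DR\<^esub> f) u = c \<odot>\<^bsub>regular K\<^esub> f u" if "c \<in> carrier K" "f \<in> carrier (KM DR)" for c f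
      proof -
        have "u \<otimes>\<^bsub>A\<^esub> sc c = c \<odot>\<^bsub>A\<^esub> u" using sc_comm sc_mult u that by simp
        then show ?thesis using that u mod_homD(3)[of f K A "regular K" c u] by simp
      qed
    qed
    fix h assume h: "h \<in> carrier (KM DR)"
      and z: "\<And>u. u \<in> U \<Longrightarrow> restrict (\<lambda>f. f u) (carrier (KM DR)) h = \<zero>\<^bsub>regular K\<^esub>"
    have hh: "h \<in> mod_hom K A (regular K)" using h by simp
    have "carrier A \<subseteq> {x \<in> carrier A. h x = \<zero>\<^bsub>regular K\<^esub>}"
      using U P.submod_kernel[OF hh] z h unfolding spans_def by auto
    then have "h = (\<lambda>x\<in>carrier A. \<zero>\<^bsub>regular K\<^esub>)"
      by (intro mod_hom_eqI[OF hh P.hom_zero_map]) auto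
    then show "h = \<zero>\<^bsub>KM DR\<^esub>" by simp
  qed
  then show ?thesis
    using finitely_generated_KM[OF left_module_DR] left_module_DR by (simp add: fg_module_def)
qed

definition I :: "('k, 'a) fmodule" where "I = copy DR"

lemma I_Obs: "I \<in> Obs"
  using fg_copy[OF fg_DR] by (simp add: Obs_def I_def)

text \<open>The homomorphism into D A that belongs to the functional \<xi> under the identification
  of Hom(M, D A) with the dual space of \<open>M\<close>. The inverse is \<open>coev\<close>,
  evaluation at 1.\<close>

definition cofun :: "('k, 'a) fmodule \<Rightarrow> ((nat \<Rightarrow> 'k) \<Rightarrow> 'k) \<Rightarrow> ('k, 'a) arrow" where
  "cofun M \<xi> = (M, \<lambda>m\<in>carrier M. cp DR (\<lambda>a\<in>carrier A. \<xi> (a \<odot>\<^bsub>M\<^esub> m)), I)"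

definition coev :: "('k, 'a) arrow \<Rightarrow> (nat \<Rightarrow> 'k) \<Rightarrow> 'k" where
  "coev f = (\<lambda>m\<in>carrier (asrc f). uncp DR (afun f m) \<one>\<^bsub>A\<^esub>)"

abbreviation functionals where "functionals M \<equiv> mod_hom K (KM M) (regular K)"

lemma functional_DR:
  assumes M: "left_module A M" and x: "\<xi> \<in> functionals M" and m: "m \<in> carrier M"
  shows "(\<lambda>a\<in>carrier A. \<xi> (a \<odot>\<^bsub>M\<^esub> m)) \<in> carrier DR"
proof -
  interpret M: left_module A M by (rule M)
  have "(\<lambda>a\<in>carrier A. \<xi> (a \<odot>\<^bsub>M\<^esub> m)) \<in> mod_hom K A (regular K)"
  proof (rule mod_hom_restrictI[OF KA.left_module_axioms])
    fix r a assume r: "r \<in> carrier K" "a \<in> carrier A"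
    have "\<xi> ((r \<odot>\<^bsub>A\<^esub> a) \<odot>\<^bsub>M\<^esub> m) = \<xi> (sc r \<odot>\<^bsub>M\<^esub> (a \<odot>\<^bsub>M\<^esub> m))"
      using r m sc_mult sc_closed M.smult_assoc[of "sc r" a m] by simp
    then show "\<xi> ((r \<odot>\<^bsub>A\<^esub> a) \<odot>\<^bsub>M\<^esub> m) = r \<odot>\<^bsub>regular K\<^esub> \<xi> (a \<odot>\<^bsub>M\<^esub> m)"
      using mod_homD(3)[OF x, of r "a \<odot>\<^bsub>M\<^esub> m"] r m M.smult_closed by simp
  qed (use m mod_homD(1,2)[OF x] in \<open>auto simp: M.smult_closed M.smult_l_distr\<close>)
  then show ?thesis by simp
qed

lemma cofun:
  assumes M: "M \<in> Obs" and x: "\<xi> \<in> functionals M"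
  shows "mc.hom (cofun M \<xi>) M I"
    "m \<in> carrier M \<Longrightarrow> uncp DR (afun (cofun M \<xi>) m) = (\<lambda>a\<in>carrier A. \<xi> (a \<odot>\<^bsub>M\<^esub> m))"
proof -
  interpret M: left_module A M by (rule ObsD(2)[OF M])
  note f = functional_DR[OF ObsD(2)[OF M] x]
  have "restrict (\<lambda>m. cp DR (\<lambda>a\<in>carrier A. \<xi> (a \<odot>\<^bsub>M\<^esub> m))) (carrier M) \<in> mod_hom A M I"
  proof (rule mod_hom_restrictI[OF ObsD(2)[OF M]])
    show "cp DR (\<lambda>a\<in>carrier A. \<xi> (a \<odot>\<^bsub>M\<^esub> m)) \<in> carrier I" if "m \<in> carrier M" for m
      unfolding I_def using f[OF that] by (rule cp_closed)
    fix m assume m: "m \<in> carrier M"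
    {
      fix n assume n: "n \<in> carrier M"
      have "(\<lambda>a\<in>carrier A. \<xi> (a \<odot>\<^bsub>M\<^esub> (m \<oplus>\<^bsub>M\<^esub> n))) =
          (\<lambda>a\<in>carrier A. \<xi> (a \<odot>\<^bsub>M\<^esub> m)) \<oplus>\<^bsub>DR\<^esub> (\<lambda>a\<in>carrier A. \<xi> (a \<odot>\<^bsub>M\<^esub> n))"
        using m n mod_homD(2)[OF x] by (auto simp: M.smult_r_distr M.smult_closed intro!: restrict_ext)
      then show "cp DR (\<lambda>a\<in>carrier A. \<xi> (a \<odot>\<^bsub>M\<^esub> (m \<oplus>\<^bsub>M\<^esub> n))) =
          cp DR (\<lambda>a\<in>carrier A. \<xi> (a \<odot>\<^bsub>M\<^esub> m)) \<oplus>\<^bsub>I\<^esub> cp DR (\<lambda>a\<in>carrier A. \<xi> (a \<odot>\<^bsub>M\<^esub> n))"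
        unfolding I_def copy_def using uncp_cp[OF fg_DR f[OF m]] uncp_cp[OF fg_DR f[OF n]] by simp
    }
    fix r assume r: "r \<in> carrier A"
    have "(\<lambda>a\<in>carrier A. \<xi> (a \<odot>\<^bsub>M\<^esub> (r \<odot>\<^bsub>M\<^esub> m))) = r \<odot>\<^bsub>DR\<^esub> (\<lambda>a\<in>carrier A. \<xi> (a \<odot>\<^bsub>M\<^esub> m))"
      using m r by (auto simp: M.smult_assoc intro!: restrict_ext)
    then show "cp DR (\<lambda>a\<in>carrier A. \<xi> (a \<odot>\<^bsub>M\<^esub> (r \<odot>\<^bsub>M\<^esub> m))) = r \<odot>\<^bsub>I\<^esub> cp DR (\<lambda>a\<in>carrier A. \<xi> (a \<odot>\<^bsub>M\<^esub> m))"
      unfolding I_def copy_def using uncp_cp[OF fg_DR f[OF m]] by simp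
  qed
  then show "mc.hom (cofun M \<xi>) M I" using M I_Obs by (simp add: cofun_def Arrs_iff)
  show "uncp DR (afun (cofun M \<xi>) m) = (\<lambda>a\<in>carrier A. \<xi> (a \<odot>\<^bsub>M\<^esub> m))" if "m \<in> carrier M"
    using that uncp_cp[OF fg_DR f[OF that]] by (simp add: cofun_def)
qed

lemma uncp_I:
  assumes "x \<in> carrier I" shows "uncp DR x \<in> mod_hom K A (regular K)" "cp DR (uncp DR x) = x"
  using uncp_closed[of x DR] cp_uncp[of x DR] assms by (simp_all add: I_def)

lemma coev:
  assumes f: "mc.hom f M I"
  shows "coev f \<in> functionals M" "f = cofun M (coev f)"
proof -
  have M: "M \<in> Obs" using f ArrsD(1)[of f] by simp
  interpret M: left_module A M by (rule ObsD(2)[OF M])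
  interpret KM: vspace K "KM M" by (rule KM_vspace[OF ObsD(2)[OF M]])
  have fI: "afun f m \<in> carrier I" if "m \<in> carrier M" for m using f that by simp
  have fa: "afun f (a \<odot>\<^bsub>M\<^esub> m) = a \<odot>\<^bsub>I\<^esub> afun f m" if "a \<in> carrier A" "m \<in> carrier M" for a m
    using f afun_smult[of f m a] that by simp
  have e: "uncp DR (afun f (a \<odot>\<^bsub>M\<^esub> m)) \<one>\<^bsub>A\<^esub> = uncp DR (afun f m) a"
    if "a \<in> carrier A" "m \<in> carrier M" for a m
    using fa[OF that] uncp_smult[OF fg_DR that(1)] fI[OF that(2)] that by (simp add: I_def)
  have "restrict (\<lambda>m. uncp DR (afun f m) \<one>\<^bsub>A\<^esub>) (carrier (KM M)) \<in> functionals M"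
  proof (rule mod_hom_restrictI[OF KM.left_module_axioms])
    fix m assume m: "m \<in> carrier (KM M)"
    then show "uncp DR (afun f m) \<one>\<^bsub>A\<^esub> \<in> carrier (regular K)"
      using mod_homD(1)[OF uncp_I(1)[OF fI[of m]]] by simp
    {
      fix n assume n: "n \<in> carrier (KM M)"
      have "afun f (m \<oplus>\<^bsub>M\<^esub> n) = afun f m \<oplus>\<^bsub>I\<^esub> afun f n"
        using afun_add[of f m n] m n f by simp
      then show "uncp DR (afun f (m \<oplus>\<^bsub>KM M\<^esub> n)) \<one>\<^bsub>A\<^esub> =
          uncp DR (afun f m) \<one>\<^bsub>A\<^esub> \<oplus>\<^bsub>regular K\<^esub> uncp DR (afun f n) \<one>\<^bsub>A\<^esub>"
        using uncp_add[OF fg_DR, of "afun f m" "afun f n"] fI m n by (simp add: I_def)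
    }
    fix c assume c: "c \<in> carrier K"
    have "uncp DR (afun f (sc c \<odot>\<^bsub>M\<^esub> m)) \<one>\<^bsub>A\<^esub> = uncp DR (afun f m) (sc c)"
      using e[of "sc c" m] c m sc_closed by simp
    also have "\<dots> = c \<otimes>\<^bsub>K\<^esub> uncp DR (afun f m) \<one>\<^bsub>A\<^esub>"
      using mod_homD(3)[OF uncp_I(1)[OF fI[of m]], of c "\<one>\<^bsub>A\<^esub>"] c m by simp
    finally show "uncp DR (afun f (c \<odot>\<^bsub>KM M\<^esub> m)) \<one>\<^bsub>A\<^esub> = c \<odot>\<^bsub>regular K\<^esub> uncp DR (afun f m) \<one>\<^bsub>A\<^esub>"
      by simp
  qed
  then show c: "coev f \<in> functionals M" using f by (simp add: coev_def)
  show "f = cofun M (coev f)"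
  proof (rule arr_eqI)
    fix m assume "m \<in> carrier (asrc (cofun M (coev f)))"
    then have m: "m \<in> carrier M" using cofun(1)[OF M c] by simp
    have "uncp DR (afun f m) = (\<lambda>a\<in>carrier A. coev f (a \<odot>\<^bsub>M\<^esub> m))"
    proof (rule extensionalityI[of _ "carrier A"])
      show "uncp DR (afun f m) \<in> extensional (carrier A)" by (rule mod_homD(4)[OF uncp_I(1)[OF fI[OF m]]])
      show "uncp DR (afun f m) a = (\<lambda>a\<in>carrier A. coev f (a \<odot>\<^bsub>M\<^esub> m)) a" if "a \<in> carrier A" for a
        using that e[OF that m] f m M.smult_closed by (simp add: coev_def)
    qed simp
    then have "uncp DR (afun f m) = uncp DR (afun (cofun M (coev f)) m)"
      using cofun(2)[OF M c m] by simp
    then show "afun f m = afun (cofun M (coev f)) m"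
      using uncp_I(2) fI[OF m] cofun(1)[OF M c] m by (metis afun_closed)
  qed (use f cofun[OF M c] in auto)
qed

lemma cofun_eval:
  assumes M: "M \<in> Obs" and x: "\<xi> \<in> functionals M" and m: "m \<in> carrier M"
  shows "uncp DR (afun (cofun M \<xi>) m) \<one>\<^bsub>A\<^esub> = \<xi> m"
  using cofun(2)[OF assms] m left_module.smult_one[OF ObsD(2)[OF M]] by simp

lemma uncp_I_zero: "uncp DR \<zero>\<^bsub>I\<^esub> \<one>\<^bsub>A\<^esub> = \<zero>\<^bsub>K\<^esub>"
proof -
  interpret left_module A DR by (rule left_module_DR)
  have "uncp DR (cp DR \<zero>\<^bsub>DR\<^esub>) = \<zero>\<^bsub>DR\<^esub>" by (rule uncp_cp[OF fg_DR M.zero_closed])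
  then show ?thesis by (simp add: I_def copy_def)
qed

text \<open>Through \<open>coev\<close>, extending a homomorphism into \<open>I\<close> along a mono
  becomes extending a functional from a subspace.\<close>

lemma I_inj: "mc.inj I"
  unfolding mc.inj_def
proof (intro conjI allI impI)
  fix m f assume m: "mc.mono m" and f: "mc.hom f (asrc m) I"
  have a: "m \<in> Arrs" "inj_on (afun m) (carrier (asrc m))" using m mono_iff by auto
  let ?M = "asrc m" and ?N = "atgt m"
  note lM = ObsD(2)[OF ArrsD(1)[OF a(1)]] and lN = ObsD(2)[OF ArrsD(2)[OF a(1)]]
  interpret VM: vspace K "KM ?M" by (rule KM_vspace[OF lM])
  interpret VN: vspace K "KM ?N" by (rule KM_vspace[OF lN])
  interpret P: module_pair K "KM ?M" "KM ?N" ..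
  have mk: "afun m \<in> mod_hom K (KM ?M) (KM ?N)" by (rule mod_hom_KM[OF ArrsD(3)[OF a(1)]])
  let ?U = "afun m ` carrier ?M" and ?\<xi> = "coev f"
  note c = coev[OF f]
  have U: "submod K (KM ?N) ?U" using P.submod_image[OF mk VM.submod_carrier] by simp
  let ?X = "(KM ?N)\<lparr>carrier := ?U\<rparr>"
  have lX: "left_module K ?X" by (rule VN.left_module_submod[OF U])
  have u: "restrict (\<lambda>y. y) (carrier ?X) \<in> mod_hom K ?X (KM ?N)"
    by (rule mod_hom_restrictI[OF lX]) (use submodD(1)[OF U] in auto)
  obtain v where v: "v \<in> mod_hom K ?X (KM ?M)" "\<And>y. y \<in> carrier ?X \<Longrightarrow> afun m (v y) = restrict (\<lambda>y. y) (carrier ?X) y"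
    using P.hom_lift_inj[OF lX mk _ u] a(2) by auto
  have vm: "v (afun m x) = x" if x: "x \<in> carrier ?M" for x
    using v(2)[of "afun m x"] inj_onD[OF a(2), of "v (afun m x)" x] mod_homD(1)[OF v(1), of "afun m x"] x
    by simp
  have fg: "finitely_generated K (KM ?N)"
    using finitely_generated_KM[OF lN] ObsD(1)[OF ArrsD(2)[OF a(1)]] by (simp add: fg_module_def)
  obtain g where g: "g \<in> functionals ?N" "\<And>y. y \<in> ?U \<Longrightarrow> g y = compose (carrier ?X) ?\<xi> v y"
    using VN.functional_extend[OF fg U mod_hom_compose[OF lX c(1) v(1)]] by blast
  have gm: "g (afun m x) = ?\<xi> x" if "x \<in> carrier ?M" for x
    using g(2)[of "afun m x"] vm[OF that] that by (simp add: compose_def)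
  note h = cofun[OF ArrsD(2)[OF a(1)] g(1)]
  have hm: "mc.hom (ccmp (cofun ?N g) m) ?M I" using h(1) a(1) by auto
  have "coev (ccmp (cofun ?N g) m) = coev f"
  proof (rule mod_hom_eqI[OF coev(1)[OF hm] c(1)])
    fix x assume "x \<in> carrier (KM ?M)"
    then have x: "x \<in> carrier ?M" by simp
    have "coev (ccmp (cofun ?N g) m) x = uncp DR (afun (cofun ?N g) (afun m x)) \<one>\<^bsub>A\<^esub>"
      using hm h(1) a(1) x by (simp add: coev_def)
    also have "\<dots> = g (afun m x)"
      using cofun_eval[OF ArrsD(2)[OF a(1)] g(1), of "afun m x"] a(1) x by simp
    finally show "coev (ccmp (cofun ?N g) m) x = coev f x" using gm[OF x] by simp
  qed
  then have "ccmp (cofun ?N g) m = f" using coev(2)[OF hm] c(2) by simp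
  then show "\<exists>h. mc.hom h ?N I \<and> ccmp h m = f" using h(1) by blast
qed (rule I_Obs)

text \<open>A nonzero element of the kernel is detected by a functional, hence by a homomorphism
  into \<open>I\<close>; but this homomorphism factors through \<open>p\<close> and kills the
  element.\<close>

lemma I_cogen:
  assumes p: "p \<in> Arrs" and l: "\<And>f. mc.hom f (asrc p) I \<Longrightarrow> \<exists>h. mc.hom h (atgt p) I \<and> ccmp h p = f"
  shows "mc.mono p"
proof -
  let ?M = "asrc p"
  note M = ArrsD(1)[OF p]
  interpret module_pair A ?M "atgt p" by (rule ArrsD(5)[OF p])
  interpret VM: vspace K "KM ?M" by (rule KM_vspace[OF ObsD(2)[OF M]])
  have fg: "finitely_generated K (KM ?M)"
    using finitely_generated_KM[OF ObsD(2)[OF M]] ObsD(1)[OF M] by (simp add: fg_module_def)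
  have "inj_on (afun p) (carrier ?M)"
  proof (rule inj_on_kernel[OF ArrsD(3)[OF p]], rule ccontr)
    fix x assume x: "x \<in> carrier ?M" "afun p x = \<zero>\<^bsub>atgt p\<^esub>" "x \<noteq> \<zero>\<^bsub>?M\<^esub>"
    obtain \<xi> where xi: "\<xi> \<in> functionals ?M" "\<xi> x \<noteq> \<zero>\<^bsub>K\<^esub>"
      using VM.separating_functional[OF fg, of x] x by auto
    note c = cofun[OF M xi(1)]
    obtain h where h: "mc.hom h (atgt p) I" "ccmp h p = cofun ?M \<xi>" using l[OF c(1)] by blast
    have "afun (cofun ?M \<xi>) x = afun h (afun p x)"
      using h(1) p x(1) unfolding h(2)[symmetric] by simp
    also have "\<dots> = \<zero>\<^bsub>I\<^esub>" using x(2) afun_zero[of h] h(1) by simp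
    finally have "\<xi> x = \<zero>\<^bsub>K\<^esub>" using cofun_eval[OF M xi(1) x(1)] uncp_I_zero by simp
    then show False using xi by simp
  qed
  then show ?thesis using p mono_iff by simp
qed

text \<open>Injectivity is secured on the spans of larger and larger subsets of a finite spanning
  set. Each vector v outside the span so far gets one more copy of \<open>I\<close>, entered by a
  functional that kills the old span but not v; it forces the coefficient of v in any kernel element
  to be zero.\<close>

lemma addc_I_mono:
  assumes X: "X \<in> Obs" shows "\<exists>m. mc.mono m \<and> asrc m = X \<and> mc.addc I (atgt m)"
proof -
  interpret X: left_module A X by (rule ObsD(2)[OF X])
  interpret V: vspace K "KM X" by (rule KM_vspace[OF ObsD(2)[OF X]])
  have fg: "finitely_generated K (KM X)"
    using finitely_generated_KM[OF ObsD(2)[OF X]] ObsD(1)[OF X] by (simp add: fg_module_def)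
  obtain S where S: "finite S" "S \<subseteq> carrier X" "spans K (KM X) S"
    using fg V.finitely_generated_iff by auto
  have "\<exists>m. m \<in> Arrs \<and> asrc m = X \<and> mc.addc I (atgt m) \<and>
      (\<forall>x\<in>V.sp S. afun m x = \<zero>\<^bsub>atgt m\<^esub> \<longrightarrow> x = \<zero>\<^bsub>X\<^esub>)"
    using S(1,2)
  proof (induction S)
    case empty
    have "V.sp {} \<subseteq> {\<zero>\<^bsub>X\<^esub>}" by (rule V.sp_least) (auto simp: submod_def sc_closed)
    then show ?case
      using I_Obs X by (intro exI[of _ "czer X I"]) (auto intro: mc.addc_self)
  next
    case (insert v S)
    then obtain m where m: "m \<in> Arrs" "asrc m = X" "mc.addc I (atgt m)"
      "\<And>x. x \<in> V.sp S \<Longrightarrow> afun m x = \<zero>\<^bsub>atgt m\<^esub> \<Longrightarrow> x = \<zero>\<^bsub>X\<^esub>" by auto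
    have v: "v \<in> carrier X" and SX: "S \<subseteq> carrier (KM X)" using insert by auto
    note sp = V.sp_submod[OF SX]
    show ?case
    proof (cases "v \<in> V.sp S")
      case True
      then have "V.sp (insert v S) \<subseteq> V.sp S"
        using V.sp_inc[of S] by (intro V.sp_least sp) auto
      then show ?thesis using m by (intro exI[of _ m]) auto
    next
      case False
      \<comment> \<open>A functional on the quotient by the old span, pulled back, vanishes on that
        span and can be chosen nonzero at \<open>v\<close>.\<close>
      note q = V.quot[OF sp]
      interpret Q: module_pair K "KM X" "quot (KM X) (V.sp S)"
        by (intro module_pair.intro V.left_module_axioms q)
      interpret QV: vspace K "quot (KM X) (V.sp S)"
        by (intro vspace.intro vspace_axioms.intro q K.field_axioms)
      let ?r = "restrict (rep (KM X) (V.sp S)) (carrier (KM X))"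
      have rv: "?r v \<in> carrier (quot (KM X) (V.sp S))" "?r v \<noteq> \<zero>\<^bsub>quot (KM X) (V.sp S)\<^esub>"
        using q(4)[of v] mod_homD(1)[OF q(2), of v] False v by auto
      obtain g where g: "g \<in> mod_hom K (quot (KM X) (V.sp S)) (regular K)" "g (?r v) \<noteq> \<zero>\<^bsub>K\<^esub>"
        using QV.separating_functional[OF Q.finitely_generated_image[OF q(2,3) fg] rv] by blast
      define \<xi> where "\<xi> = compose (carrier (KM X)) g ?r"
      have xi: "\<xi> \<in> functionals X"
        unfolding \<xi>_def by (rule mod_hom_compose[OF V.left_module_axioms g(1) q(2)])
      interpret QR: module_pair K "quot (KM X) (V.sp S)" "regular K"
        by (intro module_pair.intro q regK)
      have xv: "\<xi> v \<noteq> \<zero>\<^bsub>K\<^esub>" "\<xi> v \<in> carrier K" using g v mod_homD(1)[OF xi, of v] by (auto simp: \<xi>_def compose_def)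
      have xs: "\<xi> s = \<zero>\<^bsub>K\<^esub>" if "s \<in> V.sp S" for s
      proof -
        have s: "s \<in> carrier X" using submodD(1)[OF sp that] by simp
        then have "?r s = \<zero>\<^bsub>quot (KM X) (V.sp S)\<^esub>" using q(4)[of s] that by simp
        then show ?thesis using s QR.hom_zero[OF g(1)] by (simp add: \<xi>_def compose_def)
      qed
      note c = cofun[OF X xi]
      obtain Z i j p r where bp: "mc.biprod (atgt m) I Z i j p r"
        using inst_biprod[OF ArrsD(2)[OF m(1)] I_Obs] by auto
      then have b: "mc.hom i (atgt m) Z" "mc.hom j I Z" "mc.hom p Z (atgt m)" "mc.hom r Z I"
        "ccmp p i = cidn (atgt m)" "ccmp r j = cidn I" "ccmp r i = czer (atgt m) I" "ccmp p j = czer I (atgt m)"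
        by (auto simp: mc.biprod_def)
      let ?m = "cplus (ccmp i m) (ccmp j (cofun X \<xi>))"
      have m': "mc.hom ?m X Z" using m b c by auto
      have pm: "ccmp p ?m = m" and rm: "ccmp r ?m = cofun X \<xi>"
        using b m c X I_Obs by (simp_all add: mc.cmp_plus mc.reassoc)
      have ev: "afun (ccmp k ?m) x = \<zero>\<^bsub>W\<^esub>" if "mc.hom k Z W" "x \<in> carrier X" "afun ?m x = \<zero>\<^bsub>Z\<^esub>" for k W x
        using that m' afun_zero[of k] by simp
      have "x = \<zero>\<^bsub>X\<^esub>" if x: "x \<in> V.sp (insert v S)" and z: "afun ?m x = \<zero>\<^bsub>Z\<^esub>" for x
      proof -
        obtain e s where es: "e \<in> carrier K" "s \<in> V.sp S" "x = e \<odot>\<^bsub>KM X\<^esub> v \<oplus>\<^bsub>KM X\<^esub> s"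
          using V.sp_insert[of v S x] v SX x by auto
        have s: "s \<in> carrier X" using submodD(1)[OF sp es(2)] by simp
        have xX: "x \<in> carrier X" using es v s V.smult_closed[of e v] by simp
        have "afun (cofun X \<xi>) x = \<zero>\<^bsub>I\<^esub>" using ev[OF b(4) xX z] rm by simp
        then have "\<xi> x = \<zero>\<^bsub>K\<^esub>" using cofun_eval[OF X xi xX] uncp_I_zero by simp
        moreover have "\<xi> x = e \<otimes>\<^bsub>K\<^esub> \<xi> v"
          using mod_homD(2,3)[OF xi] es v s xs[OF es(2)] xv V.smult_closed[of e v] by simp
        ultimately have "e = \<zero>\<^bsub>K\<^esub>" using K.integral[of e "\<xi> v"] es xv by auto
        then have "x = s" using es v s V.smult_zero_l[of v] by simp
        moreover have "afun m x = \<zero>\<^bsub>atgt m\<^esub>" using ev[OF b(3) xX z] pm by simp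
        ultimately show ?thesis using m(4) es(2) by simp
      qed
      then show ?thesis
        using m' mc.addc_biprod[OF m(3) mc.addc_self[OF I_Obs] bp] by (intro exI[of _ ?m]) auto
    qed
  qed
  then obtain m where m: "m \<in> Arrs" "asrc m = X" "mc.addc I (atgt m)"
      "\<And>x. x \<in> V.sp S \<Longrightarrow> afun m x = \<zero>\<^bsub>atgt m\<^esub> \<Longrightarrow> x = \<zero>\<^bsub>X\<^esub>" by auto
  interpret module_pair A "asrc m" "atgt m" by (rule ArrsD(5)[OF m(1)])
  have "carrier X \<subseteq> V.sp S"
    using S(3) V.sp_submod[of S] V.sp_inc[of S] S(2) unfolding spans_def by simp
  then have "inj_on (afun m) (carrier (asrc m))"
    using inj_on_kernel[OF ArrsD(3)[OF m(1)]] m by auto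
  then show ?thesis using m by (intro exI[of _ m]) (simp add: mono_iff)
qed

sublocale mc: abcat Obs Arrs asrc atgt ccmp cidn cplus cneg czer
proof
  show "\<exists>m e. mc.mono m \<and> mc.epi e \<and> asrc m = atgt e \<and> f = ccmp m e" if "f \<in> Arrs" for f
    by (rule inst_factor[OF that])
  show "\<exists>e. mc.epi e \<and> atgt e = X \<and> mc.proj (asrc e)" if "X \<in> Obs" for X
    using addc_G_epi[OF that] mc.addc_proj G_proj by blast
  show "\<exists>m. mc.mono m \<and> asrc m = X \<and> mc.inj (atgt m)" if "X \<in> Obs" for X
    using addc_I_mono[OF that] mc.addc_inj I_inj by blast
qed (use inst_mono_ses inst_epi_ses inst_zero_object inst_biprod inst_fgr inst_fgl in auto)

end

section \<open>Modules of morphisms\<close>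

text \<open>In the opposite of a category, \<open>\<theta>\<close> identifies \<open>R\<close> with the opposite ring of
  endomorphisms, so that the following covers covariant and contravariant \<open>Hom\<close> functors.\<close>

locale hom_mod = abcat Ob Arr src tgt cmp idn plus neg zer + R: fdalg K R
  for Ob :: "'o set" and Arr :: "'m set" and src tgt :: "'m \<Rightarrow> 'o"
    and cmp :: "'m \<Rightarrow> 'm \<Rightarrow> 'm" (infixl "\<cdot>" 70)
    and idn :: "'o \<Rightarrow> 'm" and plus :: "'m \<Rightarrow> 'm \<Rightarrow> 'm" (infixl "\<boxplus>" 65)
    and neg :: "'m \<Rightarrow> 'm" and zer :: "'o \<Rightarrow> 'o \<Rightarrow> 'm"
    and K :: "'k ring" and R :: "('k, 'r) module" +
  fixes T :: 'o and \<theta> :: "'r \<Rightarrow> 'm"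
  assumes T_Ob: "T \<in> Ob"
    and theta_bij: "bij_betw \<theta> (carrier R) {h. hom h T T}"
    and theta_mult: "\<lbrakk>r \<in> carrier R; s \<in> carrier R\<rbrakk> \<Longrightarrow> \<theta> (r \<otimes>\<^bsub>R\<^esub> s) = \<theta> s \<cdot> \<theta> r"
    and theta_add: "\<lbrakk>r \<in> carrier R; s \<in> carrier R\<rbrakk> \<Longrightarrow> \<theta> (r \<oplus>\<^bsub>R\<^esub> s) = \<theta> r \<boxplus> \<theta> s"
    and theta_one: "\<theta> \<one>\<^bsub>R\<^esub> = idn T"
begin

lemma theta: "r \<in> carrier R \<Longrightarrow> hom (\<theta> r) T T"
  using theta_bij by (auto dest: bij_betwE)

definition itheta where "itheta = inv_into (carrier R) \<theta>"

lemma itheta: "hom h T T \<Longrightarrow> itheta h \<in> carrier R" "hom h T T \<Longrightarrow> \<theta> (itheta h) = h"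
  using theta_bij unfolding itheta_def
  by (auto simp: bij_betw_def intro!: inv_into_into f_inv_into_f)

lemma itheta_theta: "r \<in> carrier R \<Longrightarrow> itheta (\<theta> r) = r"
  using theta_bij unfolding itheta_def by (simp add: bij_betw_def)

definition Hmod :: "'o \<Rightarrow> ('r, 'm) module" where
  "Hmod X = \<lparr>carrier = {f. hom f T X}, mult = undefined, one = undefined, zero = zer T X,
     add = plus, smult = (\<lambda>r f. f \<cdot> \<theta> r)\<rparr>"

lemma Hmod_simps [simp]:
  "f \<in> carrier (Hmod X) \<longleftrightarrow> hom f T X" "\<zero>\<^bsub>Hmod X\<^esub> = zer T X"
  "f \<oplus>\<^bsub>Hmod X\<^esub> g = f \<boxplus> g" "r \<odot>\<^bsub>Hmod X\<^esub> f = f \<cdot> \<theta> r"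
  by (simp_all add: Hmod_def)

lemma left_module_Hmod:
  assumes X: "X \<in> Ob" shows "left_module R (Hmod X)"
proof -
  have "abelian_group (Hmod X)"
  proof (rule abelian_groupI)
    show "\<exists>g\<in>carrier (Hmod X). g \<oplus>\<^bsub>Hmod X\<^esub> f = \<zero>\<^bsub>Hmod X\<^esub>" if "f \<in> carrier (Hmod X)" for f
      using that by (intro bexI[of _ "neg f"]) (auto simp: plus_comm[of "neg f"])
    show "f \<oplus>\<^bsub>Hmod X\<^esub> g = g \<oplus>\<^bsub>Hmod X\<^esub> f" for f g by (simp add: plus_comm)
  qed (use X T_Ob in \<open>auto simp: plus_assoc\<close>)
  then show ?thesis
    by (intro left_module.intro left_module_axioms.intro R.A.ring_axioms)
      (auto simp: theta theta_mult theta_add theta_one cmp_plus plus_cmp cmp_assoc)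
qed

lemma fg_Hmod:
  assumes X: "X \<in> Ob" shows "fg_module R (Hmod X)"
proof -
  interpret left_module R "Hmod X" by (rule left_module_Hmod[OF X])
  obtain S where S: "finite S" "S \<subseteq> {f. hom f T X}"
    and gen: "\<And>N. S \<subseteq> N \<Longrightarrow> N \<subseteq> {f. hom f T X} \<Longrightarrow> zer T X \<in> N \<Longrightarrow> (\<forall>f\<in>N. \<forall>g\<in>N. f \<boxplus> g \<in> N) \<Longrightarrow>
        (\<forall>f\<in>N. \<forall>h. hom h T T \<longrightarrow> f \<cdot> h \<in> N) \<Longrightarrow> (\<forall>f. hom f T X \<longrightarrow> f \<in> N)"
    using fgr[OF T_Ob X] unfolding fgr_def by auto
  have "spans R (Hmod X) S"
    unfolding spans_def
  proof (intro allI impI subsetI)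
    fix N f assume N: "submod R (Hmod X) N" "S \<subseteq> N" and f: "f \<in> carrier (Hmod X)"
    have "\<forall>f. hom f T X \<longrightarrow> f \<in> N"
    proof (rule gen[OF N(2)])
      show "\<forall>f\<in>N. \<forall>h. hom h T T \<longrightarrow> f \<cdot> h \<in> N"
      proof (intro ballI allI impI)
        fix f h assume f: "f \<in> N" and h: "hom h T T"
        show "f \<cdot> h \<in> N" using submodD(4)[OF N(1) itheta(1)[OF h] f] itheta(2)[OF h] by simp
      qed
    qed (use N(1) in \<open>auto simp: submod_def\<close>)
    then show "f \<in> N" using f by simp
  qed
  then show ?thesis
    unfolding fg_module_def finitely_generated_iff
    using S left_module_axioms by (intro conjI exI[of _ S]) auto
qed

section \<open>The functor Hom(T, -) into modules over R\<close>

definition Fo :: "'o \<Rightarrow> ('k, 'r) fmodule" where "Fo X = R.copy (Hmod X)"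

definition Fa :: "'m \<Rightarrow> ('k, 'r) arrow" where
  "Fa f = (Fo (src f), \<lambda>y\<in>carrier (Fo (src f)). R.cp (Hmod (tgt f)) (f \<cdot> R.uncp (Hmod (src f)) y),
     Fo (tgt f))"

lemma Fo_Obs: "X \<in> Ob \<Longrightarrow> Fo X \<in> R.Obs"
  using R.fg_copy[OF fg_Hmod] by (simp add: Fo_def R.Obs_def)

lemma uncp_Fo: "y \<in> carrier (Fo X) \<Longrightarrow> hom (R.uncp (Hmod X) y) T X"
  using R.uncp_closed[of y "Hmod X"] by (simp add: Fo_def)

lemma cp_Fo: "hom f T X \<Longrightarrow> R.cp (Hmod X) f \<in> carrier (Fo X)"
  using R.cp_closed[of f "Hmod X"] by (simp add: Fo_def)

lemma uncp_cp_Fo: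
  assumes f: "hom f T X" shows "R.uncp (Hmod X) (R.cp (Hmod X) f) = f"
proof -
  have "X \<in> Ob" using f by auto
  then show ?thesis using R.uncp_cp[OF fg_Hmod[of X], of f] f by simp
qed

lemma cp_uncp_Fo: "y \<in> carrier (Fo X) \<Longrightarrow> R.cp (Hmod X) (R.uncp (Hmod X) y) = y"
  using R.cp_uncp[of y "Hmod X"] by (simp add: Fo_def)

lemma add_Fo: "hom f T X \<Longrightarrow> hom g T X \<Longrightarrow>
    R.cp (Hmod X) f \<oplus>\<^bsub>Fo X\<^esub> R.cp (Hmod X) g = R.cp (Hmod X) (f \<boxplus> g)"
  using uncp_cp_Fo[of f X] uncp_cp_Fo[of g X] by (simp add: Fo_def R.copy_def)

lemma smult_Fo: "hom f T X \<Longrightarrow> r \<odot>\<^bsub>Fo X\<^esub> R.cp (Hmod X) f = R.cp (Hmod X) (f \<cdot> \<theta> r)"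
  using uncp_cp_Fo[of f X] by (simp add: Fo_def R.copy_def)

lemma zero_Fo: "\<zero>\<^bsub>Fo X\<^esub> = R.cp (Hmod X) (zer T X)"
  by (simp add: Fo_def R.copy_def)

lemma FoE:
  assumes "y \<in> carrier (Fo X)" obtains f where "hom f T X" "y = R.cp (Hmod X) f"
  using assms uncp_Fo cp_uncp_Fo by metis

lemma Fa_apply: "hom f X Y \<Longrightarrow> hom h T X \<Longrightarrow> afun (Fa f) (R.cp (Hmod X) h) = R.cp (Hmod Y) (f \<cdot> h)"
  using cp_Fo[of h X] uncp_cp_Fo[of h X] by (simp add: Fa_def)

lemma Fa_Arrs:
  assumes f: "f \<in> Arr" shows "Fa f \<in> R.Arrs" "asrc (Fa f) = Fo (src f)" "atgt (Fa f) = Fo (tgt f)"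
proof -
  have "restrict (\<lambda>y. R.cp (Hmod (tgt f)) (f \<cdot> R.uncp (Hmod (src f)) y)) (carrier (Fo (src f)))
      \<in> mod_hom R (Fo (src f)) (Fo (tgt f))"
  proof (rule mod_hom_restrictI[OF R.ObsD(2)[OF Fo_Obs]])
    fix y assume y: "y \<in> carrier (Fo (src f))"
    then obtain h where h: "hom h T (src f)" "y = R.cp (Hmod (src f)) h" using FoE by blast
    show "R.cp (Hmod (tgt f)) (f \<cdot> R.uncp (Hmod (src f)) y) \<in> carrier (Fo (tgt f))"
      using f h by (auto simp: uncp_cp_Fo intro!: cp_Fo)
    {
      fix z assume z: "z \<in> carrier (Fo (src f))"
      then obtain g where g: "hom g T (src f)" "z = R.cp (Hmod (src f)) g" using FoE by blast
      have fh: "hom (f \<cdot> h) T (tgt f)" "hom (f \<cdot> g) T (tgt f)" "hom (h \<boxplus> g) T (src f)"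
        using f g h by auto
      show "R.cp (Hmod (tgt f)) (f \<cdot> R.uncp (Hmod (src f)) (y \<oplus>\<^bsub>Fo (src f)\<^esub> z)) =
          R.cp (Hmod (tgt f)) (f \<cdot> R.uncp (Hmod (src f)) y) \<oplus>\<^bsub>Fo (tgt f)\<^esub>
          R.cp (Hmod (tgt f)) (f \<cdot> R.uncp (Hmod (src f)) z)"
        unfolding h(2) g(2) add_Fo[OF h(1) g(1)] uncp_cp_Fo[OF h(1)] uncp_cp_Fo[OF g(1)]
          uncp_cp_Fo[OF fh(3)] add_Fo[OF fh(1,2)] by (simp add: cmp_plus)
    }
    fix r assume r: "r \<in> carrier R"
    have fh: "hom (f \<cdot> h) T (tgt f)" "hom (h \<cdot> \<theta> r) T (src f)" using f h theta[OF r] by auto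
    show "R.cp (Hmod (tgt f)) (f \<cdot> R.uncp (Hmod (src f)) (r \<odot>\<^bsub>Fo (src f)\<^esub> y)) =
        r \<odot>\<^bsub>Fo (tgt f)\<^esub> R.cp (Hmod (tgt f)) (f \<cdot> R.uncp (Hmod (src f)) y)"
      unfolding h(2) smult_Fo[OF h(1)] uncp_cp_Fo[OF h(1)] uncp_cp_Fo[OF fh(2)] smult_Fo[OF fh(1)]
      by (simp add: cmp_assoc)
  qed (use f in simp)
  then show "Fa f \<in> R.Arrs" using f Fo_Obs by (simp add: Fa_def R.Arrs_iff)
qed (simp_all add: Fa_def)

lemma Fa_eqI:
  assumes "a \<in> R.Arrs" "b \<in> R.Arrs" "asrc a = Fo X" "asrc b = Fo X" "atgt a = atgt b"
    "\<And>h. hom h T X \<Longrightarrow> afun a (R.cp (Hmod X) h) = afun b (R.cp (Hmod X) h)"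
  shows "a = b"
proof (rule R.arr_eqI)
  fix y assume "y \<in> carrier (asrc b)"
  then obtain h where "hom h T X" "y = R.cp (Hmod X) h" using FoE assms(4) by metis
  then show "afun a y = afun b y" using assms(6) by simp
qed (use assms in auto)

lemma Fa_laws:
  shows "\<lbrakk>g \<in> Arr; f \<in> Arr; src g = tgt f\<rbrakk> \<Longrightarrow> Fa (g \<cdot> f) = R.ccmp (Fa g) (Fa f)"
    "\<lbrakk>g \<in> Arr; f \<in> Arr; src g = src f; tgt g = tgt f\<rbrakk> \<Longrightarrow> Fa (g \<boxplus> f) = R.cplus (Fa g) (Fa f)"
    "X \<in> Ob \<Longrightarrow> Fa (idn X) = R.cidn (Fo X)"
    "\<lbrakk>X \<in> Ob; Y \<in> Ob\<rbrakk> \<Longrightarrow> Fa (zer X Y) = R.czer (Fo X) (Fo Y)"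
proof -
  assume a: "g \<in> Arr" "f \<in> Arr" "src g = tgt f"
  show "Fa (g \<cdot> f) = R.ccmp (Fa g) (Fa f)"
  proof (rule Fa_eqI[of _ _ "src f"])
    fix h assume h: "hom h T (src f)"
    show "afun (Fa (g \<cdot> f)) (R.cp (Hmod (src f)) h) = afun (R.ccmp (Fa g) (Fa f)) (R.cp (Hmod (src f)) h)"
      using a h Fa_Arrs[of f] Fa_Arrs[of g] cp_Fo[OF h] Fa_apply[of f "src f" "tgt f" h]
        Fa_apply[of g "tgt f" "tgt g" "f \<cdot> h"] Fa_apply[of "g \<cdot> f" "src f" "tgt g" h]
      by (simp add: cmp_assoc)
  qed (use a Fa_Arrs[of f] Fa_Arrs[of g] Fa_Arrs[of "g \<cdot> f"] in auto)
next
  assume a: "g \<in> Arr" "f \<in> Arr" "src g = src f" "tgt g = tgt f"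
  show "Fa (g \<boxplus> f) = R.cplus (Fa g) (Fa f)"
  proof (rule Fa_eqI[of _ _ "src f"])
    fix h assume h: "hom h T (src f)"
    show "afun (Fa (g \<boxplus> f)) (R.cp (Hmod (src f)) h) = afun (R.cplus (Fa g) (Fa f)) (R.cp (Hmod (src f)) h)"
      using a h Fa_Arrs[of f] Fa_Arrs[of g] cp_Fo[OF h] Fa_apply[of f "src f" "tgt f" h]
        Fa_apply[of g "src f" "tgt f" h] Fa_apply[of "g \<boxplus> f" "src f" "tgt f" h]
        add_Fo[of "g \<cdot> h" "tgt f" "f \<cdot> h"]
      by (simp add: plus_cmp)
  qed (use a Fa_Arrs[of f] Fa_Arrs[of g] Fa_Arrs[of "g \<boxplus> f"] in auto)
next
  assume X: "X \<in> Ob"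
  show "Fa (idn X) = R.cidn (Fo X)"
  proof (rule Fa_eqI[of _ _ X])
    fix h assume h: "hom h T X"
    show "afun (Fa (idn X)) (R.cp (Hmod X) h) = afun (R.cidn (Fo X)) (R.cp (Hmod X) h)"
      using X h cp_Fo[OF h] Fa_apply[of "idn X" X X h] Fo_Obs by simp
  qed (use X Fa_Arrs[of "idn X"] Fo_Obs in auto)
next
  assume X: "X \<in> Ob" "Y \<in> Ob"
  show "Fa (zer X Y) = R.czer (Fo X) (Fo Y)"
  proof (rule Fa_eqI[of _ _ X])
    fix h assume h: "hom h T X"
    show "afun (Fa (zer X Y)) (R.cp (Hmod X) h) = afun (R.czer (Fo X) (Fo Y)) (R.cp (Hmod X) h)"
      using X h cp_Fo[OF h] Fa_apply[of "zer X Y" X Y h] Fo_Obs by (simp add: zero_Fo)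
  qed (use X Fa_Arrs[of "zer X Y"] Fo_Obs in auto)
qed

text \<open>The identification of Hom(T, T) with the regular module, by the inverse of \<theta>. The
  element \<open>gT\<close>, which is the identity of \<open>T\<close>, corresponds to the
  generator.\<close>

definition toG :: "('k, 'r) arrow" where
  "toG = (Fo T, \<lambda>y\<in>carrier (Fo T). R.cp (regular R) (itheta (R.uncp (Hmod T) y)), R.G)"

definition gT :: "nat \<Rightarrow> 'k" where "gT = R.cp (Hmod T) (idn T)"

lemma gT: "gT \<in> carrier (Fo T)"
  using cp_Fo[of "idn T" T] T_Ob by (simp add: gT_def)

lemma toG_apply: "hom h T T \<Longrightarrow> afun toG (R.cp (Hmod T) h) = R.cp (regular R) (itheta h)"
  using cp_Fo[of h T] uncp_cp_Fo[of h T] by (simp add: toG_def)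

lemma toG: "toG \<in> R.Arrs" "asrc toG = Fo T" "atgt toG = R.G"
proof -
  have cpG: "R.cp (regular R) r \<in> carrier R.G" if "r \<in> carrier R" for r
    using R.cp_closed[of r "regular R"] that by (simp add: R.G_def)
  have ia: "itheta (f \<boxplus> g) = itheta f \<oplus>\<^bsub>R\<^esub> itheta g" if "hom f T T" "hom g T T" for f g
    using theta_add[of "itheta f" "itheta g"] itheta[OF that(1)] itheta[OF that(2)]
      itheta_theta[of "itheta f \<oplus>\<^bsub>R\<^esub> itheta g"] by simp
  have im: "itheta (f \<cdot> \<theta> r) = r \<otimes>\<^bsub>R\<^esub> itheta f" if "hom f T T" "r \<in> carrier R" for f r
    using theta_mult[of r "itheta f"] itheta[OF that(1)] that(2)
      itheta_theta[of "r \<otimes>\<^bsub>R\<^esub> itheta f"] by simp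
  have "restrict (\<lambda>y. R.cp (regular R) (itheta (R.uncp (Hmod T) y))) (carrier (Fo T)) \<in> mod_hom R (Fo T) R.G"
  proof (rule mod_hom_restrictI[OF R.ObsD(2)[OF Fo_Obs[OF T_Ob]]])
    fix y assume "y \<in> carrier (Fo T)"
    then obtain f where f: "hom f T T" "y = R.cp (Hmod T) f" using FoE by blast
    show "R.cp (regular R) (itheta (R.uncp (Hmod T) y)) \<in> carrier R.G"
      unfolding f(2) uncp_cp_Fo[OF f(1)] by (rule cpG[OF itheta(1)[OF f(1)]])
    {
      fix z assume "z \<in> carrier (Fo T)"
      then obtain g where g: "hom g T T" "z = R.cp (Hmod T) g" using FoE by blast
      have fg: "hom (f \<boxplus> g) T T" using f g by auto
      show "R.cp (regular R) (itheta (R.uncp (Hmod T) (y \<oplus>\<^bsub>Fo T\<^esub> z))) =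
          R.cp (regular R) (itheta (R.uncp (Hmod T) y)) \<oplus>\<^bsub>R.G\<^esub> R.cp (regular R) (itheta (R.uncp (Hmod T) z))"
        unfolding f(2) g(2) add_Fo[OF f(1) g(1)] uncp_cp_Fo[OF f(1)] uncp_cp_Fo[OF g(1)]
          uncp_cp_Fo[OF fg] ia[OF f(1) g(1)]
        using R.fg_regular itheta(1)[OF f(1)] itheta(1)[OF g(1)] by (simp add: R.G_def R.copy_def)
    }
    fix r assume r: "r \<in> carrier R"
    have fr: "hom (f \<cdot> \<theta> r) T T" using f theta[OF r] by auto
    show "R.cp (regular R) (itheta (R.uncp (Hmod T) (r \<odot>\<^bsub>Fo T\<^esub> y))) =
        r \<odot>\<^bsub>R.G\<^esub> R.cp (regular R) (itheta (R.uncp (Hmod T) y))"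
      unfolding f(2) smult_Fo[OF f(1)] uncp_cp_Fo[OF f(1)] uncp_cp_Fo[OF fr] im[OF f(1) r]
      using R.fg_regular itheta(1)[OF f(1)] r by (simp add: R.G_def R.copy_def)
  qed
  then show "toG \<in> R.Arrs" using Fo_Obs[OF T_Ob] R.G_Obs by (simp add: toG_def R.Arrs_iff)
qed (simp_all add: toG_def)

lemma toG_gT: "afun toG gT = R.gen_elem"
  using toG_apply[of "idn T"] T_Ob itheta_theta[of "\<one>\<^bsub>R\<^esub>"]
  by (simp add: gT_def R.gen_elem_def theta_one)

text \<open>The image of \<open>T\<close> is a retract of the regular module: \<open>toG\<close>
  followed by the map sending the generator to \<open>gT\<close> is the identity.\<close>

lemma FT_proj: "R.mc.proj (Fo T)"
proof (rule R.mc.proj_retract[OF R.G_proj])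
  show "R.mc.hom toG (Fo T) R.G" using toG by simp
  note p = R.pt[OF Fo_Obs[OF T_Ob] gT]
  show "R.mc.hom (R.pt (Fo T) gT) R.G (Fo T)" by (rule p)
  show "R.ccmp (R.pt (Fo T) gT) toG = R.cidn (Fo T)"
  proof (rule Fa_eqI[of _ _ T])
    fix h assume h: "hom h T T"
    have g: "afun toG (R.cp (Hmod T) h) \<in> carrier R.G" using toG cp_Fo[OF h] by simp
    have "afun (R.ccmp (R.pt (Fo T) gT) toG) (R.cp (Hmod T) h) =
        R.uncp (regular R) (R.cp (regular R) (itheta h)) \<odot>\<^bsub>Fo T\<^esub> gT"
      using toG p(1) cp_Fo[OF h] p(3)[OF g] toG_apply[OF h] by simp
    also have "\<dots> = itheta h \<odot>\<^bsub>Fo T\<^esub> gT"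
      using R.fg_regular itheta(1)[OF h] by simp
    also have "\<dots> = R.cp (Hmod T) h"
      unfolding gT_def using smult_Fo[of "idn T" T "itheta h"] T_Ob itheta(2)[OF h] h by simp
    finally show "afun (R.ccmp (R.pt (Fo T) gT) toG) (R.cp (Hmod T) h) =
        afun (R.cidn (Fo T)) (R.cp (Hmod T) h)"
      using Fo_Obs[OF T_Ob] cp_Fo[OF h] by simp
  qed (use toG p Fo_Obs[OF T_Ob] in auto)
qed

text \<open>One copy of \<open>T\<close> per generator s of \<open>V\<close>: the map
  \<open>toG\<close> followed by \<open>pt V s\<close> sends \<open>gT\<close> to s.\<close>

lemma F_gen:
  assumes V: "V \<in> R.Obs" shows "\<exists>X e. addc T X \<and> R.mc.epi e \<and> R.mc.hom e (Fo X) V"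
proof -
  interpret V: left_module R V by (rule R.ObsD(2)[OF V])
  obtain S where S: "finite S" "S \<subseteq> carrier V" "spans R V S"
    using R.ObsD(1)[OF V] V.finitely_generated_iff by (auto simp: fg_module_def)
  have "\<exists>X e. addc T X \<and> R.mc.hom e (Fo X) V \<and> S \<subseteq> afun e ` carrier (Fo X)"
    using S(1,2)
  proof (induction S)
    case empty
    show ?case
      using T_Ob V Fo_Obs[OF T_Ob]
      by (intro exI[of _ T] exI[of _ "R.czer (Fo T) V"]) (auto intro: addc_self)
  next
    case (insert s S)
    then obtain X e where e: "addc T X" "R.mc.hom e (Fo X) V" "S \<subseteq> afun e ` carrier (Fo X)"
      by auto
    have s: "s \<in> carrier V" using insert by simp
    have X: "X \<in> Ob" by (rule addc_Ob[OF e(1)])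
    obtain Z i j p q where bp: "biprod X T Z i j p q"
      using biprod_ex[OF X T_Ob] by auto
    then have b: "hom i X Z" "hom j T Z" "hom p Z X" "hom q Z T"
      "p \<cdot> i = idn X" "q \<cdot> j = idn T" "q \<cdot> i = zer X T" "p \<cdot> j = zer T X"
      by (auto simp: biprod_def)
    note F = Fa_Arrs[of i] Fa_Arrs[of j] Fa_Arrs[of p] Fa_Arrs[of q]
    have Fb: "R.ccmp (Fa p) (Fa i) = R.cidn (Fo X)" "R.ccmp (Fa q) (Fa j) = R.cidn (Fo T)"
      "R.ccmp (Fa q) (Fa i) = R.czer (Fo X) (Fo T)" "R.ccmp (Fa p) (Fa j) = R.czer (Fo T) (Fo X)"
      using b X T_Ob by (simp_all add: Fa_laws[symmetric])
    note t = R.pt[OF V s]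
    let ?t = "R.ccmp (R.pt V s) toG"
    have t': "R.mc.hom ?t (Fo T) V" using t toG by auto
    let ?e = "R.cplus (R.ccmp e (Fa p)) (R.ccmp ?t (Fa q))"
    have e': "R.mc.hom ?e (Fo Z) V" using e b F t' by auto
    have ei: "R.ccmp ?e (Fa i) = e"
      using b e t' F Fb Fo_Obs[OF T_Ob] Fo_Obs[OF X] V
      by (simp add: R.mc.plus_cmp R.mc.cmp_assoc[of e] R.mc.cmp_assoc[of ?t])
    have ej: "R.ccmp ?e (Fa j) = ?t"
      using b e t' F Fb Fo_Obs[OF T_Ob] Fo_Obs[OF X] V
      by (simp add: R.mc.plus_cmp R.mc.cmp_assoc[of e] R.mc.cmp_assoc[of ?t])
    have im: "afun ?e (afun k x) = afun (R.ccmp ?e k) x" if "R.mc.hom k W (Fo Z)" "x \<in> carrier W" for k W x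
      using that e' by simp
    have hi: "R.mc.hom (Fa i) (Fo X) (Fo Z)" "R.mc.hom (Fa j) (Fo T) (Fo Z)" using b F by auto
    have "afun e x \<in> afun ?e ` carrier (Fo Z)" if x: "x \<in> carrier (Fo X)" for x
      using im[OF hi(1) x] unfolding ei using hi(1) x by (metis R.afun_closed imageI)
    moreover have "s \<in> afun ?e ` carrier (Fo Z)"
    proof -
      have "afun ?t gT = s" using t toG gT toG_gT by simp
      then show ?thesis
        using im[OF hi(2) gT] unfolding ej using hi(2) gT by (metis R.afun_closed imageI)
    qed
    ultimately have "insert s S \<subseteq> afun ?e ` carrier (Fo Z)" using e(3) by auto
    then show ?case
      using e' addc_biprod[OF e(1) addc_self[OF T_Ob] bp] by (intro exI[of _ Z] exI[of _ ?e]) auto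
  qed
  then obtain X e where e: "addc T X" "R.mc.hom e (Fo X) V" "S \<subseteq> afun e ` carrier (Fo X)"
    by auto
  then have eA: "e \<in> R.Arrs" by simp
  interpret module_pair R "asrc e" "atgt e" by (rule R.ArrsD(5)[OF eA])
  have "submod R V (afun e ` carrier (Fo X))"
    using submod_image[OF R.ArrsD(3)[OF eA] M.submod_carrier] e(2) by simp
  then have "carrier V \<subseteq> afun e ` carrier (Fo X)" using S(3) e(3) by (simp add: spans_def)
  then have "R.mc.epi e" using e(2) by (auto simp: R.epi_iff)
  then show ?thesis using e by blast
qed

lemma F_epi:
  assumes p: "p \<in> Arr" "lifts p T" shows "R.mc.epi (Fa p)"
proof -
  have "y \<in> afun (Fa p) ` carrier (Fo (src p))" if "y \<in> carrier (Fo (tgt p))" for y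
  proof -
    obtain f where f: "hom f T (tgt p)" "y = R.cp (Hmod (tgt p)) f" using FoE \<open>y \<in> _\<close> by blast
    obtain h where h: "hom h T (src p)" "p \<cdot> h = f" using liftsE[OF p(2) f(1)] by metis
    have "y = afun (Fa p) (R.cp (Hmod (src p)) h)" using Fa_apply[of p "src p" "tgt p" h] p h f by simp
    then show ?thesis using cp_Fo[OF h(1)] by blast
  qed
  then show ?thesis
    using Fa_Arrs[OF p(1)] by (auto simp: R.epi_iff)
qed

lemma Fa_zero_iff:
  assumes p: "hom p X Y" and f: "hom f T X"
  shows "afun (Fa p) (R.cp (Hmod X) f) = \<zero>\<^bsub>Fo Y\<^esub> \<longleftrightarrow> p \<cdot> f = zer T Y"
proof -
  have "hom (p \<cdot> f) T Y" "hom (zer T Y) T Y" using p f T_Ob by auto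
  then have "R.cp (Hmod Y) (p \<cdot> f) = R.cp (Hmod Y) (zer T Y) \<longleftrightarrow> p \<cdot> f = zer T Y"
    by (metis uncp_cp_Fo)
  then show ?thesis by (simp only: Fa_apply[OF p f] zero_Fo)
qed

lemma F_ses:
  assumes s: "ses m p" and l: "lifts p T" shows "R.mc.ses (Fa m) (Fa p)"
proof -
  note sD = sesD[OF s]
  note Fm = Fa_Arrs[OF sD(3)] and Fp = Fa_Arrs[OF sD(4)]
  have ob: "src m \<in> Ob" "src p \<in> Ob" "tgt p \<in> Ob" using sD(3,4) by simp_all
  have pp: "hom p (src p) (tgt p)" using sD(4) by simp
  show ?thesis
    unfolding R.ses_iff
  proof (intro conjI)
    show "afun (Fa p) ` carrier (asrc (Fa p)) = carrier (atgt (Fa p))"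
      using F_epi[OF sD(4) l] by (simp add: R.epi_iff)
    show "inj_on (afun (Fa m)) (carrier (asrc (Fa m)))"
    proof (rule inj_onI)
      fix x y assume xy: "x \<in> carrier (asrc (Fa m))" "y \<in> carrier (asrc (Fa m))" "afun (Fa m) x = afun (Fa m) y"
      have xyF: "x \<in> carrier (Fo (src m))" "y \<in> carrier (Fo (src m))" using xy(1,2) Fm(2) by simp_all
      obtain f where f: "hom f T (src m)" "x = R.cp (Hmod (src m)) f" by (rule FoE[OF xyF(1)])
      obtain g where g: "hom g T (src m)" "y = R.cp (Hmod (src m)) g" by (rule FoE[OF xyF(2)])
      have m: "hom m (src m) (tgt m)" using sD(3) by simp
      have h: "hom (m \<cdot> f) T (tgt m)" "hom (m \<cdot> g) T (tgt m)" using f(1) g(1) sD(3) by simp_all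
      have "R.cp (Hmod (tgt m)) (m \<cdot> f) = R.cp (Hmod (tgt m)) (m \<cdot> g)"
        using xy(3) unfolding f(2) g(2) by (simp only: Fa_apply[OF m f(1)] Fa_apply[OF m g(1)])
      then have "m \<cdot> f = m \<cdot> g" using uncp_cp_Fo[OF h(1)] uncp_cp_Fo[OF h(2)] by metis
      then have "f = g" by (rule mono_cancel[OF sD(1) f(1) g(1)])
      then show "x = y" unfolding f(2) g(2) by simp
    qed
    show "afun (Fa m) ` carrier (asrc (Fa m)) = {x \<in> carrier (asrc (Fa p)). afun (Fa p) x = \<zero>\<^bsub>atgt (Fa p)\<^esub>}"
      unfolding Fm(2) Fp(2,3)
    proof (intro equalityI subsetI)
      fix y assume "y \<in> afun (Fa m) ` carrier (Fo (src m))"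
      then obtain x where x: "x \<in> carrier (Fo (src m))" "y = afun (Fa m) x" by blast
      obtain f where f: "hom f T (src m)" "x = R.cp (Hmod (src m)) f" by (rule FoE[OF x(1)])
      have h: "hom (m \<cdot> f) T (src p)" using f(1) sD(3,5) by simp
      have m: "hom m (src m) (src p)" using sD(3,5) by simp
      have y: "y = R.cp (Hmod (src p)) (m \<cdot> f)" unfolding x(2) f(2) by (rule Fa_apply[OF m f(1)])
      have "p \<cdot> (m \<cdot> f) = zer T (tgt p)" using f(1) ob by (simp add: reassoc[OF sD(6)])
      then show "y \<in> {x \<in> carrier (Fo (src p)). afun (Fa p) x = \<zero>\<^bsub>Fo (tgt p)\<^esub>}"
        using cp_Fo[OF h] Fa_zero_iff[OF pp h] unfolding y by blast
    next
      fix y assume "y \<in> {x \<in> carrier (Fo (src p)). afun (Fa p) x = \<zero>\<^bsub>Fo (tgt p)\<^esub>}"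
      then have y: "y \<in> carrier (Fo (src p))" "afun (Fa p) y = \<zero>\<^bsub>Fo (tgt p)\<^esub>" by auto
      obtain f where f: "hom f T (src p)" "y = R.cp (Hmod (src p)) f" by (rule FoE[OF y(1)])
      have "p \<cdot> f = zer T (tgt p)" using y(2) Fa_zero_iff[OF pp f(1)] unfolding f(2) by blast
      then obtain v where v: "hom v T (src m)" "m \<cdot> v = f" using ses_lift[OF s f(1)] by blast
      have m: "hom m (src m) (src p)" using sD(3,5) by simp
      have "y = afun (Fa m) (R.cp (Hmod (src m)) v)"
        unfolding f(2) Fa_apply[OF m v(1)] v(2) by (rule refl)
      then show "y \<in> afun (Fa m) ` carrier (Fo (src m))" using cp_Fo[OF v(1)] by (rule image_eqI)
    qed
  qed (insert Fm(1) Fp(1) Fm(3) Fp(2) sD(5), simp_all)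
qed

sublocale F: hom_functor Ob Arr src tgt cmp idn plus neg zer
  R.Obs R.Arrs asrc atgt R.ccmp R.cidn R.cplus R.cneg R.czer T Fo Fa
proof
  show "\<exists>f. hom f T X \<and> Fa f = u" if X: "X \<in> Ob" and u: "R.mc.hom u (Fo T) (Fo X)" for X u
  proof -
    \<comment> \<open>Yoneda: the preimage of \<open>u\<close> is the map T \<rightarrow> X that
      \<open>u\<close> assigns to the identity of \<open>T\<close>, since \<open>gT\<close>
      generates \<open>Fo T\<close>.\<close>
    have ug: "afun u gT \<in> carrier (Fo X)" using u gT by simp
    obtain f where f: "hom f T X" "afun u gT = R.cp (Hmod X) f" by (rule FoE[OF ug])
    have "Fa f = u"
    proof (rule Fa_eqI[of _ _ T])
      fix h assume h: "hom h T T"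
      have gh: "R.cp (Hmod T) h = itheta h \<odot>\<^bsub>Fo T\<^esub> gT"
        unfolding gT_def using smult_Fo[of "idn T" T "itheta h"] T_Ob itheta(2)[OF h] h by simp
      have "afun u (R.cp (Hmod T) h) = itheta h \<odot>\<^bsub>Fo X\<^esub> afun u gT"
        unfolding gh using R.afun_smult[of u gT "itheta h"] u gT itheta(1)[OF h] by simp
      also have "\<dots> = R.cp (Hmod X) (f \<cdot> h)"
        using f smult_Fo[OF f(1)] itheta(2)[OF h] by simp
      finally show "afun (Fa f) (R.cp (Hmod T) h) = afun u (R.cp (Hmod T) h)"
        using Fa_apply[OF f(1) h] by simp
    qed (use f(1) u Fa_Arrs[of f] in simp_all)
    with f show ?thesis by blast
  qed
  show "f = g" if f: "hom f T X" and g: "hom g T X" and e: "Fa f = Fa g" for f g X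
  proof -
    have "R.cp (Hmod X) (f \<cdot> idn T) = R.cp (Hmod X) (g \<cdot> idn T)"
      using e Fa_apply[OF f, of "idn T"] Fa_apply[OF g, of "idn T"] T_Ob by simp
    then have "R.cp (Hmod X) f = R.cp (Hmod X) g" using f g by simp
    then show ?thesis using uncp_cp_Fo[OF f] uncp_cp_Fo[OF g] by metis
  qed
  show "T \<in> Ob" by (rule T_Ob)
  show "Fo X \<in> R.Obs" if "X \<in> Ob" for X by (rule Fo_Obs[OF that])
  show "Fa f \<in> R.Arrs" "asrc (Fa f) = Fo (src f)" "atgt (Fa f) = Fo (tgt f)" if "f \<in> Arr" for f
    by (rule Fa_Arrs[OF that])+
  show "Fa (g \<cdot> f) = R.ccmp (Fa g) (Fa f)" if "g \<in> Arr" "f \<in> Arr" "src g = tgt f" for g f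
    by (rule Fa_laws(1)[OF that])
  show "Fa (g \<boxplus> f) = R.cplus (Fa g) (Fa f)"
    if "g \<in> Arr" "f \<in> Arr" "src g = src f" "tgt g = tgt f" for g f
    by (rule Fa_laws(2)[OF that])
  show "Fa (idn X) = R.cidn (Fo X)" if "X \<in> Ob" for X by (rule Fa_laws(3)[OF that])
  show "Fa (zer X Y) = R.czer (Fo X) (Fo Y)" if "X \<in> Ob" "Y \<in> Ob" for X Y
    by (rule Fa_laws(4)[OF that])
  show "R.mc.proj (Fo T)" by (rule FT_proj)
  show "\<exists>X e. addc T X \<and> R.mc.epi e \<and> R.mc.hom e (Fo X) V" if "V \<in> R.Obs" for V
    by (rule F_gen[OF that])
  show "R.mc.epi (Fa p)" if "p \<in> Arr" "lifts p T" for p by (rule F_epi[OF that])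
  show "R.mc.ses (Fa m) (Fa p)" if "ses m p" "lifts p T" for m p by (rule F_ses[OF that])
qed

end

section \<open>Comparison with resolutions of modules\<close>

context fdalg
begin

section \<open>Modules and resolutions as objects and short exact sequences\<close>

lemma projective_iff: "P \<in> Obs \<Longrightarrow> projective A P \<longleftrightarrow> mc.proj P"
proof
  assume P: "P \<in> Obs" and p: "projective A P"
  show "mc.proj P"
    unfolding mc.proj_def
  proof (intro conjI allI impI P)
    fix e f assume e: "mc.epi e" and f: "mc.hom f P (atgt e)"
    have e': "e \<in> Arrs" "afun e ` carrier (asrc e) = carrier (atgt e)" using e epi_iff by auto
    have fh: "afun f \<in> mod_hom A P (atgt e)" using ArrsD(3)[of f] f by auto
    have "\<exists>h\<in>mod_hom A P (asrc e). \<forall>x\<in>carrier P. afun e (h x) = afun f x"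
      by (rule p[unfolded projective_def, THEN conjunct2, rule_format, of "asrc e" "atgt e"])
        (simp_all add: ObsD(1) ArrsD(1-3)[OF e'(1)] fh e'(2))
    then obtain h where h: "h \<in> mod_hom A P (asrc e)" "\<And>x. x \<in> carrier P \<Longrightarrow> afun e (h x) = afun f x"
      by blast
    have hA: "mc.hom (P, h, asrc e) P (asrc e)" using h(1) P ArrsD(1)[OF e'(1)] by (simp add: Arrs_iff)
    have "ccmp e (P, h, asrc e) = f"
      by (rule arr_eqI) (use hA e' f h(2) in simp_all)
    with hA show "\<exists>h. mc.hom h P (asrc e) \<and> ccmp e h = f" by blast
  qed
next
  assume P: "P \<in> Obs" and p: "mc.proj P"
  show "projective A P"
    unfolding projective_def
  proof (intro conjI allI impI ballI ObsD(1)[OF P])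
    fix M N :: "('k, 'a) fmodule" and g f
    assume MN: "fg_module A M \<and> fg_module A N" and g: "g \<in> mod_hom A M N"
      and f: "f \<in> mod_hom A P N" and s: "g ` carrier M = carrier N"
    have gA: "(M, g, N) \<in> Arrs" and fA: "(P, f, N) \<in> Arrs" using MN g f P by (simp_all add: Arrs_iff Obs_def)
    have "mc.epi (M, g, N)" using gA s by (simp add: epi_iff)
    then obtain h where h: "mc.hom h P M" "ccmp (M, g, N) h = (P, f, N)"
      using mc.projE[OF p, of "(M, g, N)" "(P, f, N)"] fA by auto
    have "g (afun h x) = f x" if "x \<in> carrier P" for x
    proof -
      have "afun (ccmp (M, g, N) h) x = g (afun h x)" using gA h(1) that by simp
      then show ?thesis using h(2) by simp
    qed
    moreover have "afun h \<in> mod_hom A P M" using ArrsD(3)[of h] h(1) by auto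
    ultimately show "\<exists>h\<in>mod_hom A P M. \<forall>x\<in>carrier P. g (h x) = f x" by blast
  qed
qed

lemma injective_imp:
  assumes P: "P \<in> Obs" and p: "injective A P"
  shows "mc.inj P"
  unfolding mc.inj_def
proof (intro conjI allI impI P)
  fix e f assume e: "mc.mono e" and f: "mc.hom f (asrc e) P"
  have e': "e \<in> Arrs" "inj_on (afun e) (carrier (asrc e))" using e mono_iff by auto
  have fh: "afun f \<in> mod_hom A (asrc e) P" using ArrsD(3)[of f] f by auto
  have "\<exists>h\<in>mod_hom A (atgt e) P. \<forall>x\<in>carrier (asrc e). h (afun e x) = afun f x"
    by (rule p[unfolded injective_def, THEN conjunct2, rule_format, of "asrc e" "atgt e"])
      (simp_all add: ObsD(1) ArrsD(1-3)[OF e'(1)] fh e'(2))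
  then obtain h where h: "h \<in> mod_hom A (atgt e) P" "\<And>x. x \<in> carrier (asrc e) \<Longrightarrow> h (afun e x) = afun f x"
    by blast
  have hA: "mc.hom (atgt e, h, P) (atgt e) P" using h(1) P ArrsD(2)[OF e'(1)] by (simp add: Arrs_iff)
  have "ccmp (atgt e, h, P) e = f"
    by (rule arr_eqI) (use hA e' f h(2) in simp_all)
  with hA show "\<exists>h. mc.hom h (atgt e) P \<and> ccmp h e = f" by blast
qed

text \<open>The syzygy \<open>W (Suc j)\<close> is the image of \<open>d j\<close> inside
  \<open>X j\<close>, so exactness of the resolution turns into exactness of the pieces in the
  middle.\<close>

lemma left_resolution_ses:
  assumes r: "left_resolution A M X \<epsilon> d" and M: "M \<in> Obs"
  obtains W w e where "W 0 = M" "\<And>j. mc.ses (w j) (e j)" "\<And>j. mc.hom (w j) (W (Suc j)) (X j)"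
    "\<And>j. mc.hom (e j) (X j) (W j)" "\<And>j. (X (Suc j), d j, X j) = ccmp (w j) (e (Suc j))"
    "\<And>j. carrier (W (Suc j)) = d j ` carrier (X (Suc j))"
proof -
  have X: "X j \<in> Obs" for j using r by (simp add: left_resolution_def Obs_def)
  have d: "d j \<in> mod_hom A (X (Suc j)) (X j)" for j using r by (simp add: left_resolution_def)
  have e: "\<epsilon> \<in> mod_hom A (X 0) M" "\<epsilon> ` carrier (X 0) = carrier M" using r by (auto simp: left_resolution_def)
  let ?I = "\<lambda>j. d j ` carrier (X (Suc j))"
  have I: "submod A (X j) (?I j)" for j
  proof -
    interpret module_pair A "X (Suc j)" "X j" by (intro module_pair.intro ObsD(2) X)
    show ?thesis by (rule submod_image[OF d M.submod_carrier])
  qed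
  define W where "W j = (case j of 0 \<Rightarrow> M | Suc i \<Rightarrow> (X i)\<lparr>carrier := ?I i\<rparr>)" for j
  define w where "w j = (W (Suc j), \<lambda>x\<in>?I j. x, X j)" for j
  define e where "e j = (X j, case j of 0 \<Rightarrow> \<epsilon> | Suc i \<Rightarrow> d i, W j)" for j
  have W: "W j \<in> Obs" for j
    by (cases j) (simp_all add: W_def M submodule_Obs(1)[OF X I])
  have w: "mc.hom (w j) (W (Suc j)) (X j)" for j
    using submodule_Obs(2)[OF X I, of j] by (simp add: w_def W_def)
  have eA: "mc.hom (e j) (X j) (W j)" for j
  proof (cases j)
    case 0
    then show ?thesis using e X M by (simp add: e_def W_def Arrs_iff)
  next
    case (Suc i)
    have "d i \<in> mod_hom A (X (Suc i)) (W (Suc i))"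
      using d[of i] by (auto simp: mod_hom_def W_def)
    then show ?thesis using Suc X W by (simp add: e_def Arrs_iff)
  qed
  have s: "mc.ses (w j) (e j)" for j
    unfolding ses_iff
  proof (intro conjI)
    show "inj_on (afun (w j)) (carrier (asrc (w j)))" by (auto simp: w_def W_def intro: inj_onI)
    show "afun (e j) ` carrier (asrc (e j)) = carrier (atgt (e j))"
      using e by (cases j) (simp_all add: e_def W_def)
    have "afun (w j) ` carrier (asrc (w j)) = ?I j" by (simp add: w_def W_def)
    also have "\<dots> = {x \<in> carrier (asrc (e j)). afun (e j) x = \<zero>\<^bsub>atgt (e j)\<^esub>}"
      using r by (cases j) (simp_all add: left_resolution_def exact_at_def e_def W_def)
    finally show "afun (w j) ` carrier (asrc (w j)) = {x \<in> carrier (asrc (e j)). afun (e j) x = \<zero>\<^bsub>atgt (e j)\<^esub>}" .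
  qed (use w[of j] eA[of j] in simp_all)
  have "(X (Suc j), d j, X j) = ccmp (w j) (e (Suc j))" for j
  proof (rule arr_eqI)
    show "(X (Suc j), d j, X j) \<in> Arrs" using d X by (simp add: Arrs_iff)
    show "ccmp (w j) (e (Suc j)) \<in> Arrs" using w[of j] eA[of "Suc j"] by simp
    show "asrc (X (Suc j), d j, X j) = asrc (ccmp (w j) (e (Suc j)))"
      "atgt (X (Suc j), d j, X j) = atgt (ccmp (w j) (e (Suc j)))"
      using w[of j] eA[of "Suc j"] by simp_all
    fix x assume "x \<in> carrier (asrc (ccmp (w j) (e (Suc j))))"
    then have x: "x \<in> carrier (X (Suc j))" using w[of j] eA[of "Suc j"] by simp
    have "afun (ccmp (w j) (e (Suc j))) x = afun (w j) (afun (e (Suc j)) x)"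
      using w[of j] eA[of "Suc j"] x by simp
    also have "\<dots> = d j x" using x by (simp add: w_def e_def)
    finally show "afun (X (Suc j), d j, X j) x = afun (ccmp (w j) (e (Suc j))) x" by simp
  qed
  note c = this
  have W0: "W 0 = M" and WS: "carrier (W (Suc j)) = ?I j" for j by (simp_all add: W_def)
  show ?thesis by (rule that[OF W0 s w eA c WS])
qed

text \<open>Cosyzygies are taken as images inside the next term rather than as cokernels, so no
  quotient modules enter.\<close>

lemma right_resolution_ses:
  assumes r: "right_resolution A M X \<eta> d" and M: "M \<in> Obs"
  obtains Z a b where "Z 0 = M" "\<And>j. mc.ses (a j) (b j)" "\<And>j. mc.hom (a j) (Z j) (X j)"
    "\<And>j. mc.hom (b j) (X j) (Z (Suc j))"
    "\<And>j. carrier (Z (Suc j)) = d j ` carrier (X j)"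
proof -
  have X: "X j \<in> Obs" for j using r by (simp add: right_resolution_def Obs_def)
  have d: "d j \<in> mod_hom A (X j) (X (Suc j))" for j using r by (simp add: right_resolution_def)
  have e: "\<eta> \<in> mod_hom A M (X 0)" "inj_on \<eta> (carrier M)" using r by (auto simp: right_resolution_def)
  let ?I = "\<lambda>j. d j ` carrier (X j)"
  have I: "submod A (X (Suc j)) (?I j)" for j
  proof -
    interpret module_pair A "X j" "X (Suc j)" by (intro module_pair.intro ObsD(2) X)
    show ?thesis by (rule submod_image[OF d M.submod_carrier])
  qed
  define Z where "Z j = (case j of 0 \<Rightarrow> M | Suc i \<Rightarrow> (X (Suc i))\<lparr>carrier := ?I i\<rparr>)" for j
  define a where "a j = (Z j, case j of 0 \<Rightarrow> \<eta> | Suc i \<Rightarrow> (\<lambda>x\<in>?I i. x), X j)" for j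
  define b where "b j = (X j, d j, Z (Suc j))" for j
  have Z: "Z j \<in> Obs" for j
    by (cases j) (simp_all add: Z_def M submodule_Obs(1)[OF X I])
  have aA: "mc.hom (a j) (Z j) (X j)" for j
  proof (cases j)
    case 0
    then show ?thesis using e X M by (simp add: a_def Z_def Arrs_iff)
  next
    case (Suc i)
    then show ?thesis using submodule_Obs(2)[OF X I, of i] by (simp add: a_def Z_def)
  qed
  have bA: "mc.hom (b j) (X j) (Z (Suc j))" for j
  proof -
    have "d j \<in> mod_hom A (X j) (Z (Suc j))"
      using d[of j] by (auto simp: mod_hom_def Z_def)
    then show ?thesis using X Z by (simp add: b_def Arrs_iff)
  qed
  have s: "mc.ses (a j) (b j)" for j
    unfolding ses_iff
  proof (intro conjI)
    show "inj_on (afun (a j)) (carrier (asrc (a j)))"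
      using e by (cases j) (auto simp: a_def Z_def intro: inj_onI)
    show "afun (b j) ` carrier (asrc (b j)) = carrier (atgt (b j))"
      by (simp add: b_def Z_def)
    show "afun (a j) ` carrier (asrc (a j)) = {x \<in> carrier (asrc (b j)). afun (b j) x = \<zero>\<^bsub>atgt (b j)\<^esub>}"
      using r by (cases j) (simp_all add: right_resolution_def exact_at_def b_def a_def Z_def)
  qed (use aA[of j] bA[of j] in simp_all)
  have Z0: "Z 0 = M" and ZS: "carrier (Z (Suc j)) = ?I j" for j by (simp_all add: Z_def)
  show ?thesis by (rule that[OF Z0 s aA bA ZS])
qed

section \<open>Finite resolutions and the vanishing of Ext\<close>

lemma zero_module_arrow:
  assumes "mc.hom f X Y" "zero_module X" shows "f = czer X Y"
proof (rule arr_eqI)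
  have Ob: "X \<in> Obs" "Y \<in> Obs" using assms(1) ArrsD(1,2)[of f] by auto
  show "f \<in> Arrs" "czer X Y \<in> Arrs" "asrc f = asrc (czer X Y)" "atgt f = atgt (czer X Y)"
    using assms(1) Ob by simp_all
  fix x assume "x \<in> carrier (asrc (czer X Y))"
  then have x: "x = \<zero>\<^bsub>X\<^esub>" "x \<in> carrier X" using assms(2) Ob by (simp_all add: zero_module_def)
  have "afun f x = \<zero>\<^bsub>Y\<^esub>" using afun_zero[of f] assms(1) x by simp
  then show "afun f x = afun (czer X Y) x" using x(2) Ob by simp
qed

lemma hom_image_zero:
  assumes "f \<in> mod_hom A X Y" "zero_module X" "X \<in> Obs" "Y \<in> Obs"
  shows "f ` carrier X = {\<zero>\<^bsub>Y\<^esub>}"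
proof -
  interpret module_pair A X Y by (intro module_pair.intro ObsD(2) assms)
  show ?thesis using assms(2) hom_zero[OF assms(1)] by (simp add: zero_module_def)
qed

lemma ses_zero_right:
  assumes s: "mc.ses a b" and z: "carrier (atgt b) = {\<zero>\<^bsub>atgt b\<^esub>}"
  shows "\<exists>r. mc.hom r (atgt a) (asrc a) \<and> ccmp r a = cidn (asrc a)"
proof -
  note sD = mc.sesD[OF s]
  let ?Y = "atgt a"
  have Ob: "?Y \<in> Obs" "asrc a \<in> Obs" "atgt b \<in> Obs" using sD(3,4) ArrsD(1,2) by auto
  have "ccmp b (cidn ?Y) = czer ?Y (atgt b)"
  proof (rule arr_eqI)
    fix x assume "x \<in> carrier (asrc (czer ?Y (atgt b)))"
    then have x: "x \<in> carrier (asrc b)" using Ob sD(5) by simp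
    then have "afun b x = \<zero>\<^bsub>atgt b\<^esub>" using z ArrsD(4)[OF sD(4) x] by blast
    then show "afun (ccmp b (cidn ?Y)) x = afun (czer ?Y (atgt b)) x" using x Ob sD(4,5) by simp
  qed (use Ob sD(4,5) in simp_all)
  then obtain v where v: "mc.hom v ?Y (asrc a)" "ccmp a v = cidn ?Y"
    using mc.ses_lift[OF s, of "cidn ?Y" ?Y] Ob sD(5) by auto
  have "ccmp a (ccmp v a) = ccmp a (cidn (asrc a))"
    using v sD(3) Ob by (simp add: mc.reassoc[OF v(2)])
  then have "ccmp v a = cidn (asrc a)"
    using mc.mono_cancel[OF sD(1), of "ccmp v a" "asrc a" "cidn (asrc a)"] v(1) sD(3) Ob by simp
  with v(1) show ?thesis by blast
qed

lemma ses_zero_left: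
  assumes s: "mc.ses a b" and z: "carrier (asrc a) = {\<zero>\<^bsub>asrc a\<^esub>}"
  shows "\<exists>r. mc.hom r (atgt b) (asrc b) \<and> ccmp b r = cidn (atgt b)"
proof -
  note sD = mc.sesD[OF s]
  let ?Y = "asrc b"
  have Ob: "?Y \<in> Obs" "asrc a \<in> Obs" "atgt b \<in> Obs" using sD(3,4) ArrsD(1,2) by auto
  have za: "a = czer (asrc a) ?Y"
    by (rule zero_module_arrow) (use sD(3,5) z in \<open>simp_all add: zero_module_def\<close>)
  have "ccmp (cidn ?Y) a = czer (asrc a) ?Y" using za mc.idn_cmp[of a ?Y] sD(3,5) by metis
  then obtain v where v: "mc.hom v (atgt b) ?Y" "ccmp v b = cidn ?Y"
    using mc.ses_desc[OF s, of "cidn ?Y" ?Y] Ob sD(5) by auto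
  have "ccmp (ccmp b v) b = ccmp (cidn (atgt b)) b"
    using v sD(4) Ob by (simp add: mc.cmp_assoc)
  then have "ccmp b v = cidn (atgt b)"
    using mc.epi_cancel[OF sD(2), of "ccmp b v" "atgt b" "cidn (atgt b)"] v(1) sD(4) Ob by simp
  with v(1) show ?thesis by blast
qed

lemma pdim_exz:
  assumes M: "M \<in> Obs" and p: "pdim A M \<le> enat n" and Y: "Y \<in> Obs" and nm: "n \<le> m"
  shows "mc.exz m M Y"
proof -
  \<comment> \<open>The infimum is attained below n: otherwise every admissible length would be at
    least n + 1, and so would the infimum.\<close>
  have "\<exists>k P \<epsilon> d. k \<le> n \<and> projective_resolution A M P \<epsilon> d \<and> (\<forall>j>k. zero_module (P j))"
  proof (rule ccontr)
    assume c: "\<not> ?thesis"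
    have "enat (Suc n) \<le> pdim A M"
      unfolding pdim_def
    proof (rule Inf_greatest)
      fix x assume "x \<in> {enat n |n. \<exists>P \<epsilon> d. projective_resolution A M P \<epsilon> d \<and> (\<forall>j>n. zero_module (P j))}"
      then obtain k where "x = enat k" "\<exists>P \<epsilon> d. projective_resolution A M P \<epsilon> d \<and> (\<forall>j>k. zero_module (P j))"
        by blast
      with c show "enat (Suc n) \<le> x" by (metis enat_ord_simps(1) not_less_eq_eq)
    qed
    then have "enat (Suc n) \<le> enat n" using p by (rule order_trans)
    then show False by simp
  qed
  then obtain k P \<epsilon> d where k: "k \<le> n" and r: "projective_resolution A M P \<epsilon> d"
    and z: "\<And>j. k < j \<Longrightarrow> zero_module (P j)" by blast
  have lr: "left_resolution A M P \<epsilon> d" using r by (simp add: projective_resolution_def)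
  obtain W w e where W: "W 0 = M" "\<And>j. mc.ses (w j) (e j)" "\<And>j. mc.hom (w j) (W (Suc j)) (P j)"
    "\<And>j. mc.hom (e j) (P j) (W j)" "\<And>j. (P (Suc j), d j, P j) = ccmp (w j) (e (Suc j))"
    "\<And>j. carrier (W (Suc j)) = d j ` carrier (P (Suc j))"
    by (rule left_resolution_ses[OF lr M]) (rule that)
  have P: "P j \<in> Obs" for j using lr by (simp add: left_resolution_def Obs_def)
  have "mc.proj (P j)" for j using r projective_iff[OF P] by (simp add: projective_resolution_def)
  then have pres: "mc.pres (W (Suc j)) (P j) (W j) (w j) (e j)" for j
    using W(2-4) by (simp add: mc.pres_def)
  have W_Ob: "W j \<in> Obs" for j using mc.pres_Ob[OF pres] by blast
  \<comment> \<open>The syzygy after the last term vanishes, so maps out of it extend trivially, and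
    vanishing in degree one for \<open>W k\<close> climbs back to degree k + 1 for
    \<open>M\<close>.\<close>
  have zW: "zero_module (W (Suc k))"
  proof -
    have zP: "\<zero>\<^bsub>P (Suc k)\<^esub> \<in> carrier (P (Suc k))" using left_module.zero_in[OF ObsD(2)[OF P]] .
    have "afun (e (Suc k)) ` carrier (P (Suc k)) = carrier (W (Suc k))"
      using mc.sesD(2)[OF W(2)[of "Suc k"]] W(4)[of "Suc k"] by (simp add: epi_iff)
    moreover have "afun (e (Suc k)) ` carrier (P (Suc k)) = {\<zero>\<^bsub>W (Suc k)\<^esub>}"
      by (rule hom_image_zero[OF _ z P W_Ob]) (use W(4)[of "Suc k"] ArrsD(3)[of "e (Suc k)"] in auto)
    ultimately show ?thesis by (simp add: zero_module_def)
  qed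
  have E: "mc.exz k M Y'" if Y': "Y' \<in> Obs" for Y'
  proof -
    have "\<exists>v. mc.hom v (P k) Y' \<and> ccmp v (w k) = u" if u: "mc.hom u (W (Suc k)) Y'" for u
      using zero_module_arrow[OF u zW] W(3)[of k] P Y'
      by (intro exI[of _ "czer (P k) Y'"]) simp
    then have "mc.exz 0 (W k) Y'" using mc.exz0_iff_extend[OF Y' pres[of k]] by blast
    then have "mc.exz j (W (k - j)) Y'" if "j \<le> k" for j
      using that
    proof (induction j)
      case (Suc j)
      then show ?case using mc.exz_SucI[OF pres[of "k - Suc j"], of j Y'] by (simp add: Suc_diff_Suc)
    qed simp
    from this[of k] show ?thesis by (simp add: W(1))
  qed
  show ?thesis using mc.exz_mono_deg[OF E, of m Y] k nm Y by simp
qed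

lemma idim_exz:
  assumes M: "M \<in> Obs" and p: "idim A M \<le> enat n" and Y: "Y \<in> Obs" and nm: "n \<le> m"
  shows "mc.exz m Y M"
proof -
  have "\<exists>k I \<eta> d. k \<le> n \<and> injective_resolution A M I \<eta> d \<and> (\<forall>j>k. zero_module (I j))"
  proof (rule ccontr)
    assume c: "\<not> ?thesis"
    have "enat (Suc n) \<le> idim A M"
      unfolding idim_def
    proof (rule Inf_greatest)
      fix x assume "x \<in> {enat n |n. \<exists>I \<eta> d. injective_resolution A M I \<eta> d \<and> (\<forall>j>n. zero_module (I j))}"
      then obtain k where "x = enat k" "\<exists>I \<eta> d. injective_resolution A M I \<eta> d \<and> (\<forall>j>k. zero_module (I j))"
        by blast
      with c show "enat (Suc n) \<le> x" by (metis enat_ord_simps(1) not_less_eq_eq)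
    qed
    then have "enat (Suc n) \<le> enat n" using p by (rule order_trans)
    then show False by simp
  qed
  then obtain k J \<eta> d where k: "k \<le> n" and r: "injective_resolution A M J \<eta> d"
    and z: "\<And>j. k < j \<Longrightarrow> zero_module (J j)" by blast
  have lr: "right_resolution A M J \<eta> d" using r by (simp add: injective_resolution_def)
  obtain Z a b where Z: "Z 0 = M" "\<And>j. mc.ses (a j) (b j)" "\<And>j. mc.hom (a j) (Z j) (J j)"
    "\<And>j. mc.hom (b j) (J j) (Z (Suc j))" "\<And>j. carrier (Z (Suc j)) = d j ` carrier (J j)"
    by (rule right_resolution_ses[OF lr M]) (rule that)
  have P: "J j \<in> Obs" for j using lr by (simp add: right_resolution_def Obs_def)
  have "mc.inj (J j)" for j using r injective_imp[OF P] by (simp add: injective_resolution_def)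
  then have co: "mc.copres (Z j) (J j) (Z (Suc j)) (a j) (b j)" for j
    using Z(2-4) by (simp add: mc.copres_def)
  have Z_Ob: "Z j \<in> Obs" for j using mc.copres_Ob[OF co] by blast
  have zZ: "zero_module (Z (Suc k))"
  proof -
    have "inj_on (afun (a (Suc k))) (carrier (Z (Suc k)))"
      using mc.sesD(1)[OF Z(2)[of "Suc k"]] Z(3)[of "Suc k"] by (simp add: mono_iff)
    moreover have "afun (a (Suc k)) x = \<zero>\<^bsub>J (Suc k)\<^esub>" if "x \<in> carrier (Z (Suc k))" for x
    proof -
      have "afun (a (Suc k)) x \<in> carrier (J (Suc k))" using Z(3)[of "Suc k"] that by simp
      then show ?thesis using z[of "Suc k"] by (simp add: zero_module_def)
    qed
    moreover have "\<zero>\<^bsub>Z (Suc k)\<^esub> \<in> carrier (Z (Suc k))" using left_module.zero_in[OF ObsD(2)[OF Z_Ob]] .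
    ultimately have "carrier (Z (Suc k)) \<subseteq> {\<zero>\<^bsub>Z (Suc k)\<^esub>}"
      by (metis (no_types, lifting) inj_onD singletonI subsetI)
    with \<open>\<zero>\<^bsub>Z (Suc k)\<^esub> \<in> carrier (Z (Suc k))\<close> show ?thesis by (auto simp: zero_module_def)
  qed
  obtain r where rr: "mc.hom r (J k) (Z k)" "ccmp r (a k) = cidn (Z k)"
    using ses_zero_right[OF Z(2)[of k]] Z(3,4)[of k] zZ by (auto simp: zero_module_def)
  have E: "mc.exz k Y' M" if Y': "Y' \<in> Obs" for Y'
  proof -
    have "mc.exz 0 Y' (Z k)"
      by (rule mc.exz_retract2[OF Z(3)[of k] rr mc.exz_inj[OF _ Y']]) (use \<open>\<And>j. mc.inj (J j)\<close> in simp)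
    then have "mc.exz j Y' (Z (k - j))" if "j \<le> k" for j
      using that
    proof (induction j)
      case (Suc j)
      then show ?case using mc.exz_Suc_copres[OF co[of "k - Suc j"] Y', of j] by (simp add: Suc_diff_Suc)
    qed simp
    from this[of k] show ?thesis by (simp add: Z(1))
  qed
  show ?thesis
    using k nm
  proof -
    \<comment> \<open>Now the second argument is fixed, so the degree is raised by syzygies of the
      first.\<close>
    have "mc.exz j Y' M" if "Y' \<in> Obs" "k \<le> j" for Y' j
      using that(2,1)
    proof (induction arbitrary: Y' rule: dec_induct)
      case base
      then show ?case using E by blast
    next
      case (step j)
      obtain V R v q where p: "mc.pres V R Y' v q" using mc.pres_ex[OF step(4)] by metis
      then have "mc.exz j V M" using step(3) mc.pres_Ob by blast
      then show ?case by (rule mc.exz_SucI[OF p])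
    qed
    then show ?thesis using Y k nm by simp
  qed
qed

text \<open>One resolution has to witness all bounds on the projective dimension at once. Therefore
  a syzygy that is projective is taken as the next term itself, after which everything
  vanishes.\<close>

lemma projective_resolution_ex:
  assumes M: "M \<in> Obs"
  obtains P \<epsilon> d where "projective_resolution A M P \<epsilon> d"
    "\<And>n j. (\<And>Y. Y \<in> Obs \<Longrightarrow> mc.exz n M Y) \<Longrightarrow> n < j \<Longrightarrow> zero_module (P j)"
proof -
  \<comment> \<open>The trivial presentation by the identity is forced for projective objects; for
    the others any presentation does.\<close>
  have "\<exists>P w e. mc.pres (asrc w) P W w e \<and> (mc.proj W \<longrightarrow> P = W \<and> zero_module (asrc w))" if W: "W \<in> Obs" for W
  proof (cases "mc.proj W")
    case True
    have "mc.epi (cidn W)" using W by (auto simp: epi_iff)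
    then obtain w where w: "mc.ses w (cidn W)" using mc.epi_ses by blast
    note wD = mc.sesD[OF w]
    have wA: "w \<in> Arrs" "atgt w = W" "inj_on (afun w) (carrier (asrc w))"
      using wD(3,5) wD(1)[unfolded mono_iff] W by simp_all
    have w0: "w = czer (asrc w) W"
      using mc.idn_cmp[OF wA(1,2)] wD(6) cidn_Arrs(3)[OF W] by metis
    have z0: "\<zero>\<^bsub>asrc w\<^esub> \<in> carrier (asrc w)" by (rule left_module.zero_in[OF ObsD(2)[OF ArrsD(1)[OF wA(1)]]])
    have "x = \<zero>\<^bsub>asrc w\<^esub>" if "x \<in> carrier (asrc w)" for x
    proof (rule inj_onD[OF wA(3) _ that z0])
      have "afun (czer (asrc w) W) x = afun (czer (asrc w) W) \<zero>\<^bsub>asrc w\<^esub>"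
        using that z0 by (simp add: czer_def)
      then show "afun w x = afun w \<zero>\<^bsub>asrc w\<^esub>" using w0 by metis
    qed
    then have "carrier (asrc w) \<subseteq> {\<zero>\<^bsub>asrc w\<^esub>}" by blast
    then have "zero_module (asrc w)" unfolding zero_module_def using z0 by blast
    moreover have "mc.pres (asrc w) W W w (cidn W)" using w wA W True by (simp add: mc.pres_def)
    ultimately show ?thesis by (intro exI[of _ W] exI[of _ w] exI[of _ "cidn W"]) simp
  next
    case False
    obtain V P w e where p: "mc.pres V P W w e" using mc.pres_ex[OF W] by metis
    have "asrc w = V" using p by (simp add: mc.pres_def)
    then show ?thesis using p False by (intro exI[of _ P] exI[of _ w] exI[of _ e]) simp
  qed
  then obtain PP ww ee where pr: "\<And>W. W \<in> Obs \<Longrightarrow> mc.pres (asrc (ww W)) (PP W) W (ww W) (ee W)"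
    "\<And>W. W \<in> Obs \<Longrightarrow> mc.proj W \<Longrightarrow> PP W = W \<and> zero_module (asrc (ww W))"
    by metis
  define W where "W n = ((\<lambda>W. asrc (ww W)) ^^ n) M" for n
  have W0: "W 0 = M" and WS: "W (Suc n) = asrc (ww (W n))" for n by (simp_all add: W_def)
  have W: "W n \<in> Obs" for n
  proof (induction n)
    case (Suc n)
    then show ?case using mc.pres_Ob[OF pr(1)[OF Suc]] by (simp add: WS)
  qed (simp add: W0 M)
  define P where "P n = PP (W n)" for n
  define w where "w n = ww (W n)" for n
  define e where "e n = ee (W n)" for n
  have pres: "mc.pres (W (Suc n)) (P n) (W n) (w n) (e n)" for n
    using pr(1)[OF W] by (simp add: P_def w_def e_def WS)
  have s: "mc.ses (w n) (e n)" "mc.hom (w n) (W (Suc n)) (P n)" "mc.hom (e n) (P n) (W n)" "mc.proj (P n)" for n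
    using pres[of n] by (simp_all add: mc.pres_def)
  note si = s(1)[unfolded ses_iff]
  have P: "P n \<in> Obs" for n using mc.pres_Ob[OF pres] by blast
  define d where "d n = afun (ccmp (w n) (e (Suc n)))" for n
  have dA: "mc.hom (ccmp (w n) (e (Suc n))) (P (Suc n)) (P n)" for n using s(2)[of n] s(3)[of "Suc n"] by simp
  have dh: "d n \<in> mod_hom A (P (Suc n)) (P n)" for n
    using ArrsD(3)[of "ccmp (w n) (e (Suc n))"] dA[of n] by (simp add: d_def)
  have dap: "d n x = afun (w n) (afun (e (Suc n)) x)" if "x \<in> carrier (P (Suc n))" for n x
    using s(2)[of n] s(3)[of "Suc n"] that by (simp add: d_def)
  have dim: "d n ` carrier (P (Suc n)) = {x \<in> carrier (P n). afun (e n) x = \<zero>\<^bsub>W n\<^esub>}" for n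
  proof -
    have "d n ` carrier (P (Suc n)) = afun (w n) ` (afun (e (Suc n)) ` carrier (P (Suc n)))"
      using dap by (auto simp: image_image)
    also have "afun (e (Suc n)) ` carrier (P (Suc n)) = carrier (W (Suc n))"
      using si[of "Suc n"] s(3)[of "Suc n"] by simp
    finally show ?thesis using si[of n] s(2,3)[of n] by simp
  qed
  have wz: "afun (w n) y = \<zero>\<^bsub>P n\<^esub> \<longleftrightarrow> y = \<zero>\<^bsub>W (Suc n)\<^esub>" if y: "y \<in> carrier (W (Suc n))" for n y
  proof -
    have z: "\<zero>\<^bsub>W (Suc n)\<^esub> \<in> carrier (W (Suc n))" by (rule left_module.zero_in[OF ObsD(2)[OF W]])
    have "afun (w n) \<zero>\<^bsub>W (Suc n)\<^esub> = \<zero>\<^bsub>P n\<^esub>" using afun_zero[of "w n"] s(2)[of n] by simp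
    moreover have "inj_on (afun (w n)) (carrier (W (Suc n)))" using si[of n] s(2)[of n] by simp
    ultimately show ?thesis
      using inj_onD[of "afun (w n)" "carrier (W (Suc n))" y "\<zero>\<^bsub>W (Suc n)\<^esub>"] y z by auto
  qed
  have "left_resolution A M P (afun (e 0)) d"
    unfolding left_resolution_def exact_at_def
  proof (intro conjI allI dh)
    show "fg_module A (P j)" for j using ObsD(1)[OF P] .
    show "afun (e 0) \<in> mod_hom A (P 0) M" using ArrsD(3)[of "e 0"] s(3)[of 0] W0 by auto
    show "afun (e 0) ` carrier (P 0) = carrier M" using si[of 0] s(3)[of 0] W0 by simp
    show "d 0 ` carrier (P (Suc 0)) = {x \<in> carrier (P 0). afun (e 0) x = \<zero>\<^bsub>M\<^esub>}" using dim[of 0] W0 by simp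
    show "d (Suc j) ` carrier (P (Suc (Suc j))) = {x \<in> carrier (P (Suc j)). d j x = \<zero>\<^bsub>P j\<^esub>}" for j
    proof -
      have "d j x = \<zero>\<^bsub>P j\<^esub> \<longleftrightarrow> afun (e (Suc j)) x = \<zero>\<^bsub>W (Suc j)\<^esub>" if x: "x \<in> carrier (P (Suc j))" for x
        unfolding dap[OF x] by (rule wz) (use x s(3)[of "Suc j"] in simp)
      then show ?thesis unfolding dim[of "Suc j"] by blast
    qed
  qed
  then have "projective_resolution A M P (afun (e 0)) d"
    using projective_iff[OF P] s(4) by (simp add: projective_resolution_def)
  moreover have "zero_module (P j)" if E: "\<And>Y. Y \<in> Obs \<Longrightarrow> mc.exz n M Y" and j: "n < j" for n j
  proof -
    have "mc.exz (n - i) (W i) Y" if "i \<le> n" "Y \<in> Obs" for i Y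
      using that
    proof (induction i)
      case 0
      then show ?case using E W0 by simp
    next
      case (Suc i)
      then show ?case using mc.exz_Suc_pres[OF pres[of i], of Y "n - Suc i"] by (simp add: Suc_diff_Suc)
    qed
    from this[of n] have "mc.proj (W n)" by (intro mc.projI_exz W) simp
    then have z0: "zero_module (W (Suc n))" using pr(2)[OF W] WS by simp
    \<comment> \<open>A zero syzygy is projective, so the forced choice keeps all later terms
      zero.\<close>
    have step: "zero_module (P i) \<and> zero_module (W (Suc i))" if z: "zero_module (W i)" for i
    proof -
      have "mc.proj (W i)"
        unfolding mc.proj_def
      proof (intro conjI allI impI W)
        fix q f assume q: "mc.epi q" and f: "mc.hom f (W i) (atgt q)"
        have qA: "q \<in> Arrs" using q by (simp add: epi_iff)
        show "\<exists>h. mc.hom h (W i) (asrc q) \<and> ccmp q h = f"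
          using zero_module_arrow[OF f z] qA ArrsD(1)[OF qA] W
          by (intro exI[of _ "czer (W i) (asrc q)"]) simp
      qed
      then show ?thesis using pr(2)[OF W] z by (simp add: P_def WS)
    qed
    have "Suc n \<le> j" using j by simp
    then have "zero_module (W j)"
      by (induction rule: dec_induct) (use z0 step in auto)
    then show ?thesis using step by blast
  qed
  ultimately show ?thesis by (rule that)
qed

lemma gldim_le_iff: "gldim A \<le> enat n \<longleftrightarrow> mc.gl n"
proof
  assume g: "gldim A \<le> enat n"
  have "pdim A M \<le> enat n" if "M \<in> Obs" for M
    using g SUP_upper[of M "{M. fg_module A M}" "pdim A"] that unfolding gldim_def Obs_def by auto
  then show "mc.gl n" unfolding mc.gl_def using pdim_exz by blast
next
  assume g: "mc.gl n"
  show "gldim A \<le> enat n"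
    unfolding gldim_def
  proof (rule SUP_least)
    fix M :: "('k, 'a) fmodule" assume "M \<in> {M. fg_module A M}"
    then have M: "M \<in> Obs" by (simp add: Obs_def)
    obtain P \<epsilon> d where r: "projective_resolution A M P \<epsilon> d"
      "\<And>n j. (\<And>Y. Y \<in> Obs \<Longrightarrow> mc.exz n M Y) \<Longrightarrow> n < j \<Longrightarrow> zero_module (P j)"
      by (rule projective_resolution_ex[OF M]) blast
    have "\<forall>j>n. zero_module (P j)" using r(2)[of n] g M by (auto simp: mc.gl_def)
    then show "pdim A M \<le> enat n"
      unfolding pdim_def using r(1) by (intro Inf_lower) blast
  qed
qed

text \<open>A map from the syzygy \<open>W (Suc i)\<close> to \<open>T\<close>, inflated to the
  resolution, is a cocycle in degree i + 1. Triviality of Ext makes it a coboundary, which means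
  that the map extends to \<open>P i\<close>; this is vanishing in degree one for
  \<open>W i\<close>.\<close>

lemma Ext_exz:
  assumes T: "T \<in> Obs" and E: "trivial_group (Ext A (Suc i) T T)"
  shows "mc.exz i T T"
proof -
  obtain P0 \<epsilon>0 d0 where "projective_resolution A T P0 \<epsilon>0 d0"
    by (rule projective_resolution_ex[OF T]) blast
  then have ex: "\<exists>x. (\<lambda>(P, \<epsilon>, d). projective_resolution A T P \<epsilon> d) x" by auto
  obtain P \<epsilon> d where S: "(SOME (P, \<epsilon>, d). projective_resolution A T P \<epsilon> d) = (P, \<epsilon>, d)"
    by (metis prod_cases3)
  \<comment> \<open>The group is computed with a chosen resolution; since one exists, the chosen
    triple is a resolution.\<close>
  have r: "projective_resolution A T P \<epsilon> d" using someI_ex[OF ex] by (simp add: S)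
  have lr: "left_resolution A T P \<epsilon> d" using r by (simp add: projective_resolution_def)
  obtain W w e where W: "W 0 = T" "\<And>j. mc.ses (w j) (e j)" "\<And>j. mc.hom (w j) (W (Suc j)) (P j)"
    "\<And>j. mc.hom (e j) (P j) (W j)" "\<And>j. (P (Suc j), d j, P j) = ccmp (w j) (e (Suc j))"
    "\<And>j. carrier (W (Suc j)) = d j ` carrier (P (Suc j))"
    by (rule left_resolution_ses[OF lr T]) (rule that)
  have P: "P j \<in> Obs" for j using lr by (simp add: left_resolution_def Obs_def)
  have "mc.proj (P j)" for j using r projective_iff[OF P] by (simp add: projective_resolution_def)
  then have pres: "mc.pres (W (Suc j)) (P j) (W j) (w j) (e j)" for j
    using W(2-4) by (simp add: mc.pres_def)
  have dA: "(P (Suc j), d j, P j) \<in> Arrs" for j using lr P by (simp add: left_resolution_def Arrs_iff)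
  let ?H = "coboundaries A P d T (Suc i)" and ?C = "cocycles A P d T (Suc i)"
  let ?G = "(hom_group A (P (Suc i)) T)\<lparr>carrier := ?C\<rparr>"
  interpret PT: module_pair A "P i" T by (intro module_pair.intro ObsD(2) P T)
  interpret PT': module_pair A "P (Suc i)" T by (intro module_pair.intro ObsD(2) P T)
  have c: "carrier (?G Mod ?H) = {?H}"
    using E by (simp add: Ext_def S trivial_group_def FactGroup_def)
  have zH: "(\<lambda>x\<in>carrier (P (Suc i)). \<zero>\<^bsub>T\<^esub>) \<in> ?H"
  proof -
    have "compose (carrier (P (Suc i))) (\<lambda>x\<in>carrier (P i). \<zero>\<^bsub>T\<^esub>) (d i) = (\<lambda>x\<in>carrier (P (Suc i)). \<zero>\<^bsub>T\<^esub>)"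
      using ArrsD(4)[OF dA[of i]] by (auto simp: compose_def intro!: restrict_ext)
    then show ?thesis using PT.hom_zero_map by (auto simp: coboundaries_def intro: rev_image_eqI)
  qed
  \<comment> \<open>The only coset is that of the coboundaries, and the coset of \<open>f\<close>
    contains \<open>f\<close> because the zero map is a coboundary.\<close>
  have cb: "f \<in> ?H" if f: "f \<in> ?C" for f
  proof -
    have fh: "f \<in> mod_hom A (P (Suc i)) T" using f by (simp add: cocycles_def)
    have "?H #>\<^bsub>?G\<^esub> f \<in> carrier (?G Mod ?H)"
      using f by (auto simp: FactGroup_def RCOSETS_def)
    then have e: "?H #>\<^bsub>?G\<^esub> f = ?H" using c by blast
    have "(\<lambda>x\<in>carrier (P (Suc i)). (\<lambda>x\<in>carrier (P (Suc i)). \<zero>\<^bsub>T\<^esub>) x \<oplus>\<^bsub>T\<^esub> f x) \<in> ?H #>\<^bsub>?G\<^esub> f"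
      unfolding r_coset_def hom_group_def using zH by (intro UN_I[OF zH]) simp
    moreover have "(\<lambda>x\<in>carrier (P (Suc i)). (\<lambda>x\<in>carrier (P (Suc i)). \<zero>\<^bsub>T\<^esub>) x \<oplus>\<^bsub>T\<^esub> f x) = f"
      by (rule mod_hom_eqI[OF PT'.hom_plus[OF PT'.hom_zero_map fh] fh]) (simp add: mod_homD(1)[OF fh])
    ultimately show ?thesis using e by simp
  qed
  have "\<exists>v. mc.hom v (P i) T \<and> ccmp v (w i) = u" if u: "mc.hom u (W (Suc i)) T" for u
  proof -
    let ?f = "ccmp u (e (Suc i))"
    have fA: "mc.hom ?f (P (Suc i)) T" using u W(4)[of "Suc i"] by simp
    have "afun ?f \<in> ?C"
      unfolding cocycles_def
    proof (intro CollectI conjI ballI)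
      show "afun ?f \<in> mod_hom A (P (Suc i)) T" using ArrsD(3)[of ?f] fA by simp
      fix x assume x: "x \<in> carrier (P (Suc (Suc i)))"
      have z: "ccmp (e (Suc i)) (w (Suc i)) = czer (W (Suc (Suc i))) (W (Suc i))"
        using mc.sesD(6)[OF W(2)[of "Suc i"]] W(3,4)[of "Suc i"] by simp
      have "ccmp ?f (P (Suc (Suc i)), d (Suc i), P (Suc i)) =
          ccmp u (ccmp (ccmp (e (Suc i)) (w (Suc i))) (e (Suc (Suc i))))"
        unfolding W(5) by (simp only: mc.cmp_assoc)
      also have "\<dots> = czer (P (Suc (Suc i))) T"
        unfolding z using u W(4)[of "Suc (Suc i)"] mc.pres_Ob[OF pres] P T by simp
      finally have "afun (ccmp ?f (P (Suc (Suc i)), d (Suc i), P (Suc i))) x = \<zero>\<^bsub>T\<^esub>"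
        using x P T by simp
      moreover have "afun (ccmp ?f (P (Suc (Suc i)), d (Suc i), P (Suc i))) x = afun ?f (d (Suc i) x)"
        using ccmp_Arrs(4)[of ?f "(P (Suc (Suc i)), d (Suc i), P (Suc i))" x] fA dA x by simp
      ultimately show "afun ?f (d (Suc i) x) = \<zero>\<^bsub>T\<^esub>" by simp
    qed
    then obtain g where g: "g \<in> mod_hom A (P i) T" "afun ?f = compose (carrier (P (Suc i))) g (d i)"
      using cb by (auto simp: coboundaries_def)
    have gA: "mc.hom (P i, g, T) (P i) T" using g(1) P T by (simp add: Arrs_iff)
    have "?f = ccmp (P i, g, T) (P (Suc i), d i, P i)"
      by (rule arr_eqI) (use fA gA dA g(2) in \<open>simp_all add: compose_def\<close>)
    also have "\<dots> = ccmp (ccmp (P i, g, T) (w i)) (e (Suc i))"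
      unfolding W(5) by (simp only: mc.cmp_assoc)
    finally have "ccmp u (e (Suc i)) = ccmp (ccmp (P i, g, T) (w i)) (e (Suc i))" .
    then have "u = ccmp (P i, g, T) (w i)"
      using mc.epi_cancel[OF mc.sesD(2)[OF W(2)[of "Suc i"]], of u T "ccmp (P i, g, T) (w i)"]
        u gA W(3)[of i] W(4)[of "Suc i"] by simp
    then show ?thesis using gA by blast
  qed
  then have "mc.exz 0 (W i) T" using mc.exz0_iff_extend[OF T pres[of i]] by blast
  then have "mc.exz j (W (i - j)) T" if "j \<le> i" for j
    using that
  proof (induction j)
    case (Suc j)
    then show ?case using mc.exz_SucI[OF pres[of "i - Suc j"], of j T] by (simp add: Suc_diff_Suc)
  qed simp
  from this[of i] show ?thesis by (simp add: W(1))
qed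

end

lemma direct_sum_simps [simp]:
  "carrier (direct_sum n N) = (\<Pi>\<^sub>E i\<in>{..<n}. carrier (N i))"
  "\<zero>\<^bsub>direct_sum n N\<^esub> = (\<lambda>i\<in>{..<n}. \<zero>\<^bsub>N i\<^esub>)"
  "x \<oplus>\<^bsub>direct_sum n N\<^esub> y = (\<lambda>i\<in>{..<n}. x i \<oplus>\<^bsub>N i\<^esub> y i)"
  "r \<odot>\<^bsub>direct_sum n N\<^esub> x = (\<lambda>i\<in>{..<n}. r \<odot>\<^bsub>N i\<^esub> x i)"
  by (simp_all add: direct_sum_def)

section \<open>From special tilting and cotilting modules to tilting objects\<close>

context fdalg
begin

text \<open>The power of \<open>M\<close> consists of functions into the carrier type and is no
  object of the category. The identity of \<open>X\<close> is therefore rebuilt coordinate by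
  coordinate through objects of add M.\<close>

lemma in_add_addc:
  assumes a: "in_add A X M" and M: "M \<in> Obs" and X: "X \<in> Obs"
  shows "mc.addc M X"
proof -
  obtain n \<iota> \<pi> where i: "\<iota> \<in> mod_hom A X (direct_sum n (\<lambda>_. M))"
    and p: "\<pi> \<in> mod_hom A (direct_sum n (\<lambda>_. M)) X" and pi: "\<And>x. x \<in> carrier X \<Longrightarrow> \<pi> (\<iota> x) = x"
    using a unfolding in_add_def is_summand_def by blast
  interpret M: left_module A M by (rule ObsD(2)[OF M])
  interpret X: left_module A X by (rule ObsD(2)[OF X])
  let ?D = "direct_sum n (\<lambda>_. M)"
  \<comment> \<open>Truncation to the first m coordinates, and below the inclusion of coordinate m.
    The composite of \<iota>, truncation and \<pi> runs from the zero map at m = 0 to the identity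
    at m = n.\<close>
  define tr where "tr m y = (\<lambda>i\<in>{..<n}. if i < m then y i else \<zero>\<^bsub>M\<^esub>)" for m :: nat and y :: "nat \<Rightarrow> nat \<Rightarrow> 'k"
  define inc where "inc m v = (\<lambda>i\<in>{..<n}. if i = m then v else \<zero>\<^bsub>M\<^esub>)" for m :: nat and v :: "nat \<Rightarrow> 'k"
  have iM: "\<iota> x j \<in> carrier M" if "x \<in> carrier X" "j < n" for x j
    using mod_homD(1)[OF i that(1)] that(2) by (auto simp: PiE_iff)
  have trD: "tr m (\<iota> x) \<in> carrier ?D" if "x \<in> carrier X" for m x
    using iM[OF that] by (simp add: tr_def PiE_iff)
  have incD: "inc m v \<in> carrier ?D" if "v \<in> carrier M" for m v
    using that by (simp add: inc_def PiE_iff)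
  have p0: "\<pi> \<zero>\<^bsub>?D\<^esub> = \<zero>\<^bsub>X\<^esub>"
  proof -
    have z: "\<zero>\<^bsub>?D\<^esub> \<in> carrier ?D" by (simp add: PiE_iff)
    have "\<zero>\<^bsub>?D\<^esub> \<oplus>\<^bsub>?D\<^esub> \<zero>\<^bsub>?D\<^esub> = \<zero>\<^bsub>?D\<^esub>" by (auto intro!: restrict_ext)
    then have "\<pi> \<zero>\<^bsub>?D\<^esub> \<oplus>\<^bsub>X\<^esub> \<pi> \<zero>\<^bsub>?D\<^esub> = \<pi> \<zero>\<^bsub>?D\<^esub>"
      using mod_homD(2)[OF p z z] by metis
    then show ?thesis using mod_homD(1)[OF p z] X.M.add.l_cancel_one by simp
  qed
  have "\<exists>Z s r. mc.addc M Z \<and> mc.hom s X Z \<and> mc.hom r Z X \<and>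
      (\<forall>x\<in>carrier X. afun (ccmp r s) x = \<pi> (tr m (\<iota> x)))" if "m \<le> n" for m
    using that
  proof (induction m)
    case 0
    have t0: "tr 0 y = \<zero>\<^bsub>?D\<^esub>" for y by (auto simp: tr_def)
    show ?case
      by (rule exI[of _ M], rule exI[of _ "czer X M"], rule exI[of _ "czer M X"], unfold t0 p0)
        (use M X mc.addc_self[OF M] in simp)
  next
    case (Suc m)
    then obtain Z s r where z: "mc.addc M Z" "mc.hom s X Z" "mc.hom r Z X"
      "\<And>x. x \<in> carrier X \<Longrightarrow> afun (ccmp r s) x = \<pi> (tr m (\<iota> x))" by auto
    have mn: "m < n" using Suc by simp
    let ?a = "(X, \<lambda>x\<in>carrier X. \<iota> x m, M)" and ?b = "(M, \<lambda>v\<in>carrier M. \<pi> (inc m v), X)"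
    have "(\<lambda>x\<in>carrier X. \<iota> x m) \<in> mod_hom A X M"
      by (rule mod_hom_restrictI[OF X.left_module_axioms])
        (use iM mn mod_homD(2,3)[OF i] in simp_all)
    then have aA: "mc.hom ?a X M" using X M by (simp add: Arrs_iff)
    have "inc m (v \<oplus>\<^bsub>M\<^esub> w) = inc m v \<oplus>\<^bsub>?D\<^esub> inc m w" for v w
      by (auto simp: inc_def intro!: restrict_ext)
    moreover have "inc m (c \<odot>\<^bsub>M\<^esub> v) = c \<odot>\<^bsub>?D\<^esub> inc m v" if "c \<in> carrier A" for c v
      using that by (auto simp: inc_def intro!: restrict_ext)
    ultimately have "(\<lambda>v\<in>carrier M. \<pi> (inc m v)) \<in> mod_hom A M X"
      by (intro mod_hom_restrictI[OF M.left_module_axioms])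
        (simp_all only: mod_homD(1-3)[OF p] incD)
    then have bA: "mc.hom ?b M X" using X M by (simp add: Arrs_iff)
    obtain W i' j' p' q' where bp: "mc.biprod Z M W i' j' p' q'"
      using inst_biprod[OF mc.addc_Ob[OF z(1)] M] by auto
    then have b: "mc.hom i' Z W" "mc.hom j' M W" "mc.hom p' W Z" "mc.hom q' W M"
      "ccmp p' i' = cidn Z" "ccmp q' j' = cidn M" "ccmp q' i' = czer Z M" "ccmp p' j' = czer M Z"
      by (auto simp: mc.biprod_def)
    let ?s = "cplus (ccmp i' s) (ccmp j' ?a)" and ?r = "cplus (ccmp r p') (ccmp ?b q')"
    have sA: "mc.hom ?s X W" using b z aA by auto
    have rA: "mc.hom ?r W X" using b z bA by auto
    have ps: "ccmp p' ?s = s"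
      using b z(2) aA X mc.addc_Ob[OF z(1)] M by (simp add: mc.cmp_plus mc.reassoc[OF b(5)] mc.reassoc[OF b(8)])
    have qs: "ccmp q' ?s = ?a"
      using b z(2) aA X mc.addc_Ob[OF z(1)] M by (simp add: mc.cmp_plus mc.reassoc[OF b(6)] mc.reassoc[OF b(7)])
    have rs: "ccmp ?r ?s = cplus (ccmp r s) (ccmp ?b ?a)"
      by (simp only: mc.plus_cmp mc.cmp_assoc ps qs)
    have "afun (ccmp ?r ?s) x = \<pi> (tr (Suc m) (\<iota> x))" if x: "x \<in> carrier X" for x
    proof -
      have rsA: "mc.hom (ccmp r s) X X" "mc.hom (ccmp ?b ?a) X X" using z aA bA by simp_all
      have "afun (ccmp ?b ?a) x = afun ?b (afun ?a x)"
        using ccmp_Arrs(4)[of ?b ?a x] aA bA x by simp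
      also have "\<dots> = \<pi> (inc m (\<iota> x m))" using x iM[OF x mn] by simp
      finally have "afun (ccmp ?r ?s) x = \<pi> (tr m (\<iota> x)) \<oplus>\<^bsub>X\<^esub> \<pi> (inc m (\<iota> x m))"
        unfolding rs using cplus_Arrs(4)[of "ccmp r s" "ccmp ?b ?a" x] rsA x z(4)[OF x] by simp
      also have "\<dots> = \<pi> (tr m (\<iota> x) \<oplus>\<^bsub>?D\<^esub> inc m (\<iota> x m))"
        by (rule mod_homD(2)[OF p trD[OF x] incD[OF iM[OF x mn]], symmetric])
      also have "tr m (\<iota> x) \<oplus>\<^bsub>?D\<^esub> inc m (\<iota> x m) = tr (Suc m) (\<iota> x)"
        using iM[OF x] by (auto simp: tr_def inc_def less_Suc_eq intro!: restrict_ext)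
      finally show ?thesis .
    qed
    then show ?case
      using mc.addc_biprod[OF z(1) mc.addc_self[OF M] bp] sA rA by blast
  qed
  from this[of n] obtain Z s r where z: "mc.addc M Z" "mc.hom s X Z" "mc.hom r Z X"
    "\<And>x. x \<in> carrier X \<Longrightarrow> afun (ccmp r s) x = \<pi> (tr n (\<iota> x))" by auto
  have "ccmp r s = cidn X"
  proof (rule arr_eqI)
    fix x assume "x \<in> carrier (asrc (cidn X))"
    then have x: "x \<in> carrier X" using X by simp
    have "tr n (\<iota> x) = \<iota> x"
      using mod_homD(1)[OF i x] by (auto simp: tr_def PiE_iff extensional_def)
    then show "afun (ccmp r s) x = afun (cidn X) x" using z(4)[OF x] pi[OF x] x X by simp
  qed (use z X in simp_all)
  then show ?thesis by (rule mc.addc_retract[OF z(1-3)])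
qed

lemma zero_module_mono:
  assumes f: "mc.hom f X Y" and m: "mc.mono f" and z: "zero_module Y"
  shows "carrier X = {\<zero>\<^bsub>X\<^esub>}"
proof -
  have X: "X \<in> Obs" using f ArrsD(1)[of f] by simp
  have z0: "\<zero>\<^bsub>X\<^esub> \<in> carrier X" by (rule left_module.zero_in[OF ObsD(2)[OF X]])
  have i: "inj_on (afun f) (carrier X)" using m f by (simp add: mono_iff)
  have fz: "afun f x = \<zero>\<^bsub>Y\<^esub>" if "x \<in> carrier X" for x
  proof -
    have "afun f x \<in> carrier Y" using f that by simp
    then show ?thesis using z by (simp add: zero_module_def)
  qed
  have "carrier X \<subseteq> {\<zero>\<^bsub>X\<^esub>}"
  proof
    fix x assume x: "x \<in> carrier X"
    have "x = \<zero>\<^bsub>X\<^esub>" by (rule inj_onD[OF i _ x z0]) (simp only: fz[OF x] fz[OF z0])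
    then show "x \<in> {\<zero>\<^bsub>X\<^esub>}" by simp
  qed
  then show ?thesis using z0 by blast
qed

lemma zero_module_epi:
  assumes f: "mc.hom f X Y" and m: "mc.epi f" and z: "zero_module X"
  shows "carrier Y = {\<zero>\<^bsub>Y\<^esub>}"
proof -
  have "X \<in> Obs" "Y \<in> Obs" "afun f \<in> mod_hom A X Y" using f ArrsD(1-3)[of f] by simp_all
  then have "afun f ` carrier X = {\<zero>\<^bsub>Y\<^esub>}" using hom_image_zero z by blast
  then show ?thesis using m f by (simp add: epi_iff)
qed

text \<open>The definitions speak of \<open>regular A\<close>, whose elements have another type than
  objects of the category; the coresolution is transferred to the copy \<open>G\<close>.\<close>

lemma right_resolution_regular:
  assumes r: "right_resolution A (regular A) t \<eta> d"
  shows "\<exists>\<eta>'. right_resolution A G t \<eta>' d"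
proof -
  let ?u = "restrict (uncp (regular A)) (carrier G)"
  have u: "?u \<in> mod_hom A G (regular A)" using uncp_hom[OF fg_regular] by (simp add: G_def)
  have im: "?u ` carrier G = carrier (regular A)"
  proof
    show "?u ` carrier G \<subseteq> carrier (regular A)" using mod_homD(1)[OF u] by blast
    show "carrier (regular A) \<subseteq> ?u ` carrier G"
    proof
      fix x assume x: "x \<in> carrier (regular A)"
      then have "cp (regular A) x \<in> carrier G" unfolding G_def by (rule cp_closed)
      then show "x \<in> ?u ` carrier G" using uncp_cp[OF fg_regular x] by (intro image_eqI) simp_all
    qed
  qed
  have inj: "inj_on ?u (carrier G)"
  proof (rule inj_onI)
    fix x y assume xy: "x \<in> carrier G" "y \<in> carrier G" "?u x = ?u y"
    then have "cp (regular A) (uncp (regular A) x) = cp (regular A) (uncp (regular A) y)" by simp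
    then show "x = y" using cp_uncp[of x "regular A"] cp_uncp[of y "regular A"] xy unfolding G_def by metis
  qed
  have e: "\<eta> \<in> mod_hom A (regular A) (t 0)" "inj_on \<eta> (carrier (regular A))"
    using r by (auto simp: right_resolution_def)
  have c: "compose (carrier G) \<eta> ?u \<in> mod_hom A G (t 0)"
    by (rule mod_hom_compose[OF ObsD(2)[OF G_Obs] e(1) u])
  have "compose (carrier G) \<eta> ?u ` carrier G = \<eta> ` carrier (regular A)"
    unfolding im[symmetric] image_image by (auto simp: compose_def)
  moreover have "inj_on (compose (carrier G) \<eta> ?u) (carrier G)"
  proof (rule inj_onI)
    fix x y assume xy: "x \<in> carrier G" "y \<in> carrier G" "compose (carrier G) \<eta> ?u x = compose (carrier G) \<eta> ?u y"
    then have "\<eta> (?u x) = \<eta> (?u y)" by (simp add: compose_def)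
    then have "?u x = ?u y" by (rule inj_onD[OF e(2)]) (use mod_homD(1)[OF u] xy in blast)+
    then show "x = y" by (rule inj_onD[OF inj _ xy(1,2)])
  qed
  ultimately have "right_resolution A G t (compose (carrier G) \<eta> ?u) d"
    using r c unfolding right_resolution_def exact_at_def by simp
  then show ?thesis by blast
qed

text \<open>The same passage for the dual module, replaced by its copy \<open>I\<close>.\<close>

lemma left_resolution_dual:
  assumes r: "left_resolution A DR c \<epsilon> d"
  shows "\<exists>\<epsilon>'. left_resolution A I c \<epsilon>' d"
proof -
  let ?u = "restrict (cp DR) (carrier DR)"
  have u: "?u \<in> mod_hom A DR I" using cp_hom[OF fg_DR] by (simp add: I_def)
  have im: "?u ` carrier DR = carrier I" by (simp add: I_def copy_def)
  interpret P: module_pair A DR I by (intro module_pair.intro left_module_DR ObsD(2)[OF I_Obs])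
  have z: "?u x = \<zero>\<^bsub>I\<^esub> \<longleftrightarrow> x = \<zero>\<^bsub>DR\<^esub>" if x: "x \<in> carrier DR" for x
  proof
    assume "?u x = \<zero>\<^bsub>I\<^esub>"
    then have "?u x = ?u \<zero>\<^bsub>DR\<^esub>" using P.hom_zero[OF u] by simp
    then show "x = \<zero>\<^bsub>DR\<^esub>"
      using inj_onD[OF cp_inj[OF fg_DR] _ x P.M.zero_in] x P.M.zero_in by simp
  qed (use P.hom_zero[OF u] in simp)
  have X: "left_module A (c 0)" "\<epsilon> \<in> mod_hom A (c 0) DR" "\<epsilon> ` carrier (c 0) = carrier DR"
    using r by (auto simp: left_resolution_def fg_module_def)
  have cc: "compose (carrier (c 0)) ?u \<epsilon> \<in> mod_hom A (c 0) I"
    by (rule mod_hom_compose[OF X(1) u X(2)])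
  have "compose (carrier (c 0)) ?u \<epsilon> ` carrier (c 0) = ?u ` (\<epsilon> ` carrier (c 0))"
    unfolding image_image by (auto simp: compose_def)
  then have s: "compose (carrier (c 0)) ?u \<epsilon> ` carrier (c 0) = carrier I" unfolding X(3) im .
  have "{x \<in> carrier (c 0). compose (carrier (c 0)) ?u \<epsilon> x = \<zero>\<^bsub>I\<^esub>} = {x \<in> carrier (c 0). \<epsilon> x = \<zero>\<^bsub>DR\<^esub>}"
    by (rule Collect_cong) (metis (no_types) compose_apply z mod_homD(1)[OF X(2)])
  then have "left_resolution A I c (compose (carrier (c 0)) ?u \<epsilon>) d"
    using r cc s unfolding left_resolution_def exact_at_def by simp
  then show ?thesis by blast
qed

lemma special_tilting_tilt:
  fixes Q T :: "('k, 'a) fmodule"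
  assumes st: "special_tilting A Q k T" and Q: "injective A Q"
  shows "\<exists>Z t a b. tilt Obs Arrs asrc atgt ccmp cidn cplus cneg czer T G k Z t a b"
proof -
  have tl: "tilting A k T" "projective A Q" "in_add A Q T" using st by (simp_all add: special_tilting_def)
  have T: "T \<in> Obs" using tl(1) by (simp add: tilting_def Obs_def)
  have QO: "Q \<in> Obs" using tl(2) by (simp add: projective_def Obs_def)
  obtain t \<eta> d where t: "tilting_sequence A k T t \<eta> d" "\<And>j. j < k \<Longrightarrow> in_add A (t j) Q"
    using st unfolding special_tilting_def by blast
  have r: "right_resolution A (regular A) t \<eta> d" "\<And>j. j \<le> k \<Longrightarrow> in_add A (t j) T"
    "\<And>j. k < j \<Longrightarrow> zero_module (t j)" using t(1) by (simp_all add: tilting_sequence_def)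
  obtain \<eta>' where lr: "right_resolution A G t \<eta>' d" using right_resolution_regular[OF r(1)] by blast
  obtain Z a b where Z: "Z 0 = G" "\<And>j. mc.ses (a j) (b j)" "\<And>j. mc.hom (a j) (Z j) (t j)"
    "\<And>j. mc.hom (b j) (t j) (Z (Suc j))" "\<And>j. carrier (Z (Suc j)) = d j ` carrier (t j)"
    by (rule right_resolution_ses[OF lr G_Obs]) (rule that)
  have tO: "t j \<in> Obs" for j using lr by (simp add: right_resolution_def Obs_def)
  have QT: "mc.addc T Q" by (rule in_add_addc[OF tl(3) T QO])
  have tQ: "mc.addc Q (t j)" if "j < k" for j by (rule in_add_addc[OF t(2)[OF that] QO tO])
  \<comment> \<open>Beyond k the terms vanish, hence so does this cosyzygy, and \<open>Z k\<close>
    is a retract of the last term, which lies in add T.\<close>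
  have "carrier (Z (Suc k)) = {\<zero>\<^bsub>Z (Suc k)\<^esub>}"
    by (rule zero_module_mono[OF Z(3) mc.sesD(1)[OF Z(2)] r(3)]) simp
  then obtain \<rho> where rr: "mc.hom \<rho> (t k) (Z k)" "ccmp \<rho> (a k) = cidn (Z k)"
    using ses_zero_right[OF Z(2)[of k]] Z(3,4)[of k] by auto
  have Zk: "mc.addc T (Z k)"
    by (rule mc.addc_retract[OF in_add_addc[OF r(2)[OF order_refl] T tO] Z(3) rr])
  have "tilt Obs Arrs asrc atgt ccmp cidn cplus cneg czer T G k Z t a b"
  proof (intro tilt.intro[OF mc.abcat_axioms] tilt_axioms.intro)
    show "mc.exz n T Y" if "k \<le> n" "Y \<in> Obs" for n Y
      by (rule pdim_exz[OF T _ that(2,1)]) (use tl(1) in \<open>simp add: tilting_def\<close>)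
    show "mc.exz n T T" for n
      by (rule Ext_exz[OF T]) (use tl(1) in \<open>simp add: tilting_def\<close>)
    show "mc.proj (t i)" if "i < k" for i
      by (rule mc.addc_proj[OF tQ[OF that]]) (use projective_iff[OF QO] tl(2) in simp)
    show "mc.inj (t i)" if "i < k" for i
      by (rule mc.addc_inj[OF tQ[OF that] injective_imp[OF QO Q]])
    show "mc.addc T (t i)" if "i < k" for i
      by (rule mc.addc_trans[OF tQ[OF that] QT])
    show "mc.epi p" if "p \<in> Arrs" "mc.lifts p G" for p
      using G_gen[OF that(1)] that(2) unfolding mc.lifts_def by blast
  qed (rule T Z(1) Zk Z(2) Z(3) Z(4))+
  then show ?thesis by blast
qed

lemma special_cotilting_tilt:
  fixes Q C :: "('k, 'a) fmodule"
  assumes st: "special_cotilting K A Q k C" and Q: "projective A Q"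
  shows "\<exists>Z t a b. tilt Obs Arrs atgt asrc (\<lambda>g f. ccmp f g) cidn cplus cneg (\<lambda>X Y. czer Y X) C I k Z t a b"
proof -
  have tl: "cotilting K A k C" "injective A Q" "in_add A Q C" using st by (simp_all add: special_cotilting_def)
  have C: "C \<in> Obs" using tl(1) by (simp add: cotilting_def Obs_def)
  have QO: "Q \<in> Obs" using tl(2) by (simp add: injective_def Obs_def)
  obtain t \<epsilon> d where t: "cotilting_sequence K A k C t \<epsilon> d" "\<And>j. j < k \<Longrightarrow> in_add A (t j) Q"
    using st unfolding special_cotilting_def by blast
  have r: "left_resolution A DR t \<epsilon> d" "\<And>j. j \<le> k \<Longrightarrow> in_add A (t j) C"
    "\<And>j. k < j \<Longrightarrow> zero_module (t j)" using t(1) by (simp_all add: cotilting_sequence_def)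
  obtain \<epsilon>' where lr: "left_resolution A I t \<epsilon>' d" using left_resolution_dual[OF r(1)] by blast
  obtain W w e where W: "W 0 = I" "\<And>j. mc.ses (w j) (e j)" "\<And>j. mc.hom (w j) (W (Suc j)) (t j)"
    "\<And>j. mc.hom (e j) (t j) (W j)" "\<And>j. (t (Suc j), d j, t j) = ccmp (w j) (e (Suc j))"
    "\<And>j. carrier (W (Suc j)) = d j ` carrier (t (Suc j))"
    by (rule left_resolution_ses[OF lr I_Obs]) (rule that)
  have tO: "t j \<in> Obs" for j using lr by (simp add: left_resolution_def Obs_def)
  have QC: "mc.addc C Q" by (rule in_add_addc[OF tl(3) C QO])
  have tQ: "mc.addc Q (t j)" if "j < k" for j by (rule in_add_addc[OF t(2)[OF that] QO tO])
  have "carrier (W (Suc k)) = {\<zero>\<^bsub>W (Suc k)\<^esub>}"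
    by (rule zero_module_epi[OF W(4) mc.sesD(2)[OF W(2)] r(3)]) simp
  then obtain \<rho> where rr: "mc.hom \<rho> (W k) (t k)" "ccmp (e k) \<rho> = cidn (W k)"
    using ses_zero_left[OF W(2)[of k]] W(3,4)[of k] by auto
  have Wk: "mc.addc C (W k)"
    by (rule mc.addc_retract[OF in_add_addc[OF r(2)[OF order_refl] C tO] rr(1) W(4) rr(2)])
  \<comment> \<open>Read backwards, the resolution of the dual module is a coresolution: syzygies
    \<open>W\<close> become cosyzygies, \<open>e\<close> and \<open>w\<close> exchange their places,
    injective dimension becomes projective dimension, and the cogenerator \<open>I\<close> becomes
    the generator.\<close>
  have "tilt Obs Arrs atgt asrc (\<lambda>g f. ccmp f g) cidn cplus cneg (\<lambda>X Y. czer Y X) C I k W t e w"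
  proof (intro tilt.intro[OF mc.op_abcat] tilt_axioms.intro,
      unfold mc.op_exz mc.op_ses mc.op_proj mc.op_inj mc.op_epi abcat.lifts_def[OF mc.op_abcat])
    show "mc.exz n Y C" if "k \<le> n" "Y \<in> Obs" for n Y
      by (rule idim_exz[OF C _ that(2,1)]) (use tl(1) in \<open>simp add: cotilting_def\<close>)
    show "mc.exz n C C" for n
      by (rule Ext_exz[OF C]) (use tl(1) in \<open>simp add: cotilting_def\<close>)
    show "mc.inj (t i)" if "i < k" for i
      by (rule mc.addc_inj[OF tQ[OF that] injective_imp[OF QO tl(2)]])
    show "mc.proj (t i)" if "i < k" for i
      by (rule mc.addc_proj[OF tQ[OF that]]) (use projective_iff[OF QO] Q in simp)
    show "precat.addc Obs Arrs atgt asrc (\<lambda>g f. ccmp f g) cidn cplus (\<lambda>X Y. czer Y X) C (t i)"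
      if "i < k" for i
      by (rule mc.op_addc[OF mc.addc_trans[OF tQ[OF that] QC]])
    show "precat.addc Obs Arrs atgt asrc (\<lambda>g f. ccmp f g) cidn cplus (\<lambda>X Y. czer Y X) C (W k)"
      by (rule mc.op_addc[OF Wk])
    show "mc.mono p" if p: "p \<in> Arrs" and l: "\<forall>f. f \<in> Arrs \<and> atgt f = I \<and> asrc f = asrc p \<longrightarrow>
        (\<exists>h. (h \<in> Arrs \<and> atgt h = I \<and> asrc h = atgt p) \<and> ccmp h p = f)" for p
    proof (rule I_cogen[OF p])
      fix f assume "mc.hom f (asrc p) I"
      then show "\<exists>h. mc.hom h (atgt p) I \<and> ccmp h p = f" using l[rule_format, of f] by blast
    qed
    show "mc.ses (w i) (e i)" if "i < k" for i by (rule W(2))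
    show "e i \<in> Arrs \<and> atgt (e i) = W i \<and> asrc (e i) = t i" if "i < k" for i using W(4)[of i] by simp
    show "w i \<in> Arrs \<and> atgt (w i) = t i \<and> asrc (w i) = W (Suc i)" if "i < k" for i using W(3)[of i] by simp
  qed (rule C W(1))+
  then show ?thesis by blast
qed

end

section \<open>Endomorphism algebras and duality\<close>

lemma (in hom_mod) tilt_gldim:
  assumes t: "tilt Ob Arr src tgt cmp idn plus neg zer T G k Z t a b"
  shows "gl g \<Longrightarrow> gldim R \<le> enat g" "gldim R \<le> enat n \<Longrightarrow> gl (k + n)"
proof -
  interpret TF: tilt_functor Ob Arr src tgt cmp idn plus neg zer
    R.Obs R.Arrs asrc atgt R.ccmp R.cidn R.cplus R.cneg R.czer T Fo Fa G k Z t a b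
    by (intro tilt_functor.intro F.hom_functor_axioms t)
  show "gl g \<Longrightarrow> gldim R \<le> enat g" using TF.gl_upper R.gldim_le_iff by blast
  show "gldim R \<le> enat n \<Longrightarrow> gl (k + n)" using TF.gl_lower R.gldim_le_iff by blast
qed

text \<open>Inequalities between possibly infinite dimensions are decided by their finite upper
  bounds; an infinite \<open>x\<close> forces an infinite \<open>y\<close> by the second
  hypothesis.\<close>

lemma enat_bounds:
  assumes "\<And>g. x \<le> enat g \<Longrightarrow> y \<le> enat g" "\<And>n. y \<le> enat n \<Longrightarrow> x \<le> enat (k + n)"
  shows "x - enat k \<le> y \<and> y \<le> x"
proof
  show "y \<le> x" using assms(1) by (cases x) auto
  show "x - enat k \<le> y"
  proof (cases y)
    case (enat n)
    then have "x \<le> enat (k + n)" using assms(2) by simp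
    then show ?thesis using enat by (cases x) auto
  qed simp
qed

lemma opposite_algebra_simps [simp]:
  "carrier (opposite_algebra A) = carrier A" "\<zero>\<^bsub>opposite_algebra A\<^esub> = \<zero>\<^bsub>A\<^esub>"
  "\<one>\<^bsub>opposite_algebra A\<^esub> = \<one>\<^bsub>A\<^esub>" "x \<oplus>\<^bsub>opposite_algebra A\<^esub> y = x \<oplus>\<^bsub>A\<^esub> y"
  "x \<otimes>\<^bsub>opposite_algebra A\<^esub> y = y \<otimes>\<^bsub>A\<^esub> x" "c \<odot>\<^bsub>opposite_algebra A\<^esub> x = c \<odot>\<^bsub>A\<^esub> x"
  by (simp_all add: opposite_algebra_def)

lemma end_algebra_simps [simp]:
  "carrier (end_algebra A M) = mod_hom A M M"
  "\<zero>\<^bsub>end_algebra A M\<^esub> = (\<lambda>x\<in>carrier M. \<zero>\<^bsub>M\<^esub>)"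
  "\<one>\<^bsub>end_algebra A M\<^esub> = (\<lambda>x\<in>carrier M. x)"
  "f \<oplus>\<^bsub>end_algebra A M\<^esub> g = (\<lambda>x\<in>carrier M. f x \<oplus>\<^bsub>M\<^esub> g x)"
  "f \<otimes>\<^bsub>end_algebra A M\<^esub> g = compose (carrier M) f g"
  "c \<odot>\<^bsub>end_algebra A M\<^esub> f = (\<lambda>x\<in>carrier M. (c \<odot>\<^bsub>A\<^esub> \<one>\<^bsub>A\<^esub>) \<odot>\<^bsub>M\<^esub> f x)"
  by (simp_all add: end_algebra_def)

section \<open>Endomorphism algebras as finite-dimensional algebras\<close>

context fdalg
begin

text \<open>Serves to pass between records that agree as modules and differ in their ring fields,
  such as \<open>homK T T\<close> and \<open>end_algebra A T\<close>.\<close>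

lemma left_module_same:
  assumes M: "left_module K M" and N: "finitely_generated K M"
    and e: "carrier N = carrier M" "\<zero>\<^bsub>N\<^esub> = \<zero>\<^bsub>M\<^esub>" "\<And>x y. x \<oplus>\<^bsub>N\<^esub> y = x \<oplus>\<^bsub>M\<^esub> y"
      "\<And>c x. c \<odot>\<^bsub>N\<^esub> x = c \<odot>\<^bsub>M\<^esub> x"
  shows "left_module K N" "finitely_generated K N"
proof -
  interpret M: left_module K M by (rule M)
  show l: "left_module K N" by (rule M.left_module_image[of _ "\<lambda>x. x"]) (simp_all add: e)
  interpret P: module_pair K M N by (intro module_pair.intro M l)
  have "restrict (\<lambda>x. x) (carrier M) \<in> mod_hom K M N"
    by (rule mod_hom_restrictI[OF M]) (simp_all add: e)
  then show "finitely_generated K N" by (rule P.finitely_generated_image) (simp_all add: e N)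
qed

lemma fd_opposite: "fin_dim_algebra K (opposite_algebra A)"
proof -
  note s = left_module_same[OF KA.left_module_axioms fg_KA, of "opposite_algebra A", simplified]
  interpret L: left_module K "opposite_algebra A" by (rule s)
  have "monoid (opposite_algebra A)"
    by (rule monoidI) (auto simp: A.m_assoc)
  then have "ring (opposite_algebra A)"
    by (intro ring.intro ring_axioms.intro L.M.abelian_group_axioms) (auto simp: A.l_distr A.r_distr)
  moreover have "Module.module K (opposite_algebra A)"
    using s(1) left_module_iff_module[OF K.is_cring] by blast
  ultimately show ?thesis
    unfolding fin_dim_algebra_def using s(2) K.field_axioms smult_mult by auto
qed

lemma fd_end_algebra:
  assumes T: "T \<in> Obs" shows "fin_dim_algebra K (end_algebra A T)"
proof -
  let ?E = "end_algebra A T"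
  note lT = ObsD(2)[OF T]
  interpret T: left_module A T by (rule lT)
  interpret H: vspace K "homK T T" by (rule homK_vspace[OF lT lT])
  have s: "left_module K ?E" "finitely_generated K ?E"
    using left_module_same[OF H.left_module_axioms fg_homK[OF ObsD(1)[OF T] ObsD(1)[OF T]], of ?E]
    by (simp_all add: homK_def)
  interpret L: left_module K ?E by (rule s)
  have c: "compose (carrier T) f g \<in> mod_hom A T T" if "f \<in> mod_hom A T T" "g \<in> mod_hom A T T" for f g
    by (rule mod_hom_compose[OF lT that])
  have D: "f x \<in> carrier T" if "f \<in> mod_hom A T T" "x \<in> carrier T" for f x
    by (rule mod_homD(1)[OF that])
  have one: "(\<lambda>x\<in>carrier T. x) \<in> mod_hom A T T"
    by (rule mod_hom_restrictI[OF lT]) auto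
  have ext: "f = g" if "f \<in> mod_hom A T T" "g \<in> mod_hom A T T" "\<And>x. x \<in> carrier T \<Longrightarrow> f x = g x" for f g
    by (rule mod_hom_eqI[OF that])
  have "monoid ?E"
  proof (rule monoidI)
    fix f g h assume "f \<in> carrier ?E" "g \<in> carrier ?E" "h \<in> carrier ?E"
    then have fgh: "f \<in> mod_hom A T T" "g \<in> mod_hom A T T" "h \<in> mod_hom A T T" by simp_all
    show "f \<otimes>\<^bsub>?E\<^esub> g \<otimes>\<^bsub>?E\<^esub> h = f \<otimes>\<^bsub>?E\<^esub> (g \<otimes>\<^bsub>?E\<^esub> h)"
      using D[OF fgh(3)] by (auto simp: compose_def intro!: restrict_ext)
  next
    fix f assume "f \<in> carrier ?E"
    then have f: "f \<in> mod_hom A T T" by simp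
    show "\<one>\<^bsub>?E\<^esub> \<otimes>\<^bsub>?E\<^esub> f = f"
      unfolding end_algebra_simps by (rule ext[OF c[OF one f] f]) (simp add: compose_def D[OF f])
    show "f \<otimes>\<^bsub>?E\<^esub> \<one>\<^bsub>?E\<^esub> = f"
      unfolding end_algebra_simps by (rule ext[OF c[OF f one] f]) (simp add: compose_def)
  qed (simp_all add: one c)
  moreover have "(f \<oplus>\<^bsub>?E\<^esub> g) \<otimes>\<^bsub>?E\<^esub> h = f \<otimes>\<^bsub>?E\<^esub> h \<oplus>\<^bsub>?E\<^esub> g \<otimes>\<^bsub>?E\<^esub> h"
    "h \<otimes>\<^bsub>?E\<^esub> (f \<oplus>\<^bsub>?E\<^esub> g) = h \<otimes>\<^bsub>?E\<^esub> f \<oplus>\<^bsub>?E\<^esub> h \<otimes>\<^bsub>?E\<^esub> g"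
    if "f \<in> carrier ?E" "g \<in> carrier ?E" "h \<in> carrier ?E" for f g h
  proof -
    have fgh: "f \<in> mod_hom A T T" "g \<in> mod_hom A T T" "h \<in> mod_hom A T T" using that by simp_all
    show "(f \<oplus>\<^bsub>?E\<^esub> g) \<otimes>\<^bsub>?E\<^esub> h = f \<otimes>\<^bsub>?E\<^esub> h \<oplus>\<^bsub>?E\<^esub> g \<otimes>\<^bsub>?E\<^esub> h"
      using D[OF fgh(3)] by (auto simp: compose_def intro!: restrict_ext)
    show "h \<otimes>\<^bsub>?E\<^esub> (f \<oplus>\<^bsub>?E\<^esub> g) = h \<otimes>\<^bsub>?E\<^esub> f \<oplus>\<^bsub>?E\<^esub> h \<otimes>\<^bsub>?E\<^esub> g"
      using D[OF fgh(1)] D[OF fgh(2)] mod_homD(2)[OF fgh(3)]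
      by (auto simp: compose_def intro!: restrict_ext)
  qed
  ultimately have "ring ?E"
    by (intro ring.intro ring_axioms.intro L.M.abelian_group_axioms) blast+
  moreover have "Module.module K ?E"
    using s(1) left_module_iff_module[OF K.is_cring] by blast
  moreover have "c \<odot>\<^bsub>?E\<^esub> (f \<otimes>\<^bsub>?E\<^esub> g) = (c \<odot>\<^bsub>?E\<^esub> f) \<otimes>\<^bsub>?E\<^esub> g \<and> c \<odot>\<^bsub>?E\<^esub> (f \<otimes>\<^bsub>?E\<^esub> g) = f \<otimes>\<^bsub>?E\<^esub> (c \<odot>\<^bsub>?E\<^esub> g)"
    if "c \<in> carrier K" "f \<in> carrier ?E" "g \<in> carrier ?E" for c f g
  proof -
    have fg: "f \<in> mod_hom A T T" "g \<in> mod_hom A T T" using that by simp_all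
    show ?thesis
      using D[OF fg(2)] mod_homD(3)[OF fg(1) sc_closed[OF that(1)]]
      by (auto simp: compose_def intro!: restrict_ext)
  qed
  ultimately show ?thesis
    unfolding fin_dim_algebra_def using s(2) K.field_axioms by blast
qed

lemma end_arrows_bij:
  assumes T: "T \<in> Obs" shows "bij_betw (\<lambda>f. (T, f, T)) (mod_hom A T T) {h. mc.hom h T T}"
proof (rule bij_betwI')
  show "\<exists>f\<in>mod_hom A T T. h = (T, f, T)" if "h \<in> {h. mc.hom h T T}" for h
  proof (rule bexI[of _ "afun h"])
    show "h = (T, afun h, T)" using that by (cases h) (simp add: asrc_def atgt_def afun_def)
    show "afun h \<in> mod_hom A T T" using that ArrsD(3)[of h] by auto
  qed
qed (use T in \<open>auto simp: Arrs_iff\<close>)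

lemma hom_mod_endop:
  assumes T: "T \<in> Obs"
  shows "hom_mod Obs Arrs asrc atgt ccmp cidn cplus cneg czer K (endop A T) T (\<lambda>f. (T, f, T))"
proof -
  interpret E: fdalg K "end_algebra A T" by unfold_locales (rule fd_end_algebra[OF T])
  have fd: "fin_dim_algebra K (endop A T)" unfolding endop_def by (rule E.fd_opposite)
  show ?thesis
  proof (intro hom_mod.intro mc.abcat_axioms fdalg.intro fd hom_mod_axioms.intro T)
    show "bij_betw (\<lambda>f. (T, f, T)) (carrier (endop A T)) {h. mc.hom h T T}"
      using end_arrows_bij[OF T] by (simp add: endop_def)
    show "(T, r \<otimes>\<^bsub>endop A T\<^esub> s, T) = ccmp (T, s, T) (T, r, T)"
      if "r \<in> carrier (endop A T)" "s \<in> carrier (endop A T)" for r s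
      using that T by (simp add: endop_def ccmp_def Arrs_iff)
    show "(T, r \<oplus>\<^bsub>endop A T\<^esub> s, T) = cplus (T, r, T) (T, s, T)"
      if "r \<in> carrier (endop A T)" "s \<in> carrier (endop A T)" for r s
      using that T by (simp add: endop_def cplus_def Arrs_iff)
    show "(T, \<one>\<^bsub>endop A T\<^esub>, T) = cidn T" by (simp add: endop_def cidn_def)
  qed
qed

text \<open>Composition is already reversed in the opposite category, so the algebra acting is
  \<open>end_algebra\<close> itself; the passage to \<open>endop\<close> is left to
  \<open>gldim_opposite\<close>.\<close>

lemma hom_mod_end:
  assumes T: "T \<in> Obs"
  shows "hom_mod Obs Arrs atgt asrc (\<lambda>g f. ccmp f g) cidn cplus cneg (\<lambda>X Y. czer Y X)
    K (end_algebra A T) T (\<lambda>f. (T, f, T))"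
proof (intro hom_mod.intro mc.op_abcat fdalg.intro fd_end_algebra hom_mod_axioms.intro T)
  have e: "{h. mc.hom h T T} = {h. h \<in> Arrs \<and> atgt h = T \<and> asrc h = T}" by auto
  show "bij_betw (\<lambda>f. (T, f, T)) (carrier (end_algebra A T)) {h. h \<in> Arrs \<and> atgt h = T \<and> asrc h = T}"
    using end_arrows_bij[OF T] unfolding e by simp
  show "(T, r \<otimes>\<^bsub>end_algebra A T\<^esub> s, T) = ccmp (T, r, T) (T, s, T)"
    if "r \<in> carrier (end_algebra A T)" "s \<in> carrier (end_algebra A T)" for r s
    using that T by (simp add: ccmp_def Arrs_iff)
  show "(T, r \<oplus>\<^bsub>end_algebra A T\<^esub> s, T) = cplus (T, r, T) (T, s, T)"
    if "r \<in> carrier (end_algebra A T)" "s \<in> carrier (end_algebra A T)" for r s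
    using that T by (simp add: cplus_def Arrs_iff)
  show "(T, \<one>\<^bsub>end_algebra A T\<^esub>, T) = cidn T" by (simp add: cidn_def)
qed

text \<open>Reflexivity of a finite-dimensional space: functionals on the dual are evaluations. The
  induction runs over a finite set whose common annihilator is killed by \<Psi>; a member v that
  imposes a new condition is removed by subtracting a multiple of the evaluation at v.\<close>

lemma functional_eval:
  assumes P: "\<Psi> \<in> functionals DR"
  shows "\<exists>a\<in>carrier A. \<forall>\<xi>\<in>carrier DR. \<Psi> \<xi> = \<xi> a"
proof -
  interpret V: vspace K "KM DR" by (rule KM_vspace[OF left_module_DR])
  interpret Q: module_pair K A "regular K" by (intro module_pair.intro KA.left_module_axioms regK)
  have Dc: "\<xi> x \<in> carrier K" if "\<xi> \<in> carrier DR" "x \<in> carrier A" for \<xi> x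
    using mod_homD(1)[of \<xi> K A "regular K" x] that by simp
  have sm: "(c \<odot>\<^bsub>KM DR\<^esub> \<xi>) x = c \<otimes>\<^bsub>K\<^esub> \<xi> x" if "\<xi> \<in> carrier DR" "x \<in> carrier A" "c \<in> carrier K" for c \<xi> x
    using mod_homD(3)[of \<xi> K A "regular K" c x] that sc_comm sc_mult by simp
  have pl: "(\<xi> \<oplus>\<^bsub>KM DR\<^esub> \<zeta>) x = \<xi> x \<oplus>\<^bsub>K\<^esub> \<zeta> x" if "x \<in> carrier A" for \<xi> \<zeta> x
    using that by simp
  have main: "\<exists>a\<in>carrier A. \<forall>\<xi>\<in>carrier DR. \<Psi> \<xi> = \<xi> a"
    if "finite S" "S \<subseteq> carrier A" "\<Psi> \<in> functionals DR"
      "\<And>\<xi>. \<xi> \<in> carrier DR \<Longrightarrow> (\<forall>s\<in>S. \<xi> s = \<zero>\<^bsub>K\<^esub>) \<Longrightarrow> \<Psi> \<xi> = \<zero>\<^bsub>K\<^esub>" for S \<Psi>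
    using that
  proof (induction S arbitrary: \<Psi>)
    case empty
    then have "\<Psi> \<xi> = \<xi> \<zero>\<^bsub>A\<^esub>" if "\<xi> \<in> carrier DR" for \<xi> using Q.hom_zero[of \<xi>] that by simp
    then show ?case by (intro bexI[of _ "\<zero>\<^bsub>A\<^esub>"]) auto
  next
    case (insert v S)
    have v: "v \<in> carrier A" and S: "S \<subseteq> carrier A" using insert.prems by auto
    note P = mod_homD[OF insert.prems(2)]
    have Pc: "\<Psi> \<xi> \<in> carrier K" if "\<xi> \<in> carrier DR" for \<xi> using P(1)[of \<xi>] that by simp
    show ?case
    proof (cases "\<forall>\<xi>\<in>carrier DR. (\<forall>s\<in>S. \<xi> s = \<zero>\<^bsub>K\<^esub>) \<longrightarrow> \<xi> v = \<zero>\<^bsub>K\<^esub>")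
      case True
      have "\<Psi> \<xi> = \<zero>\<^bsub>K\<^esub>" if "\<xi> \<in> carrier DR" "\<forall>s\<in>S. \<xi> s = \<zero>\<^bsub>K\<^esub>" for \<xi>
        by (rule insert.prems(3)) (use True that in blast)+
      then show ?thesis using insert.IH[OF S insert.prems(2)] by blast
    next
      case False
      then obtain \<xi>0 where x0: "\<xi>0 \<in> carrier DR" "\<And>s. s \<in> S \<Longrightarrow> \<xi>0 s = \<zero>\<^bsub>K\<^esub>" "\<xi>0 v \<noteq> \<zero>\<^bsub>K\<^esub>" by blast
      obtain e where e: "e \<in> carrier K" "e \<otimes>\<^bsub>K\<^esub> \<xi>0 v = \<one>\<^bsub>K\<^esub>"
        using KA.inverse_ex[OF Dc[OF x0(1) v] x0(3)] by blast
      \<comment> \<open>Chosen such that the corrected functional vanishes at \<open>\<xi>0\<close>,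
        which lies in the annihilator of S but not in that of v.\<close>
      define c where "c = \<Psi> \<xi>0 \<otimes>\<^bsub>K\<^esub> e"
      have c: "c \<in> carrier K" using Pc[OF x0(1)] e by (simp add: c_def)
      define \<Psi>' where "\<Psi>' = restrict (\<lambda>\<xi>. \<Psi> \<xi> \<oplus>\<^bsub>K\<^esub> \<ominus>\<^bsub>K\<^esub> (c \<otimes>\<^bsub>K\<^esub> \<xi> v)) (carrier (KM DR))"
      have P'h: "\<Psi>' \<in> functionals DR"
        unfolding \<Psi>'_def
      proof (rule mod_hom_restrictI[OF V.left_module_axioms])
        fix \<xi> assume "\<xi> \<in> carrier (KM DR)"
        then have x: "\<xi> \<in> carrier DR" by simp
        show "\<Psi> \<xi> \<oplus>\<^bsub>K\<^esub> \<ominus>\<^bsub>K\<^esub> (c \<otimes>\<^bsub>K\<^esub> \<xi> v) \<in> carrier (regular K)"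
          using Pc[OF x] c Dc[OF x v] by simp
        {
          fix \<zeta> assume "\<zeta> \<in> carrier (KM DR)"
          then have z: "\<zeta> \<in> carrier DR" by simp
          have "\<Psi> (\<xi> \<oplus>\<^bsub>KM DR\<^esub> \<zeta>) = \<Psi> \<xi> \<oplus>\<^bsub>K\<^esub> \<Psi> \<zeta>"
            by (rule trans[OF P(2)]) (use x z in simp_all)
          then show "\<Psi> (\<xi> \<oplus>\<^bsub>KM DR\<^esub> \<zeta>) \<oplus>\<^bsub>K\<^esub> \<ominus>\<^bsub>K\<^esub> (c \<otimes>\<^bsub>K\<^esub> (\<xi> \<oplus>\<^bsub>KM DR\<^esub> \<zeta>) v) =
              (\<Psi> \<xi> \<oplus>\<^bsub>K\<^esub> \<ominus>\<^bsub>K\<^esub> (c \<otimes>\<^bsub>K\<^esub> \<xi> v)) \<oplus>\<^bsub>regular K\<^esub> (\<Psi> \<zeta> \<oplus>\<^bsub>K\<^esub> \<ominus>\<^bsub>K\<^esub> (c \<otimes>\<^bsub>K\<^esub> \<zeta> v))"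
            unfolding pl[OF v] using Pc[OF x] Pc[OF z] c Dc[OF x v] Dc[OF z v]
            by (simp add: K.r_distr K.minus_add K.a_ac)
        }
        fix a assume a: "a \<in> carrier K"
        have "\<Psi> (a \<odot>\<^bsub>KM DR\<^esub> \<xi>) = a \<otimes>\<^bsub>K\<^esub> \<Psi> \<xi>" by (rule trans[OF P(3)[OF a]]) (use x in simp_all)
        then show "\<Psi> (a \<odot>\<^bsub>KM DR\<^esub> \<xi>) \<oplus>\<^bsub>K\<^esub> \<ominus>\<^bsub>K\<^esub> (c \<otimes>\<^bsub>K\<^esub> (a \<odot>\<^bsub>KM DR\<^esub> \<xi>) v) =
            a \<odot>\<^bsub>regular K\<^esub> (\<Psi> \<xi> \<oplus>\<^bsub>K\<^esub> \<ominus>\<^bsub>K\<^esub> (c \<otimes>\<^bsub>K\<^esub> \<xi> v))"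
          unfolding sm[OF x v a] using Pc[OF x] c Dc[OF x v] a
          by (simp add: K.r_distr K.r_minus K.m_lcomm)
      qed
      have P': "\<Psi>' \<xi> = \<Psi> \<xi> \<oplus>\<^bsub>K\<^esub> \<ominus>\<^bsub>K\<^esub> (c \<otimes>\<^bsub>K\<^esub> \<xi> v)" if "\<xi> \<in> carrier DR" for \<xi>
        unfolding \<Psi>'_def using that by simp
      have "\<Psi>' \<xi> = \<zero>\<^bsub>K\<^esub>" if x: "\<xi> \<in> carrier DR" and z: "\<forall>s\<in>S. \<xi> s = \<zero>\<^bsub>K\<^esub>" for \<xi>
      proof -
        \<comment> \<open>Adding this multiple of \<open>\<xi>0\<close> makes \<xi> vanish at v as
          well, and the hypothesis on \<Psi> applies to the sum.\<close>
        let ?r = "\<ominus>\<^bsub>K\<^esub> (\<xi> v \<otimes>\<^bsub>K\<^esub> e)"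
        have xv: "\<xi> v \<in> carrier K" "\<xi>0 v \<in> carrier K" by (rule Dc[OF x v], rule Dc[OF x0(1) v])
        have r: "?r \<in> carrier K" using xv e by simp
        let ?y = "?r \<odot>\<^bsub>KM DR\<^esub> \<xi>0"
        have y: "?y \<in> carrier DR" using V.smult_closed[OF r, of \<xi>0] x0(1) by simp
        have xy: "\<xi> \<oplus>\<^bsub>KM DR\<^esub> ?y \<in> carrier DR" using V.M.add.m_closed[of \<xi> ?y] x y by simp
        have "\<Psi> (\<xi> \<oplus>\<^bsub>KM DR\<^esub> ?y) = \<zero>\<^bsub>K\<^esub>"
        proof (rule insert.prems(3)[OF xy], rule ballI)
          fix s assume s: "s \<in> insert v S"
          show "(\<xi> \<oplus>\<^bsub>KM DR\<^esub> ?y) s = \<zero>\<^bsub>K\<^esub>"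
          proof (cases "s = v")
            case True
            have "?r \<otimes>\<^bsub>K\<^esub> \<xi>0 v = \<ominus>\<^bsub>K\<^esub> (\<xi> v)"
              using xv e by (simp add: K.l_minus K.m_assoc)
            then show ?thesis unfolding True pl[OF v] sm[OF x0(1) v r] using xv by (simp add: K.r_neg)
          next
            case False
            then have sS: "s \<in> S" "s \<in> carrier A" using s S by auto
            show ?thesis
              unfolding pl[OF sS(2)] sm[OF x0(1) sS(2) r] using z sS(1) x0(2)[OF sS(1)] r by simp
          qed
        qed
        moreover have "\<Psi> (\<xi> \<oplus>\<^bsub>KM DR\<^esub> ?y) = \<Psi> \<xi> \<oplus>\<^bsub>K\<^esub> \<Psi> ?y"
          by (rule trans[OF P(2)], use x in simp, use y in simp, simp only: regular_simps)
        moreover have "\<Psi> ?y = ?r \<otimes>\<^bsub>K\<^esub> \<Psi> \<xi>0" by (rule trans[OF P(3)[OF r]]) (use x0(1) in simp_all)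
        moreover have "?r \<otimes>\<^bsub>K\<^esub> \<Psi> \<xi>0 = \<ominus>\<^bsub>K\<^esub> (c \<otimes>\<^bsub>K\<^esub> \<xi> v)"
          unfolding c_def using xv e Pc[OF x0(1)] by (simp add: K.l_minus K.r_minus K.m_ac)
        ultimately show ?thesis using P'[OF x] by metis
      qed
      then obtain a where a: "a \<in> carrier A" "\<And>\<xi>. \<xi> \<in> carrier DR \<Longrightarrow> \<Psi>' \<xi> = \<xi> a"
        using insert.IH[OF S P'h] by blast
      have cv: "c \<odot>\<^bsub>A\<^esub> v \<in> carrier A" using c v KA.smult_closed by simp
      have "\<Psi> \<xi> = \<xi> (a \<oplus>\<^bsub>A\<^esub> c \<odot>\<^bsub>A\<^esub> v)" if x: "\<xi> \<in> carrier DR" for \<xi>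
      proof -
        have xh: "\<xi> \<in> mod_hom K A (regular K)" using x by simp
        have cx: "c \<otimes>\<^bsub>K\<^esub> \<xi> v \<in> carrier K" using c Dc[OF x v] by simp
        have "\<Psi> \<xi> = \<Psi>' \<xi> \<oplus>\<^bsub>K\<^esub> c \<otimes>\<^bsub>K\<^esub> \<xi> v"
          unfolding P'[OF x] using Pc[OF x] cx by (simp add: K.a_assoc K.l_neg)
        also have "\<dots> = \<xi> (a \<oplus>\<^bsub>A\<^esub> c \<odot>\<^bsub>A\<^esub> v)"
          unfolding a(2)[OF x] using mod_homD(2)[OF xh a(1) cv] mod_homD(3)[OF xh c v] by simp
        finally show ?thesis .
      qed
      then show ?thesis using a(1) cv by (intro bexI[of _ "a \<oplus>\<^bsub>A\<^esub> c \<odot>\<^bsub>A\<^esub> v"]) simp_all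
    qed
  qed
  obtain S where S: "finite S" "S \<subseteq> carrier A" "spans K A S"
    using fg_KA KA.finitely_generated_iff by auto
  have "\<Psi> \<xi> = \<zero>\<^bsub>K\<^esub>" if x: "\<xi> \<in> carrier DR" and z: "\<forall>s\<in>S. \<xi> s = \<zero>\<^bsub>K\<^esub>" for \<xi>
  proof -
    have xh: "\<xi> \<in> mod_hom K A (regular K)" using x by simp
    have "carrier A \<subseteq> {x \<in> carrier A. \<xi> x = \<zero>\<^bsub>regular K\<^esub>}"
      by (rule S(3)[unfolded spans_def, rule_format, OF Q.submod_kernel[OF xh]]) (use S(2) z in auto)
    then have "\<xi> = \<zero>\<^bsub>KM DR\<^esub>"
      using mod_hom_eqI[OF xh Q.hom_zero_map] by auto
    moreover have "\<Psi> \<zero>\<^bsub>KM DR\<^esub> = \<zero>\<^bsub>regular K\<^esub>"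
      by (rule module_pair.hom_zero[OF module_pair.intro[OF V.left_module_axioms regK] P])
    ultimately show ?thesis by simp
  qed
  then show ?thesis using main[OF S(1,2) P] by blast
qed

text \<open>The endomorphism of D A dual to left multiplication by \<open>a\<close> on
  \<open>A\<close>, obtained from the functional that evaluates at \<open>a\<close>.\<close>

definition rmult :: "'a \<Rightarrow> ('k, 'a) arrow" where
  "rmult a = cofun I (\<lambda>y\<in>carrier I. uncp DR y a)"

lemma rmult_functional:
  assumes a: "a \<in> carrier A" shows "(\<lambda>y\<in>carrier I. uncp DR y a) \<in> functionals I"
proof -
  interpret V: vspace K "KM I" by (rule KM_vspace[OF ObsD(2)[OF I_Obs]])
  have "restrict (\<lambda>y. uncp DR y a) (carrier (KM I)) \<in> functionals I"
  proof (rule mod_hom_restrictI[OF V.left_module_axioms])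
    fix y assume "y \<in> carrier (KM I)"
    then have y: "y \<in> carrier I" by simp
    show "uncp DR y a \<in> carrier (regular K)" by (rule mod_homD(1)[OF uncp_I(1)[OF y] a])
    {
      fix z assume "z \<in> carrier (KM I)"
      then have z: "z \<in> carrier I" by simp
      have "uncp DR (y \<oplus>\<^bsub>I\<^esub> z) = uncp DR y \<oplus>\<^bsub>DR\<^esub> uncp DR z"
        unfolding I_def by (rule uncp_add[OF fg_DR]) (use y z in \<open>simp_all add: I_def\<close>)
      then show "uncp DR (y \<oplus>\<^bsub>KM I\<^esub> z) a = uncp DR y a \<oplus>\<^bsub>regular K\<^esub> uncp DR z a"
        using a by simp
    }
    fix c assume c: "c \<in> carrier K"
    have "uncp DR (sc c \<odot>\<^bsub>I\<^esub> y) = sc c \<odot>\<^bsub>DR\<^esub> uncp DR y"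
      unfolding I_def by (rule uncp_smult[OF fg_DR sc_closed[OF c]]) (use y in \<open>simp add: I_def\<close>)
    then have "uncp DR (c \<odot>\<^bsub>KM I\<^esub> y) a = uncp DR y (c \<odot>\<^bsub>A\<^esub> a)"
      using a sc_comm[OF c a] sc_mult[OF c a] by simp
    then show "uncp DR (c \<odot>\<^bsub>KM I\<^esub> y) a = c \<odot>\<^bsub>regular K\<^esub> uncp DR y a"
      using mod_homD(3)[OF uncp_I(1)[OF y] c a] by simp
  qed
  then show ?thesis by simp
qed

lemma rmult:
  assumes a: "a \<in> carrier A"
  shows "mc.hom (rmult a) I I"
    "y \<in> carrier I \<Longrightarrow> uncp DR (afun (rmult a) y) = (\<lambda>b\<in>carrier A. uncp DR y (a \<otimes>\<^bsub>A\<^esub> b))"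
proof -
  note c = cofun[OF I_Obs rmult_functional[OF a]]
  show "mc.hom (rmult a) I I" unfolding rmult_def by (rule c(1))
  assume y: "y \<in> carrier I"
  have "(\<lambda>z\<in>carrier I. uncp DR z a) (b \<odot>\<^bsub>I\<^esub> y) = uncp DR y (a \<otimes>\<^bsub>A\<^esub> b)" if b: "b \<in> carrier A" for b
  proof -
    have "b \<odot>\<^bsub>I\<^esub> y \<in> carrier I" by (rule left_module.smult_closed[OF ObsD(2)[OF I_Obs] b y])
    moreover have "uncp DR (b \<odot>\<^bsub>I\<^esub> y) = b \<odot>\<^bsub>DR\<^esub> uncp DR y"
      unfolding I_def by (rule uncp_smult[OF fg_DR b]) (use y in \<open>simp add: I_def\<close>)
    ultimately show ?thesis using a by simp
  qed
  then show "uncp DR (afun (rmult a) y) = (\<lambda>b\<in>carrier A. uncp DR y (a \<otimes>\<^bsub>A\<^esub> b))"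
    unfolding rmult_def c(2)[OF y] by (auto intro!: restrict_ext)
qed

lemma I_arr_eqI:
  assumes f: "mc.hom f X I" and g: "mc.hom g X I"
    and e: "\<And>x. x \<in> carrier X \<Longrightarrow> uncp DR (afun f x) = uncp DR (afun g x)"
  shows "f = g"
proof (rule arr_eqI)
  fix x assume "x \<in> carrier (asrc g)"
  then have x: "x \<in> carrier X" using g by simp
  have fx: "afun f x \<in> carrier I" "afun g x \<in> carrier I" using f g x by simp_all
  show "afun f x = afun g x" using e[OF x] uncp_I(2)[OF fx(1)] uncp_I(2)[OF fx(2)] by metis
qed (use f g in simp_all)

text \<open>Composing \<open>rmult r\<close> after \<open>rmult s\<close> gives \<open>rmult\<close>
  of the product s r, which identifies the endomorphisms of D A with the opposite algebra.\<close>

lemma hom_mod_opposite: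
  "hom_mod Obs Arrs atgt asrc (\<lambda>g f. ccmp f g) cidn cplus cneg (\<lambda>X Y. czer Y X)
    K (opposite_algebra A) I rmult"
proof (intro hom_mod.intro mc.op_abcat fdalg.intro fd_opposite hom_mod_axioms.intro I_Obs)
  have rA: "afun (rmult a) y \<in> carrier I" if "a \<in> carrier A" "y \<in> carrier I" for a y
    using rmult(1)[OF that(1)] that(2) by simp
  show "bij_betw rmult (carrier (opposite_algebra A)) {h. h \<in> Arrs \<and> atgt h = I \<and> asrc h = I}"
    unfolding opposite_algebra_simps(1)
  proof (rule bij_betwI')
    fix a b assume a: "a \<in> carrier A" and b: "b \<in> carrier A"
    show "rmult a = rmult b \<longleftrightarrow> a = b"
    proof
      assume e: "rmult a = rmult b"
      show "a = b"
      proof (rule ccontr)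
        assume "a \<noteq> b"
        then have "a \<ominus>\<^bsub>A\<^esub> b \<noteq> \<zero>\<^bsub>A\<^esub>" using KA.minus_eq_zero a b by simp
        \<comment> \<open>A functional separating \<open>a\<close> from \<open>b\<close> is an
          element of D A on which the two endomorphisms differ, as evaluation at 1 shows.\<close>
        then obtain \<xi> where xi: "\<xi> \<in> mod_hom K A (regular K)" "\<xi> (a \<ominus>\<^bsub>A\<^esub> b) \<noteq> \<zero>\<^bsub>K\<^esub>"
          using KA.separating_functional[OF fg_KA, of "a \<ominus>\<^bsub>A\<^esub> b"] a b by auto
        let ?y = "cp DR \<xi>"
        have y: "?y \<in> carrier I" "uncp DR ?y = \<xi>"
          using xi(1) cp_closed[of \<xi> DR] uncp_cp[OF fg_DR, of \<xi>] by (simp_all add: I_def)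
        have "(\<lambda>c\<in>carrier A. uncp DR ?y (a \<otimes>\<^bsub>A\<^esub> c)) \<one>\<^bsub>A\<^esub> = (\<lambda>c\<in>carrier A. uncp DR ?y (b \<otimes>\<^bsub>A\<^esub> c)) \<one>\<^bsub>A\<^esub>"
          using rmult(2)[OF a y(1)] rmult(2)[OF b y(1)] e by metis
        then have "\<xi> a = \<xi> b" using a b unfolding y(2) by simp
        moreover have "\<xi> (a \<ominus>\<^bsub>A\<^esub> b) = \<xi> a \<ominus>\<^bsub>regular K\<^esub> \<xi> b"
          by (rule module_pair.hom_minus[OF module_pair.intro[OF KA.left_module_axioms regK] xi(1) a b])
        ultimately show False
          using xi(2) left_module.minus_eq_zero[OF regK, of "\<xi> b" "\<xi> b"] mod_homD(1)[OF xi(1) b] by simp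
      qed
    qed simp
  next
    fix a assume "a \<in> carrier A"
    then show "rmult a \<in> {h. h \<in> Arrs \<and> atgt h = I \<and> asrc h = I}" using rmult(1)[of a] by simp
  next
    fix h assume "h \<in> {h. h \<in> Arrs \<and> atgt h = I \<and> asrc h = I}"
    then have h: "mc.hom h I I" by simp
    have u: "restrict (cp DR) (carrier DR) \<in> mod_hom K (KM DR) (KM I)"
      using mod_hom_KM[OF cp_hom[OF fg_DR]] by (simp add: I_def)
    have "compose (carrier (KM DR)) (coev h) (restrict (cp DR) (carrier DR)) \<in> functionals DR"
      by (rule mod_hom_compose[OF vspace.axioms(1)[OF KM_vspace[OF left_module_DR]] coev(1)[OF h] u])
    then obtain a where a: "a \<in> carrier A"
      "\<And>\<xi>. \<xi> \<in> carrier DR \<Longrightarrow> compose (carrier (KM DR)) (coev h) (restrict (cp DR) (carrier DR)) \<xi> = \<xi> a"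
      using functional_eval by blast
    \<comment> \<open>An endomorphism of D A is determined by a functional on D A, and that
      functional is evaluation at some \<open>a\<close> by reflexivity.\<close>
    have "coev h = (\<lambda>y\<in>carrier I. uncp DR y a)"
    proof (rule mod_hom_eqI[OF coev(1)[OF h] rmult_functional[OF a(1)]])
      fix y assume "y \<in> carrier (KM I)"
      then have y: "y \<in> carrier I" by simp
      have "uncp DR y \<in> carrier DR" using uncp_I(1)[OF y] by simp
      then have "coev h (cp DR (uncp DR y)) = uncp DR y a"
        using a(2)[of "uncp DR y"] by (simp add: compose_def)
      then show "coev h y = (\<lambda>y\<in>carrier I. uncp DR y a) y" using y uncp_I(2)[OF y] by simp
    qed
    then have "h = rmult a" using coev(2)[OF h] unfolding rmult_def by metis
    then show "\<exists>a\<in>carrier A. h = rmult a" using a(1) by blast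
  qed
  fix r s assume "r \<in> carrier (opposite_algebra A)" "s \<in> carrier (opposite_algebra A)"
  then have r: "r \<in> carrier A" and s: "s \<in> carrier A" by simp_all
  note R = rmult[OF r] and S = rmult[OF s]
  show "rmult (r \<otimes>\<^bsub>opposite_algebra A\<^esub> s) = ccmp (rmult r) (rmult s)"
    unfolding opposite_algebra_simps(5)
  proof (rule I_arr_eqI)
    show "mc.hom (rmult (s \<otimes>\<^bsub>A\<^esub> r)) I I" by (rule rmult(1)) (use r s in simp)
    show "mc.hom (ccmp (rmult r) (rmult s)) I I" using R(1) S(1) by simp
    fix y assume y: "y \<in> carrier I"
    have "afun (ccmp (rmult r) (rmult s)) y = afun (rmult r) (afun (rmult s) y)"
      using R(1) S(1) y by simp
    then show "uncp DR (afun (rmult (s \<otimes>\<^bsub>A\<^esub> r)) y) = uncp DR (afun (ccmp (rmult r) (rmult s)) y)"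
      using rmult(2)[OF A.m_closed[OF s r] y] R(2)[OF rA[OF s y]] S(2)[OF y] r s
      by (auto simp: A.m_assoc intro!: restrict_ext)
  qed
  show "rmult (r \<oplus>\<^bsub>opposite_algebra A\<^esub> s) = cplus (rmult r) (rmult s)"
    unfolding opposite_algebra_simps(4)
  proof (rule I_arr_eqI)
    show "mc.hom (rmult (r \<oplus>\<^bsub>A\<^esub> s)) I I" by (rule rmult(1)) (use r s in simp)
    show "mc.hom (cplus (rmult r) (rmult s)) I I" using R(1) S(1) by simp
    fix y assume y: "y \<in> carrier I"
    have "afun (cplus (rmult r) (rmult s)) y = afun (rmult r) y \<oplus>\<^bsub>I\<^esub> afun (rmult s) y"
      using R(1) S(1) y by simp
    moreover have "uncp DR (afun (rmult r) y \<oplus>\<^bsub>I\<^esub> afun (rmult s) y) =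
        uncp DR (afun (rmult r) y) \<oplus>\<^bsub>DR\<^esub> uncp DR (afun (rmult s) y)"
      unfolding I_def by (rule uncp_add[OF fg_DR]) (use rA[OF r y] rA[OF s y] in \<open>simp_all add: I_def\<close>)
    ultimately show "uncp DR (afun (rmult (r \<oplus>\<^bsub>A\<^esub> s)) y) = uncp DR (afun (cplus (rmult r) (rmult s)) y)"
      using rmult(2)[OF A.a_closed[OF r s] y] R(2)[OF y] S(2)[OF y] r s
        mod_homD(2)[OF uncp_I(1)[OF y]]
      by (auto simp: A.l_distr intro!: restrict_ext)
  qed
next
  show "rmult \<one>\<^bsub>opposite_algebra A\<^esub> = cidn I"
    unfolding opposite_algebra_simps(3)
  proof (rule I_arr_eqI)
    show "mc.hom (rmult \<one>\<^bsub>A\<^esub>) I I" by (rule rmult(1)) simp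
    show "mc.hom (cidn I) I I" using I_Obs by simp
    fix y assume y: "y \<in> carrier I"
    have "uncp DR (afun (rmult \<one>\<^bsub>A\<^esub>) y) = (\<lambda>b\<in>carrier A. uncp DR y b)"
      unfolding rmult(2)[OF A.one_closed y] by (auto intro!: restrict_ext)
    also have "\<dots> = uncp DR y" by (rule extensional_restrict[OF mod_homD(4)[OF uncp_I(1)[OF y]]])
    finally show "uncp DR (afun (rmult \<one>\<^bsub>A\<^esub>) y) = uncp DR (afun (cidn I) y)" using y I_Obs by simp
  qed
qed

text \<open>For k = 0 the lower and the upper bound coincide. The injective cogenerator meets the
  conditions of a tilting object in the opposite category because it has no extensions as second
  argument.\<close>

lemma gldim_opposite: "gldim (opposite_algebra A) \<le> enat n \<longleftrightarrow> gldim A \<le> enat n"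
proof -
  interpret H: hom_mod Obs Arrs atgt asrc "\<lambda>g f. ccmp f g" cidn cplus cneg "\<lambda>X Y. czer Y X"
    K "opposite_algebra A" I rmult
    by (rule hom_mod_opposite)
  \<comment> \<open>With k = 0 no index i < k exists, so the sequences \<open>t\<close>,
    \<open>a\<close> and \<open>b\<close> may be arbitrary and \<open>Z\<close> is constant.\<close>
  have t: "tilt Obs Arrs atgt asrc (\<lambda>g f. ccmp f g) cidn cplus cneg (\<lambda>X Y. czer Y X) I I 0 (\<lambda>_. I) t a b"
    for t a b
  proof (intro tilt.intro[OF mc.op_abcat] tilt_axioms.intro,
      unfold mc.op_exz mc.op_ses mc.op_proj mc.op_inj mc.op_epi abcat.lifts_def[OF mc.op_abcat])
    show "mc.exz n Y I" if "Y \<in> Obs" for n Y by (rule mc.exz_inj[OF I_inj that])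
    show "mc.exz n I I" for n by (rule mc.exz_inj[OF I_inj I_Obs])
    show "precat.addc Obs Arrs atgt asrc (\<lambda>g f. ccmp f g) cidn cplus (\<lambda>X Y. czer Y X) I I"
      by (rule mc.op_addc[OF mc.addc_self[OF I_Obs]])
    show "mc.mono p" if p: "p \<in> Arrs" and l: "\<forall>f. f \<in> Arrs \<and> atgt f = I \<and> asrc f = asrc p \<longrightarrow>
        (\<exists>h. (h \<in> Arrs \<and> atgt h = I \<and> asrc h = atgt p) \<and> ccmp h p = f)" for p
    proof (rule I_cogen[OF p])
      fix f assume "mc.hom f (asrc p) I"
      then show "\<exists>h. mc.hom h (atgt p) I \<and> ccmp h p = f" using l[rule_format, of f] by blast
    qed
  qed (simp_all add: I_Obs)
  show ?thesis
    using H.tilt_gldim[OF t] unfolding mc.op_gl gldim_le_iff by auto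
qed

section \<open>The bounds for the shifted and coshifted algebras\<close>

theorem shifted_bounds:
  fixes Q T :: "('k, 'a) fmodule"
  assumes st: "special_tilting A Q k T" and Q: "injective A Q"
  shows "gldim A - enat k \<le> gldim (endop A T) \<and> gldim (endop A T) \<le> gldim A"
proof -
  have T: "T \<in> Obs" using st by (simp add: special_tilting_def tilting_def Obs_def)
  interpret H: hom_mod Obs Arrs asrc atgt ccmp cidn cplus cneg czer K "endop A T" T "\<lambda>f. (T, f, T)"
    by (rule hom_mod_endop[OF T])
  obtain Z t a b where t: "tilt Obs Arrs asrc atgt ccmp cidn cplus cneg czer T G k Z t a b"
    using special_tilting_tilt[OF st Q] by blast
  show ?thesis
    using H.tilt_gldim[OF t] by (intro enat_bounds) (simp_all only: gldim_le_iff)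
qed

theorem coshifted_bounds:
  fixes Q C :: "('k, 'a) fmodule"
  assumes st: "special_cotilting K A Q k C" and Q: "projective A Q"
  shows "gldim A - enat k \<le> gldim (endop A C) \<and> gldim (endop A C) \<le> gldim A"
proof -
  have C: "C \<in> Obs" using st by (simp add: special_cotilting_def cotilting_def Obs_def)
  interpret H: hom_mod Obs Arrs atgt asrc "\<lambda>g f. ccmp f g" cidn cplus cneg "\<lambda>X Y. czer Y X"
    K "end_algebra A C" C "\<lambda>f. (C, f, C)"
    by (rule hom_mod_end[OF C])
  obtain Z t a b where t: "tilt Obs Arrs atgt asrc (\<lambda>g f. ccmp f g) cidn cplus cneg (\<lambda>X Y. czer Y X) C I k Z t a b"
    using special_cotilting_tilt[OF st Q] by blast
  have o: "gldim (endop A C) \<le> enat n \<longleftrightarrow> gldim (end_algebra A C) \<le> enat n" for n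
    unfolding endop_def by (rule H.R.gldim_opposite)
  show ?thesis
    using H.tilt_gldim[OF t] unfolding mc.op_gl
    by (intro enat_bounds) (simp_all only: gldim_le_iff o)
qed

end

theorem proposition2p13:
  fixes K :: "'k ring"
    and \<Gamma> :: "('k, 'a) module"
    and Q :: "('k, 'a) fmodule"
    and d :: enat
    and k :: nat
  assumes "fin_dim_algebra K \<Gamma>"
    and "basic_algebra \<Gamma>"
    and "domdim \<Gamma> = d"
    and "enat k \<le> d"
    and "maximal_projective_injective_summand \<Gamma> Q"
  shows "(\<forall>T :: ('k, 'a) fmodule. is_shifted_module \<Gamma> Q k T \<longrightarrow>
            gldim \<Gamma> - enat k \<le> gldim (endop \<Gamma> T) \<and> gldim (endop \<Gamma> T) \<le> gldim \<Gamma>) \<and>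
         (\<forall>C :: ('k, 'a) fmodule. is_coshifted_module K \<Gamma> Q k C \<longrightarrow>
            gldim \<Gamma> - enat k \<le> gldim (endop \<Gamma> C) \<and> gldim (endop \<Gamma> C) \<le> gldim \<Gamma>)"
proof -
  interpret fdalg K \<Gamma> by unfold_locales (rule assms(1))
  have "projective \<Gamma> Q" "injective \<Gamma> Q"
    using assms(5)
    by (simp_all add: maximal_projective_injective_summand_def projective_injective_summand_def)
  then show ?thesis
    using shifted_bounds coshifted_bounds
    unfolding is_shifted_module_def is_coshifted_module_def by blast
qed

end
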